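(* Let $d\ge 2$, $k\in\mathbb{N}_+$, $0<p<1$, $0<q\le 1$, let $m$ be an integer with $0\le m\le k$, and let $\Omega\subset\mathbb{R}^d$ be a bounded Lipschitz domain. For every $M\in[0,\infty]$ there is $c>0$, independent of $n$ and $M$, such that for every integer $n\ge1$, $$E_{n,m}\bigl(B_{B^{k+d/p}_{p,q}(\Omega)};M\bigr)=\sup_{\|f\|_{B^{k+d/p}_{p,q}(\Omega)}\le1}\ \inf_{g\in\Sigma_{n,M}}\|f-g\|_{H^m(\Omega)}\ \ge\ c\,n^{-A_m},\qquad A_m=\frac{k-m+d/2}{d-1}.$$
   Context: $\sigma_k(t)=(\max\{t,0\})^k$. $\|f\|_{H^m(\Omega)}^2=\sum_{|\alpha|\le m}\|D^\alpha f\|_{L^2(\Omega)}^2$. Besov spaces: for a fixed smooth inhomogeneous Littlewood–Paley resolution $\{\Delta_j\}_{j\ge0}$, $\|F\|_{B^s_{p,q}(\mathbb{R}^d)}=\|(2^{js}\|\Delta_jF\|_{L^p(\mathbb{R}^d)})_{j\ge0}\|_{\ell^q}$; on $\Omega$ the quasi-norm is the infimum over all extensions $F$ with $F|_\Omega=f$. Dictionary: fix reals $b_-<\inf_{x\in\Omega,|\omega|=1}\omega\cdot x-1$ and $b_+>\sup_{x\in\Omega,|\omega|=1}\omega\cdot x+1$. For $n\in\mathbb{N}_0$ and $M\in[0,\infty]$, $$\Sigma_{n,M}=\Bigl\{\sum_{r=1}^N a_r\sigma_k(\omega_r\cdot x-b_r):\ N\in\{0,\dots,n\},\ |\omega_r|=1,\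 b_r\in[b_-,b_+],\ \sum_{r=1}^N|a_r|\le M\Bigr\},$$ (the empty sum is $0$; for $M=\infty$ there is no coefficient constraint). *)

theory Defs
  imports "HOL-Analysis.Analysis"
begin

section \<open>Multi-index derivatives, test functions, tempered distributions\<close>

definition partial_deriv :: "'d \<Rightarrow> (real ^ 'd \<Rightarrow> 'b) \<Rightarrow> real ^ 'd \<Rightarrow> 'b::real_normed_vector"
  where "partial_deriv i f x = vector_derivative (\<lambda>t. f (x + t *\<^sub>R axis i 1)) (at 0)"

fun iter_deriv :: "'d list \<Rightarrow> (real ^ 'd \<Rightarrow> 'b) \<Rightarrow> real ^ 'd \<Rightarrow> 'b::real_normed_vector"
  where
    "iter_deriv [] f = f"
  | "iter_deriv (i # is) f = partial_deriv i (iter_deriv is f)"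

definition smooth_fun :: "(real ^ 'd \<Rightarrow> 'b::real_normed_vector) \<Rightarrow> bool"
  where "smooth_fun f \<longleftrightarrow> (\<forall>is x. iter_deriv is f differentiable at x)"

definition order_mi :: "('d::finite \<Rightarrow> nat) \<Rightarrow> nat"
  where "order_mi \<alpha> = (\<Sum>i\<in>UNIV. \<alpha> i)"

text \<open>The index type carries no order, so the order of the partial derivatives in \<open>D\<^sup>\<alpha> f\<close> is
  left to choice. The operator is only applied to smooth functions, where the order is
  irrelevant by Schwarz's theorem.\<close>

definition mi_deriv ::
    "('d::finite \<Rightarrow> nat) \<Rightarrow> (real ^ 'd \<Rightarrow> 'b) \<Rightarrow> real ^ 'd \<Rightarrow> 'b::real_normed_vector"
  where "mi_deriv \<alpha> f = iter_deriv (SOME is. \<forall>i. count_list is i = \<alpha> i) f"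

definition test_functions :: "(real ^ 'd) set \<Rightarrow> (real ^ 'd \<Rightarrow> 'b::real_normed_vector) set"
  where "test_functions \<Omega> =
    {\<phi>. smooth_fun \<phi> \<and> compact (closure {x. \<phi> x \<noteq> 0}) \<and> closure {x. \<phi> x \<noteq> 0} \<subseteq> \<Omega>}"

definition schwartz_space :: "(real ^ 'd::finite \<Rightarrow> complex) set"
  where "schwartz_space = {\<phi>. smooth_fun \<phi> \<and>
    (\<forall>N \<alpha>. bounded (range (\<lambda>x. (1 + norm x) ^ N *\<^sub>R mi_deriv \<alpha> \<phi> x)))}"

definition schwartz_seminorm :: "nat \<Rightarrow> (real ^ 'd::finite \<Rightarrow> complex) \<Rightarrow> real"
  where "schwartz_seminorm N \<phi> =
    Sup {(1 + norm x) ^ N * norm (mi_deriv \<alpha> \<phi> x) | x \<alpha>. order_mi \<alpha> \<le> N}"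

text \<open>Continuous linear functionals on the Schwartz space. Values outside the Schwartz space are
  irrelevant.\<close>

definition tempered_distribution :: "((real ^ 'd::finite \<Rightarrow> complex) \<Rightarrow> complex) \<Rightarrow> bool"
  where "tempered_distribution F \<longleftrightarrow>
    (\<forall>\<phi>\<in>schwartz_space. \<forall>\<psi>\<in>schwartz_space. F (\<lambda>x. \<phi> x + \<psi> x) = F \<phi> + F \<psi>) \<and>
    (\<forall>\<phi>\<in>schwartz_space. \<forall>c. F (\<lambda>x. c * \<phi> x) = c * F \<phi>) \<and>
    (\<exists>C N. \<forall>\<phi>\<in>schwartz_space. norm (F \<phi>) \<le> C * schwartz_seminorm N \<phi>)"

definition locally_integrable_in :: "(real ^ 'd::finite) set \<Rightarrow> (real ^ 'd \<Rightarrow> real) \<Rightarrow> bool"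
  where "locally_integrable_in \<Omega> f \<longleftrightarrow>
    (\<forall>K. compact K \<and> K \<subseteq> \<Omega> \<longrightarrow> f absolutely_integrable_on K)"

text \<open>\<open>F\<close> restricts to \<open>f\<close> on \<open>\<Omega>\<close>, in the sense of distributions on \<open>\<Omega>\<close>. Local integrability is
  essential: without it the Bochner integral could silently be \<open>0\<close>.\<close>

definition restricts_to ::
    "((real ^ 'd::finite \<Rightarrow> complex) \<Rightarrow> complex) \<Rightarrow> (real ^ 'd) set \<Rightarrow> (real ^ 'd \<Rightarrow> real) \<Rightarrow> bool"
  where "restricts_to F \<Omega> f \<longleftrightarrow> locally_integrable_in \<Omega> f \<and>
    (\<forall>\<phi>\<in>test_functions \<Omega>. F \<phi> = (LINT x:\<Omega>|lebesgue. complex_of_real (f x) * \<phi> x))"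


section \<open>Besov spaces\<close>

text \<open>Powers \<open>x\<^sup>s\<close> of extended nonnegative reals, for \<open>s > 0\<close>.\<close>

definition epowr :: "ennreal \<Rightarrow> real \<Rightarrow> ennreal"
  where "epowr x s = (if x = \<infinity> then \<infinity> else ennreal (enn2real x powr s))"

definition Lp_qnorm ::
    "real \<Rightarrow> (real ^ 'd::finite) set \<Rightarrow> (real ^ 'd \<Rightarrow> 'b::real_normed_vector) \<Rightarrow> ennreal"
  where "Lp_qnorm p \<Omega> g = epowr (\<integral>\<^sup>+x\<in>\<Omega>. ennreal (norm (g x) powr p) \<partial>lebesgue) (1 / p)"

text \<open>A smooth inhomogeneous Littlewood--Paley resolution is generated by a smooth compactly
  supported \<open>\<theta>\<close> equal to \<open>1\<close> near the origin. Its symbols are \<open>\<theta>\<close> for \<open>j = 0\<close> and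
  \<open>\<theta>(2\<^sup>-\<^sup>j \<xi>) - \<theta>(2\<^sup>-\<^sup>j\<^sup>+\<^sup>1 \<xi>)\<close> for \<open>j \<ge> 1\<close>. They telescope, so they sum to \<open>1\<close>.\<close>

definition LP_generator :: "(real ^ 'd::finite \<Rightarrow> complex) \<Rightarrow> bool"
  where "LP_generator \<theta> \<longleftrightarrow> \<theta> \<in> test_functions UNIV \<and> (\<exists>r>0. \<forall>\<xi>\<in>ball 0 r. \<theta> \<xi> = 1)"

fun LP_symbol :: "(real ^ 'd::finite \<Rightarrow> complex) \<Rightarrow> nat \<Rightarrow> real ^ 'd \<Rightarrow> complex"
  where
    "LP_symbol \<theta> 0 \<xi> = \<theta> \<xi>"
  | "LP_symbol \<theta> (Suc j) \<xi> = \<theta> (\<xi> /\<^sub>R 2 ^ Suc j) - \<theta> (\<xi> /\<^sub>R 2 ^ j)"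

text \<open>The kernel is the inverse Fourier transform of the symbol.\<close>

definition LP_kernel :: "(real ^ 'd::finite \<Rightarrow> complex) \<Rightarrow> nat \<Rightarrow> real ^ 'd \<Rightarrow> complex"
  where "LP_kernel \<theta> j x =
    (LINT \<xi>|lebesgue. LP_symbol \<theta> j \<xi> * cis (x \<bullet> \<xi>)) / complex_of_real ((2 * pi) ^ CARD('d))"

text \<open>The Fourier multiplier \<open>\<Delta>\<^sub>j F\<close> of a tempered distribution is the convolution of \<open>F\<close> with the
  kernel, which is a smooth function.\<close>

definition LP_block ::
    "(real ^ 'd::finite \<Rightarrow> complex) \<Rightarrow> nat \<Rightarrow> ((real ^ 'd \<Rightarrow> complex) \<Rightarrow> complex) \<Rightarrow> real ^ 'd \<Rightarrow> complex"
  where "LP_block \<theta> j F x = F (\<lambda>y. LP_kernel \<theta> j (x - y))"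

definition besov_norm_Rd ::
    "(real ^ 'd::finite \<Rightarrow> complex) \<Rightarrow> real \<Rightarrow> real \<Rightarrow> real \<Rightarrow>
     ((real ^ 'd \<Rightarrow> complex) \<Rightarrow> complex) \<Rightarrow> ennreal"
  where "besov_norm_Rd \<theta> s p q F =
    epowr (\<Sum>j. epowr (ennreal (2 powr (real j * s)) * Lp_qnorm p UNIV (LP_block \<theta> j F)) q) (1 / q)"

text \<open>The value is \<open>\<infinity>\<close> if \<open>f\<close> has no extension of finite Besov quasi-norm.\<close>

definition besov_norm ::
    "(real ^ 'd::finite \<Rightarrow> complex) \<Rightarrow> real \<Rightarrow> real \<Rightarrow> real \<Rightarrow> (real ^ 'd) set \<Rightarrow>
     (real ^ 'd \<Rightarrow> real) \<Rightarrow> ennreal"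
  where "besov_norm \<theta> s p q \<Omega> f =
    Inf {besov_norm_Rd \<theta> s p q F | F. tempered_distribution F \<and> restricts_to F \<Omega> f}"


section \<open>Sobolev norm\<close>

definition has_weak_deriv ::
    "(real ^ 'd::finite) set \<Rightarrow> ('d \<Rightarrow> nat) \<Rightarrow> (real ^ 'd \<Rightarrow> real) \<Rightarrow> (real ^ 'd \<Rightarrow> real) \<Rightarrow> bool"
  where "has_weak_deriv \<Omega> \<alpha> f v \<longleftrightarrow>
    locally_integrable_in \<Omega> f \<and> locally_integrable_in \<Omega> v \<and>
    (\<forall>\<phi>\<in>test_functions \<Omega>. (LINT x:\<Omega>|lebesgue. f x * mi_deriv \<alpha> \<phi> x) =
       (-1) ^ order_mi \<alpha> * (LINT x:\<Omega>|lebesgue. v x * \<phi> x))"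

text \<open>Weak derivatives are unique almost everywhere, so the choice does not affect their norms.\<close>

definition weak_deriv ::
    "(real ^ 'd::finite) set \<Rightarrow> ('d \<Rightarrow> nat) \<Rightarrow> (real ^ 'd \<Rightarrow> real) \<Rightarrow> real ^ 'd \<Rightarrow> real"
  where "weak_deriv \<Omega> \<alpha> f = (SOME v. has_weak_deriv \<Omega> \<alpha> f v)"

text \<open>The value is \<open>\<infinity>\<close> if \<open>f\<close> is not in \<open>H\<^sup>m(\<Omega>)\<close>.\<close>

definition sobolev_norm :: "nat \<Rightarrow> (real ^ 'd::finite) set \<Rightarrow> (real ^ 'd \<Rightarrow> real) \<Rightarrow> ennreal"
  where "sobolev_norm m \<Omega> f =
    (if \<forall>\<alpha>. order_mi \<alpha> \<le> m \<longrightarrow> (\<exists>v. has_weak_deriv \<Omega> \<alpha> f v)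
     then epowr (\<Sum>\<alpha> | order_mi \<alpha> \<le> m. (Lp_qnorm 2 \<Omega> (weak_deriv \<Omega> \<alpha> f))\<^sup>2) (1 / 2)
     else \<infinity>)"


section \<open>Bounded Lipschitz domains\<close>

text \<open>Near each boundary point, in suitable Cartesian coordinates with last axis along the unit
  vector \<open>\<nu>\<close>, the domain is the part above the graph of a Lipschitz function on the hyperplane
  orthogonal to \<open>\<nu>\<close>.\<close>

definition bounded_lipschitz_domain :: "(real ^ 'd::finite) set \<Rightarrow> bool"
  where "bounded_lipschitz_domain \<Omega> \<longleftrightarrow>
    open \<Omega> \<and> connected \<Omega> \<and> \<Omega> \<noteq> {} \<and> bounded \<Omega> \<and>
    (\<forall>z\<in>frontier \<Omega>. \<exists>r>0. \<exists>\<nu> L \<gamma>. norm \<nu> = 1 \<and> L-lipschitz_on {y. y \<bullet> \<nu> = 0} \<gamma> \<and>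
       \<Omega> \<inter> ball z r = {x \<in> ball z r. \<gamma> (x - (x \<bullet> \<nu>) *\<^sub>R \<nu>) < x \<bullet> \<nu>})"


section \<open>The dictionary and the approximation error\<close>

definition sigma_k :: "nat \<Rightarrow> real \<Rightarrow> real"
  where "sigma_k k t = (max t 0) ^ k"

definition Sigma_nM ::
    "nat \<Rightarrow> real \<Rightarrow> real \<Rightarrow> nat \<Rightarrow> ennreal \<Rightarrow> (real ^ 'd::finite \<Rightarrow> real) set"
  where "Sigma_nM k bm bp n M =
    {(\<lambda>x. \<Sum>r<N. a r * sigma_k k (\<omega> r \<bullet> x - b r)) | N a \<omega> b.
       N \<le> n \<and> (\<forall>r<N. norm (\<omega> r) = 1 \<and> b r \<in> {bm..bp}) \<and> ennreal (\<Sum>r<N. \<bar>a r\<bar>) \<le> M}"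

definition approx_error ::
    "nat \<Rightarrow> real \<Rightarrow> real \<Rightarrow> nat \<Rightarrow> nat \<Rightarrow> (real ^ 'd::finite) set \<Rightarrow> (real ^ 'd \<Rightarrow> real) set \<Rightarrow>
     ennreal \<Rightarrow> ennreal"
  where "approx_error k bm bp n m \<Omega> B M =
    (SUP f\<in>B. INF g\<in>Sigma_nM k bm bp n M. sobolev_norm m \<Omega> (\<lambda>x. f x - g x))"

end

theory Submission
  imports Defs "HOL-Probability.Probability"
begin

text \<open>A test function whose Fourier transform vanishes on the line spanned by \<open>\<omega>\<close> annihilates every
  continuous ridge function \<open>g(\<omega> \<bullet> x)\<close>. Take \<open>N = K(d - 1)\<close> with \<open>(K + 1)\<^bsup>d-1\<^esup> \<ge> 2n\<close>. The homogeneous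
  polynomials of degree \<open>N\<close> have dimension at least \<open>2n\<close>, so rotation invariance yields a nonnegative
  \<open>P\<close> of degree \<open>2N\<close> (a sum of squares) that vanishes in \<open>n\<close> prescribed directions and has large mean
  compared with \<open>norm y ^ (2N)\<close>. Multiplying \<open>P\<close> by the transform of a compactly supported measure
  with spectrum at \<open>norm \<xi> ~ N\<close> and mollifying gives a test function \<open>\<psi>\<close> that annihilates the whole
  approximant \<open>g\<close>, but whose derivative of order \<open>m\<close> in a suitable coordinate direction correlates
  with a Gaussian of width \<open>h = 1/N\<close>. The approximated function is this Gaussian times
  \<open>h\<^sup>k\<close>, whose Besov norm is bounded uniformly in \<open>h\<close>. Pairing \<open>f - g\<close> with the derivative of \<open>\<psi>\<close>
  and moving the derivative onto \<open>f - g\<close> bounds the Sobolev norm from below; the coefficients of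
  \<open>g\<close> play no role.\<close>

section \<open>Smooth functions and test functions\<close>

text \<open>The obstacle is that the transform of a compactly supported \<open>\<psi>\<close> is
  analytic and cannot be cut off at \<open>norm \<xi> ~ N\<close>, while the polynomial that
  vanishes on \<open>n\<close> lines grows like \<open>norm \<xi> ^ (2N)\<close>. The measure has to
  undo this growth inside a ball of fixed radius, with constants uniform in \<open>N\<close>; hence
  a convolution of \<open>4N\<close> tents of width of order \<open>1/N\<close>, averaged over
  dilations. Nonnegativity prevents cancellation: \<open>\<psi>\<close> carries a factor
  \<open>\<xi>_i ^ m\<close> and its derivative another one, so the pairing with the Gaussian
  integrates \<open>\<xi>_i ^ (2m) * P\<close> times nonnegative functions. Exponents: the pairing
  divided by the \<open>L^2\<close> norm of \<open>\<psi>\<close> is of order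
  \<open>N powr (m - d/2)\<close>. The smoothness \<open>k + d/p\<close> exceeds \<open>d/p\<close>
  by \<open>k\<close>, so a Gaussian of width \<open>h\<close> and height \<open>A\<close> has Besov
  norm at most a multiple of \<open>A / h^k\<close>, whatever \<open>p\<close> and \<open>q\<close>;
  this is the origin of the height \<open>h^k\<close>. Together this gives
  \<open>N powr (-(k - m + d/2))\<close>, where \<open>N\<close> is of order
  \<open>n powr (1/(d-1))\<close>.\<close>

lemma partial_deriv_has_derivative:
  assumes "(f has_derivative f') (at x)"
  shows "partial_deriv i f x = f' (axis i 1)"
proof -
  have 1: "((\<lambda>t::real. x + t *\<^sub>R axis i 1) has_derivative (\<lambda>t. t *\<^sub>R axis i 1)) (at 0)"
    by (auto intro!: derivative_eq_intros)
  have "((\<lambda>t::real. f (x + t *\<^sub>R axis i 1)) has_derivative (\<lambda>t. f' (t *\<^sub>R axis i 1))) (at 0)"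
    by (rule has_derivative_compose[OF 1]) (use assms in simp)
  moreover have "(\<lambda>t. f' (t *\<^sub>R axis i 1)) = (\<lambda>t. t *\<^sub>R f' (axis i 1))"
    using has_derivative_bounded_linear[OF assms] by (simp add: linear_simps)
  ultimately show ?thesis
    unfolding partial_deriv_def by (simp add: has_vector_derivative_def vector_derivative_at)
qed

lemma has_derivative_partial:
  fixes f :: "real ^ 'd::finite \<Rightarrow> 'b::real_normed_vector"
  assumes "f differentiable at x"
  shows "(f has_derivative (\<lambda>v. \<Sum>i\<in>UNIV. v $ i *\<^sub>R partial_deriv i f x)) (at x)"
proof -
  obtain f' where f': "(f has_derivative f') (at x)"
    using assms by (auto simp: differentiable_def)
  have lin: "linear f'" using f' has_derivative_linear by blast
  have "f' v = (\<Sum>i\<in>UNIV. v $ i *\<^sub>R partial_deriv i f x)" for v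
  proof -
    have "f' v = f' (\<Sum>i\<in>UNIV. v $ i *\<^sub>R axis i 1)"
      using basis_expansion[of v] by (simp add: scalar_mult_eq_scaleR)
    also have "\<dots> = (\<Sum>i\<in>UNIV. v $ i *\<^sub>R f' (axis i 1))"
      by (simp add: linear_sum[OF lin] linear_cmul[OF lin])
    finally show ?thesis
      by (simp add: partial_deriv_has_derivative[OF f'])
  qed
  then have "f' = (\<lambda>v. \<Sum>i\<in>UNIV. v $ i *\<^sub>R partial_deriv i f x)" by (rule ext)
  with f' show ?thesis by simp
qed

text \<open>Every iterated derivative of \<open>f\<close> stays in \<open>S\<close>, by induction on
  the list of directions. Smoothness of a concrete function thus reduces to guessing a class that
  contains it, consists of differentiable functions and is closed under
  \<open>partial_deriv\<close>.\<close>

lemma smooth_fun_coinduct: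
  fixes S :: "(real ^ 'd \<Rightarrow> 'b::real_normed_vector) set"
  assumes "f \<in> S" and "\<And>g x. g \<in> S \<Longrightarrow> g differentiable at x"
    and "\<And>g i. g \<in> S \<Longrightarrow> partial_deriv i g \<in> S"
  shows "smooth_fun f"
proof -
  have "iter_deriv is f \<in> S" for "is"
    using assms by (induction "is") auto
  then show ?thesis
    unfolding smooth_fun_def using assms(2) by blast
qed

lemma iter_deriv_append: "iter_deriv (is @ js) f = iter_deriv is (iter_deriv js f)"
  by (induction "is") auto

lemma smooth_fun_iter_deriv: "smooth_fun f \<Longrightarrow> smooth_fun (iter_deriv is f)"
  unfolding smooth_fun_def iter_deriv_append[symmetric] by blast

lemma smooth_fun_partial_deriv: "smooth_fun f \<Longrightarrow> smooth_fun (partial_deriv i f)"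
  using smooth_fun_iter_deriv[of f "[i]"] by simp

lemma smooth_fun_differentiable:
  assumes "smooth_fun f" shows "f differentiable at x"
proof -
  have "iter_deriv [] f differentiable at x"
    using assms unfolding smooth_fun_def by blast
  then show ?thesis by simp
qed

lemma smooth_fun_continuous_on: "smooth_fun f \<Longrightarrow> continuous_on S f"
  by (meson continuous_at_imp_continuous_on differentiable_imp_continuous_within smooth_fun_differentiable)

lemma smooth_fun_step:
  assumes "\<And>x. f differentiable at x" "\<And>i. smooth_fun (partial_deriv i f)"
  shows "smooth_fun f"
  by (rule smooth_fun_coinduct[of f "insert f {g. smooth_fun g}"])
     (use assms in \<open>auto intro: smooth_fun_partial_deriv smooth_fun_differentiable\<close>)

lemma partial_deriv_const: "partial_deriv i (\<lambda>x. c) = (\<lambda>x. 0)"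
  by (rule ext, subst partial_deriv_has_derivative[of _ "\<lambda>_. 0"]) auto

lemma smooth_fun_const [simp]: "smooth_fun (\<lambda>x. c)"
  by (rule smooth_fun_coinduct[of _ "range (\<lambda>c x. c)"]) (auto simp: partial_deriv_const)

lemma partial_deriv_linear:
  assumes "bounded_linear h" shows "partial_deriv i h = (\<lambda>x. h (axis i 1))"
  using assms by (auto intro!: ext partial_deriv_has_derivative bounded_linear_imp_has_derivative)

lemma smooth_fun_linear: "bounded_linear h \<Longrightarrow> smooth_fun h"
  by (rule smooth_fun_step)
     (auto simp: partial_deriv_linear intro: bounded_linear_imp_differentiable)

lemma partial_deriv_add:
  assumes "f differentiable at x" "g differentiable at x"
  shows "partial_deriv i (\<lambda>x. f x + g x) x = partial_deriv i f x + partial_deriv i g x"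
proof -
  from assms obtain f' g' where "(f has_derivative f') (at x)" "(g has_derivative g') (at x)"
    by (auto simp: differentiable_def)
  then show ?thesis
    by (simp add: partial_deriv_has_derivative partial_deriv_has_derivative[OF has_derivative_add])
qed

lemma partial_deriv_bilinear:
  assumes "bounded_bilinear pr" "f differentiable at x" "g differentiable at x"
  shows "partial_deriv i (\<lambda>x. pr (f x) (g x)) x = pr (f x) (partial_deriv i g x) + pr (partial_deriv i f x) (g x)"
proof -
  from assms obtain f' g' where "(f has_derivative f') (at x)" "(g has_derivative g') (at x)"
    by (auto simp: differentiable_def)
  then show ?thesis
    by (simp add: partial_deriv_has_derivative
        partial_deriv_has_derivative[OF bounded_bilinear.FDERIV[OF assms(1)]])
qed

lemma differentiable_bilinear:
  assumes "bounded_bilinear pr" "f differentiable at x" "g differentiable at x"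
  shows "(\<lambda>x. pr (f x) (g x)) differentiable at x"
  using assms bounded_bilinear.FDERIV[OF assms(1)] unfolding differentiable_def by blast

lemma partial_deriv_comp_linear:
  assumes "bounded_linear h" "f differentiable at x"
  shows "partial_deriv i (\<lambda>x. h (f x)) x = h (partial_deriv i f x)"
proof -
  from assms obtain f' where "(f has_derivative f') (at x)"
    by (auto simp: differentiable_def)
  then show ?thesis
    by (simp add: partial_deriv_has_derivative
        partial_deriv_has_derivative[OF bounded_linear.has_derivative[OF assms(1)]])
qed

lemma smooth_fun_add:
  assumes "smooth_fun f" "smooth_fun g" shows "smooth_fun (\<lambda>x. f x + g x)"
proof (rule smooth_fun_coinduct)
  let ?S = "{\<lambda>x. f x + g x | f g. smooth_fun f \<and> smooth_fun g}"
  show "(\<lambda>x. f x + g x) \<in> ?S" using assms by auto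
  fix u assume "u \<in> ?S"
  then obtain f g where g: "smooth_fun f" "smooth_fun g" "u = (\<lambda>x. f x + g x)" by auto
  show "u differentiable at x" for x
    unfolding g(3) by (intro differentiable_add smooth_fun_differentiable g)
  have "partial_deriv i u = (\<lambda>x. partial_deriv i f x + partial_deriv i g x)" for i
    using g by (auto simp: partial_deriv_add smooth_fun_differentiable)
  then show "partial_deriv i u \<in> ?S" for i
    using g smooth_fun_partial_deriv by blast
qed

lemma smooth_fun_sum:
  "(\<And>a. a \<in> A \<Longrightarrow> smooth_fun (f a)) \<Longrightarrow> smooth_fun (\<lambda>x. \<Sum>a\<in>A. f a x)"
  by (induction A rule: infinite_finite_induct) (auto intro: smooth_fun_add)

text \<open>The Leibniz rule turns one product into a sum of two, so products alone are not closed
  under \<open>partial_deriv\<close>; their finite sums are. This is the class for the coinduction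
  on products.\<close>

inductive_set bilinear_span ::
    "('a::real_normed_vector \<Rightarrow> 'b::real_normed_vector \<Rightarrow> 'c::real_normed_vector) \<Rightarrow> (real ^ 'd \<Rightarrow> 'c) set"
  for pr where
    bilinear_span_prod:
      "smooth_fun f \<Longrightarrow> smooth_fun g \<Longrightarrow> (\<lambda>x. pr (f x) (g x)) \<in> bilinear_span pr"
  | bilinear_span_add:
      "u \<in> bilinear_span pr \<Longrightarrow> v \<in> bilinear_span pr \<Longrightarrow> (\<lambda>x. u x + v x) \<in> bilinear_span pr"

lemma smooth_fun_bilinear:
  fixes f :: "real ^ 'n \<Rightarrow> 'a::real_normed_vector" and g :: "real ^ 'n \<Rightarrow> 'b::real_normed_vector"
    and pr :: "'a \<Rightarrow> 'b \<Rightarrow> 'c::real_normed_vector"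
  assumes pr: "bounded_bilinear pr" and fg: "smooth_fun f" "smooth_fun g"
  shows "smooth_fun (\<lambda>x. pr (f x) (g x))"
proof (rule smooth_fun_coinduct)
  show "(\<lambda>x. pr (f x) (g x)) \<in> bilinear_span pr"
    by (intro bilinear_span_prod fg)
next
  fix u :: "real ^ 'n \<Rightarrow> 'c" and x
  assume "u \<in> bilinear_span pr"
  then show "u differentiable at x"
  proof induction
    case (bilinear_span_prod f g)
    then show ?case
      by (intro differentiable_bilinear[OF pr] smooth_fun_differentiable)
  qed (rule differentiable_add)
next
  fix u :: "real ^ 'n \<Rightarrow> 'c" and i
  assume "u \<in> bilinear_span pr"
  then have "partial_deriv i u \<in> bilinear_span pr \<and> (\<forall>x. u differentiable at x)"
  proof induction
    case (bilinear_span_prod f g)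
    then have *: "partial_deriv i (\<lambda>x. pr (f x) (g x)) =
        (\<lambda>x. pr (f x) (partial_deriv i g x) + pr (partial_deriv i f x) (g x))"
      by (auto simp: partial_deriv_bilinear[OF pr] smooth_fun_differentiable)
    show ?case
      unfolding * using bilinear_span_prod
      by (intro conjI allI bilinear_span.intros smooth_fun_partial_deriv
          differentiable_bilinear[OF pr] smooth_fun_differentiable)
  next
    case (bilinear_span_add u v)
    then have "partial_deriv i (\<lambda>x. u x + v x) = (\<lambda>x. partial_deriv i u x + partial_deriv i v x)"
      by (auto simp: partial_deriv_add)
    with bilinear_span_add show ?case
      by (auto intro: bilinear_span.intros differentiable_add)
  qed
  then show "partial_deriv i u \<in> bilinear_span pr" ..
qed

lemmas smooth_fun_mult = smooth_fun_bilinear[OF bounded_bilinear_mult]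

lemma smooth_fun_comp_linear:
  assumes h: "bounded_linear h" and f: "smooth_fun f"
  shows "smooth_fun (\<lambda>x. h (f x))"
proof (rule smooth_fun_coinduct)
  let ?S = "{\<lambda>x. h (f x) | f. smooth_fun f}"
  show "(\<lambda>x. h (f x)) \<in> ?S" using f by auto
  fix u assume "u \<in> ?S"
  then obtain g where g: "smooth_fun g" "u = (\<lambda>x. h (g x))" by auto
  show "u differentiable at x" for x
    using bounded_linear.has_derivative[OF h] smooth_fun_differentiable[OF g(1), of x]
    unfolding g(2) differentiable_def by blast
  have "partial_deriv i u = (\<lambda>x. h (partial_deriv i g x))" for i
    using g by (auto simp: partial_deriv_comp_linear[OF h] smooth_fun_differentiable)
  then show "partial_deriv i u \<in> ?S" for i
    using smooth_fun_partial_deriv[OF g(1)] by blast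
qed

lemma smooth_fun_coord: "smooth_fun (\<lambda>x. x $ i)"
  by (rule smooth_fun_linear[OF bounded_linear_vec_nth])

lemma smooth_fun_of_real:
  "smooth_fun f \<Longrightarrow> smooth_fun (\<lambda>x. of_real (f x) :: 'b::real_normed_algebra_1)"
  by (rule smooth_fun_comp_linear[OF bounded_linear_of_real])

lemma smooth_fun_inner_right: "smooth_fun (\<lambda>x::real^'d::finite. x \<bullet> \<xi>)"
  by (rule smooth_fun_linear[OF bounded_linear_inner_left])

lemma smooth_fun_norm_power2: "smooth_fun (\<lambda>x::real^'d::finite. (norm x)\<^sup>2)"
proof -
  have "(\<lambda>x::real^'d. (norm x)\<^sup>2) = (\<lambda>x. \<Sum>i\<in>UNIV. x $ i * x $ i)"
    by (simp add: power2_norm_eq_inner inner_vec_def fun_eq_iff)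
  then show ?thesis
    by (auto intro!: smooth_fun_sum smooth_fun_mult smooth_fun_coord)
qed

lemma partial_deriv_exp:
  fixes g :: "real ^ 'd \<Rightarrow> 'b::{real_normed_field,banach}"
  assumes "g differentiable at x"
  shows "partial_deriv i (\<lambda>x. exp (g x)) x = partial_deriv i g x * exp (g x)"
    and "(\<lambda>x. exp (g x)) differentiable at x"
proof -
  from assms obtain g' where g': "(g has_derivative g') (at x)"
    by (auto simp: differentiable_def)
  have "((\<lambda>x. exp (g x)) has_derivative (\<lambda>v. exp (g x) * g' v)) (at x)"
    by (rule has_derivative_compose[OF g'])
       (use DERIV_exp[of "g x"] in \<open>simp add: has_field_derivative_def\<close>)
  from partial_deriv_has_derivative[OF this] partial_deriv_has_derivative[OF g'] this
  show "partial_deriv i (\<lambda>x. exp (g x)) x = partial_deriv i g x * exp (g x)"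
    "(\<lambda>x. exp (g x)) differentiable at x"
    by (auto simp: mult_ac differentiable_def)
qed

lemma smooth_fun_exp:
  fixes g :: "real ^ 'd \<Rightarrow> 'b::{real_normed_field,banach}"
  assumes g: "smooth_fun g"
  shows "smooth_fun (\<lambda>x. exp (g x))"
proof (rule smooth_fun_coinduct)
  \<comment> \<open>Each derivative only changes the smooth factor in front of the exponential, so
    these products are closed under differentiation.\<close>
  let ?S = "{\<lambda>x. h x * exp (g x) | h. smooth_fun h}"
  show "(\<lambda>x. exp (g x)) \<in> ?S"
    by (intro CollectI exI[of _ "\<lambda>_. 1"]) auto
  fix u assume "u \<in> ?S"
  then obtain h where h: "smooth_fun h" "u = (\<lambda>x. h x * exp (g x))" by auto
  show "u differentiable at x" for x
    unfolding h(2) using h(1) g by (intro differentiable_mult partial_deriv_exp smooth_fun_differentiable)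
  have "partial_deriv i u x = (h x * partial_deriv i g x + partial_deriv i h x) * exp (g x)" for x i
    using h g by (simp add: partial_deriv_bilinear[OF bounded_bilinear_mult] partial_deriv_exp
        smooth_fun_differentiable algebra_simps)
  then show "partial_deriv i u \<in> ?S" for i
    using h g by (auto intro!: exI[of _ "\<lambda>x. h x * partial_deriv i g x + partial_deriv i h x"]
        smooth_fun_add smooth_fun_mult smooth_fun_partial_deriv)
qed

lemma smooth_fun_cis: "smooth_fun (\<lambda>x::real^'d::finite. cis (x \<bullet> \<xi>))"
proof -
  have "smooth_fun (\<lambda>x::real^'d. exp (\<i> * complex_of_real (x \<bullet> \<xi>)))"
    by (intro smooth_fun_exp smooth_fun_mult smooth_fun_const smooth_fun_of_real smooth_fun_inner_right)
  then show ?thesis by (simp add: cis_conv_exp)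
qed

lemma partial_deriv_translate: "partial_deriv i (\<lambda>x. f (x - a)) = (\<lambda>x. partial_deriv i f (x - a))"
  unfolding partial_deriv_def by (simp add: algebra_simps fun_eq_iff)

lemma iter_deriv_translate: "iter_deriv is (\<lambda>x. f (x - a)) = (\<lambda>x. iter_deriv is f (x - a))"
  by (induction "is") (simp_all add: partial_deriv_translate)

lemma smooth_fun_translate:
  assumes "smooth_fun f" shows "smooth_fun (\<lambda>x. f (x - a))"
proof -
  have "(\<lambda>x. iter_deriv is f (x - a)) differentiable at x" for "is" x
  proof -
    obtain g' where g': "(iter_deriv is f has_derivative g') (at (x - a))"
      using assms unfolding smooth_fun_def differentiable_def by blast
    have "((\<lambda>x. x - a) has_derivative (\<lambda>v. v)) (at x)"
      by (auto intro!: derivative_eq_intros)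
    from has_derivative_compose[OF this g'] show ?thesis
      by (auto simp: differentiable_def)
  qed
  then show ?thesis
    unfolding smooth_fun_def iter_deriv_translate by blast
qed

text \<open>Any compact subset of \<open>\<Omega>\<close> outside of which \<open>\<phi>\<close>
  vanishes is as good as the closed support, so closure properties only have to name such a
  set.\<close>

lemma test_functions_iff:
  "\<phi> \<in> test_functions \<Omega> \<longleftrightarrow>
     smooth_fun \<phi> \<and> (\<exists>K. compact K \<and> K \<subseteq> \<Omega> \<and> (\<forall>x. x \<notin> K \<longrightarrow> \<phi> x = 0))"
proof
  assume "\<phi> \<in> test_functions \<Omega>"
  then show "smooth_fun \<phi> \<and> (\<exists>K. compact K \<and> K \<subseteq> \<Omega> \<and> (\<forall>x. x \<notin> K \<longrightarrow> \<phi> x = 0))"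
    unfolding test_functions_def using closure_subset[of "{x. \<phi> x \<noteq> 0}"] by blast
next
  assume "smooth_fun \<phi> \<and> (\<exists>K. compact K \<and> K \<subseteq> \<Omega> \<and> (\<forall>x. x \<notin> K \<longrightarrow> \<phi> x = 0))"
  then obtain K where K: "smooth_fun \<phi>" "compact K" "K \<subseteq> \<Omega>" "\<forall>x. x \<notin> K \<longrightarrow> \<phi> x = 0" by auto
  then have "closure {x. \<phi> x \<noteq> 0} \<subseteq> K"
    by (intro closure_minimal) (auto intro: compact_imp_closed)
  then have "compact (closure {x. \<phi> x \<noteq> 0})"
    using K(2) by (meson bounded_subset closed_closure compact_eq_bounded_closed)
  with K \<open>closure {x. \<phi> x \<noteq> 0} \<subseteq> K\<close> show "\<phi> \<in> test_functions \<Omega>"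
    unfolding test_functions_def by auto
qed

lemma test_functions_mono: "\<phi> \<in> test_functions A \<Longrightarrow> A \<subseteq> B \<Longrightarrow> \<phi> \<in> test_functions B"
  unfolding test_functions_def by auto

lemma test_functions_smooth: "\<phi> \<in> test_functions \<Omega> \<Longrightarrow> smooth_fun \<phi>"
  unfolding test_functions_def by auto

lemma partial_deriv_zero_outside:
  assumes "compact K" "\<And>x. x \<notin> K \<Longrightarrow> \<phi> x = 0" "x \<notin> K"
  shows "partial_deriv i \<phi> x = 0"
proof -
  have "open (- K)" using assms(1) compact_imp_closed by blast
  then have "(\<phi> has_derivative (\<lambda>_. 0)) (at x)"
    by (rule has_derivative_transform_within_open[of "\<lambda>_. 0", rotated]) (use assms in auto)
  from partial_deriv_has_derivative[OF this] show ?thesis by simp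
qed

lemma test_functions_partial_deriv:
  "\<phi> \<in> test_functions \<Omega> \<Longrightarrow> partial_deriv i \<phi> \<in> test_functions \<Omega>"
  unfolding test_functions_iff
  using partial_deriv_zero_outside[of _ \<phi> _ i] smooth_fun_partial_deriv[of \<phi> i] by blast

lemma test_functions_iter_deriv:
  "\<phi> \<in> test_functions \<Omega> \<Longrightarrow> iter_deriv is \<phi> \<in> test_functions \<Omega>"
  by (induction "is") (auto intro: test_functions_partial_deriv)

lemma test_functions_bilinear1:
  assumes pr: "bounded_bilinear pr" and f: "f \<in> test_functions \<Omega>" and g: "smooth_fun g"
  shows "(\<lambda>x. pr (f x) (g x)) \<in> test_functions \<Omega>"
proof -
  from f obtain K where K: "smooth_fun f" "compact K" "K \<subseteq> \<Omega>" "\<forall>x. x \<notin> K \<longrightarrow> f x = 0"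
    unfolding test_functions_iff by auto
  have "\<forall>x. x \<notin> K \<longrightarrow> pr (f x) (g x) = 0"
    using K(4) bounded_bilinear.zero_left[OF pr] by auto
  with K smooth_fun_bilinear[OF pr K(1) g] show ?thesis
    unfolding test_functions_iff by blast
qed

lemmas test_functions_mult = test_functions_bilinear1[OF bounded_bilinear_mult]

lemma test_functions_comp_linear:
  assumes h: "bounded_linear h" and f: "f \<in> test_functions \<Omega>"
  shows "(\<lambda>x. h (f x)) \<in> test_functions \<Omega>"
proof -
  from f obtain K where K: "smooth_fun f" "compact K" "K \<subseteq> \<Omega>" "\<forall>x. x \<notin> K \<longrightarrow> f x = 0"
    unfolding test_functions_iff by auto
  have "\<forall>x. x \<notin> K \<longrightarrow> h (f x) = 0"
    using K(4) linear_simps(3)[OF h] by auto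
  with K smooth_fun_comp_linear[OF h K(1)] show ?thesis
    unfolding test_functions_iff by blast
qed

lemma test_functions_of_real:
  "\<phi> \<in> test_functions \<Omega> \<Longrightarrow> (\<lambda>x. of_real (\<phi> x) :: 'b::real_normed_algebra_1) \<in> test_functions \<Omega>"
  by (rule test_functions_comp_linear[OF bounded_linear_of_real])

lemma test_functions_add:
  assumes "f \<in> test_functions \<Omega>" "g \<in> test_functions \<Omega>"
  shows "(\<lambda>x. f x + g x) \<in> test_functions \<Omega>"
proof -
  from assms obtain K L where "smooth_fun f" "compact K" "K \<subseteq> \<Omega>" "\<And>x. x \<notin> K \<Longrightarrow> f x = 0"
     "smooth_fun g" "compact L" "L \<subseteq> \<Omega>" "\<And>x. x \<notin> L \<Longrightarrow> g x = 0"
    unfolding test_functions_iff by blast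
  then show ?thesis unfolding test_functions_iff
    by (intro conjI smooth_fun_add exI[of _ "K \<union> L"]) auto
qed

lemma test_functions_translate:
  fixes \<phi> :: "real ^ 'd::finite \<Rightarrow> 'b::real_normed_vector"
  assumes "\<phi> \<in> test_functions \<Omega>"
  shows "(\<lambda>x. \<phi> (x - a)) \<in> test_functions ((\<lambda>x. a + x) ` \<Omega>)"
proof -
  from assms obtain K where K: "smooth_fun \<phi>" "compact K" "K \<subseteq> \<Omega>" "\<forall>x. x \<notin> K \<longrightarrow> \<phi> x = 0"
    unfolding test_functions_iff by auto
  then show ?thesis unfolding test_functions_iff
    by (intro conjI exI[of _ "(\<lambda>x. a + x) ` K"] smooth_fun_translate compact_translation image_mono)
       (auto simp: image_iff, metis add.commute diff_add_cancel)
qed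

lemma test_functions_integrable:
  fixes \<phi> :: "real ^ 'd::finite \<Rightarrow> 'b::euclidean_space"
  assumes "\<phi> \<in> test_functions \<Omega>"
  shows "integrable lborel \<phi>"
proof -
  from assms obtain K where K: "smooth_fun \<phi>" "compact K" "\<forall>x. x \<notin> K \<longrightarrow> \<phi> x = 0"
    unfolding test_functions_iff by auto
  have "integrable lborel (\<lambda>x. indicator K x *\<^sub>R \<phi> x)"
    by (intro borel_integrable_compact K smooth_fun_continuous_on)
  also have "(\<lambda>x. indicator K x *\<^sub>R \<phi> x) = \<phi>"
    using K by (auto simp: indicator_def)
  finally show ?thesis .
qed

lemma test_functions_bounded:
  fixes \<phi> :: "real ^ 'd::finite \<Rightarrow> 'b::real_normed_vector"
  assumes "\<phi> \<in> test_functions \<Omega>"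
  obtains B where "B > 0" "\<And>x. norm (\<phi> x) \<le> B"
proof -
  from assms obtain K where K: "smooth_fun \<phi>" "compact K" "\<forall>x. x \<notin> K \<longrightarrow> \<phi> x = 0"
    unfolding test_functions_iff by auto
  have "bounded (\<phi> ` K)"
    by (intro compact_imp_bounded compact_continuous_image K smooth_fun_continuous_on)
  then obtain B where B: "B > 0" "\<forall>x\<in>K. norm (\<phi> x) \<le> B"
    unfolding bounded_pos by auto
  then have "norm (\<phi> x) \<le> B" for x
    using K(3) by (cases "x \<in> K") auto
  with B that show thesis by blast
qed

lemma test_functions_Lipschitz:
  fixes \<phi> :: "real ^ 'd::finite \<Rightarrow> 'b::real_normed_vector"
  assumes "\<phi> \<in> test_functions \<Omega>"
  obtains B where "B > 0" "\<And>x y. norm (\<phi> x - \<phi> y) \<le> B * norm (x - y)"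
proof -
  have "\<exists>b>0. \<forall>x. norm (partial_deriv i \<phi> x) \<le> b" for i
    using test_functions_bounded[OF test_functions_partial_deriv[OF assms]] by metis
  then obtain b where b: "\<And>i. b i > 0" "\<And>i x. norm (partial_deriv i \<phi> x) \<le> b i" by metis
  let ?B = "\<Sum>i\<in>UNIV. b i"
  have on: "onorm (\<lambda>v. \<Sum>i\<in>UNIV. v $ i *\<^sub>R partial_deriv i \<phi> x) \<le> ?B" for x
  proof (rule onorm_le)
    fix v :: "real ^ 'd"
    have "norm (\<Sum>i\<in>UNIV. v $ i *\<^sub>R partial_deriv i \<phi> x) \<le> (\<Sum>i\<in>UNIV. norm v * b i)"
      by (intro sum_norm_le) (auto intro!: mult_mono component_le_norm_cart b)
    also have "\<dots> = ?B * norm v"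
      by (simp add: sum_distrib_left[symmetric] mult.commute)
    finally show "norm (\<Sum>i\<in>UNIV. v $ i *\<^sub>R partial_deriv i \<phi> x) \<le> ?B * norm v" .
  qed
  have "norm (\<phi> x - \<phi> y) \<le> ?B * norm (x - y)" for x y
    by (rule differentiable_bound[of UNIV \<phi> "\<lambda>x v. \<Sum>i\<in>UNIV. v $ i *\<^sub>R partial_deriv i \<phi> x"])
       (use assms on in \<open>auto intro!: has_derivative_partial smooth_fun_differentiable test_functions_smooth\<close>)
  moreover have "?B > 0" using b by (intro sum_pos) auto
  ultimately show thesis using that by blast
qed

section \<open>Translation invariance and integration by parts\<close>

lemma integral_translate_lborel:
  fixes f :: "'a::euclidean_space \<Rightarrow> 'b::{banach,second_countable_topology}"
  assumes "f \<in> borel_measurable borel"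
  shows "(\<integral>x. f (a + x) \<partial>lborel) = (\<integral>x. f x \<partial>lborel)"
  using integral_distr[of "(+) a" lborel borel f] assms by (simp add: lborel_distr_plus)

lemma integrable_translate_lborel:
  fixes f :: "'a::euclidean_space \<Rightarrow> 'b::{banach,second_countable_topology}"
  assumes "f \<in> borel_measurable borel"
  shows "integrable lborel (\<lambda>x. f (a + x)) \<longleftrightarrow> integrable lborel f"
  using integrable_distr_eq[of "(+) a" lborel borel f] assms by (simp add: lborel_distr_plus)

lemma has_vector_derivative_at_0_quotient:
  assumes "(f has_vector_derivative D) (at (0::real))"
  shows "((\<lambda>s. (f s - f 0) /\<^sub>R s) \<longlongrightarrow> D) (at 0)"
proof -
  have *: "((\<lambda>s. norm (f s - f 0 - s *\<^sub>R D) / norm s) \<longlongrightarrow> 0) (at 0)"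
    using assms by (simp add: has_vector_derivative_def has_derivative_at)
  have "((\<lambda>s. norm ((f s - f 0) /\<^sub>R s - D)) \<longlongrightarrow> 0) (at 0)"
  proof (rule Lim_transform_eventually[OF *], unfold eventually_at, intro exI[of _ 1] conjI ballI impI)
    fix s :: real assume "s \<noteq> 0 \<and> dist s 0 < 1"
    then have "(f s - f 0) /\<^sub>R s - D = (f s - f 0 - s *\<^sub>R D) /\<^sub>R s"
      by (simp add: scaleR_diff_right)
    then show "norm (f s - f 0 - s *\<^sub>R D) / norm s = norm ((f s - f 0) /\<^sub>R s - D)"
      by (simp add: divide_inverse mult.commute)
  qed simp
  then show ?thesis using Lim_null tendsto_norm_zero_iff by blast
qed

text \<open>Difference quotients have integral 0 by translation invariance, and they converge to the
  derivative. Dominated convergence applies by the Lipschitz bound and the compact support.\<close>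

lemma integral_partial_deriv_eq_0:
  fixes \<phi> :: "real ^ 'd::finite \<Rightarrow> 'b::euclidean_space"
  assumes \<phi>: "\<phi> \<in> test_functions \<Omega>"
  shows "(\<integral>x. partial_deriv i \<phi> x \<partial>lborel) = 0"
proof -
  from \<phi> obtain K where K: "smooth_fun \<phi>" "compact K" "\<forall>x. x \<notin> K \<longrightarrow> \<phi> x = 0"
    unfolding test_functions_iff by auto
  from test_functions_Lipschitz[OF \<phi>] obtain B
    where B: "B > 0" "\<And>x y. norm (\<phi> x - \<phi> y) \<le> B * norm (x - y)" by blast
  from K obtain r where r: "K \<subseteq> cball 0 r"
    using bounded_subset_ballD[OF compact_imp_bounded[OF K(2)], of 0] ball_subset_cball by blast
  define t where "t n = inverse (real (Suc n))" for n
  have t: "t n > 0" "t n \<le> 1" for n by (auto simp: t_def inverse_le_1_iff)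
  have meas [measurable]: "\<phi> \<in> borel_measurable borel"
    using K(1) by (intro borel_measurable_continuous_onI smooth_fun_continuous_on)
  have meas' [measurable]: "partial_deriv i \<phi> \<in> borel_measurable borel"
    using K(1) by (intro borel_measurable_continuous_onI smooth_fun_continuous_on smooth_fun_partial_deriv)
  let ?q = "\<lambda>n x. (\<phi> (t n *\<^sub>R axis i 1 + x) - \<phi> x) /\<^sub>R t n"
  have "(\<lambda>n. \<integral>x. ?q n x \<partial>lborel) \<longlonglongrightarrow> (\<integral>x. partial_deriv i \<phi> x \<partial>lborel)"
  \<comment> \<open>Since \<open>t n \<le> 1\<close>, both arguments of the quotient miss
    \<open>K\<close> outside the ball of radius \<open>r + 1\<close>; inside, the Lipschitz constant
    bounds the quotient.\<close>
  proof (rule integral_dominated_convergence[where w = "\<lambda>x. B * indicator (cball 0 (r + 1)) x"])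
    show "integrable lborel (\<lambda>x. B * indicator (cball (0::real^'d) (r + 1)) x :: real)"
      by (intro integrable_mult_right integrable_real_indicator) (use emeasure_lborel_cball_finite[of "0::real^'d" "r + 1"] in auto)
    show "AE x in lborel. (\<lambda>n. ?q n x) \<longlonglongrightarrow> partial_deriv i \<phi> x"
    proof (intro AE_I2)
      fix x
      obtain f' where f': "(\<phi> has_derivative f') (at x)"
        using smooth_fun_differentiable[OF K(1)] by (auto simp: differentiable_def)
      have 1: "((\<lambda>s::real. x + s *\<^sub>R axis i 1) has_derivative (\<lambda>s. s *\<^sub>R axis i 1)) (at 0)"
        by (auto intro!: derivative_eq_intros)
      have "((\<lambda>s::real. \<phi> (x + s *\<^sub>R axis i 1)) has_derivative (\<lambda>s. f' (s *\<^sub>R axis i 1))) (at 0)"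
        by (rule has_derivative_compose[OF 1]) (use f' in simp)
      moreover have "(\<lambda>s. f' (s *\<^sub>R axis i 1)) = (\<lambda>s. s *\<^sub>R partial_deriv i \<phi> x)"
        using has_derivative_bounded_linear[OF f'] partial_deriv_has_derivative[OF f']
        by (simp add: linear_simps)
      ultimately have "((\<lambda>s::real. \<phi> (x + s *\<^sub>R axis i 1)) has_vector_derivative partial_deriv i \<phi> x) (at 0)"
        by (simp add: has_vector_derivative_def)
      from has_vector_derivative_at_0_quotient[OF this]
      have lim: "((\<lambda>s. (\<phi> (x + s *\<^sub>R axis i 1) - \<phi> x) /\<^sub>R s) \<longlongrightarrow> partial_deriv i \<phi> x) (at 0)" by simp
      have "filterlim t (at 0) sequentially"
        unfolding filterlim_at using LIMSEQ_inverse_real_of_nat t(1) unfolding t_def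
        by (auto simp: less_le)
      from filterlim_compose[OF lim this] show "(\<lambda>n. ?q n x) \<longlonglongrightarrow> partial_deriv i \<phi> x"
        by (simp add: add.commute)
    qed
    show "AE x in lborel. norm (?q n x) \<le> B * indicator (cball 0 (r + 1)) x" for n
    proof (intro AE_I2)
      fix x
      show "norm (?q n x) \<le> B * indicator (cball 0 (r + 1)) x"
      proof (cases "x \<in> cball 0 (r + 1)")
        case True
        have "norm (\<phi> (t n *\<^sub>R axis i 1 + x) - \<phi> x) \<le> B * t n"
          using B(2)[of "t n *\<^sub>R axis i 1 + x" x] t[of n] by simp
        moreover have "norm (?q n x) = norm (\<phi> (t n *\<^sub>R axis i 1 + x) - \<phi> x) / t n"
          using t(1)[of n] by (simp add: divide_inverse mult.commute)
        ultimately show ?thesis using True t(1)[of n] by (simp add: pos_divide_le_eq)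
      next
        case False
        then have "x \<notin> K" using r by auto
        moreover have "t n *\<^sub>R axis i 1 + x \<notin> K"
        proof
          assume "t n *\<^sub>R axis i 1 + x \<in> K"
          then have "norm (t n *\<^sub>R axis i 1 + x) \<le> r" using r by auto
          moreover have "norm x \<le> norm (t n *\<^sub>R axis i 1 + x) + norm (t n *\<^sub>R (axis i 1 :: real ^ 'd))"
            by (metis add.commute norm_triangle_sub add_diff_cancel_left' norm_minus_commute norm_triangle_ineq4)
          ultimately show False using False t[of n] by simp
        qed
        ultimately show ?thesis using K(3) False by simp
      qed
    qed
  qed measurable
  moreover have "(\<integral>x. ?q n x \<partial>lborel) = 0" for n
    using test_functions_integrable[OF \<phi>]
    by (simp add: integrable_translate_lborel integral_translate_lborel)
  ultimately show ?thesis
    by (simp only: LIMSEQ_const_iff)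
qed

section \<open>The Fourier transform\<close>

lemma integral_affine_lborel:
  fixes f :: "'a::euclidean_space \<Rightarrow> 'b::{banach,second_countable_topology}"
  assumes [measurable]: "f \<in> borel_measurable borel" and c: "c > 0"
  shows "(\<integral>x. f x \<partial>lborel) = c ^ DIM('a) *\<^sub>R (\<integral>x. f (t + c *\<^sub>R x) \<partial>lborel)"
proof -
  have "(\<integral>x. f x \<partial>lborel) = (\<integral>x. f x \<partial>density (distr lborel borel (\<lambda>x. t + c *\<^sub>R x)) (\<lambda>_. ennreal (c ^ DIM('a))))"
    using c by (subst lborel_affine[of c t]) auto
  also have "\<dots> = c ^ DIM('a) *\<^sub>R (\<integral>x. f (t + c *\<^sub>R x) \<partial>lborel)"
    using c by (subst integral_density) (auto simp: integral_distr)
  finally show ?thesis .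
qed

lemma integrable_affine_lborel:
  fixes f :: "'a::euclidean_space \<Rightarrow> 'b::{banach,second_countable_topology}"
  assumes [measurable]: "f \<in> borel_measurable borel" and c: "c > 0"
  shows "integrable lborel (\<lambda>x. f (t + c *\<^sub>R x)) \<longleftrightarrow> integrable lborel f"
proof -
  have "integrable lborel f \<longleftrightarrow> integrable (density (distr lborel borel (\<lambda>x. t + c *\<^sub>R x)) (\<lambda>_. ennreal (c ^ DIM('a)))) f"
    using c by (subst lborel_affine[of c t]) auto
  also have "\<dots> \<longleftrightarrow> integrable lborel (\<lambda>x. f (t + c *\<^sub>R x))"
    using c integrable_scaleR_right[of "inverse (c ^ DIM('a))" lborel "\<lambda>x. c ^ DIM('a) *\<^sub>R f (t + c *\<^sub>R x)"]
    by (subst integrable_density) (auto simp: integrable_distr_eq)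
  finally show ?thesis by simp
qed

lemma nn_integral_affine_lborel:
  fixes f :: "'a::euclidean_space \<Rightarrow> ennreal"
  assumes [measurable]: "f \<in> borel_measurable borel" and c: "c > 0"
  shows "(\<integral>\<^sup>+x. f x \<partial>lborel) = ennreal (c ^ DIM('a)) * (\<integral>\<^sup>+x. f (t + c *\<^sub>R x) \<partial>lborel)"
proof -
  have "(\<integral>\<^sup>+x. f x \<partial>lborel) = (\<integral>\<^sup>+x. f x \<partial>density (distr lborel borel (\<lambda>x. t + c *\<^sub>R x)) (\<lambda>_. ennreal (c ^ DIM('a))))"
    using c by (subst lborel_affine[of c t]) auto
  also have "\<dots> = ennreal (c ^ DIM('a)) * (\<integral>\<^sup>+x. f (t + c *\<^sub>R x) \<partial>lborel)"
    using c by (subst nn_integral_density) (auto simp: nn_integral_distr nn_integral_cmult)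
  finally show ?thesis .
qed

text \<open>The bound by 1 on the kernel makes \<open>f x * g y * K x y\<close> integrable on the
  product, whatever its oscillation. With \<open>K\<close> a character this is the multiplication
  formula that moves the Fourier transform from one factor to the other.\<close>

lemma (in pair_sigma_finite) Fubini_kernel:
  fixes f g :: "_ \<Rightarrow> complex"
  assumes f: "integrable M1 f" and g: "integrable M2 g"
    and K [measurable]: "(\<lambda>(x, y). K x y) \<in> borel_measurable (M1 \<Otimes>\<^sub>M M2)"
    and K1: "\<And>x y. norm (K x y) \<le> 1"
  shows "(\<integral>x. f x * (\<integral>y. g y * K x y \<partial>M2) \<partial>M1) = (\<integral>y. g y * (\<integral>x. f x * K x y \<partial>M1) \<partial>M2)"
    and "integrable M1 (\<lambda>x. f x * (\<integral>y. g y * K x y \<partial>M2))"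
proof -
  have [measurable]: "f \<in> borel_measurable M1" "g \<in> borel_measurable M2" using f g by auto
  have fn: "integrable M1 (\<lambda>x. norm (f x))" and gn: "integrable M2 (\<lambda>x. norm (g x))"
    using f g by auto
  have 0: "integrable (M1 \<Otimes>\<^sub>M M2) (\<lambda>(x, y). norm (f x) * norm (g y))"
    by (rule Fubini_integrable) (use fn gn in \<open>auto simp: integrable_mult_left integrable_mult_right\<close>)
  have int: "integrable (M1 \<Otimes>\<^sub>M M2) (\<lambda>(x, y). f x * g y * K x y)"
  proof (rule Bochner_Integration.integrable_bound[OF 0], measurable, intro AE_I2, clarsimp)
    fix x y show "norm (f x * g y * K x y) \<le> norm (f x) * norm (g y)"
      using mult_left_mono[OF K1[of x y], of "norm (f x * g y)"] by (simp add: norm_mult)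
  qed
  have *: "(\<integral>y. f x * g y * K x y \<partial>M2) = f x * (\<integral>y. g y * K x y \<partial>M2)" for x
    by (simp add: mult.assoc)
  have **: "(\<integral>x. f x * g y * K x y \<partial>M1) = g y * (\<integral>x. f x * K x y \<partial>M1)" for y
    by (subst integral_mult_right_zero[symmetric]) (simp add: mult_ac)
  show "(\<integral>x. f x * (\<integral>y. g y * K x y \<partial>M2) \<partial>M1) = (\<integral>y. g y * (\<integral>x. f x * K x y \<partial>M1) \<partial>M2)"
    using Fubini_integral[OF int] by (simp add: * **)
  show "integrable M1 (\<lambda>x. f x * (\<integral>y. g y * K x y \<partial>M2))"
    using integrable_fst[OF int] by (simp add: *)
qed

text \<open>The sign is \<open>+\<close> and there is no normalizing factor: differentiation becomes
  multiplication by \<open>- \<i> * \<xi> $ i\<close>, and \<open>LP_kernel\<close> is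
  \<open>ft\<close> of the symbol up to the factor \<open>(2 * pi) ^ CARD('d)\<close>.\<close>

definition ft :: "(real ^ 'd::finite \<Rightarrow> complex) \<Rightarrow> real ^ 'd \<Rightarrow> complex"
  where "ft \<phi> \<xi> = (\<integral>x. \<phi> x * cis (x \<bullet> \<xi>) \<partial>lborel)"

lemma borel_measurable_cis [measurable (raw)]:
  "f \<in> borel_measurable M \<Longrightarrow> (\<lambda>x. cis (f x)) \<in> borel_measurable M"
  by (rule measurable_compose[of _ _ borel]) (auto intro!: borel_measurable_continuous_onI continuous_intros)

lemma borel_measurable_cnj [measurable (raw)]:
  "f \<in> borel_measurable M \<Longrightarrow> (\<lambda>x. cnj (f x)) \<in> borel_measurable M"
  by (rule measurable_compose[of _ _ borel]) (auto intro!: borel_measurable_continuous_onI continuous_intros)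

lemma integrable_mult_cis:
  assumes "integrable M \<phi>" "f \<in> borel_measurable M"
  shows "integrable M (\<lambda>x. \<phi> x * cis (f x))"
  by (rule Bochner_Integration.integrable_bound[OF assms(1)]) (use assms in \<open>auto simp: norm_mult\<close>)

lemma norm_ft_le: "norm (ft \<phi> \<xi>) \<le> (\<integral>x. norm (\<phi> x) \<partial>lborel)"
  unfolding ft_def using integral_norm_bound[of lborel "\<lambda>x. \<phi> x * cis (x \<bullet> \<xi>)"]
  by (simp add: norm_mult)

lemma ft_measurable [measurable]:
  assumes [measurable]: "\<phi> \<in> borel_measurable borel"
  shows "ft \<phi> \<in> borel_measurable borel"
  unfolding ft_def[abs_def] by measurable

lemma test_functions_borel [measurable_dest]:
  "\<phi> \<in> test_functions \<Omega> \<Longrightarrow> \<phi> \<in> borel_measurable borel"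
  by (intro borel_measurable_continuous_onI smooth_fun_continuous_on test_functions_smooth)

text \<open>Integration by parts, in the form that the derivative of the test function
  \<open>\<phi> x * cis (x \<bullet> \<xi>)\<close> has integral 0.\<close>

lemma ft_partial_deriv:
  assumes \<phi>: "\<phi> \<in> test_functions \<Omega>"
  shows "ft (partial_deriv i \<phi>) \<xi> = - \<i> * complex_of_real (\<xi> $ i) * ft \<phi> \<xi>"
proof -
  let ?e = "\<lambda>x::real^'a. cis (x \<bullet> \<xi>)"
  have e: "partial_deriv i ?e x = \<i> * complex_of_real (\<xi> $ i) * ?e x" for x
  proof -
    have "smooth_fun (\<lambda>x::real^'a. complex_of_real (x \<bullet> \<xi>))"
      by (intro smooth_fun_of_real smooth_fun_inner_right)
    then have sm: "smooth_fun (\<lambda>x::real^'a. \<i> * complex_of_real (x \<bullet> \<xi>))"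
      by (intro smooth_fun_mult smooth_fun_const)
    have "bounded_linear (\<lambda>x::real^'a. \<i> * complex_of_real (x \<bullet> \<xi>))"
      by (intro bounded_linear_const_mult bounded_linear_compose[OF bounded_linear_of_real] bounded_linear_inner_left)
    from partial_deriv_linear[OF this, of i]
    have "partial_deriv i (\<lambda>x::real^'a. \<i> * complex_of_real (x \<bullet> \<xi>)) x = \<i> * complex_of_real (\<xi> $ i)"
      by (simp add: inner_axis' )
    with partial_deriv_exp(1)[OF smooth_fun_differentiable[OF sm], of i x]
    show ?thesis by (simp add: cis_conv_exp)
  qed
  have "partial_deriv i (\<lambda>x. \<phi> x * ?e x) x = \<phi> x * (\<i> * complex_of_real (\<xi> $ i) * ?e x) + partial_deriv i \<phi> x * ?e x" for x
    by (subst partial_deriv_bilinear[OF bounded_bilinear_mult])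
       (auto intro!: smooth_fun_differentiable smooth_fun_cis test_functions_smooth[OF \<phi>] simp: e)
  then have "0 = (\<integral>x. \<i> * complex_of_real (\<xi> $ i) * (\<phi> x * ?e x) + partial_deriv i \<phi> x * ?e x \<partial>lborel)"
    using integral_partial_deriv_eq_0[OF test_functions_mult[OF \<phi> smooth_fun_cis[of \<xi>]], of i]
    by (simp add: mult_ac)
  also have "\<dots> = \<i> * complex_of_real (\<xi> $ i) * ft \<phi> \<xi> + ft (partial_deriv i \<phi>) \<xi>"
    unfolding ft_def
    by (subst Bochner_Integration.integral_add)
       (auto intro!: integrable_mult_cis test_functions_integrable[OF \<phi>]
         test_functions_integrable[OF test_functions_partial_deriv[OF \<phi>]])
  finally show ?thesis by (simp add: eq_neg_iff_add_eq_0 add.commute)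
qed

section \<open>Gaussian integrals, the Parseval formula and the Plancherel inequality\<close>

lemma prod_Basis_vec: "(\<Prod>b\<in>(Basis :: (real ^ 'd::finite) set). g b) = (\<Prod>i\<in>UNIV. g (axis i 1))"
proof -
  have *: "(Basis :: (real ^ 'd) set) = (\<lambda>i. axis i 1) ` UNIV"
    by (auto simp: Basis_vec_def)
  show ?thesis unfolding * by (subst prod.reindex) (auto simp: inj_def axis_eq_axis)
qed

text \<open>Lebesgue measure on \<open>real ^ 'd\<close> is the image of a product of
  one-dimensional measures indexed by \<open>Basis\<close>; the work lies in passing from basis
  vectors to coordinate indices.\<close>

lemma
  fixes f :: "'d::finite \<Rightarrow> real \<Rightarrow> complex"
  assumes int: "\<And>i. integrable lborel (f i)"
  shows integral_prod_coords: "(\<integral>x. (\<Prod>i\<in>UNIV. f i (x $ i)) \<partial>(lborel :: (real^'d) measure)) = (\<Prod>i\<in>UNIV. \<integral>t. f i t \<partial>lborel)"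
    and integrable_prod_coords: "integrable (lborel :: (real^'d) measure) (\<lambda>x. \<Prod>i\<in>UNIV. f i (x $ i))"
proof -
  have [measurable]: "f i \<in> borel_measurable borel" for i
    using borel_measurable_integrable[OF int] by simp
  let ?B = "Basis :: (real^'d) set"
  let ?P = "\<Pi>\<^sub>M b\<in>?B. lborel :: real measure"
  let ?v = "\<lambda>f. \<Sum>b\<in>?B. f b *\<^sub>R b"
  let ?F = "\<lambda>b. f (axis_index b)"
  interpret product_sigma_finite "\<lambda>b::real^'d. lborel :: real measure" ..
  have eq: "(\<Prod>i\<in>UNIV. f i (?v y $ i)) = (\<Prod>b\<in>?B. ?F b (y b))" for y :: "real^'d \<Rightarrow> real"
  proof -
    have "?v y $ i = y (axis i 1)" for i
    proof -
      have "?v y $ i = ?v y \<bullet> axis i 1" by (simp add: inner_axis)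
      also have "\<dots> = y (axis i 1)" by (rule inner_sum_left_Basis) (auto simp: axis_in_Basis_iff)
      finally show ?thesis .
    qed
    then show ?thesis unfolding prod_Basis_vec by (simp add: axis_index_axis)
  qed
  have [measurable]: "(\<lambda>x::real^'d. \<Prod>i\<in>UNIV. f i (x $ i)) \<in> borel_measurable borel"
    by measurable
  have [measurable]: "?v \<in> measurable ?P borel" by measurable
  have "(\<integral>x. (\<Prod>i\<in>UNIV. f i (x $ i)) \<partial>(lborel :: (real^'d) measure)) = (\<integral>y. (\<Prod>b\<in>?B. ?F b (y b)) \<partial>?P)"
    by (subst lborel_eq, subst integral_distr) (measurable, simp only: eq)
  also have "\<dots> = (\<Prod>b\<in>?B. \<integral>t. ?F b t \<partial>lborel)"
    by (rule product_integral_prod) (auto intro: int)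
  finally show "(\<integral>x. (\<Prod>i\<in>UNIV. f i (x $ i)) \<partial>(lborel :: (real^'d) measure)) = (\<Prod>i\<in>UNIV. \<integral>t. f i t \<partial>lborel)"
    by (simp add: prod_Basis_vec axis_index_axis)
  have "integrable ?P (\<lambda>y. \<Prod>b\<in>?B. ?F b (y b))"
    by (rule product_integrable_prod) (auto intro: int)
  then show "integrable (lborel :: (real^'d) measure) (\<lambda>x. \<Prod>i\<in>UNIV. f i (x $ i))"
    by (subst lborel_eq, subst integrable_distr_eq) (measurable, simp only: eq)
qed

text \<open>The characteristic function of the standard normal law is the case \<open>a = 1\<close>;
  the substitution by the factor \<open>1 / sqrt a\<close> gives the rest.\<close>

lemma
  assumes a: "a > 0"
  shows integral_gauss_real: "(\<integral>t. complex_of_real (exp (- (a * t\<^sup>2 / 2))) * cis (t * z) \<partial>lborel) = complex_of_real (sqrt (2 * pi / a) * exp (- (z\<^sup>2 / (2 * a))))"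
    and integrable_gauss_real: "integrable lborel (\<lambda>t. complex_of_real (exp (- (a * t\<^sup>2 / 2))) * cis (t * z))"
proof -
  have std: "(\<integral>t. complex_of_real (exp (- (t\<^sup>2 / 2))) * cis (t * w) \<partial>lborel) = complex_of_real (sqrt (2 * pi) * exp (- (w\<^sup>2 / 2)))" for w
  proof -
    have "complex_of_real (exp (- (w^2) / 2)) = char std_normal_distribution w"
      by (simp add: char_std_normal_distribution)
    also have "\<dots> = (\<integral>t. std_normal_density t *\<^sub>R cis (w * t) \<partial>lborel)"
      unfolding char_def by (subst integral_density) (auto simp: cis_conv_exp normal_density_nonneg)
    also have "\<dots> = (\<integral>t. complex_of_real (1 / sqrt (2 * pi)) * (complex_of_real (exp (- (t\<^sup>2 / 2))) * cis (t * w)) \<partial>lborel)"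
      by (intro Bochner_Integration.integral_cong) (auto simp: std_normal_density_def scaleR_conv_of_real mult_ac)
    also have "\<dots> = complex_of_real (1 / sqrt (2 * pi)) * (\<integral>t. complex_of_real (exp (- (t\<^sup>2 / 2))) * cis (t * w) \<partial>lborel)"
      by simp
    finally show ?thesis by (simp add: field_simps)
  qed
  have int_std: "integrable lborel (\<lambda>t. exp (- (t\<^sup>2 / 2)) :: real)"
  proof -
    have "integrable lborel (\<lambda>t. sqrt (2 * pi) * std_normal_density t)"
      by (intro integrable_mult_right integrable_normal_density) auto
    also have "(\<lambda>t. sqrt (2 * pi) * std_normal_density t) = (\<lambda>t. exp (- (t\<^sup>2 / 2)))"
      by (auto simp: std_normal_density_def fun_eq_iff)
    finally show ?thesis .
  qed
  let ?c = "1 / sqrt a"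
  have c: "?c > 0" using a by simp
  have sc: "a * (?c * t)\<^sup>2 = t\<^sup>2" for t using a by (simp add: power_mult_distrib power_divide)
  have [measurable]: "(\<lambda>t. complex_of_real (exp (- (a * t\<^sup>2 / 2))) * cis (t * z)) \<in> borel_measurable borel"
    by measurable
  have "(\<integral>t. complex_of_real (exp (- (a * t\<^sup>2 / 2))) * cis (t * z) \<partial>lborel) =
     ?c *\<^sub>R (\<integral>t. complex_of_real (exp (- (a * (?c * t)\<^sup>2 / 2))) * cis ((?c * t) * z) \<partial>lborel)"
    by (subst integral_affine_lborel[OF _ c, where t = 0]) auto
  also have "\<dots> = ?c *\<^sub>R complex_of_real (sqrt (2 * pi) * exp (- ((z / sqrt a)\<^sup>2 / 2)))"
    unfolding sc std[symmetric] by (simp add: mult_ac)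
  finally show "(\<integral>t. complex_of_real (exp (- (a * t\<^sup>2 / 2))) * cis (t * z) \<partial>lborel) = complex_of_real (sqrt (2 * pi / a) * exp (- (z\<^sup>2 / (2 * a))))"
    using a by (simp add: scaleR_conv_of_real real_sqrt_divide power_divide mult_ac)
  have "integrable lborel (\<lambda>t. exp (- (a * (0 + ?c *\<^sub>R t)\<^sup>2 / 2)) :: real)"
    using int_std unfolding real_scaleR_def add_0 sc .
  then have "integrable lborel (\<lambda>t. exp (- (a * t\<^sup>2 / 2)) :: real)"
    by (subst (asm) integrable_affine_lborel[OF _ c]) auto
  then show "integrable lborel (\<lambda>t. complex_of_real (exp (- (a * t\<^sup>2 / 2))) * cis (t * z))"
    by (intro integrable_mult_cis) auto
qed

lemma
  fixes z :: "real ^ 'd::finite"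
  assumes a: "a > 0"
  shows ft_gauss: "ft (\<lambda>x. complex_of_real (exp (- (a * (norm x)\<^sup>2 / 2)))) z =
      complex_of_real (sqrt (2 * pi / a) ^ CARD('d) * exp (- ((norm z)\<^sup>2 / (2 * a))))"
    and integrable_gauss: "integrable lborel (\<lambda>x::real^'d. exp (- (a * (norm x)\<^sup>2 / 2)))"
proof -
  have n2: "(norm x)\<^sup>2 = (\<Sum>i\<in>UNIV. (x $ i)\<^sup>2)" for x :: "real^'d"
    unfolding power2_norm_eq_inner inner_vec_def by (simp add: power2_eq_square)
  have eq: "complex_of_real (exp (- (a * (norm x)\<^sup>2 / 2))) * cis (x \<bullet> w) =
    (\<Prod>i\<in>UNIV. complex_of_real (exp (- (a * (x $ i)\<^sup>2 / 2))) * cis (x $ i * w $ i))" for x w :: "real ^'d"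
  proof -
    have "complex_of_real (exp (- (a * (norm x)\<^sup>2 / 2))) = (\<Prod>i\<in>UNIV. complex_of_real (exp (- (a * (x $ i)\<^sup>2 / 2))))"
      unfolding n2 of_real_prod[symmetric] exp_sum[symmetric, OF finite]
      by (simp add: sum_distrib_left sum_divide_distrib sum_negf)
    moreover have "cis (x \<bullet> w) = (\<Prod>i\<in>UNIV. cis (x $ i * w $ i))"
      unfolding cis_conv_exp exp_sum[symmetric, OF finite] inner_vec_def by (simp add: sum_distrib_left)
    ultimately show ?thesis by (simp add: prod.distrib)
  qed
  show "ft (\<lambda>x. complex_of_real (exp (- (a * (norm x)\<^sup>2 / 2)))) z =
      complex_of_real (sqrt (2 * pi / a) ^ CARD('d) * exp (- ((norm z)\<^sup>2 / (2 * a))))"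
    unfolding ft_def eq
    by (subst integral_prod_coords)
       (auto simp: integral_gauss_real[OF a] integrable_gauss_real[OF a] prod.distrib n2 exp_sum[symmetric]
         sum_divide_distrib sum_negf simp del: of_real_exp of_real_mult simp flip: of_real_prod)
  have "integrable lborel (\<lambda>x::real^'d. complex_of_real (exp (- (a * (norm x)\<^sup>2 / 2))) * cis (x \<bullet> 0))"
    unfolding eq by (intro integrable_prod_coords integrable_gauss_real a)
  then show "integrable lborel (\<lambda>x::real^'d. exp (- (a * (norm x)\<^sup>2 / 2)))"
    by (simp add: complex_of_real_integrable_eq)
qed

text \<open>The Gaussian of width \<open>h\<close> is, up to a factor, the transform of a Gaussian
  of width \<open>1 / h\<close>, so the multiplication formula moves the transform onto
  \<open>\<psi>\<close>. The pairing of the Gaussian with the fooling function is computed on the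
  frequency side in this way.\<close>

lemma gauss_parseval:
  fixes \<psi> :: "real ^ 'd::finite \<Rightarrow> complex"
  assumes h: "h > 0" and \<psi>: "integrable lborel \<psi>"
  shows "(\<integral>x. complex_of_real (exp (- ((norm x)\<^sup>2 / (2 * h\<^sup>2)))) * \<psi> x \<partial>lborel) =
    complex_of_real ((h / sqrt (2 * pi)) ^ CARD('d)) * (\<integral>\<xi>. complex_of_real (exp (- (h\<^sup>2 * (norm \<xi>)\<^sup>2 / 2))) * ft \<psi> \<xi> \<partial>lborel)"
proof -
  have h2: "h\<^sup>2 > 0" using h by simp
  let ?G = "\<lambda>\<xi>::real^'d. complex_of_real (exp (- (h\<^sup>2 * (norm \<xi>)\<^sup>2 / 2)))"
  have [measurable]: "(\<lambda>(\<xi>, x). cis ((x::real^'d) \<bullet> \<xi>)) \<in> borel_measurable (lborel \<Otimes>\<^sub>M lborel)"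
    by measurable
  have "(\<integral>\<xi>. ?G \<xi> * ft \<psi> \<xi> \<partial>lborel) = (\<integral>x. \<psi> x * (\<integral>\<xi>. ?G \<xi> * cis (x \<bullet> \<xi>) \<partial>lborel) \<partial>lborel)"
    unfolding ft_def using integrable_gauss[OF h2] \<psi>
    by (intro lborel_pair.Fubini_kernel(1)) (auto simp: complex_of_real_integrable_eq)
  also have "\<dots> = (\<integral>x. \<psi> x * ft ?G x \<partial>lborel)"
    unfolding ft_def by (simp add: inner_commute)
  also have "\<dots> = (\<integral>x. complex_of_real (sqrt (2 * pi / h\<^sup>2) ^ CARD('d)) * (complex_of_real (exp (- ((norm x)\<^sup>2 / (2 * h\<^sup>2)))) * \<psi> x) \<partial>lborel)"
    unfolding ft_gauss[OF h2] by (intro Bochner_Integration.integral_cong) (auto simp: mult_ac)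
  also have "\<dots> = complex_of_real (sqrt (2 * pi / h\<^sup>2) ^ CARD('d)) * (\<integral>x. complex_of_real (exp (- ((norm x)\<^sup>2 / (2 * h\<^sup>2)))) * \<psi> x \<partial>lborel)"
    by simp
  finally show ?thesis
    using h by (simp add: real_sqrt_divide power_divide mult_ac)
qed

text \<open>This direction bounds the \<open>L^2\<close> norm of the fooling function by its
  transform. Inserting the Gaussian \<open>E a\<close> makes all exchanges of integrals legitimate;
  as \<open>a\<close> tends to 0 the resulting expression tends to the \<open>L^2\<close> norm,
  while the inserted factor is at most 1 on the frequency side.\<close>

lemma plancherel_le:
  fixes \<psi> :: "real ^ 'd::finite \<Rightarrow> complex"
  assumes \<psi>: "\<psi> \<in> test_functions \<Omega>" and int: "integrable lborel (\<lambda>\<xi>. (norm (ft \<psi> \<xi>))\<^sup>2)"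
  shows "(2 * pi) ^ CARD('d) * (\<integral>x. (norm (\<psi> x))\<^sup>2 \<partial>lborel) \<le> (\<integral>\<xi>. (norm (ft \<psi> \<xi>))\<^sup>2 \<partial>lborel)"
proof -
  note [measurable] = test_functions_borel[OF \<psi>]
  note I\<psi> = test_functions_integrable[OF \<psi>]
  define s where "s = sqrt (2 * pi) ^ CARD('d)"
  have s0: "s > 0" by (simp add: s_def)
  define E where "E a \<xi> = complex_of_real (exp (- (a * (norm \<xi>)\<^sup>2 / 2)))" for a and \<xi> :: "real ^ 'd"
  have E1: "norm (E a \<xi>) \<le> 1" if "a > 0" for a \<xi> using that by (simp add: E_def)
  have IE: "integrable lborel (E a)" if "a > 0" for a
    using integrable_gauss[OF that] unfolding E_def by (simp add: complex_of_real_integrable_eq)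
  have [measurable]: "E a \<in> borel_measurable borel" for a unfolding E_def by measurable
  \<comment> \<open>An unnormalized Gaussian average of \<open>\<psi>\<close> around
    \<open>y\<close> at scale \<open>sqrt a\<close>. After the substitution its weight
    \<open>E 1\<close> no longer depends on \<open>a\<close>, and it tends to
    \<open>s * \<psi> y\<close>.\<close>
  define H where "H a y = (\<integral>z. \<psi> (y + sqrt a *\<^sub>R z) * E 1 z \<partial>lborel)" for a y
  have step1: "(\<integral>\<xi>. E a \<xi> * (ft \<psi> \<xi> * cnj (ft \<psi> \<xi>)) \<partial>lborel) = complex_of_real s * (\<integral>y. cnj (\<psi> y) * H a y \<partial>lborel)"
    if a: "a > 0" for a
  proof -
    have IEf: "integrable lborel (\<lambda>\<xi>. E a \<xi> * ft \<psi> \<xi>)"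
    proof (rule Bochner_Integration.integrable_bound[OF integrable_mult_right[OF IE[OF a], of "complex_of_real (\<integral>x. norm (\<psi> x) \<partial>lborel)"]])
      show "AE x in lborel. norm (E a x * ft \<psi> x) \<le> norm (complex_of_real (\<integral>x. norm (\<psi> x) \<partial>lborel) * E a x)"
      proof (intro AE_I2)
        fix x
        have "norm (ft \<psi> x) \<le> \<bar>\<integral>x. norm (\<psi> x) \<partial>lborel\<bar>"
          using norm_ft_le[of \<psi> x] by linarith
        note le = this
        show "norm (E a x * ft \<psi> x) \<le> norm (complex_of_real (\<integral>x. norm (\<psi> x) \<partial>lborel) * E a x)"
          using mult_left_mono[OF le norm_ge_zero[of "E a x"]]
          unfolding norm_mult norm_of_real by (simp only: mult.commute)
      qed
    qed simp
    have "(\<integral>\<xi>. E a \<xi> * (ft \<psi> \<xi> * cnj (ft \<psi> \<xi>)) \<partial>lborel) =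
        (\<integral>\<xi>. (E a \<xi> * ft \<psi> \<xi>) * (\<integral>y. cnj (\<psi> y) * cis (- (y \<bullet> \<xi>)) \<partial>lborel) \<partial>lborel)"
    proof (intro Bochner_Integration.integral_cong refl)
      fix \<xi> :: "real^'d"
      have "cnj (ft \<psi> \<xi>) = (\<integral>y. cnj (\<psi> y) * cis (- (y \<bullet> \<xi>)) \<partial>lborel)"
        unfolding ft_def by (subst Bochner_Integration.integral_cnj[symmetric]) (simp add: cis_cnj)
      then show "E a \<xi> * (ft \<psi> \<xi> * cnj (ft \<psi> \<xi>)) = (E a \<xi> * ft \<psi> \<xi>) * (\<integral>y. cnj (\<psi> y) * cis (- (y \<bullet> \<xi>)) \<partial>lborel)"
        by (simp add: mult.assoc)
    qed
    also have "\<dots> = (\<integral>y. cnj (\<psi> y) * (\<integral>\<xi>. (E a \<xi> * ft \<psi> \<xi>) * cis (- (y \<bullet> \<xi>)) \<partial>lborel) \<partial>lborel)"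
      using IEf I\<psi> by (intro lborel_pair.Fubini_kernel(1)) auto
    also have "\<dots> = (\<integral>y. cnj (\<psi> y) * (complex_of_real s * H a y) \<partial>lborel)"
    proof (intro Bochner_Integration.integral_cong refl arg_cong2[where f = "(*)"])
      fix y :: "real^'d"
      have "(\<integral>\<xi>. (E a \<xi> * ft \<psi> \<xi>) * cis (- (y \<bullet> \<xi>)) \<partial>lborel) =
          (\<integral>\<xi>. (E a \<xi> * cis (- (y \<bullet> \<xi>))) * (\<integral>x. \<psi> x * cis (x \<bullet> \<xi>) \<partial>lborel) \<partial>lborel)"
        unfolding ft_def by (simp add: mult_ac)
      also have "\<dots> = (\<integral>x. \<psi> x * (\<integral>\<xi>. (E a \<xi> * cis (- (y \<bullet> \<xi>))) * cis (x \<bullet> \<xi>) \<partial>lborel) \<partial>lborel)"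
        using IE[OF a] I\<psi> by (intro lborel_pair.Fubini_kernel(1) integrable_mult_cis) auto
      also have "\<dots> = (\<integral>x. \<psi> x * ft (E a) (x - y) \<partial>lborel)"
        unfolding ft_def by (simp add: mult.assoc cis_mult inner_diff_right inner_commute algebra_simps)
      also have "\<dots> = (\<integral>x. \<psi> x * complex_of_real (sqrt (2 * pi / a) ^ CARD('d) * exp (- ((norm (x - y))\<^sup>2 / (2 * a)))) \<partial>lborel)"
        unfolding E_def[abs_def] ft_gauss[OF a] ..
      also have "\<dots> = sqrt a ^ CARD('d) *\<^sub>R (\<integral>z. \<psi> (y + sqrt a *\<^sub>R z) * complex_of_real (sqrt (2 * pi / a) ^ CARD('d) * exp (- ((norm (y + sqrt a *\<^sub>R z - y))\<^sup>2 / (2 * a)))) \<partial>lborel)"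
        using a by (subst integral_affine_lborel[of _ "sqrt a" y]) auto
      also have "\<dots> = sqrt a ^ CARD('d) *\<^sub>R (\<integral>z. complex_of_real (sqrt (2 * pi / a) ^ CARD('d)) * (\<psi> (y + sqrt a *\<^sub>R z) * E 1 z) \<partial>lborel)"
        using a by (intro arg_cong2[where f = "scaleR"] Bochner_Integration.integral_cong refl)
          (auto simp: E_def power_mult_distrib mult_ac)
      also have "\<dots> = complex_of_real s * H a y"
        using a by (simp add: H_def s_def scaleR_conv_of_real real_sqrt_divide power_divide)
      finally show "(\<integral>\<xi>. (E a \<xi> * ft \<psi> \<xi>) * cis (- (y \<bullet> \<xi>)) \<partial>lborel) = complex_of_real s * H a y" .
    qed
    also have "\<dots> = complex_of_real s * (\<integral>y. cnj (\<psi> y) * H a y \<partial>lborel)"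
      by (subst integral_mult_right_zero[symmetric]) (simp add: mult_ac)
    finally show ?thesis .
  qed
  obtain B where B: "B > 0" "\<And>x. norm (\<psi> x) \<le> B"
    using test_functions_bounded[OF \<psi>] by blast
  have E1int: "(\<integral>z. E 1 z \<partial>lborel) = complex_of_real s"
    using ft_gauss[of 1 "0::real^'d"] by (simp add: ft_def E_def s_def)
  \<comment> \<open>A squared null sequence, so that the scale \<open>sqrt (a n)\<close> is simply
    \<open>1 / (n + 1)\<close>.\<close>
  define a where "a n = (inverse (real (Suc n)))\<^sup>2" for n
  have a0: "a n > 0" for n by (simp add: a_def)
  have alim: "(\<lambda>n. sqrt (a n)) \<longlonglongrightarrow> 0"
    unfolding a_def using LIMSEQ_inverse_real_of_nat by simp
  have Hb: "norm (H (a n) y) \<le> B * (\<integral>z. norm (E 1 z) \<partial>lborel)" for n y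
  proof -
    have "norm (H (a n) y) \<le> (\<integral>z. norm (\<psi> (y + sqrt (a n) *\<^sub>R z) * E 1 z) \<partial>lborel)"
      unfolding H_def by (rule integral_norm_bound)
    also have "\<dots> \<le> (\<integral>z. B * norm (E 1 z) \<partial>lborel)"
    proof (rule integral_mono)
      show "integrable lborel (\<lambda>z. norm (\<psi> (y + sqrt (a n) *\<^sub>R z) * E 1 z))"
        by (rule Bochner_Integration.integrable_bound[OF integrable_mult_right[OF integrable_norm[OF IE[of 1]], of B]])
           (use B in \<open>auto simp: norm_mult intro!: mult_right_mono\<close>)
    qed (use B IE[of 1] in \<open>auto simp: norm_mult intro!: mult_right_mono\<close>)
    finally show ?thesis by simp
  qed
  have Hlim: "(\<lambda>n. H (a n) y) \<longlonglongrightarrow> \<psi> y * complex_of_real s" for y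
  proof -
    have "(\<lambda>n. H (a n) y) \<longlonglongrightarrow> (\<integral>z. \<psi> y * E 1 z \<partial>lborel)"
      unfolding H_def
    proof (rule integral_dominated_convergence[where w = "\<lambda>z. B * norm (E 1 z)"])
      show "AE z in lborel. (\<lambda>n. \<psi> (y + sqrt (a n) *\<^sub>R z) * E 1 z) \<longlonglongrightarrow> \<psi> y * E 1 z"
      proof (intro AE_I2 tendsto_mult tendsto_const)
        fix z :: "real^'d"
        have "(\<lambda>n. y + sqrt (a n) *\<^sub>R z) \<longlonglongrightarrow> y + 0 *\<^sub>R z"
          by (intro tendsto_intros alim)
        moreover have "isCont \<psi> y"
          using smooth_fun_continuous_on[OF test_functions_smooth[OF \<psi>], of UNIV] by (simp add: continuous_on_eq_continuous_at)
        ultimately show "(\<lambda>n. \<psi> (y + sqrt (a n) *\<^sub>R z)) \<longlonglongrightarrow> \<psi> y"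
          using isCont_tendsto_compose by fastforce
      qed
    qed (use B IE[of 1] in \<open>auto simp: norm_mult intro!: mult_right_mono\<close>)
    then show ?thesis by (simp add: E1int)
  qed
  have Hm [measurable]: "H (a n) \<in> borel_measurable borel" for n
    unfolding H_def[abs_def] by measurable
  have "(\<lambda>n. \<integral>y. cnj (\<psi> y) * H (a n) y \<partial>lborel) \<longlonglongrightarrow> (\<integral>y. cnj (\<psi> y) * (\<psi> y * complex_of_real s) \<partial>lborel)"
  proof (rule integral_dominated_convergence[where w = "\<lambda>y. (B * (\<integral>z. norm (E 1 z) \<partial>lborel)) * norm (\<psi> y)"])
    show "AE y in lborel. (\<lambda>n. cnj (\<psi> y) * H (a n) y) \<longlonglongrightarrow> cnj (\<psi> y) * (\<psi> y * complex_of_real s)"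
      by (intro AE_I2 tendsto_intros Hlim)
    show "AE y in lborel. norm (cnj (\<psi> y) * H (a n) y) \<le> B * (\<integral>z. norm (E 1 z) \<partial>lborel) * norm (\<psi> y)" for n
      using Hb by (intro AE_I2) (auto simp: norm_mult mult.commute[of "norm (\<psi> _)"] intro!: mult_right_mono)
  qed (use I\<psi> in auto)
  also have "(\<integral>y. cnj (\<psi> y) * (\<psi> y * complex_of_real s) \<partial>lborel) = (\<integral>y. complex_of_real s * complex_of_real ((norm (\<psi> y))\<^sup>2) \<partial>lborel)"
    unfolding complex_norm_square by (simp add: mult_ac)
  also have "\<dots> = complex_of_real (s * (\<integral>y. (norm (\<psi> y))\<^sup>2 \<partial>lborel))"
    unfolding integral_mult_right_zero integral_complex_of_real of_real_mult ..
  finally have "(\<lambda>n. complex_of_real s * (\<integral>y. cnj (\<psi> y) * H (a n) y \<partial>lborel)) \<longlonglongrightarrow> complex_of_real s * complex_of_real (s * (\<integral>y. (norm (\<psi> y))\<^sup>2 \<partial>lborel))"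
    by (intro tendsto_intros)
  then have "(\<lambda>n. norm (\<integral>\<xi>. E (a n) \<xi> * (ft \<psi> \<xi> * cnj (ft \<psi> \<xi>)) \<partial>lborel)) \<longlonglongrightarrow> norm (complex_of_real s * complex_of_real (s * (\<integral>y. (norm (\<psi> y))\<^sup>2 \<partial>lborel)))"
    unfolding step1[OF a0] by (rule tendsto_norm)
  moreover have "norm (\<integral>\<xi>. E (a n) \<xi> * (ft \<psi> \<xi> * cnj (ft \<psi> \<xi>)) \<partial>lborel) \<le> (\<integral>\<xi>. (norm (ft \<psi> \<xi>))\<^sup>2 \<partial>lborel)" for n
  proof -
    have *: "norm (E (a n) \<xi> * (ft \<psi> \<xi> * cnj (ft \<psi> \<xi>))) \<le> (norm (ft \<psi> \<xi>))\<^sup>2" for \<xi>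
      using mult_right_mono[OF E1[OF a0[of n], of \<xi>], of "(norm (ft \<psi> \<xi>))\<^sup>2"]
      by (simp add: norm_mult power2_eq_square)
    show ?thesis
      by (rule order_trans[OF integral_norm_bound], rule integral_mono[OF _ int *])
         (rule Bochner_Integration.integrable_bound[OF int], use * in auto)
  qed
  ultimately have "norm (complex_of_real s * complex_of_real (s * (\<integral>y. (norm (\<psi> y))\<^sup>2 \<partial>lborel))) \<le> (\<integral>\<xi>. (norm (ft \<psi> \<xi>))\<^sup>2 \<partial>lborel)"
    by (intro tendsto_upperbound[OF _ always_eventually]) auto
  moreover have "norm (complex_of_real s * complex_of_real (s * (\<integral>y. (norm (\<psi> y))\<^sup>2 \<partial>lborel))) = s * (s * (\<integral>y. (norm (\<psi> y))\<^sup>2 \<partial>lborel))"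
    using s0 by (subst of_real_mult[symmetric], subst norm_of_real) simp
  moreover have "s * s = (2 * pi) ^ CARD('d)"
    unfolding s_def power_mult_distrib[symmetric] by simp
  ultimately show ?thesis by (simp add: mult.assoc[symmetric])
qed

section \<open>Rotation invariance of Lebesgue measure\<close>

text \<open>The library proves this only for well-ordered index types. Here it follows from the
  uniqueness argument for Haar measure, tested against the unit ball.\<close>

lemma nn_integral_translate_lborel:
  fixes F :: "'a::euclidean_space \<Rightarrow> ennreal"
  assumes "F \<in> borel_measurable borel"
  shows "(\<integral>\<^sup>+x. F (a + x) \<partial>lborel) = (\<integral>\<^sup>+x. F x \<partial>lborel)"
  using nn_integral_distr[of "(+) a" lborel borel F] assms by (simp add: lborel_distr_plus)

lemma nn_integral_orthogonal_transformation:
  fixes f :: "'a::euclidean_space \<Rightarrow> 'a" and F :: "'a::euclidean_space \<Rightarrow> ennreal"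
  assumes f: "orthogonal_transformation f" and F: "F \<in> borel_measurable borel"
  shows "(\<integral>\<^sup>+x. F (f x) \<partial>lborel) = (\<integral>\<^sup>+x. F x \<partial>lborel)"
proof -
  note [measurable] = F
  have lin: "linear f" using f orthogonal_transformation_linear by blast
  then have [measurable]: "f \<in> borel_measurable borel"
    by (intro borel_measurable_continuous_onI linear_continuous_on) (simp add: linear_conv_bounded_linear)
  have surj: "surj f" using f by (rule orthogonal_transformation_surj)
  define G :: "'a \<Rightarrow> ennreal" where "G = indicator (ball 0 1)"
  have [measurable]: "G \<in> borel_measurable borel" unfolding G_def by (intro borel_measurable_indicator) auto
  have Gf: "G (f x) = G x" for x
    using orthogonal_transformation_norm[OF f, of x] by (simp add: G_def indicator_def)
  have "(\<integral>\<^sup>+x. F (f x) \<partial>lborel) * (\<integral>\<^sup>+y. G y \<partial>lborel) = (\<integral>\<^sup>+x. F (f x) * (\<integral>\<^sup>+y. G (f x + y) \<partial>lborel) \<partial>lborel)"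
    by (simp add: nn_integral_translate_lborel nn_integral_multc)
  also have "\<dots> = (\<integral>\<^sup>+x. (\<integral>\<^sup>+y. F (f x) * G (f x + y) \<partial>lborel) \<partial>lborel)"
    by (simp add: nn_integral_cmult)
  also have "\<dots> = (\<integral>\<^sup>+y. (\<integral>\<^sup>+x. F (f x) * G (f x + y) \<partial>lborel) \<partial>lborel)"
    by (rule lborel_pair.Fubini') measurable
  also have "\<dots> = (\<integral>\<^sup>+y. (\<integral>\<^sup>+x. F (f x - y) * G (f x) \<partial>lborel) \<partial>lborel)"
  proof (rule nn_integral_cong)
    fix y :: 'a
    \<comment> \<open>Translating \<open>x\<close> by a preimage of \<open>- y\<close> moves the
      shift from the ball function \<open>G\<close> to \<open>F\<close>; afterwards
      \<open>G (f x) = G x\<close> frees the integral of \<open>G\<close> from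
      \<open>f\<close>.\<close>
    obtain z where z: "f z = - y" using surj by (metis surjD)
    have "(\<integral>\<^sup>+x. F (f x) * G (f x + y) \<partial>lborel) = (\<integral>\<^sup>+x. F (f (z + x)) * G (f (z + x) + y) \<partial>lborel)"
      by (subst nn_integral_translate_lborel[of "\<lambda>x. F (f x) * G (f x + y)" z, symmetric]) auto
    moreover have "f (z + x) = f x - y" for x using lin z by (simp add: linear_add)
    ultimately show "(\<integral>\<^sup>+x. F (f x) * G (f x + y) \<partial>lborel) = (\<integral>\<^sup>+x. F (f x - y) * G (f x) \<partial>lborel)"
      by simp
  qed
  also have "\<dots> = (\<integral>\<^sup>+x. (\<integral>\<^sup>+y. F (f x - y) * G (f x) \<partial>lborel) \<partial>lborel)"
    by (rule lborel_pair.Fubini'[symmetric]) measurable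
  also have "\<dots> = (\<integral>\<^sup>+x. (\<integral>\<^sup>+y. F y \<partial>lborel) * G x \<partial>lborel)"
  proof (rule nn_integral_cong)
    fix x :: 'a
    have "(\<integral>\<^sup>+y. F (f x - y) \<partial>lborel) = (\<integral>\<^sup>+y. F y \<partial>lborel)"
    proof -
      have "(\<integral>\<^sup>+y. F y \<partial>lborel) = (\<integral>\<^sup>+y. F y \<partial>density (distr lborel borel (\<lambda>y. f x + (-1) *\<^sub>R y)) (\<lambda>_. 1))"
        using lborel_affine[of "-1" "f x"] by simp
      also have "\<dots> = (\<integral>\<^sup>+y. F (f x - y) \<partial>lborel)"
        by (subst nn_integral_density) (auto simp: nn_integral_distr)
      finally show ?thesis by simp
    qed
    then show "(\<integral>\<^sup>+y. F (f x - y) * G (f x) \<partial>lborel) = (\<integral>\<^sup>+y. F y \<partial>lborel) * G x"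
      by (simp add: nn_integral_multc Gf)
  qed
  also have "\<dots> = (\<integral>\<^sup>+y. F y \<partial>lborel) * (\<integral>\<^sup>+y. G y \<partial>lborel)"
    by (simp add: nn_integral_cmult)
  finally have eq: "(\<integral>\<^sup>+x. F (f x) \<partial>lborel) * (\<integral>\<^sup>+y. G y \<partial>lborel) = (\<integral>\<^sup>+y. F y \<partial>lborel) * (\<integral>\<^sup>+y. G y \<partial>lborel)" .
  have G: "(\<integral>\<^sup>+y. G y \<partial>lborel) = emeasure lborel (ball (0::'a) 1)" unfolding G_def by simp
  have fin: "emeasure lborel (ball (0::'a) 1) < \<infinity>" by (rule emeasure_lborel_ball_finite)
  have "emeasure lborel (ball (0::'a) 1) \<noteq> 0"
    using content_ball_pos[of 1 "0::'a"] by (auto simp: measure_def emeasure_completion)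
  then have "a * (\<integral>\<^sup>+y. G y \<partial>lborel) / (\<integral>\<^sup>+y. G y \<partial>lborel) = a" for a :: ennreal
    using fin unfolding G by (intro ennreal_mult_divide_eq) auto
  with eq show ?thesis by metis
qed

lemma distr_orthogonal_transformation:
  fixes f :: "'a::euclidean_space \<Rightarrow> 'a"
  assumes f: "orthogonal_transformation f"
  shows "distr lborel borel f = lborel"
proof (rule measure_eqI)
  have [measurable]: "f \<in> borel_measurable borel"
    using orthogonal_transformation_linear[OF f]
    by (intro borel_measurable_continuous_onI linear_continuous_on) (simp add: linear_conv_bounded_linear)
  fix A assume "A \<in> sets (distr lborel borel f)"
  then have [measurable]: "A \<in> sets borel" by simp
  have "emeasure (distr lborel borel f) A = (\<integral>\<^sup>+x. indicator A (f x) \<partial>lborel)"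
    by (subst nn_integral_distr[symmetric, of f lborel borel "indicator A"]) auto
  also have "\<dots> = emeasure lborel A"
    by (subst nn_integral_orthogonal_transformation[OF f]) auto
  finally show "emeasure (distr lborel borel f) A = emeasure lborel A" .
qed simp

lemma integral_orthogonal_transformation:
  fixes f :: "'a::euclidean_space \<Rightarrow> 'a" and F :: "'a::euclidean_space \<Rightarrow> 'b::{banach,second_countable_topology}"
  assumes f: "orthogonal_transformation f" and F: "F \<in> borel_measurable borel"
  shows "(\<integral>x. F (f x) \<partial>lborel) = (\<integral>x. F x \<partial>lborel)"
proof -
  have "f \<in> borel_measurable borel"
    using orthogonal_transformation_linear[OF f]
    by (intro borel_measurable_continuous_onI linear_continuous_on) (simp add: linear_conv_bounded_linear)
  then show ?thesis
    using integral_distr[of f lborel borel F] F by (simp add: distr_orthogonal_transformation[OF f])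
qed

section \<open>Homogeneous polynomials\<close>

text \<open>Homogeneous polynomials as functions, built by multiplying with one coordinate at a
  time, so that most properties are one induction. The zero function has every degree, which makes
  each degree a vector space.\<close>

inductive hom_poly :: "nat \<Rightarrow> (real ^ 'd::finite \<Rightarrow> real) \<Rightarrow> bool" where
  hom_poly_const: "hom_poly 0 (\<lambda>x. c)"
| hom_poly_coord: "hom_poly n Q \<Longrightarrow> hom_poly (Suc n) (\<lambda>x. x $ i * Q x)"
| hom_poly_add: "hom_poly n P \<Longrightarrow> hom_poly n Q \<Longrightarrow> hom_poly n (\<lambda>x. P x + Q x)"

lemma hom_poly_cmult: "hom_poly n Q \<Longrightarrow> hom_poly n (\<lambda>x. c * Q x)"
proof (induction rule: hom_poly.induct)
  case (hom_poly_const c')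
  then show ?case by (rule hom_poly.hom_poly_const)
next
  case (hom_poly_coord n Q i)
  then show ?case using hom_poly.hom_poly_coord[of n "\<lambda>x. c * Q x" i] by (simp add: mult_ac)
next
  case (hom_poly_add n P Q)
  then show ?case using hom_poly.hom_poly_add by (simp add: distrib_left)
qed

lemma hom_poly_zero: "hom_poly n (\<lambda>x. 0)"
proof (induction n)
  case (Suc n)
  then show ?case using hom_poly_coord[of n "\<lambda>x. 0"] by simp
qed (rule hom_poly_const)

lemma hom_poly_sum: "(\<And>a. a \<in> A \<Longrightarrow> hom_poly n (f a)) \<Longrightarrow> hom_poly n (\<lambda>x. \<Sum>a\<in>A. f a x)"
  by (induction A rule: infinite_finite_induct) (auto intro: hom_poly_zero hom_poly_add)

lemma hom_poly_mult:
  assumes "hom_poly n P" "hom_poly m Q" shows "hom_poly (n + m) (\<lambda>x. P x * Q x)"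
  using assms
proof (induction rule: hom_poly.induct)
  case (hom_poly_const c)
  then show ?case using hom_poly_cmult[of m Q c] by simp
next
  case (hom_poly_coord n P i)
  then show ?case using hom_poly.hom_poly_coord[of "n + m" "\<lambda>x. P x * Q x" i] by (simp add: mult.assoc)
next
  case (hom_poly_add n P P')
  then show ?case using hom_poly.hom_poly_add[of "n + m" "\<lambda>x. P x * Q x" "\<lambda>x. P' x * Q x"]
    by (simp add: distrib_right)
qed

lemma hom_poly_prod:
  assumes "finite A" "\<And>a. a \<in> A \<Longrightarrow> hom_poly (n a) (f a)"
  shows "hom_poly (\<Sum>a\<in>A. n a) (\<lambda>x. \<Prod>a\<in>A. f a x)"
  using assms by (induction A rule: finite_induct) (auto intro: hom_poly_const hom_poly_mult)

lemma hom_poly_linear_times: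
  assumes "hom_poly n Q" shows "hom_poly (Suc n) (\<lambda>x. (v \<bullet> x) * Q x)"
proof -
  have "(\<lambda>x. (v \<bullet> x) * Q x) = (\<lambda>x. \<Sum>i\<in>UNIV. x $ i * (v $ i * Q x))"
    by (simp add: inner_vec_def sum_distrib_left mult_ac)
  then show ?thesis
    using assms by (auto intro!: hom_poly_sum hom_poly_coord hom_poly_cmult)
qed

lemma hom_poly_linear: "hom_poly 1 (\<lambda>x. v \<bullet> x)"
  using hom_poly_linear_times[OF hom_poly_const[of 1], of v] by simp

text \<open>A coordinate of \<open>f x\<close> is a linear form \<open>v \<bullet> x\<close>, and
  products with linear forms stay homogeneous. Hence rotations act on the space of each
  degree.\<close>

lemma hom_poly_comp_linear:
  assumes "hom_poly n Q" and f: "linear f" shows "hom_poly n (\<lambda>x. Q (f x))"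
  using assms(1)
proof (induction rule: hom_poly.induct)
  case (hom_poly_coord n Q i)
  define v where "v = (\<chi> j. f (axis j 1) $ i)"
  have "f x $ i = v \<bullet> x" for x
  proof -
    have "f x = f (\<Sum>j\<in>UNIV. x $ j *\<^sub>R axis j 1)"
      using basis_expansion[of x] by (simp add: scalar_mult_eq_scaleR)
    then show ?thesis
      by (simp add: linear_sum[OF f] linear_cmul[OF f] inner_vec_def mult.commute v_def)
  qed
  with hom_poly_linear_times[OF hom_poly_coord.IH] show ?case by simp
qed (auto intro: hom_poly.intros)

lemma hom_poly_scale: "hom_poly n Q \<Longrightarrow> Q (c *\<^sub>R x) = c ^ n * Q x"
  by (induction rule: hom_poly.induct) (auto simp: algebra_simps)

lemma hom_poly_continuous: "hom_poly n Q \<Longrightarrow> continuous_on S Q"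
  by (induction rule: hom_poly.induct) (auto intro!: continuous_intros)

lemma hom_poly_borel [measurable_dest]: "hom_poly n Q \<Longrightarrow> Q \<in> borel_measurable borel"
  by (intro borel_measurable_continuous_onI hom_poly_continuous)

text \<open>Words over the index type stand for monomials, each counted once per ordering of its
  factors. The excess is harmless: only finiteness of the spanning family matters.\<close>

lemma hom_poly_finite_span:
  "hom_poly n Q \<Longrightarrow> \<exists>c. \<forall>x. Q x = (\<Sum>w | length w = n. c w * (\<Prod>i\<leftarrow>w. x $ i))"
proof (induction rule: hom_poly.induct)
  case (hom_poly_const c)
  then show ?case by (auto intro!: exI[of _ "\<lambda>_. c"])
next
  case (hom_poly_coord n Q i)
  then obtain c where c: "\<And>x. Q x = (\<Sum>w | length w = n. c w * (\<Prod>i\<leftarrow>w. x $ i))" by blast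
  have fin: "finite {w::'a list. length w = n}" for n
    using finite_lists_length_eq[of "UNIV::'a set" n] by simp
  have "x $ i * Q x = (\<Sum>w | length w = Suc n. (if hd w = i then c (tl w) else 0) * (\<Prod>i\<leftarrow>w. x $ i))" for x
  proof -
    have "x $ i * Q x = (\<Sum>w | length w = n. c w * (\<Prod>i\<leftarrow>(i # w). x $ i))"
      by (simp add: c sum_distrib_left mult_ac)
    also have "\<dots> = (\<Sum>w\<in>(#) i ` {w. length w = n}. c (tl w) * (\<Prod>i\<leftarrow>w. x $ i))"
      by (subst sum.reindex) auto
    also have "\<dots> = (\<Sum>w | length w = Suc n. (if hd w = i then c (tl w) else 0) * (\<Prod>i\<leftarrow>w. x $ i))"
      by (rule sum.mono_neutral_cong_left[OF fin]) (auto simp: length_Suc_conv)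
    finally show ?thesis .
  qed
  then show ?case by (intro exI[of _ "\<lambda>w. if hd w = i then c (tl w) else 0"] allI)
next
  case (hom_poly_add n P Q)
  then obtain c c' where "\<And>x. P x = (\<Sum>w | length w = n. c w * (\<Prod>i\<leftarrow>w. x $ i))"
      "\<And>x. Q x = (\<Sum>w | length w = n. c' w * (\<Prod>i\<leftarrow>w. x $ i))" by blast
  then show ?case
    by (auto intro!: exI[of _ "\<lambda>w. c w + c' w"] simp: sum.distrib distrib_right)
qed

text \<open>A differential operator with constant coefficients is a polynomial multiplier that does
  not enlarge the support. All terms have the same degree, so they share the factor
  \<open>(- \<i>) ^ n\<close> and \<open>\<psi>\<close> remains real.\<close>

lemma hom_poly_multiplier:
  assumes "hom_poly n Q" and \<phi>: "\<phi> \<in> test_functions \<Omega>"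
  shows "\<exists>\<psi>. \<psi> \<in> test_functions \<Omega> \<and> (\<forall>\<xi>. ft (\<lambda>x. complex_of_real (\<psi> x)) \<xi> =
     (- \<i>) ^ n * complex_of_real (Q \<xi>) * ft (\<lambda>x. complex_of_real (\<phi> x)) \<xi>)"
  using assms(1)
proof (induction rule: hom_poly.induct)
  case (hom_poly_const c)
  have "(\<lambda>x. c * \<phi> x) \<in> test_functions \<Omega>"
    using test_functions_comp_linear[OF bounded_linear_mult_right \<phi>] .
  moreover have "ft (\<lambda>x. complex_of_real (c * \<phi> x)) \<xi> = complex_of_real c * ft (\<lambda>x. complex_of_real (\<phi> x)) \<xi>" for \<xi>
    unfolding ft_def by (simp add: mult.assoc)
  ultimately show ?case by auto
next
  case (hom_poly_coord n Q i)
  then obtain \<psi> where \<psi>: "\<psi> \<in> test_functions \<Omega>" "\<And>\<xi>. ft (\<lambda>x. complex_of_real (\<psi> x)) \<xi> =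
     (- \<i>) ^ n * complex_of_real (Q \<xi>) * ft (\<lambda>x. complex_of_real (\<phi> x)) \<xi>" by blast
  have "partial_deriv i (\<lambda>x. complex_of_real (\<psi> x)) = (\<lambda>x. complex_of_real (partial_deriv i \<psi> x))"
    by (auto simp: partial_deriv_comp_linear[OF bounded_linear_of_real]
        smooth_fun_differentiable test_functions_smooth[OF \<psi>(1)])
  with ft_partial_deriv[OF test_functions_of_real[OF \<psi>(1)], of i]
  have "ft (\<lambda>x. complex_of_real (partial_deriv i \<psi> x)) \<xi> = - \<i> * complex_of_real (\<xi> $ i) * ft (\<lambda>x. complex_of_real (\<psi> x)) \<xi>" for \<xi>
    by simp
  with \<psi> test_functions_partial_deriv[OF \<psi>(1), of i] show ?case
    by (intro exI[of _ "partial_deriv i \<psi>"]) (auto simp: mult_ac)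
next
  case (hom_poly_add n P Q)
  then obtain \<psi> \<psi>' where \<psi>: "\<psi> \<in> test_functions \<Omega>" "\<And>\<xi>. ft (\<lambda>x. complex_of_real (\<psi> x)) \<xi> =
     (- \<i>) ^ n * complex_of_real (P \<xi>) * ft (\<lambda>x. complex_of_real (\<phi> x)) \<xi>"
    "\<psi>' \<in> test_functions \<Omega>" "\<And>\<xi>. ft (\<lambda>x. complex_of_real (\<psi>' x)) \<xi> =
     (- \<i>) ^ n * complex_of_real (Q \<xi>) * ft (\<lambda>x. complex_of_real (\<phi> x)) \<xi>" by blast
  have "ft (\<lambda>x. complex_of_real (\<psi> x + \<psi>' x)) \<xi> = ft (\<lambda>x. complex_of_real (\<psi> x)) \<xi> + ft (\<lambda>x. complex_of_real (\<psi>' x)) \<xi>" for \<xi>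
    unfolding ft_def using \<psi>(1,3)
    by (subst Bochner_Integration.integral_add[symmetric])
       (auto simp: distrib_right intro!: integrable_mult_cis test_functions_integrable[OF test_functions_of_real])
  with \<psi> test_functions_add[OF \<psi>(1,3)] show ?case
    by (intro exI[of _ "\<lambda>x. \<psi> x + \<psi>' x"]) (auto simp: algebra_simps)
qed


section \<open>Fooling polynomials\<close>

text \<open>Gaussian elimination by induction on the equations: an unknown \<open>k\<close> that
  occurs in equation \<open>j\<close> is solved for and removed from the others.\<close>

lemma underdetermined_system:
  fixes a :: "'i \<Rightarrow> 'j \<Rightarrow> real"
  assumes "finite J" "finite I" "card J < card I"
  shows "\<exists>c. (\<exists>i\<in>I. c i \<noteq> 0) \<and> (\<forall>j\<in>J. (\<Sum>i\<in>I. c i * a i j) = 0)"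
  using assms
proof (induction J arbitrary: I a rule: finite_induct)
  case empty
  then have "I \<noteq> {}" by auto
  then show ?case by (auto intro!: exI[of _ "\<lambda>_. 1"])
next
  case (insert j J)
  show ?case
  proof (cases "\<forall>i\<in>I. a i j = 0")
    case True
    have "card J < card I" using insert by auto
    from insert.IH[OF insert.prems(1) this, of a] True show ?thesis by auto
  next
    case False
    then obtain k where k: "k \<in> I" "a k j \<noteq> 0" by auto
    have "card J < card (I - {k})" using insert k by auto
    from insert.IH[OF finite_Diff[OF insert.prems(1)] this, of "\<lambda>i j'. a i j' - a i j / a k j * a k j'"]
    obtain c where c: "\<exists>i\<in>I - {k}. c i \<noteq> 0"
      "\<And>j'. j' \<in> J \<Longrightarrow> (\<Sum>i\<in>I - {k}. c i * (a i j' - a i j / a k j * a k j')) = 0" by blast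
    \<comment> \<open>The value of the pivot unknown that equation \<open>j\<close> forces.\<close>
    define b where "b = - (\<Sum>i\<in>I - {k}. c i * a i j) / a k j"
    define c' where "c' = c(k := b)"
    have sum: "(\<Sum>i\<in>I. c' i * a i j') = b * a k j' + (\<Sum>i\<in>I - {k}. c i * a i j')" for j'
    proof -
      have "(\<Sum>i\<in>I - {k}. c' i * a i j') = (\<Sum>i\<in>I - {k}. c i * a i j')"
        by (intro sum.cong) (auto simp: c'_def)
      then show ?thesis
        using sum.remove[OF insert.prems(1) k(1), of "\<lambda>i. c' i * a i j'"] by (simp add: c'_def)
    qed
    have "(\<Sum>i\<in>I. c' i * a i j) = 0"
      using k(2) by (simp add: sum b_def)
    moreover have "(\<Sum>i\<in>I. c' i * a i j') = 0" if "j' \<in> J" for j'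
    proof -
      have "(\<Sum>i\<in>I - {k}. c i * (a i j' - a i j / a k j * a k j')) =
          (\<Sum>i\<in>I - {k}. c i * a i j') - (\<Sum>i\<in>I - {k}. c i * a i j) / a k j * a k j'"
      proof -
        have "(\<Sum>i\<in>I - {k}. c i * (a i j' - a i j / a k j * a k j')) =
            (\<Sum>i\<in>I - {k}. c i * a i j' - c i * a i j * (a k j' / a k j))"
          by (intro sum.cong) (auto simp: algebra_simps)
        also have "\<dots> = (\<Sum>i\<in>I - {k}. c i * a i j') - (\<Sum>i\<in>I - {k}. c i * a i j) * (a k j' / a k j)"
          by (simp only: sum_subtractf sum_distrib_right[symmetric])
        finally show ?thesis by simp
      qed
      then show ?thesis
        using c(2)[OF that] by (simp add: sum b_def)
    qed
    moreover have "\<exists>i\<in>I. c' i \<noteq> 0" using c(1) by (auto simp: c'_def)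
    ultimately show ?thesis by (intro exI[of _ c']) auto
  qed
qed

text \<open>The shell replaces the unit sphere, so that Lebesgue measure can be used throughout; it
  stays away from the origin, where the quotient in \<open>ip\<close> is singular.\<close>

definition shell :: "(real ^ 'd::finite) set" where "shell = cball 0 2 - ball 0 1"

lemma shell_iff: "y \<in> shell \<longleftrightarrow> 1 \<le> norm y \<and> norm y \<le> 2"
  by (auto simp: shell_def)

lemma compact_shell: "compact shell"
  unfolding shell_def by (intro compact_diff compact_cball open_ball)

lemma shell_borel [measurable]: "shell \<in> sets borel"
  using compact_shell by (intro borel_closed compact_imp_closed)

text \<open>The inner product is the one of \<open>L\<^sup>2\<close> of the sphere, integrated over radii in \<open>[1, 2]\<close>.\<close>

definition ip :: "nat \<Rightarrow> (real ^ 'd::finite \<Rightarrow> real) \<Rightarrow> (real ^ 'd \<Rightarrow> real) \<Rightarrow> real"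
  where "ip N P Q = (\<integral>y. indicator shell y * (P y * Q y / norm y ^ (2 * N)) \<partial>lborel)"

lemma integrable_shell:
  assumes "continuous_on shell F"
  shows "integrable lborel (\<lambda>y. indicator shell y * (F y :: real))"
  using borel_integrable_compact[OF compact_shell assms] by simp

lemma continuous_on_shell_div:
  fixes F :: "real ^ 'a::finite \<Rightarrow> real"
  assumes "continuous_on shell F"
  shows "continuous_on shell (\<lambda>y. F y / norm y ^ M)"
proof (rule continuous_on_divide[OF assms])
  show "continuous_on shell (\<lambda>y::real^'a. norm y ^ M)" by (intro continuous_intros)
  show "\<forall>x\<in>shell. norm (x::real^'a) ^ M \<noteq> 0"
  proof
    fix x :: "real^'a" assume "x \<in> shell"
    then have "norm x > 0" unfolding shell_iff by linarith
    then show "norm x ^ M \<noteq> 0" by simp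
  qed
qed

lemma integrable_ip:
  assumes "hom_poly n P" "hom_poly m Q"
  shows "integrable lborel (\<lambda>y. indicator shell y * (P y * Q y / norm y ^ M))"
  by (rule integrable_shell, rule continuous_on_shell_div, rule continuous_on_mult)
     (rule hom_poly_continuous[OF assms(1)], rule hom_poly_continuous[OF assms(2)])

lemma ip_commute: "ip N P Q = ip N Q P"
  unfolding ip_def by (simp add: mult.commute)

lemma ip_sum_left:
  assumes "\<And>a. a \<in> A \<Longrightarrow> hom_poly N (f a)" "hom_poly N Q"
  shows "ip N (\<lambda>x. \<Sum>a\<in>A. c a * f a x) Q = (\<Sum>a\<in>A. c a * ip N (f a) Q)"
proof -
  have "ip N (\<lambda>x. \<Sum>a\<in>A. c a * f a x) Q =
      (\<integral>y. (\<Sum>a\<in>A. c a * (indicator shell y * (f a y * Q y / norm y ^ (2 * N)))) \<partial>lborel)"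
    unfolding ip_def by (simp add: sum_distrib_left sum_distrib_right sum_divide_distrib mult_ac)
  also have "\<dots> = (\<Sum>a\<in>A. c a * ip N (f a) Q)"
  proof -
    have "(\<integral>y. (\<Sum>a\<in>A. c a * (indicator shell y * (f a y * Q y / norm y ^ (2 * N)))) \<partial>lborel) =
       (\<Sum>a\<in>A. \<integral>y. c a * (indicator shell y * (f a y * Q y / norm y ^ (2 * N))) \<partial>lborel)"
      by (rule Bochner_Integration.integral_sum, rule integrable_mult_right, rule integrable_ip[OF assms(1) assms(2)])
    also have "\<dots> = (\<Sum>a\<in>A. c a * ip N (f a) Q)"
      unfolding ip_def by (intro sum.cong refl integral_mult_right_zero)
    finally show ?thesis .
  qed
  finally show ?thesis .
qed

lemma ip_diff_left:
  assumes "hom_poly N P" "hom_poly N Q" "hom_poly N R"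
  shows "ip N (\<lambda>x. P x - Q x) R = ip N P R - ip N Q R"
  unfolding ip_def
  by (subst Bochner_Integration.integral_diff[OF integrable_ip[OF assms(1,3)] integrable_ip[OF assms(2,3)], symmetric])
     (intro Bochner_Integration.integral_cong, simp_all add: left_diff_distrib diff_divide_distrib right_diff_distrib)

text \<open>Homogeneity carries a nonzero value at \<open>y0\<close> along its ray into the open
  shell, where continuity gives a whole open set of nonzero values.\<close>

lemma ip_pos:
  assumes Q: "hom_poly N Q" and y0: "Q y0 \<noteq> 0" "y0 \<noteq> 0"
  shows "ip N Q Q > 0"
proof -
  let ?F = "\<lambda>y. indicator shell y * (Q y * Q y / norm y ^ (2 * N)) :: real"
  have nn: "?F y \<ge> 0" for y by (auto simp: indicator_def)
  have "ip N Q Q \<ge> 0" unfolding ip_def using nn by (intro Bochner_Integration.integral_nonneg) auto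
  moreover have "ip N Q Q \<noteq> 0"
  proof
    assume "ip N Q Q = 0"
    then have "AE y in lborel. ?F y = 0"
      unfolding ip_def by (subst (asm) integral_nonneg_eq_0_iff_AE) (use integrable_ip[OF Q Q] nn in auto)
    moreover define U where "U = {y::real^'a. 1 < norm y \<and> norm y < 2 \<and> Q y \<noteq> 0}"
    have "y \<notin> U" if "?F y = 0" for y using that by (auto simp: U_def shell_iff indicator_def)
    ultimately have "AE y in lborel. y \<notin> U" by auto
    moreover have "open U"
    proof -
      have "U = {y. 1 < norm y} \<inter> {y. norm y < 2} \<inter> (Q -` (- {0}))" by (auto simp: U_def)
      then show ?thesis using hom_poly_continuous[OF Q, of UNIV]
        by (auto intro!: open_Int open_Collect_less continuous_intros open_vimage)
    qed
    ultimately have "emeasure lborel U = 0"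
      by (subst (asm) AE_iff_measurable[of U]) auto
    then have "negligible U" using \<open>open U\<close>
      by (simp add: negligible_iff_emeasure0 emeasure_completion)
    with \<open>open U\<close> have "U = {}" using open_not_negligible by blast
    moreover have "(3 / 2 / norm y0) *\<^sub>R y0 \<in> U"
      using y0 by (simp add: U_def hom_poly_scale[OF Q])
    ultimately show False by blast
  qed
  ultimately show ?thesis by simp
qed

lemma hom_poly_at_0: "hom_poly N Q \<Longrightarrow> N \<ge> 1 \<Longrightarrow> Q 0 = 0"
  using hom_poly_scale[of N Q 0 0] by (simp add: power_0_left)

section \<open>Orthonormal systems of homogeneous polynomials and dimension counts\<close>

definition orthonormal_sys :: "nat \<Rightarrow> nat \<Rightarrow> (nat \<Rightarrow> real ^ 'd::finite \<Rightarrow> real) \<Rightarrow> bool"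
  where "orthonormal_sys N m e \<longleftrightarrow> (\<forall>i<m. hom_poly N (e i)) \<and>
    (\<forall>i<m. \<forall>j<m. ip N (e i) (e j) = (if i = j then 1 else 0))"

lemma orthonormal_sys_extend:
  assumes e: "orthonormal_sys N m e" and N: "N \<ge> 1"
    and Q: "hom_poly N Q" "Q y \<noteq> 0" "\<And>i. i < m \<Longrightarrow> ip N Q (e i) = 0"
  shows "\<exists>c. orthonormal_sys N (Suc m) (e(m := \<lambda>x. c * Q x))"
proof -
  have "y \<noteq> 0" using hom_poly_at_0[OF Q(1) N] Q(2) by auto
  then have pos: "ip N Q Q > 0" using ip_pos[OF Q(1,2)] by blast
  define c where "c = 1 / sqrt (ip N Q Q)"
  have sc: "ip N (\<lambda>x. c * Q x) R = c * ip N Q R" if "hom_poly N R" for R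
    using ip_sum_left[of "{()}" N "\<lambda>_. Q" R "\<lambda>_. c"] Q(1) that by simp
  have cQ: "hom_poly N (\<lambda>x. c * Q x)" by (rule hom_poly_cmult[OF Q(1)])
  have "ip N (\<lambda>x. c * Q x) (\<lambda>x. c * Q x) = c * (c * ip N Q Q)"
    by (subst sc[OF cQ], subst ip_commute, subst sc[OF Q(1)]) simp
  also have "\<dots> = 1" using pos by (simp add: c_def)
  finally have n1: "ip N (\<lambda>x. c * Q x) (\<lambda>x. c * Q x) = 1" .
  have o: "ip N (\<lambda>x. c * Q x) (e i) = 0" "ip N (e i) (\<lambda>x. c * Q x) = 0" if "i < m" for i
    using sc[of "e i"] e Q(3)[OF that] that ip_commute[of N "e i"] by (auto simp: orthonormal_sys_def)
  have "orthonormal_sys N (Suc m) (e(m := \<lambda>x. c * Q x))"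
    using e cQ n1 o unfolding orthonormal_sys_def by (auto simp: less_Suc_eq)
  then show ?thesis by blast
qed

lemma orthonormal_sys_combination:
  assumes e: "orthonormal_sys N m e" and k: "k < m"
  shows "ip N (\<lambda>x. \<Sum>i<m. c i * e i x) (e k) = c k"
proof -
  have "ip N (\<lambda>x. \<Sum>i<m. c i * e i x) (e k) = (\<Sum>i<m. c i * ip N (e i) (e k))"
    by (rule ip_sum_left) (use assms in \<open>auto simp: orthonormal_sys_def\<close>)
  also have "\<dots> = (\<Sum>i<m. if i = k then c i else 0)"
    using assms by (intro sum.cong) (auto simp: orthonormal_sys_def)
  finally show ?thesis using k by simp
qed

text \<open>An orthonormal system is linearly independent, so it has no more members than there are
  spanning monomials. The bound is crude; its purpose is that a system of maximal size
  exists.\<close>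

lemma orthonormal_sys_bounded:
  assumes e: "orthonormal_sys N m (e :: nat \<Rightarrow> real ^ 'd::finite \<Rightarrow> real)"
  shows "m \<le> card {w :: 'd list. length w = N}"
proof (rule ccontr)
  assume neg: "\<not> ?thesis"
  let ?W = "{w :: 'd list. length w = N}"
  have fin: "finite ?W" using finite_lists_length_eq[of "UNIV::'d set" N] by simp
  have "\<exists>c. \<forall>x. e i x = (\<Sum>w\<in>?W. c w * (\<Prod>j\<leftarrow>w. x $ j))" if "i < m" for i
    by (rule hom_poly_finite_span) (use e that in \<open>auto simp: orthonormal_sys_def\<close>)
  then have "\<forall>i\<in>{..<m}. \<exists>c. \<forall>x. e i x = (\<Sum>w\<in>?W. c w * (\<Prod>j\<leftarrow>w. x $ j))" by auto
  from bchoice[OF this] obtain a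
    where a: "\<And>i x. i < m \<Longrightarrow> e i x = (\<Sum>w\<in>?W. a i w * (\<Prod>j\<leftarrow>w. x $ j))" by auto
  obtain c where c: "\<exists>i\<in>{..<m}. c i \<noteq> 0" "\<forall>w\<in>?W. (\<Sum>i\<in>{..<m}. c i * a i w) = 0"
    using underdetermined_system[OF fin, of "{..<m}" a] neg by auto
  have "(\<Sum>i<m. c i * e i x) = 0" for x
  proof -
    have "(\<Sum>i<m. c i * e i x) = (\<Sum>i<m. \<Sum>w\<in>?W. c i * a i w * (\<Prod>j\<leftarrow>w. x $ j))"
      by (simp add: a sum_distrib_left mult.assoc)
    also have "\<dots> = (\<Sum>w\<in>?W. (\<Sum>i<m. c i * a i w) * (\<Prod>j\<leftarrow>w. x $ j))"
      by (subst sum.swap) (simp add: sum_distrib_right)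
    finally show ?thesis using c(2) by simp
  qed
  then have "c k = 0" if "k < m" for k
    using orthonormal_sys_combination[OF e that, of c] by (simp add: ip_def)
  with c(1) show False by auto
qed

text \<open>A system of maximal size is complete: a nonzero residual of an expansion would be
  orthogonal to it and, once normalized, would extend it.\<close>

lemma complete_orthonormal_sys:
  assumes N: "N \<ge> 1"
  obtains D and e :: "nat \<Rightarrow> real ^ 'd::finite \<Rightarrow> real" where "orthonormal_sys N D e"
    "\<And>Q x. hom_poly N Q \<Longrightarrow> Q x = (\<Sum>i<D. ip N Q (e i) * e i x)"
proof -
  define E where "E m \<longleftrightarrow> (\<exists>e :: nat \<Rightarrow> real ^ 'd \<Rightarrow> real. orthonormal_sys N m e)" for m
  define D where "D = Greatest E"
  have ex0: "E 0" by (simp add: E_def orthonormal_sys_def)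
  have bd: "m \<le> card {w :: 'd list. length w = N}" if "E m" for m
    using that orthonormal_sys_bounded unfolding E_def by blast
  have "E D"
    unfolding D_def by (rule GreatestI_nat[of E 0, OF ex0 bd])
  then obtain e :: "nat \<Rightarrow> real ^ 'd \<Rightarrow> real" where e: "orthonormal_sys N D e"
    unfolding E_def by blast
  have max: "m \<le> D" if "orthonormal_sys N m e'" for m and e' :: "nat \<Rightarrow> real ^ 'd \<Rightarrow> real"
    unfolding D_def by (rule Greatest_le_nat[of E m, OF _ bd]) (use that in \<open>auto simp: E_def\<close>)
  have "Q x = (\<Sum>i<D. ip N Q (e i) * e i x)" if Q: "hom_poly N Q" for Q x
  proof (rule ccontr)
    assume neq: "Q x \<noteq> (\<Sum>i<D. ip N Q (e i) * e i x)"
    have eh: "hom_poly N (e i)" if "i < D" for i using e that by (auto simp: orthonormal_sys_def)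
    define S where "S = (\<lambda>x. \<Sum>i<D. ip N Q (e i) * e i x)"
    define R where "R = (\<lambda>x. Q x - S x)"
    have S: "hom_poly N S"
      unfolding S_def by (intro hom_poly_sum hom_poly_cmult eh) auto
    have R: "hom_poly N R"
      using hom_poly_add[OF Q hom_poly_cmult[OF S, of "-1"]] by (simp add: R_def)
    have "ip N R (e k) = 0" if k: "k < D" for k
      using orthonormal_sys_combination[OF e k, of "\<lambda>i. ip N Q (e i)"]
      by (simp add: R_def ip_diff_left[OF Q S eh[OF k]] S_def[symmetric])
    from orthonormal_sys_extend[OF e N R _ this, of x] neq
    obtain c where "orthonormal_sys N (Suc D) (e(D := \<lambda>x. c * R x))" by (auto simp: R_def S_def)
    from max[OF this] show False by simp
  qed
  then show thesis by (rule that[OF e])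
qed

lemma orthonormal_sys_hom: "orthonormal_sys N m e \<Longrightarrow> i < m \<Longrightarrow> hom_poly N (e i)"
  by (auto simp: orthonormal_sys_def)

text \<open>The sum of squares at \<open>y\<close> is the largest value of \<open>(Q y)^2\<close>
  over the \<open>Q\<close> of norm 1 in the span (the Christoffel function), and a smaller space
  has a smaller one. The proof tests with the reproducing kernel \<open>Q\<close> of the system
  \<open>g\<close> at \<open>y\<close>: its value at \<open>y\<close> and its squared norm are both
  \<open>S\<close>.\<close>

lemma orthonormal_sys_sum_squares_le:
  assumes e: "orthonormal_sys N D e" "\<And>Q x. hom_poly N Q \<Longrightarrow> Q x = (\<Sum>i<D. ip N Q (e i) * e i x)"
    and g: "orthonormal_sys N m g"
  shows "(\<Sum>i<m. (g i y)\<^sup>2) \<le> (\<Sum>i<D. (e i y)\<^sup>2)"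
proof -
  define Q where "Q x = (\<Sum>i<m. g i y * g i x)" for x
  define S where "S = (\<Sum>i<m. (g i y)\<^sup>2)"
  have Q: "hom_poly N Q" unfolding Q_def[abs_def]
    by (intro hom_poly_sum hom_poly_cmult) (use orthonormal_sys_hom[OF g] in auto)
  have S0: "S \<ge> 0" by (simp add: S_def sum_nonneg)
  have QS: "Q y = S" by (simp add: Q_def S_def power2_eq_square)
  have "ip N Q Q = (\<Sum>i<m. g i y * ip N Q (g i))"
  proof -
    have "ip N Q Q = ip N (\<lambda>x. \<Sum>i<m. g i y * g i x) Q"
      by (rule arg_cong[OF meta_eq_to_obj_eq[OF Q_def[abs_def]], of "\<lambda>R. ip N R Q"])
    also have "\<dots> = (\<Sum>i<m. g i y * ip N (g i) Q)"
      by (rule ip_sum_left) (use orthonormal_sys_hom[OF g] Q in auto)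
    finally show ?thesis by (simp only: ip_commute[of N "g _" Q])
  qed
  also have "\<dots> = S"
    unfolding S_def power2_eq_square
  proof (intro sum.cong refl arg_cong2[where f = "(*)"])
    fix i assume "i \<in> {..<m}"
    then show "ip N Q (g i) = g i y"
      using orthonormal_sys_combination[OF g, of i "\<lambda>i. g i y"] unfolding Q_def[abs_def] by simp
  qed
  finally have QQ: "ip N Q Q = S" .
  have Qe: "Q = (\<lambda>x. \<Sum>i<D. ip N Q (e i) * e i x)" by (rule ext) (rule e(2)[OF Q])
  have "ip N Q Q = ip N (\<lambda>x. \<Sum>i<D. ip N Q (e i) * e i x) Q"
    by (rule arg_cong[OF Qe, of "\<lambda>R. ip N R Q"])
  also have "\<dots> = (\<Sum>i<D. ip N Q (e i) * ip N (e i) Q)"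
    by (rule ip_sum_left) (use orthonormal_sys_hom[OF e(1)] Q in auto)
  finally have "ip N Q Q = (\<Sum>i<D. ip N Q (e i) * ip N (e i) Q)" .
  then have QQ2: "(\<Sum>i<D. (ip N Q (e i))\<^sup>2) = S"
    using QQ by (simp add: power2_eq_square ip_commute[of N "e _" Q])
  have "S\<^sup>2 = (\<Sum>i<D. ip N Q (e i) * e i y)\<^sup>2" using QS e(2)[OF Q, of y] by simp
  also have "\<dots> \<le> (\<Sum>i<D. (ip N Q (e i))\<^sup>2) * (\<Sum>i<D. (e i y)\<^sup>2)"
    by (rule Cauchy_Schwarz_ineq_sum)
  finally have "S * S \<le> S * (\<Sum>i<D. (e i y)\<^sup>2)" by (simp only: QQ2 power2_eq_square[of S])
  then show ?thesis
    using S0 unfolding S_def[symmetric]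
    by (cases "S = 0") (auto simp: mult_le_cancel_left sum_nonneg)
qed

lemma ip_orthogonal_transformation:
  fixes f :: "real ^ 'd::finite \<Rightarrow> real ^ 'd"
  assumes f: "orthogonal_transformation f" and P: "hom_poly N P" and Q: "hom_poly N Q"
  shows "ip N (\<lambda>x. P (f x)) (\<lambda>x. Q (f x)) = ip N P Q"
proof -
  have nf: "norm (f x) = norm x" for x using orthogonal_transformation_norm[OF f] .
  note [measurable] = hom_poly_borel[OF P] hom_poly_borel[OF Q]
  define F where "F y = (indicator shell y * (P y * Q y / norm y ^ (2 * N)) :: real)" for y
  have [measurable]: "F \<in> borel_measurable borel" unfolding F_def by measurable
  have "ip N (\<lambda>x. P (f x)) (\<lambda>x. Q (f x)) = (\<integral>y. F (f y) \<partial>lborel)"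
    unfolding ip_def F_def by (intro Bochner_Integration.integral_cong) (auto simp: nf indicator_def shell_iff)
  also have "\<dots> = (\<integral>y. F y \<partial>lborel)"
    by (rule integral_orthogonal_transformation[OF f]) measurable
  finally show ?thesis by (simp add: ip_def F_def)
qed

text \<open>Composition with a rotation that takes \<open>y\<close> to \<open>x\<close> preserves
  \<open>ip\<close>, so it gives another orthonormal system to which the comparison of sums of
  squares applies. Exchanging \<open>x\<close> and \<open>y\<close> turns this into
  equality.\<close>

lemma christoffel_function_radial:
  assumes e: "orthonormal_sys N D e" "\<And>Q x. hom_poly N Q \<Longrightarrow> Q x = (\<Sum>i<D. ip N Q (e i) * e i x)"
    and xy: "norm x = norm y"
  shows "(\<Sum>i<D. (e i x)\<^sup>2) \<le> (\<Sum>i<D. (e i y)\<^sup>2)"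
proof -
  obtain f where f: "orthogonal_transformation f" "f y = x"
    using orthogonal_transformation_exists[OF xy[symmetric]] by blast
  have "orthonormal_sys N D (\<lambda>i x. e i (f x))"
    using e(1) f(1) hom_poly_comp_linear[OF _ orthogonal_transformation_linear[OF f(1)]]
    unfolding orthonormal_sys_def by (auto simp: ip_orthogonal_transformation)
  from orthonormal_sys_sum_squares_le[OF e this, of y] f(2) show ?thesis by simp
qed

text \<open>Dimension count: a new member must be orthogonal to the previous \<open>m\<close> ones
  and vanish at \<open>n\<close> points, which is fewer than \<open>D\<close> linear conditions on
  its \<open>D\<close> coefficients.\<close>

lemma orthonormal_sys_vanishing:
  fixes e :: "nat \<Rightarrow> real ^ 'd::finite \<Rightarrow> real" and \<omega> :: "nat \<Rightarrow> real ^ 'd"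
  assumes e: "orthonormal_sys N D e" and N: "N \<ge> 1" and m: "m + n \<le> D"
  shows "\<exists>g. orthonormal_sys N m g \<and> (\<forall>i<m. \<forall>r<n. g i (\<omega> r) = 0)"
  using m
proof (induction m)
  case 0
  show ?case by (auto simp: orthonormal_sys_def)
next
  case (Suc m)
  then obtain g where g: "orthonormal_sys N m g" "\<forall>i<m. \<forall>r<n. g i (\<omega> r) = 0" by auto
  \<comment> \<open>Both kinds of conditions in one index set: \<open>Inl\<close> for orthogonality,
    \<open>Inr\<close> for prescribed zeros.\<close>
  define J where "J = Inl ` {..<m} \<union> (Inr ` {..<n} :: (nat + nat) set)"
  define a where "a i j = (case j of Inl k \<Rightarrow> ip N (e i) (g k) | Inr r \<Rightarrow> e i (\<omega> r))" for i j
  have "card J = m + n" unfolding J_def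
    by (subst card_Un_disjoint) (auto simp: card_image)
  then obtain c where c: "\<exists>i\<in>{..<D}. c i \<noteq> 0" "\<forall>j\<in>J. (\<Sum>i\<in>{..<D}. c i * a i j) = 0"
    using underdetermined_system[of J "{..<D}" a] Suc.prems by (auto simp: J_def)
  define Q where "Q x = (\<Sum>i<D. c i * e i x)" for x
  have Q: "hom_poly N Q" unfolding Q_def[abs_def]
    by (intro hom_poly_sum hom_poly_cmult) (use orthonormal_sys_hom[OF e] in auto)
  have Qg: "ip N Q (g k) = 0" if "k < m" for k
  proof -
    have "ip N Q (g k) = (\<Sum>i<D. c i * a i (Inl k))"
      unfolding Q_def[abs_def] a_def
      by (subst ip_sum_left) (use orthonormal_sys_hom[OF e] orthonormal_sys_hom[OF g(1) that] in auto)
    then show ?thesis using c(2) that by (auto simp: J_def)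
  qed
  have Qz: "Q (\<omega> r) = 0" if "r < n" for r
    using c(2) that by (auto simp: J_def Q_def a_def dest!: bspec[of _ _ "Inr r"])
  have "\<exists>y. Q y \<noteq> 0"
  proof (rule ccontr)
    assume "\<nexists>y. Q y \<noteq> 0"
    then have "ip N Q (e k) = 0" for k by (simp add: ip_def)
    moreover obtain k where "k < D" "c k \<noteq> 0" using c(1) by auto
    ultimately show False
      using orthonormal_sys_combination[OF e, of k c] by (simp add: Q_def[abs_def])
  qed
  then obtain y where "Q y \<noteq> 0" by blast
  from orthonormal_sys_extend[OF g(1) N Q this Qg] obtain b
    where "orthonormal_sys N (Suc m) (g(m := \<lambda>x. b * Q x))" by blast
  moreover have "\<forall>i<Suc m. \<forall>r<n. (g(m := \<lambda>x. b * Q x)) i (\<omega> r) = 0"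
    using g(2) Qz by (auto simp: less_Suc_eq)
  ultimately show ?case by blast
qed

text \<open>The values at the points \<open>y i\<close> make the \<open>q j\<close> linearly
  independent, whereas more than \<open>D\<close> of them would satisfy a nontrivial relation after
  expansion in \<open>e\<close>.\<close>

lemma complete_orthonormal_sys_dim_ge:
  fixes e :: "nat \<Rightarrow> real ^ 'd::finite \<Rightarrow> real" and q :: "'j \<Rightarrow> real ^ 'd \<Rightarrow> real"
  assumes e: "orthonormal_sys N D e" "\<And>Q x. hom_poly N Q \<Longrightarrow> Q x = (\<Sum>i<D. ip N Q (e i) * e i x)"
    and J: "finite J" "\<And>j. j \<in> J \<Longrightarrow> hom_poly N (q j)"
    "\<And>i j. i \<in> J \<Longrightarrow> j \<in> J \<Longrightarrow> q j (y i) = (if i = j then 1 else 0)"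
  shows "card J \<le> D"
proof (rule ccontr)
  assume "\<not> card J \<le> D"
  then obtain c where c: "\<exists>j\<in>J. c j \<noteq> 0" "\<forall>i\<in>{..<D}. (\<Sum>j\<in>J. c j * ip N (q j) (e i)) = 0"
    using underdetermined_system[of "{..<D}" J "\<lambda>j i. ip N (q j) (e i)"] J(1) by auto
  have "(\<Sum>j\<in>J. c j * q j x) = 0" for x
  proof -
    have "(\<Sum>j\<in>J. c j * q j x) = (\<Sum>j\<in>J. \<Sum>i<D. c j * ip N (q j) (e i) * e i x)"
      using e(2)[OF J(2)] by (intro sum.cong refl) (simp add: sum_distrib_left mult.assoc)
    also have "\<dots> = (\<Sum>i<D. (\<Sum>j\<in>J. c j * ip N (q j) (e i)) * e i x)"
      by (subst sum.swap) (simp add: sum_distrib_right)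
    finally show ?thesis using c(2) by simp
  qed
  moreover have "(\<Sum>j\<in>J. c j * q j (y i)) = c i" if "i \<in> J" for i
  proof -
    have "(\<Sum>j\<in>J. c j * q j (y i)) = (\<Sum>j\<in>J. if i = j then c j else 0)"
      using J(3) that by (intro sum.cong) auto
    then show ?thesis using J(1) that by simp
  qed
  ultimately show False using c(1) by auto
qed

text \<open>Lagrange interpolation on the grid \<open>{0..K}\<^bsup>d-1\<^esup>\<close> in the affine chart where one
  coordinate is \<open>1\<close>.\<close>

lemma homogeneous_lagrange_basis:
  fixes i0 :: "'d::finite" and K :: nat
  defines "J \<equiv> PiE (UNIV - {i0}) (\<lambda>_. {..K})"
  shows "\<exists>(q :: ('d \<Rightarrow> nat) \<Rightarrow> real ^ 'd \<Rightarrow> real) y. (\<forall>j\<in>J. hom_poly (K * (CARD('d) - 1)) (q j)) \<and>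
     (\<forall>i\<in>J. \<forall>j\<in>J. q j (y i) = (if i = j then 1 else 0)) \<and> finite J \<and> card J = (K + 1) ^ (CARD('d) - 1)"
proof -
  define y :: "('d \<Rightarrow> nat) \<Rightarrow> real ^ 'd" where "y j = (\<chi> i. if i = i0 then 1 else real (j i))" for j
  \<comment> \<open>\<open>v i k l \<bullet> x\<close> is
    \<open>(x $ i - l * x $ i0) / (k - l)\<close>, a homogenized Lagrange factor: in the chart
    \<open>x $ i0 = 1\<close> it vanishes at coordinate value \<open>l\<close> and equals 1 at
    \<open>k\<close>.\<close>
  define v :: "'d \<Rightarrow> nat \<Rightarrow> nat \<Rightarrow> real ^ 'd" where
    "v i k l = inverse (real k - real l) *\<^sub>R (axis i 1 - real l *\<^sub>R axis i0 1)" for i k l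
  define q :: "('d \<Rightarrow> nat) \<Rightarrow> real ^ 'd \<Rightarrow> real" where
    "q j x = (\<Prod>i\<in>UNIV - {i0}. \<Prod>l\<in>{..K} - {j i}. v i (j i) l \<bullet> x)" for j x
  have "hom_poly (K * (CARD('d) - 1)) (q j)" if j: "j \<in> J" for j
  proof -
    have "hom_poly (\<Sum>i\<in>UNIV - {i0}. \<Sum>l\<in>{..K} - {j i}. 1) (q j)"
      unfolding q_def[abs_def] by (intro hom_poly_prod hom_poly_linear) auto
    moreover have "(\<Sum>l\<in>{..K} - {j i}. 1) = K" if "i \<in> UNIV - {i0}" for i
      using j that by (auto simp: J_def card_Diff_singleton_if)
    moreover from this have "(\<Sum>i\<in>UNIV - {i0}. \<Sum>l\<in>{..K} - {j i}. 1) = (\<Sum>i\<in>UNIV - {i0}. K)"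
      by (rule sum.cong[OF refl])
    ultimately have "hom_poly (\<Sum>i\<in>UNIV - {i0}. K) (q j)" by (simp only:)
    then show ?thesis by (simp add: card_Diff_singleton mult.commute)
  qed
  moreover have "q j (y i) = (if i = j then 1 else 0)" if i: "i \<in> J" and j: "j \<in> J" for i j
  proof -
    have v: "v a k l \<bullet> y i = (real (i a) - real l) / (real k - real l)" if "a \<noteq> i0" for a k l
      using that by (simp add: v_def y_def inner_diff_left inner_axis' divide_inverse mult.commute)
    have q: "q j (y i) = (\<Prod>a\<in>UNIV - {i0}. \<Prod>l\<in>{..K} - {j a}. (real (i a) - real l) / (real (j a) - real l))"
      unfolding q_def by (intro prod.cong refl) (auto simp: v)
    show ?thesis
    proof (cases "i = j")
      case True
      then show ?thesis unfolding q by (auto intro!: prod.neutral)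
    next
      case False
      then have "\<exists>a\<in>UNIV - {i0}. i a \<noteq> j a"
        using PiE_ext[OF i[unfolded J_def] j[unfolded J_def]] by blast
      then obtain a where a: "a \<noteq> i0" "i a \<noteq> j a" by blast
      then have "i a \<in> {..K} - {j a}" using i by (auto simp: J_def)
      then have "(\<Prod>l\<in>{..K} - {j a}. (real (i a) - real l) / (real (j a) - real l)) = 0"
        by (intro prod_zero) auto
      then have "q j (y i) = 0" unfolding q using a by (intro prod_zero) auto
      with False show ?thesis by simp
    qed
  qed
  moreover have "finite J" "card J = (K + 1) ^ (CARD('d) - 1)"
    by (auto simp: J_def card_PiE card_Diff_singleton intro!: finite_PiE)
  ultimately show ?thesis by (intro exI[of _ q] exI[of _ y] conjI ballI)
qed

lemma shell_volume_pos: "measure lborel (shell :: (real ^ 'd::finite) set) > 0"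
proof -
  have "interior (shell :: (real^'d) set) \<noteq> {}"
  proof -
    define U :: "(real^'d) set" where "U = {y. 1 < norm y} \<inter> {y. norm y < 2}"
    have "open U" unfolding U_def by (intro open_Int open_Collect_less continuous_intros)
    moreover have "U \<subseteq> shell" by (auto simp: U_def shell_iff)
    moreover have "(3 / 2) *\<^sub>R axis undefined 1 \<in> U" by (simp add: U_def)
    ultimately show ?thesis using interior_maximal by blast
  qed
  then have "\<not> negligible (shell :: (real^'d) set)"
    using open_not_negligible[OF open_interior] negligible_subset[OF _ interior_subset] by blast
  then have "emeasure lborel (shell :: (real^'d) set) \<noteq> 0"
    by (simp add: negligible_iff_emeasure0 emeasure_completion)
  then show ?thesis
    using emeasure_compact_finite[OF compact_shell] unfolding measure_def
    by (simp add: enn2real_positive_iff zero_less_iff_neq_zero)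
qed

text \<open>\<open>P\<close> is the Christoffel function of a space of dimension
  \<open>D - n\<close> of polynomials vanishing at the \<open>\<omega> r\<close>, divided by the
  value of the full Christoffel function on the unit sphere. The full one is
  \<open>k0 * norm y ^ (2 * N)\<close> by rotation invariance and dominates the other, whence the
  upper bound. Integration over the shell counts dimensions, so the mean is the share
  \<open>(D - n) / D\<close> of the volume, at least one half.\<close>

lemma fooling_polynomial:
  fixes \<omega> :: "nat \<Rightarrow> real ^ 'd::finite"
  assumes d: "CARD('d) \<ge> 2" and K: "K \<ge> 1" and n: "2 * n \<le> (K + 1) ^ (CARD('d) - 1)"
  defines "N \<equiv> K * (CARD('d) - 1)"
  shows "\<exists>P. hom_poly (2 * N) P \<and> (\<forall>r<n. P (\<omega> r) = 0) \<and> (\<forall>y. 0 \<le> P y \<and> P y \<le> norm y ^ (2 * N)) \<and>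
    (\<integral>y. indicator shell y * (P y / norm y ^ (2 * N)) \<partial>lborel) \<ge> measure lborel (shell :: (real^'d) set) / 2"
proof -
  have N: "N \<ge> 1" using d K by (auto simp: N_def)
  obtain D and e :: "nat \<Rightarrow> real ^ 'd \<Rightarrow> real" where e: "orthonormal_sys N D e"
    "\<And>Q x. hom_poly N Q \<Longrightarrow> Q x = (\<Sum>i<D. ip N Q (e i) * e i x)"
    using complete_orthonormal_sys[OF N] by blast
  have D: "(K + 1) ^ (CARD('d) - 1) \<le> D"
  proof -
    define J where "J = PiE (UNIV - {undefined :: 'd}) (\<lambda>_. {..K})"
    have "\<exists>(q :: ('d \<Rightarrow> nat) \<Rightarrow> real ^ 'd \<Rightarrow> real) y. (\<forall>j\<in>J. hom_poly N (q j)) \<and>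
      (\<forall>i\<in>J. \<forall>j\<in>J. q j (y i) = (if i = j then 1 else 0)) \<and> finite J \<and> card J = (K + 1) ^ (CARD('d) - 1)"
      unfolding J_def N_def by (rule homogeneous_lagrange_basis)
    then obtain q :: "('d \<Rightarrow> nat) \<Rightarrow> real ^ 'd \<Rightarrow> real" and y where q:
      "\<forall>j\<in>J. hom_poly N (q j)" "\<forall>i\<in>J. \<forall>j\<in>J. q j (y i) = (if i = j then 1 else 0)"
      "finite J" "card J = (K + 1) ^ (CARD('d) - 1)"
      by (elim exE conjE)
    have "card J \<le> D"
      by (rule complete_orthonormal_sys_dim_ge[OF e, where q = q and y = y]) (use q in blast)+
    then show ?thesis by (simp only: q(4))
  qed
  define m where "m = D - n"
  have m: "m + n \<le> D" "2 * m \<ge> D" "m \<ge> 1" "D \<ge> 1"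
  proof -
    have "(K + 1) ^ (CARD('d) - 1) \<ge> 1" by simp
    then show "D \<ge> 1" using D by linarith
    then show "m + n \<le> D" "2 * m \<ge> D" "m \<ge> 1" using n D unfolding m_def by linarith+
  qed
  obtain g where g: "orthonormal_sys N m g" "\<forall>i<m. \<forall>r<n. g i (\<omega> r) = 0"
    using orthonormal_sys_vanishing[OF e(1) N m(1)] by blast
  define vol where "vol = measure lborel (shell :: (real^'d) set)"
  have vol: "vol > 0" unfolding vol_def by (rule shell_volume_pos)
  define u :: "real^'d" where "u = axis undefined 1"
  define k0 where "k0 = (\<Sum>i<D. (e i u)\<^sup>2)"
  have Kf: "(\<Sum>i<D. (e i y)\<^sup>2) = k0 * norm y ^ (2 * N)" for y
  proof -
    have [simp]: "norm u = 1" by (simp add: u_def)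
    have "(\<Sum>i<D. (e i y)\<^sup>2) = (\<Sum>i<D. (e i (norm y *\<^sub>R u))\<^sup>2)"
      by (intro antisym christoffel_function_radial[OF e]) auto
    also have "\<dots> = (\<Sum>i<D. norm y ^ (2 * N) * (e i u)\<^sup>2)"
    proof (intro sum.cong refl)
      fix i assume "i \<in> {..<D}"
      then have "hom_poly N (e i)" using orthonormal_sys_hom[OF e(1)] by auto
      from hom_poly_scale[OF this]
      show "(e i (norm y *\<^sub>R u))\<^sup>2 = norm y ^ (2 * N) * (e i u)\<^sup>2"
        by (simp add: power_mult_distrib power_mult[symmetric] mult.commute)
    qed
    finally show ?thesis by (simp add: k0_def sum_distrib_left mult.commute)
  qed
  \<comment> \<open>Each member of an orthonormal system contributes its squared norm 1, so the
    integral counts the members. Comparison with the radial formula then determines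
    \<open>k0\<close>.\<close>
  have trace: "(\<integral>y. indicator shell y * ((\<Sum>i<l. (h i y)\<^sup>2) / norm y ^ (2 * N)) \<partial>lborel) = real l"
    if h: "orthonormal_sys N l h" for l and h :: "nat \<Rightarrow> real^'d \<Rightarrow> real"
  proof -
    have "(\<integral>y. indicator shell y * ((\<Sum>i<l. (h i y)\<^sup>2) / norm y ^ (2 * N)) \<partial>lborel) =
        (\<integral>y. (\<Sum>i<l. indicator shell y * (h i y * h i y / norm y ^ (2 * N))) \<partial>lborel)"
      by (simp add: sum_distrib_left sum_divide_distrib power2_eq_square)
    also have "\<dots> = (\<Sum>i<l. ip N (h i) (h i))"
      unfolding ip_def
      by (rule Bochner_Integration.integral_sum, rule integrable_ip[where n = N and m = N])
         (use orthonormal_sys_hom[OF h] in auto)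
    finally show ?thesis using h by (simp add: orthonormal_sys_def)
  qed
  have "real D = (\<integral>y. indicator shell y * ((\<Sum>i<D. (e i y)\<^sup>2) / norm y ^ (2 * N)) \<partial>lborel)"
    by (rule trace[OF e(1), symmetric])
  also have "\<dots> = (\<integral>y. k0 * indicator shell (y::real^'d) \<partial>lborel)"
    unfolding Kf by (intro Bochner_Integration.integral_cong) (auto simp: indicator_def shell_iff)
  also have "\<dots> = k0 * vol" by (simp add: vol_def)
  finally have k0: "k0 * vol = real D" ..
  then have k0p: "k0 > 0" using m(4) vol zero_less_mult_pos2[of k0 vol] by simp
  define P where "P y = (1 / k0) * (\<Sum>i<m. g i y * g i y)" for y
  have "hom_poly (2 * N) P" unfolding P_def[abs_def] mult_2
    by (intro hom_poly_cmult hom_poly_sum hom_poly_mult) (use orthonormal_sys_hom[OF g(1)] in auto)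
  moreover have "\<forall>r<n. P (\<omega> r) = 0" using g(2) by (simp add: P_def)
  moreover have "0 \<le> P y \<and> P y \<le> norm y ^ (2 * N)" for y
  proof
    show "0 \<le> P y" using k0p by (simp add: P_def sum_nonneg)
    have "(\<Sum>i<m. (g i y)\<^sup>2) \<le> k0 * norm y ^ (2 * N)"
      using orthonormal_sys_sum_squares_le[OF e g(1), of y] Kf by simp
    then show "P y \<le> norm y ^ (2 * N)"
      using k0p by (simp add: P_def power2_eq_square pos_divide_le_eq mult.commute)
  qed
  moreover have "(\<integral>y. indicator shell y * (P y / norm y ^ (2 * N)) \<partial>lborel) \<ge> vol / 2"
  proof -
    have "(\<integral>y. indicator shell y * (P y / norm y ^ (2 * N)) \<partial>lborel) =
       (\<integral>y. (1 / k0) * (indicator shell y * ((\<Sum>i<m. (g i y)\<^sup>2) / norm y ^ (2 * N))) \<partial>lborel)"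
      by (simp add: P_def power2_eq_square mult_ac)
    also have "\<dots> = real m / k0"
      unfolding integral_mult_right_zero trace[OF g(1)] by simp
    also have "\<dots> \<ge> vol / 2"
    proof -
      have "vol * k0 \<le> 2 * real m" using k0 m(2) by (simp add: mult.commute)
      then show ?thesis using k0p by (simp add: field_simps)
    qed
    finally show ?thesis .
  qed
  ultimately show ?thesis unfolding vol_def by (intro exI[of _ P] conjI allI) auto
qed

section \<open>A compactly supported measure with prescribed radial spectrum\<close>

lemma integrable_indicator_Icc:
  fixes f :: "real \<Rightarrow> real"
  assumes "continuous_on UNIV f"
  shows "integrable lborel (\<lambda>t. indicator {a..b} t * f t)"
  using borel_integrable_compact[of "{a..b}" f] continuous_on_subset[OF assms] by simp

text \<open>Powers of \<open>\<Gamma>\<close> concentrate where \<open>\<Gamma>\<close> is large. Averaging over a fixed window of translates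
  makes the spectrum flat from below on \<open>[v0, v0 + ln 2]\<close>, without any asymptotic analysis.\<close>

lemma window_average:
  fixes \<Gamma> :: "real \<Rightarrow> real" and B :: nat
  assumes cont: "continuous_on UNIV \<Gamma>" and nn: "\<And>w. 0 \<le> \<Gamma> w"
    and A: "A > 0" "\<And>w. \<Gamma> w \<le> A * exp w" "\<And>w. \<Gamma> w \<le> A * exp (- w)" and w0: "\<Gamma> w0 > 0"
  shows "\<exists>v0 l C. l > 0 \<and> C > 0 \<and> v0 \<ge> 0 \<and> (\<forall>N\<ge>B. \<exists>I>0.
     (\<forall>v\<in>{v0..v0 + ln 2}. I \<le> (\<integral>w. indicator {v - l..v} w * \<Gamma> w ^ (2 * N) \<partial>lborel)) \<and>
     (\<forall>v. (\<integral>w. indicator {v - l..v} w * \<Gamma> w ^ (2 * N) \<partial>lborel) \<le> C * I) \<and>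
     (\<forall>v. (\<integral>w. indicator {v - l..v} w * \<Gamma> w ^ (2 * N) \<partial>lborel) * exp (real B * v) \<le> C * I))"
proof -
  define \<gamma> where "\<gamma> = \<Gamma> w0"
  have g: "\<gamma> > 0" using w0 by (simp add: \<gamma>_def)
  \<comment> \<open>Outside \<open>[-W, W]\<close> the exponential bounds keep the function below
    \<open>\<gamma> / 2\<close>, against at least \<open>3 * \<gamma> / 4\<close> near
    \<open>w0\<close>; high powers preserve this order.\<close>
  define W where "W = \<bar>ln (2 * A / \<gamma>)\<bar> + \<bar>w0\<bar> + 1"
  have Gs: "\<Gamma> w \<le> \<gamma> / 2" if "\<bar>w\<bar> \<ge> W" for w
  proof -
    have "\<Gamma> w \<le> A * exp (- \<bar>w\<bar>)" using A(2)[of w] A(3)[of w] by (cases "w \<ge> 0") auto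
    also have "\<dots> \<le> A * exp (- ln (2 * A / \<gamma>))" using that A(1) by (auto simp: W_def)
    also have "\<dots> = \<gamma> / 2" using A(1) g by (simp add: exp_minus)
    finally show ?thesis .
  qed
  have "isCont \<Gamma> w0" using cont by (simp add: continuous_on_eq_continuous_at)
  then obtain \<delta>0 where \<delta>0: "\<delta>0 > 0" "\<And>w. \<bar>w - w0\<bar> < \<delta>0 \<Longrightarrow> \<bar>\<Gamma> w - \<gamma>\<bar> < \<gamma> / 4"
    using g unfolding continuous_at_eps_delta \<gamma>_def dist_real_def by (metis zero_less_divide_iff zero_less_numeral)
  define \<delta> where "\<delta> = min (\<delta>0 / 2) 1"
  have \<delta>: "\<delta> > 0" "\<delta> \<le> 1" "\<delta> < \<delta>0" using \<delta>0(1) by (auto simp: \<delta>_def min_def)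
  have Gb: "\<Gamma> w \<ge> 3 * \<gamma> / 4" if "w \<in> {w0 - \<delta>..w0 + \<delta>}" for w
  proof -
    have "\<bar>w - w0\<bar> < \<delta>0" using that \<delta> by (auto simp: abs_less_iff)
    from \<delta>0(2)[OF this] show ?thesis by linarith
  qed
  \<comment> \<open>For \<open>v\<close> in \<open>[W, W + ln 2]\<close> the window
    \<open>[v - l, v]\<close> contains all of \<open>[-W, W]\<close>.\<close>
  define l where "l = 2 * W + ln 2"
  have W: "W \<ge> 1" by (simp add: W_def)
  have l: "l > 0" using W by (simp add: l_def add_pos_pos)
  define C1 where "C1 = 1 + l / (2 * \<delta>)"
  have C1: "C1 \<ge> 1" using l \<delta> by (simp add: C1_def)
  define C2 where "C2 = l / (2 * \<delta>) * (2 * A * exp l / \<gamma>) ^ B"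
  define C where "C = C1 * exp (real B * (W + l)) + C2"
  have C2: "C2 > 0" using l \<delta> A g by (simp add: C2_def)
  have CC: "C \<ge> C1" "C \<ge> C2" "C \<ge> C1 * exp (real B * (W + l))"
  proof -
    have "exp (real B * (W + l)) \<ge> 1" using W l by simp
    then have "C1 * 1 \<le> C1 * exp (real B * (W + l))" using C1 by (intro mult_left_mono) auto
    then have "C1 \<le> C1 * exp (real B * (W + l))" by linarith
    then show "C \<ge> C1" "C \<ge> C2" "C \<ge> C1 * exp (real B * (W + l))" using C1 C2 unfolding C_def by linarith+
  qed
  define U where "U N v = (\<integral>w. indicator {v - l..v} w * \<Gamma> w ^ (2 * N) \<partial>lborel)" for N v
  have cp: "continuous_on UNIV (\<lambda>w. \<Gamma> w ^ k)" for k by (intro continuous_intros cont)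
  have int: "integrable lborel (\<lambda>w. indicator {a..b} w * \<Gamma> w ^ k)" for a b k
    by (rule integrable_indicator_Icc[OF cp])
  have intc: "integrable lborel (\<lambda>w. indicator {a..b} w * c)" for a b c :: real
    by (rule integrable_indicator_Icc) auto
  have "\<exists>I>0. (\<forall>v\<in>{W..W + ln 2}. I \<le> U N v) \<and> (\<forall>v. U N v \<le> C * I) \<and> (\<forall>v. U N v * exp (real B * v) \<le> C * I)"
    if N: "N \<ge> B" for N
  proof -
    define I where "I = (\<integral>w. indicator {-W..W} w * \<Gamma> w ^ (2 * N) \<partial>lborel)"
    have "2 * \<delta> * (3 * \<gamma> / 4) ^ (2 * N) = (\<integral>w. indicator {w0 - \<delta>..w0 + \<delta>} w * (3 * \<gamma> / 4) ^ (2 * N) \<partial>lborel)"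
      using \<delta> by simp
    also have "\<dots> \<le> I" unfolding I_def
    proof (rule integral_mono[OF intc int])
      fix w
      have "(3 * \<gamma> / 4) ^ (2 * N) \<le> \<Gamma> w ^ (2 * N)" if "w \<in> {w0 - \<delta>..w0 + \<delta>}"
        using Gb[OF that] g by (intro power_mono) auto
      moreover have "w \<in> {-W..W}" if "w \<in> {w0 - \<delta>..w0 + \<delta>}" using that \<delta> by (auto simp: W_def)
      ultimately show "indicator {w0 - \<delta>..w0 + \<delta>} w * (3 * \<gamma> / 4) ^ (2 * N) \<le> indicator {-W..W} w * \<Gamma> w ^ (2 * N)"
        using nn[of w] by (auto simp: indicator_def)
    qed
    finally have I34: "2 * \<delta> * (3 * \<gamma> / 4) ^ (2 * N) \<le> I" .
    have I0: "I > 0" using I34 \<delta> g by (smt (verit) mult_pos_pos zero_less_power divide_pos_pos)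
    \<comment> \<open>The tail outside \<open>[-W, W]\<close> is thus at most a fixed multiple of
      \<open>I\<close>, with a factor that does not involve \<open>N\<close>.\<close>
    have "(\<gamma> / 2) ^ (2 * N) \<le> (3 * \<gamma> / 4) ^ (2 * N)" using g by (intro power_mono) auto
    then have "2 * \<delta> * (\<gamma> / 2) ^ (2 * N) \<le> I" using I34 \<delta> by (smt (verit) mult_left_mono)
    then have g2: "(\<gamma> / 2) ^ (2 * N) \<le> I / (2 * \<delta>)" using \<delta> by (simp add: field_simps)
    have U1: "I \<le> U N v" if "v \<in> {W..W + ln 2}" for v
      unfolding U_def I_def
      by (rule integral_mono[OF int int]) (use that nn in \<open>auto simp: indicator_def l_def\<close>)
    have U2: "U N v \<le> C1 * I" for v
    proof -
      have "U N v \<le> (\<integral>w. indicator {-W..W} w * \<Gamma> w ^ (2 * N) + indicator {v - l..v} w * (\<gamma> / 2) ^ (2 * N) \<partial>lborel)"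
        unfolding U_def
      proof (rule integral_mono[OF int Bochner_Integration.integrable_add[OF int intc]])
        fix w
        have "\<Gamma> w ^ (2 * N) \<le> (\<gamma> / 2) ^ (2 * N)" if "w \<notin> {-W..W}"
          using that nn[of w] by (intro power_mono Gs) auto
        then show "indicator {v - l..v} w * \<Gamma> w ^ (2 * N) \<le> indicator {-W..W} w * \<Gamma> w ^ (2 * N) + indicator {v - l..v} w * (\<gamma> / 2) ^ (2 * N)"
          using nn[of w] g by (auto simp: indicator_def)
      qed
      also have "\<dots> = I + l * (\<gamma> / 2) ^ (2 * N)"
        using l by (subst Bochner_Integration.integral_add[OF int intc]) (simp add: I_def)
      also have "\<dots> \<le> I + l * (I / (2 * \<delta>))" using g2 l by (intro add_left_mono mult_left_mono) auto
      also have "\<dots> = C1 * I" by (simp add: C1_def algebra_simps)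
      finally show ?thesis .
    qed
    have U0: "U N v \<ge> 0" for v unfolding U_def using nn by (intro Bochner_Integration.integral_nonneg) auto
    have U3: "U N v * exp (real B * v) \<le> C * I" for v
    proof (cases "v \<le> W + l")
      case True
      have "U N v * exp (real B * v) \<le> (C1 * I) * exp (real B * (W + l))"
        using U2[of v] U0[of v] True C1 I0 by (intro mult_mono) (auto intro!: mult_left_mono)
      also have "\<dots> \<le> C * I" using CC(3) I0 by (simp add: mult.assoc mult.commute[of I] mult_right_mono flip: mult.assoc)
      finally show ?thesis .
    next
      case False
      \<comment> \<open>Here the window lies to the right of \<open>W\<close>. Of the
        \<open>2 * N\<close> factors, \<open>B\<close> are bounded by the exponential decay, which
        pays for \<open>exp (B * v)\<close>, and the others by \<open>\<gamma> / 2\<close>.\<close>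
      define c where "c = (\<gamma> / 2) ^ (2 * N - B) * (A * exp (- (v - l))) ^ B"
      have "U N v \<le> (\<integral>w. indicator {v - l..v} w * c \<partial>lborel)"
        unfolding U_def
      proof (rule integral_mono[OF int intc])
        fix w
        have "\<Gamma> w ^ (2 * N) \<le> c" if "w \<in> {v - l..v}"
        proof -
          have "\<Gamma> w \<le> \<gamma> / 2" using that False W by (intro Gs) auto
          moreover have "\<Gamma> w \<le> A * exp (- (v - l))"
            using A(1) that by (intro order_trans[OF A(3)] mult_left_mono) auto
          ultimately have "\<Gamma> w ^ (2 * N - B) * \<Gamma> w ^ B \<le> c"
            unfolding c_def using nn[of w] by (intro mult_mono power_mono) auto
          moreover have "2 * N = (2 * N - B) + B" using N by auto
          ultimately show ?thesis by (metis power_add)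
        qed
        then show "indicator {v - l..v} w * \<Gamma> w ^ (2 * N) \<le> indicator {v - l..v} w * c"
          by (auto simp: indicator_def)
      qed
      also have "\<dots> = l * c" using l by simp
      finally have "U N v * exp (real B * v) \<le> l * c * exp (real B * v)" by (intro mult_right_mono) auto
      also have "\<dots> = l * (\<gamma> / 2) ^ (2 * N) * (2 * A * exp l / \<gamma>) ^ B"
      proof -
        have "(\<gamma> / 2) ^ (2 * N) = (\<gamma> / 2) ^ (2 * N - B) * (\<gamma> / 2) ^ B"
          using N by (simp add: power_add[symmetric])
        moreover have "(\<gamma> / 2) ^ B * (2 * A * exp l / \<gamma>) ^ B = (A * exp l) ^ B"
          using g by (simp add: power_mult_distrib[symmetric])
        moreover have "(A * exp (- (v - l))) ^ B * exp (real B * v) = (A * exp l) ^ B"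
          by (simp add: exp_of_nat_mult power_mult_distrib[symmetric] exp_diff)
        ultimately show ?thesis by (simp add: c_def mult.assoc)
      qed
      also have "\<dots> \<le> l * (I / (2 * \<delta>)) * (2 * A * exp l / \<gamma>) ^ B"
        using g2 l A g by (intro mult_right_mono mult_left_mono) auto
      also have "\<dots> = C2 * I" by (simp add: C2_def)
      also have "\<dots> \<le> C * I" using CC(2) I0 by simp
      finally show ?thesis .
    qed
    show ?thesis
      using I0 U1 U2 U3 CC(1) by (intro exI[of _ I]) (auto intro: order_trans[OF U2] mult_right_mono)
  qed
  then show ?thesis
    unfolding U_def using l C2 CC W by (intro exI[of _ W] exI[of _ l] exI[of _ C]) auto
qed

text \<open>Chosen because it is radial, supported in the unit ball and Lipschitz. The last property
  gives its transform decay of order \<open>1 / norm \<xi>\<close>, and two such factors beat one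
  factor \<open>norm \<xi>\<close>, which is what \<open>radial_measure\<close> needs.\<close>

definition tent :: "real ^ 'd::finite \<Rightarrow> real" where "tent x = max 0 (1 - norm x)"

lemma tent_nonneg: "0 \<le> tent x" by (simp add: tent_def)

lemma tent_borel [measurable]: "tent \<in> borel_measurable borel"
  unfolding tent_def[abs_def] by measurable

lemma tent_le: "tent x \<le> indicator (cball 0 1) x" by (auto simp: tent_def indicator_def)

lemma integrable_ball: "integrable lborel (indicator (cball (a::'a::euclidean_space) r) :: 'a \<Rightarrow> real)"
  using emeasure_lborel_cball_finite[of a r] by (intro integrable_real_indicator) auto

lemma integrable_tent: "integrable lborel (tent :: real ^ 'd::finite \<Rightarrow> real)"
  by (rule Bochner_Integration.integrable_bound[OF integrable_ball[of 0 1]])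
     (auto simp: abs_of_nonneg[OF tent_nonneg] tent_le)

lemma tent_integral_pos: "(\<integral>x. tent (x::real ^ 'd::finite) \<partial>lborel) > 0"
proof -
  have "0 < measure lborel (cball (0::real^'d) (1/2)) / 2"
    using content_cball_pos[of "1/2" "0::real^'d"] by simp
  also have "\<dots> = (\<integral>x. indicator (cball (0::real^'d) (1/2)) x * (1 / 2) \<partial>lborel)" by simp
  also have "\<dots> \<le> (\<integral>x. tent (x::real ^ 'd) \<partial>lborel)"
    by (rule integral_mono[OF integrable_mult_left[OF integrable_ball] integrable_tent])
       (auto simp: tent_def indicator_def)
  finally show ?thesis .
qed

text \<open>The characteristic function of the probability density proportional to
  \<open>tent\<close>. Taking the real part loses nothing, since the transform of a real radial
  function is real (\<open>ft_tent\<close>).\<close>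

definition tent_ft :: "real ^ 'd::finite \<Rightarrow> real"
  where "tent_ft \<xi> = Re (ft (\<lambda>x. complex_of_real (tent x)) \<xi>) / (\<integral>x. tent (x::real ^ 'd) \<partial>lborel)"

lemma integrable_tent_cis:
  "integrable lborel (\<lambda>x. complex_of_real (tent x) * cis (x \<bullet> \<xi>))"
  by (rule integrable_mult_cis) (use integrable_tent in \<open>auto simp: complex_of_real_integrable_eq\<close>)

lemma ft_tent_radial:
  fixes \<xi> \<eta> :: "real ^ 'd::finite"
  assumes "norm \<xi> = norm \<eta>"
  shows "ft (\<lambda>x. complex_of_real (tent x)) \<xi> = ft (\<lambda>x. complex_of_real (tent x)) \<eta>"
proof -
  obtain f where f: "orthogonal_transformation f" "f \<eta> = \<xi>"
    using orthogonal_transformation_exists[of \<eta> \<xi>] assms by metis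
  have "ft (\<lambda>x. complex_of_real (tent x)) \<xi> = (\<integral>x. complex_of_real (tent (f x)) * cis (f x \<bullet> \<xi>) \<partial>lborel)"
    unfolding ft_def by (rule integral_orthogonal_transformation[OF f(1), symmetric]) measurable
  also have "\<dots> = ft (\<lambda>x. complex_of_real (tent x)) \<eta>"
    unfolding ft_def tent_def f(2)[symmetric] using f(1)
    by (simp add: orthogonal_transformation_norm[OF f(1)] orthogonal_transformation_def)
  finally show ?thesis .
qed

lemma ft_tent:
  fixes \<xi> :: "real ^ 'd::finite"
  shows "ft (\<lambda>x. complex_of_real (tent x)) \<xi> = complex_of_real ((\<integral>x. tent (x::real ^ 'd) \<partial>lborel) * tent_ft \<xi>)"
proof -
  have "cnj (ft (\<lambda>x. complex_of_real (tent x)) \<xi>) = ft (\<lambda>x. complex_of_real (tent x)) (- \<xi>)"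
    unfolding ft_def by (subst Bochner_Integration.integral_cnj[symmetric]) (simp add: cis_cnj)
  also have "\<dots> = ft (\<lambda>x. complex_of_real (tent x)) \<xi>" by (rule ft_tent_radial) simp
  finally have "ft (\<lambda>x. complex_of_real (tent x)) \<xi> \<in> \<real>" by (simp add: Reals_cnj_iff)
  then have "ft (\<lambda>x. complex_of_real (tent x)) \<xi> = complex_of_real (Re (ft (\<lambda>x. complex_of_real (tent x)) \<xi>))"
    by (simp add: of_real_Re)
  moreover have "(\<integral>x. tent (x::real ^ 'd) \<partial>lborel) * tent_ft \<xi> = Re (ft (\<lambda>x. complex_of_real (tent x)) \<xi>)"
    unfolding tent_ft_def using tent_integral_pos[where 'd = 'd] by simp
  ultimately show ?thesis by (simp only:)
qed

lemma tent_ft_radial: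
  fixes \<xi> \<eta> :: "real ^ 'd::finite"
  shows "norm \<xi> = norm \<eta> \<Longrightarrow> tent_ft \<xi> = tent_ft \<eta>"
  unfolding tent_ft_def using ft_tent_radial[of \<xi> \<eta>] by simp

lemma abs_tent_ft_le_1: "\<bar>tent_ft (\<xi> :: real ^ 'd::finite)\<bar> \<le> 1"
proof -
  let ?Z = "\<integral>x. tent (x::real ^ 'd) \<partial>lborel"
  have "norm (ft (\<lambda>x. complex_of_real (tent x)) \<xi>) \<le> ?Z"
    using norm_ft_le[of "\<lambda>x. complex_of_real (tent x)" \<xi>] by (simp add: abs_of_nonneg[OF tent_nonneg])
  then have "?Z * \<bar>tent_ft \<xi>\<bar> \<le> ?Z * 1"
    unfolding ft_tent using tent_integral_pos[where 'd = 'd] by (simp add: abs_mult norm_mult)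
  then show ?thesis using tent_integral_pos[where 'd = 'd] by (simp only: mult_le_cancel_left_pos)
qed

lemma tent_ft_0: "tent_ft (0 :: real ^ 'd::finite) = 1"
  unfolding tent_ft_def ft_def using tent_integral_pos[where 'd = 'd] by simp

lemma continuous_tent_ft: "continuous_on UNIV (tent_ft :: real ^ 'd::finite \<Rightarrow> real)"
proof -
  have "(\<lambda>n. ft (\<lambda>x. complex_of_real (tent x)) (X n)) \<longlonglongrightarrow> ft (\<lambda>x. complex_of_real (tent x)) \<xi>"
    if X: "X \<longlonglongrightarrow> \<xi>" for X and \<xi> :: "real ^ 'd"
    unfolding ft_def
  proof (rule integral_dominated_convergence[where w = "\<lambda>x. tent x"])
    show "AE x in lborel. (\<lambda>n. complex_of_real (tent x) * cis (x \<bullet> X n)) \<longlonglongrightarrow> complex_of_real (tent x) * cis (x \<bullet> \<xi>)"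
      by (intro AE_I2 tendsto_intros continuous_on_tendsto_compose[of UNIV cis] X continuous_intros) auto
  qed (use integrable_tent in \<open>auto simp: norm_mult abs_of_nonneg[OF tent_nonneg]\<close>)
  then have "continuous_on UNIV (ft (\<lambda>x::real^'d. complex_of_real (tent x)))"
    by (auto simp: continuous_on_sequentially o_def)
  then show ?thesis unfolding tent_ft_def[abs_def]
    using tent_integral_pos[where 'd = 'd] by (intro continuous_intros) auto
qed

text \<open>Shifting by half a wavelength and the Lipschitz continuity of the tent give the decay.\<close>

lemma tent_ft_decay:
  "\<exists>A>0. \<forall>\<xi>::real ^ 'd::finite. \<xi> \<noteq> 0 \<longrightarrow> \<bar>tent_ft \<xi>\<bar> \<le> A / norm \<xi>"
proof -
  let ?Z = "\<integral>x. tent (x::real ^ 'd) \<partial>lborel"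
  define V where "V = measure lborel (cball (0::real^'d) 1)"
  have V: "V > 0" unfolding V_def using content_cball_pos[of 1 "0::real^'d"] by simp
  have "\<bar>tent_ft \<xi>\<bar> \<le> (V * pi / ?Z) / norm \<xi>" if "\<xi> \<noteq> 0" for \<xi> :: "real ^ 'd"
  proof -
    define z where "z = (pi / (norm \<xi>)\<^sup>2) *\<^sub>R \<xi>"
    have nz: "norm z = pi / norm \<xi>" using that by (simp add: z_def power2_eq_square)
    have "z \<bullet> \<xi> = pi" using that by (simp add: z_def dot_square_norm)
    then have cz: "cis ((z + x) \<bullet> \<xi>) = - cis (x \<bullet> \<xi>)" for x by (simp add: inner_add_left cis_mult[symmetric])
    let ?F = "ft (\<lambda>x. complex_of_real (tent x)) \<xi>"
    have "?F = (\<integral>x. complex_of_real (tent (z + x)) * cis ((z + x) \<bullet> \<xi>) \<partial>lborel)"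
      unfolding ft_def by (rule integral_translate_lborel[symmetric]) measurable
    also have "\<dots> = (\<integral>x. - (complex_of_real (tent (z + x)) * cis (x \<bullet> \<xi>)) \<partial>lborel)"
      unfolding cz by simp
    also have "\<dots> = - (\<integral>x. complex_of_real (tent (z + x)) * cis (x \<bullet> \<xi>) \<partial>lborel)"
      by (rule integral_minus)
    finally have F: "?F = - (\<integral>x. complex_of_real (tent (z + x)) * cis (x \<bullet> \<xi>) \<partial>lborel)" .
    have it: "integrable lborel (\<lambda>x. tent (z + x))"
      by (subst integrable_translate_lborel) (auto intro: integrable_tent)
    have it2: "integrable lborel (\<lambda>x. complex_of_real (tent (z + x)) * cis (x \<bullet> \<xi>))"
      by (rule integrable_mult_cis) (use it in \<open>auto simp: complex_of_real_integrable_eq\<close>)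
    have iball: "integrable lborel (\<lambda>x. indicator (cball 0 1) (z + x) :: real)"
    proof -
      have "(indicator (cball 0 1) :: real^'d \<Rightarrow> real) \<in> borel_measurable borel"
        by (intro borel_measurable_indicator borel_closed closed_cball)
      from integrable_translate_lborel[OF this, of z] integrable_ball show ?thesis by blast
    qed
    have "?F + ?F = (\<integral>x. complex_of_real (tent x) * cis (x \<bullet> \<xi>) \<partial>lborel) - (\<integral>x. complex_of_real (tent (z + x)) * cis (x \<bullet> \<xi>) \<partial>lborel)"
      by (subst (2) F) (simp add: ft_def)
    also have "\<dots> = (\<integral>x. complex_of_real (tent x - tent (z + x)) * cis (x \<bullet> \<xi>) \<partial>lborel)"
      by (subst Bochner_Integration.integral_diff[OF integrable_tent_cis it2, symmetric])
         (simp add: left_diff_distrib)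
    finally have "norm (?F + ?F) \<le> (\<integral>x. \<bar>tent x - tent (z + x)\<bar> \<partial>lborel)"
      using integral_norm_bound[of lborel "\<lambda>x. complex_of_real (tent x - tent (z + x)) * cis (x \<bullet> \<xi>)"]
      by (simp add: norm_mult del: of_real_diff)
    also have "\<dots> \<le> (\<integral>x. norm z * indicator (cball 0 1) x + norm z * indicator (cball 0 1) (z + x) \<partial>lborel)"
    proof (rule integral_mono)
      show "integrable lborel (\<lambda>x. \<bar>tent x - tent (z + x)\<bar>)"
        by (intro integrable_abs Bochner_Integration.integrable_diff integrable_tent it)
      show "integrable lborel (\<lambda>x. norm z * indicator (cball 0 1) x + norm z * indicator (cball 0 1) (z + x))"
        by (intro Bochner_Integration.integrable_add integrable_mult_right integrable_ball iball)
      fix x :: "real^'d"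
      have "\<bar>norm x - norm (z + x)\<bar> \<le> norm z"
        using norm_triangle_ineq3[of x "z + x"] by simp
      then show "\<bar>tent x - tent (z + x)\<bar> \<le> norm z * indicator (cball 0 1) x + norm z * indicator (cball 0 1) (z + x)"
        by (auto simp: tent_def indicator_def max_def)
    qed
    also have "\<dots> = norm z * V + norm z * V"
    proof -
      have iV: "(\<integral>x. indicator (cball 0 1) (z + x) \<partial>lborel) = V"
      proof -
        have "(indicator (cball 0 1) :: real^'d \<Rightarrow> real) \<in> borel_measurable borel"
          by (intro borel_measurable_indicator borel_closed closed_cball)
        from integral_translate_lborel[OF this, of z] show ?thesis by (simp add: V_def)
      qed
      then show ?thesis
        unfolding Bochner_Integration.integral_add[OF integrable_mult_right[OF integrable_ball] integrable_mult_right[OF iball]]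
          integral_mult_right_zero iV by (simp add: V_def)
    qed
    also have "norm z * V + norm z * V = 2 * (V * pi / norm \<xi>)" by (simp add: nz)
    also have "norm (?F + ?F) = 2 * norm ?F" by (simp only: mult_2[symmetric] norm_mult) simp
    finally have "norm ?F \<le> V * pi / norm \<xi>" by linarith
    then have "?Z * \<bar>tent_ft \<xi>\<bar> \<le> V * pi / norm \<xi>"
      unfolding ft_tent using tent_integral_pos[where 'd = 'd] by (simp add: abs_mult norm_mult)
    then have "\<bar>tent_ft \<xi>\<bar> \<le> V * pi / norm \<xi> / ?Z"
      using tent_integral_pos[where 'd = 'd] by (simp only: pos_le_divide_eq mult.commute)
    then show ?thesis by (simp add: mult.commute)
  qed
  then show ?thesis
    using V tent_integral_pos[where 'd = 'd] by (intro exI[of _ "V * pi / ?Z"]) simp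
qed



text \<open>The law of a sum of \<open>J\<close> independent vectors
  \<open>\<tau> *\<^sub>R X\<close>, where \<open>X\<close> has density proportional to
  \<open>tent\<close>: radii of supports add up and characteristic functions multiply.\<close>

lemma tent_convolution_power:
  assumes \<tau>: "\<tau> > 0"
  shows "\<exists>M :: (real ^ 'd::finite) measure. prob_space M \<and> sets M = sets borel \<and>
     (AE y in M. norm y \<le> real J * \<tau>) \<and> (\<forall>\<xi>. (\<integral>y. cis (y \<bullet> \<xi>) \<partial>M) = complex_of_real (tent_ft (\<tau> *\<^sub>R \<xi>) ^ J))"
proof (induction J)
  case 0
  show ?case
    by (intro exI[of _ "return borel 0"]) (auto simp: prob_space_return AE_return integral_return)
next
  case (Suc J)
  then obtain M :: "(real ^ 'd) measure" where M: "prob_space M" "sets M = sets borel"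
    "AE y in M. norm y \<le> real J * \<tau>" "\<And>\<xi>. (\<integral>y. cis (y \<bullet> \<xi>) \<partial>M) = complex_of_real (tent_ft (\<tau> *\<^sub>R \<xi>) ^ J)" by blast
  interpret M: prob_space M by fact
  let ?Z = "\<integral>x. tent (x::real ^ 'd) \<partial>lborel"
  note Z = tent_integral_pos[where 'd = 'd]
  define D where "D = density lborel (\<lambda>x::real^'d. ennreal (tent x / ?Z))"
  have [measurable_cong, simp]: "sets M = sets borel" "sets D = sets borel" by (simp_all add: M(2) D_def)
  have "(\<integral>\<^sup>+x. ennreal (tent x / ?Z) \<partial>(lborel :: (real^'d) measure)) = ennreal (\<integral>x. tent x / ?Z \<partial>(lborel :: (real^'d) measure))"
    using Z by (intro nn_integral_eq_integral)
      (auto intro!: integrable_tent AE_I2 divide_nonneg_pos tent_nonneg)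
  then have "prob_space D"
    using Z by (intro prob_spaceI) (simp add: D_def emeasure_density)
  then interpret D: prob_space D .
  interpret P: pair_prob_space M D ..
  have DC: "(\<integral>x. cis ((\<tau> *\<^sub>R x) \<bullet> \<xi>) \<partial>D) = complex_of_real (tent_ft (\<tau> *\<^sub>R \<xi>))" for \<xi>
  proof -
    have "(\<integral>x. cis ((\<tau> *\<^sub>R x) \<bullet> \<xi>) \<partial>D) = (\<integral>x. (tent x / ?Z) *\<^sub>R cis (x \<bullet> (\<tau> *\<^sub>R \<xi>)) \<partial>lborel)"
      unfolding D_def using Z tent_nonneg by (subst integral_density) (auto simp: inner_scaleR_left intro!: AE_I2 divide_nonneg_pos)
    also have "\<dots> = (\<integral>x. complex_of_real (1 / ?Z) * (complex_of_real (tent x) * cis (x \<bullet> (\<tau> *\<^sub>R \<xi>))) \<partial>lborel)"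
      by (simp add: scaleR_conv_of_real)
    also have "\<dots> = complex_of_real (tent_ft (\<tau> *\<^sub>R \<xi>))"
      unfolding integral_mult_right_zero ft_def[symmetric] ft_tent using Z by simp
    finally show ?thesis .
  qed
  define M' where "M' = distr (M \<Otimes>\<^sub>M D) borel (\<lambda>(y, x). y + \<tau> *\<^sub>R x)"
  have meas [measurable]: "(\<lambda>(y, x). y + \<tau> *\<^sub>R x) \<in> borel_measurable (M \<Otimes>\<^sub>M D)" by measurable
  have "prob_space M'" unfolding M'_def by (rule P.prob_space_distr[OF meas])
  moreover have "sets M' = sets borel" by (simp add: M'_def)
  moreover have "AE y in M'. norm y \<le> real (Suc J) * \<tau>"
  proof -
    have [measurable]: "fst \<in> borel_measurable (M \<Otimes>\<^sub>M D)" "snd \<in> borel_measurable (M \<Otimes>\<^sub>M D)"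
      using measurable_compose[OF measurable_fst measurable_ident_sets[of M borel]]
        measurable_compose[OF measurable_snd measurable_ident_sets[of D borel]] by auto
    have sets_pair: "{z \<in> space (M \<Otimes>\<^sub>M D). norm (snd z) \<le> 1} \<in> sets (M \<Otimes>\<^sub>M D)"
      "{z \<in> space (M \<Otimes>\<^sub>M D). norm (fst z) \<le> real J * \<tau>} \<in> sets (M \<Otimes>\<^sub>M D)" by measurable
    have "AE x in D. norm x \<le> 1"
      unfolding D_def by (subst AE_density) (auto simp: tent_def max_def split: if_splits)
    then have D1: "AE z in M \<Otimes>\<^sub>M D. norm (snd z) \<le> 1"
      by (intro P.AE_pair_measure sets_pair) auto
    have M1: "AE z in M \<Otimes>\<^sub>M D. norm (fst z) \<le> real J * \<tau>"
      using M(3) by (intro P.AE_pair_measure sets_pair) auto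
    have "AE z in M \<Otimes>\<^sub>M D. norm ((\<lambda>(y, x). y + \<tau> *\<^sub>R x) z) \<le> real (Suc J) * \<tau>"
      using D1 M1
    proof eventually_elim
      case (elim z)
      have "norm (fst z + \<tau> *\<^sub>R snd z) \<le> norm (fst z) + \<tau> * norm (snd z)"
        using norm_triangle_ineq[of "fst z" "\<tau> *\<^sub>R snd z"] \<tau> by simp
      also have "\<dots> \<le> real J * \<tau> + \<tau> * 1" using elim \<tau> by (intro add_mono mult_left_mono) auto
      finally show ?case by (simp add: case_prod_beta algebra_simps)
    qed
    then show ?thesis unfolding M'_def
      by (subst AE_distr_iff) auto
  qed
  moreover have "(\<integral>y. cis (y \<bullet> \<xi>) \<partial>M') = complex_of_real (tent_ft (\<tau> *\<^sub>R \<xi>) ^ Suc J)" for \<xi>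
  proof -
    have "(\<integral>y. cis (y \<bullet> \<xi>) \<partial>M') = (\<integral>z. cis ((\<lambda>(y, x). y + \<tau> *\<^sub>R x) z \<bullet> \<xi>) \<partial>(M \<Otimes>\<^sub>M D))"
      unfolding M'_def by (subst integral_distr) auto
    also have "\<dots> = (\<integral>z. (\<lambda>(y, x). cis (y \<bullet> \<xi>) * cis ((\<tau> *\<^sub>R x) \<bullet> \<xi>)) z \<partial>(M \<Otimes>\<^sub>M D))"
      by (intro Bochner_Integration.integral_cong) (auto simp: inner_add_left cis_mult)
    also have "\<dots> = (\<integral>y. (\<integral>x. cis (y \<bullet> \<xi>) * cis ((\<tau> *\<^sub>R x) \<bullet> \<xi>) \<partial>D) \<partial>M)"
      by (subst P.integral_fst'[symmetric])
         (auto intro!: P.P.integrable_const_bound[of _ 1] simp: norm_mult case_prod_beta)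
    also have "\<dots> = complex_of_real (tent_ft (\<tau> *\<^sub>R \<xi>) ^ Suc J)"
      by (simp only: integral_mult_right_zero DC integral_mult_left_zero M(4) of_real_mult[symmetric] power_Suc2)
    finally show ?thesis .
  qed
  ultimately show ?case by blast
qed

text \<open>The measure is the image under \<open>exp (- t) *\<^sub>R Y\<close>, where
  \<open>Y\<close> is a sum of \<open>4 * N\<close> scaled tent variables and \<open>t\<close> in
  \<open>[0, l]\<close> carries the weight \<open>exp (- 2 * N * t)\<close>. In the variable
  \<open>w = ln (\<tau> * norm \<xi>) - t\<close>, the quantity
  \<open>(\<tau> * norm \<xi>) ^ (2 * N) * m \<xi>\<close> becomes the integral of
  \<open>G w ^ (2 * N)\<close> over a window of length \<open>l\<close>, to which
  \<open>window_average\<close> applies. The tent transform enters with an even power, so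
  \<open>m\<close> is nonnegative.\<close>

lemma radial_measure:
  assumes \<rho>: "\<rho> > 0"
  shows "\<exists>\<beta> C. \<beta> > 0 \<and> C > 0 \<and> (\<forall>N\<ge>max 1 B. \<exists>(M :: (real ^ 'd::finite) measure) m I.
    finite_measure M \<and> sets M = sets borel \<and> (AE y in M. norm y \<le> \<rho>) \<and> I > 0 \<and>
    (\<forall>\<xi>. (\<integral>y. cis (y \<bullet> \<xi>) \<partial>M) = complex_of_real (m \<xi>)) \<and> (\<forall>\<xi>. 0 \<le> m \<xi>) \<and>
    (\<forall>\<xi>. \<beta> * N \<le> norm \<xi> \<and> norm \<xi> \<le> 2 * (\<beta> * N) \<longrightarrow> I \<le> (norm \<xi> / (\<beta> * N)) ^ (2 * N) * m \<xi>) \<and>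
    (\<forall>\<xi>. (norm \<xi> / (\<beta> * N)) ^ (2 * N) * m \<xi> \<le> C * I) \<and>
    (\<forall>\<xi>. (norm \<xi> / (\<beta> * N)) ^ B * ((norm \<xi> / (\<beta> * N)) ^ (2 * N) * m \<xi>) \<le> C * I))"
proof -
  define u :: "real ^ 'd" where "u = axis undefined 1"
  have u: "norm u = 1" by (simp add: u_def)
  then have uz: "u \<noteq> 0" by auto
  \<comment> \<open>One factor \<open>norm \<xi>\<close> against two tent transforms, along a ray:
    bounded by multiples of \<open>exp w\<close> and of \<open>exp (- w)\<close>, as
    \<open>window_average\<close> demands.\<close>
  define G where "G w = exp w * (tent_ft (exp w *\<^sub>R u))\<^sup>2" for w :: real
  obtain A where A: "A > 0" "\<And>\<xi>::real^'d. \<xi> \<noteq> 0 \<Longrightarrow> \<bar>tent_ft \<xi>\<bar> \<le> A / norm \<xi>"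
    using tent_ft_decay by blast
  have Gc: "continuous_on UNIV G"
    unfolding G_def[abs_def]
    by (intro continuous_intros continuous_on_compose2[OF continuous_tent_ft]) auto
  then have [measurable]: "G \<in> borel_measurable borel" by (rule borel_measurable_continuous_onI)
  have G0: "0 \<le> G w" for w by (simp add: G_def)
  have G1: "G w \<le> max 1 (A\<^sup>2) * exp w" for w
  proof -
    have "(tent_ft (exp w *\<^sub>R u))\<^sup>2 \<le> 1" using abs_tent_ft_le_1 by (simp add: abs_square_le_1)
    also have "1 \<le> max 1 (A\<^sup>2)" by simp
    finally have "(tent_ft (exp w *\<^sub>R u))\<^sup>2 * exp w \<le> max 1 (A\<^sup>2) * exp w" by (intro mult_right_mono) auto
    then show ?thesis by (simp add: G_def mult.commute)
  qed
  have G2: "G w \<le> max 1 (A\<^sup>2) * exp (- w)" for w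
  proof -
    have "\<bar>tent_ft (exp w *\<^sub>R u)\<bar> \<le> A / exp w" using A(2)[of "exp w *\<^sub>R u"] u uz by simp
    then have "(tent_ft (exp w *\<^sub>R u))\<^sup>2 \<le> (A / exp w)\<^sup>2" by (metis abs_ge_zero power2_abs power_mono)
    then have "G w \<le> exp w * (A / exp w)\<^sup>2" unfolding G_def by (intro mult_left_mono) auto
    also have "\<dots> = A\<^sup>2 * exp (- w)" by (simp add: power2_eq_square exp_minus field_simps)
    also have "\<dots> \<le> max 1 (A\<^sup>2) * exp (- w)" by (intro mult_right_mono) auto
    finally show ?thesis .
  qed
  have "\<exists>w0. G w0 > 0"
  proof -
    have "((\<lambda>t. tent_ft (t *\<^sub>R u)) \<longlongrightarrow> tent_ft (0 *\<^sub>R u)) (at_right 0)"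
      by (intro tendsto_intros continuous_on_tendsto_compose[OF continuous_tent_ft]) auto
    then have "\<forall>\<^sub>F t in at_right 0. tent_ft (t *\<^sub>R u) > 0"
      by (rule order_tendstoD) (simp add: tent_ft_0)
    moreover have "\<forall>\<^sub>F t in at_right (0::real). t > 0" by (rule eventually_at_right_less)
    ultimately have "\<forall>\<^sub>F t in at_right (0::real). t > 0 \<and> tent_ft (t *\<^sub>R u) > 0" by eventually_elim auto
    then obtain t where "t > 0" "tent_ft (t *\<^sub>R u) > 0"
      using eventually_happens'[OF trivial_limit_at_right_real] by blast
    then show ?thesis by (intro exI[of _ "ln t"]) (simp add: G_def)
  qed
  then obtain w0 where w0: "G w0 > 0" ..
  obtain v0 l C where l: "l > 0" and C: "C > 0" and v0: "v0 \<ge> 0" and win: "\<forall>N\<ge>B. \<exists>I>0.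
     (\<forall>v\<in>{v0..v0 + ln 2}. I \<le> (\<integral>w. indicator {v - l..v} w * G w ^ (2 * N) \<partial>lborel)) \<and>
     (\<forall>v. (\<integral>w. indicator {v - l..v} w * G w ^ (2 * N) \<partial>lborel) \<le> C * I) \<and>
     (\<forall>v. (\<integral>w. indicator {v - l..v} w * G w ^ (2 * N) \<partial>lborel) * exp (real B * v) \<le> C * I)"
  proof -
    have "max 1 (A\<^sup>2) > 0" by (simp add: less_max_iff_disj)
    from window_average[OF Gc G0 this G1 G2 w0, of B] show ?thesis by (elim exE conjE) (rule that)
  qed
  \<comment> \<open>With \<open>\<tau> = \<rho> / (4 * N)\<close>, the radius
    \<open>norm \<xi> = \<beta> * N\<close> corresponds to
    \<open>ln (\<tau> * norm \<xi>) = v0\<close>, the left end of the flat interval; its length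
    \<open>ln 2\<close> matches the radii up to \<open>2 * (\<beta> * N)\<close>.\<close>
  define \<beta> where "\<beta> = 4 * exp v0 / \<rho>"
  have \<beta>: "\<beta> > 0" using \<rho> by (simp add: \<beta>_def)
  have "\<exists>(M :: (real ^ 'd) measure) m I.
    finite_measure M \<and> sets M = sets borel \<and> (AE y in M. norm y \<le> \<rho>) \<and> I > 0 \<and>
    (\<forall>\<xi>. (\<integral>y. cis (y \<bullet> \<xi>) \<partial>M) = complex_of_real (m \<xi>)) \<and> (\<forall>\<xi>. 0 \<le> m \<xi>) \<and>
    (\<forall>\<xi>. \<beta> * N \<le> norm \<xi> \<and> norm \<xi> \<le> 2 * (\<beta> * N) \<longrightarrow> I \<le> (norm \<xi> / (\<beta> * N)) ^ (2 * N) * m \<xi>) \<and>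
    (\<forall>\<xi>. (norm \<xi> / (\<beta> * N)) ^ (2 * N) * m \<xi> \<le> C * I) \<and>
    (\<forall>\<xi>. (norm \<xi> / (\<beta> * N)) ^ B * ((norm \<xi> / (\<beta> * N)) ^ (2 * N) * m \<xi>) \<le> C * I)"
    if N: "N \<ge> max 1 B" for N
  proof -
    \<comment> \<open>The supports of \<open>4 * N\<close> tents of this width add up to radius
      \<open>\<rho>\<close>.\<close>
    define \<tau> where "\<tau> = \<rho> / real (4 * N)"
    have \<tau>: "\<tau> > 0" using \<rho> N by (simp add: \<tau>_def)
    obtain M :: "(real ^ 'd) measure" where M: "prob_space M" "sets M = sets borel"
      "AE y in M. norm y \<le> real (4 * N) * \<tau>"
      "\<And>\<xi>. (\<integral>y. cis (y \<bullet> \<xi>) \<partial>M) = complex_of_real (tent_ft (\<tau> *\<^sub>R \<xi>) ^ (4 * N))"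
      using tent_convolution_power[OF \<tau>, of "4 * N"] by blast
    interpret M: prob_space M by fact
    \<comment> \<open>Contraction by \<open>exp (- t)\<close> keeps the support in the ball, as
      \<open>t \<ge> 0\<close>. The weight \<open>exp (- (2 * N * t))\<close> turns
      \<open>(\<tau> * norm \<xi>) ^ (2 * N)\<close> into the same power of the contracted
      radius.\<close>
    define T where "T = density lborel (\<lambda>t::real. ennreal (indicator {0..l} t * exp (- (2 * real N * t))))"
    have [measurable_cong, simp]: "sets M = sets borel" "sets T = sets borel" by (simp_all add: M(2) T_def)
    have iT: "integrable lborel (\<lambda>t. indicator {0..l} t * exp (- (2 * real N * t)))"
      by (rule integrable_indicator_Icc) (intro continuous_intros)
    have "finite_measure T"
    proof (rule finite_measureI)
      have "emeasure T (space T) = (\<integral>\<^sup>+t. ennreal (indicator {0..l} t * exp (- (2 * real N * t))) \<partial>lborel)"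
        by (simp add: T_def emeasure_density)
      also have "\<dots> = ennreal (\<integral>t. indicator {0..l} t * exp (- (2 * real N * t)) \<partial>lborel)"
        by (rule nn_integral_eq_integral[OF iT]) auto
      finally show "emeasure T (space T) \<noteq> \<infinity>" by simp
    qed
    then interpret T: finite_measure T .
    interpret P: pair_sigma_finite T M ..
    have "finite_measure (T \<Otimes>\<^sub>M M)"
      by (rule finite_measure_pair_measure) unfold_locales
    then interpret TM: finite_measure "T \<Otimes>\<^sub>M M" .
    define f where "f = (\<lambda>(t::real, y::real^'d). exp (- t) *\<^sub>R y)"
    have f [measurable]: "f \<in> borel_measurable (T \<Otimes>\<^sub>M M)" unfolding f_def by measurable
    define M' where "M' = distr (T \<Otimes>\<^sub>M M) borel f"
    define U where "U v = (\<integral>w. indicator {v - l..v} w * G w ^ (2 * N) \<partial>lborel)" for v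
    define m where "m \<xi> = (\<integral>t. indicator {0..l} t * exp (- (2 * real N * t)) * tent_ft ((\<tau> * exp (- t)) *\<^sub>R \<xi>) ^ (4 * N) \<partial>lborel)" for \<xi> :: "real^'d"
    have c1: "finite_measure M'" unfolding M'_def by (rule TM.finite_measure_distr[OF f])
    have c2: "sets M' = sets borel" by (simp add: M'_def)
    have c3: "AE y in M'. norm y \<le> \<rho>"
    proof -
      have [measurable]: "fst \<in> borel_measurable (T \<Otimes>\<^sub>M M)" "snd \<in> borel_measurable (T \<Otimes>\<^sub>M M)"
        using measurable_compose[OF measurable_fst measurable_ident_sets[of T borel]]
          measurable_compose[OF measurable_snd measurable_ident_sets[of M borel]] by auto
      have sets_pair: "{z \<in> space (T \<Otimes>\<^sub>M M). fst z \<ge> 0} \<in> sets (T \<Otimes>\<^sub>M M)"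
        "{z \<in> space (T \<Otimes>\<^sub>M M). norm (snd z) \<le> real (4 * N) * \<tau>} \<in> sets (T \<Otimes>\<^sub>M M)" by measurable
      have "AE t in T. t \<ge> 0"
        unfolding T_def by (subst AE_density) (auto simp: indicator_def)
      then have D1: "AE z in T \<Otimes>\<^sub>M M. fst z \<ge> 0"
        by (intro P.AE_pair_measure sets_pair) auto
      have M1: "AE z in T \<Otimes>\<^sub>M M. norm (snd z) \<le> real (4 * N) * \<tau>"
        using M(3) by (intro P.AE_pair_measure sets_pair) auto
      have "AE z in T \<Otimes>\<^sub>M M. norm (f z) \<le> \<rho>"
        using D1 M1
      proof eventually_elim
        case (elim z)
        have "norm (f z) = exp (- fst z) * norm (snd z)" by (simp add: f_def case_prod_beta)
        also have "\<dots> \<le> 1 * (real (4 * N) * \<tau>)" using elim by (intro mult_mono) auto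
        also have "\<dots> = \<rho>" using N by (simp add: \<tau>_def)
        finally show ?case .
      qed
      then show ?thesis unfolding M'_def by (subst AE_distr_iff) auto
    qed
    have c4: "(\<integral>y. cis (y \<bullet> \<xi>) \<partial>M') = complex_of_real (m \<xi>)" for \<xi>
    proof -
      have "(\<integral>y. cis (y \<bullet> \<xi>) \<partial>M') = (\<integral>z. cis (f z \<bullet> \<xi>) \<partial>(T \<Otimes>\<^sub>M M))"
        unfolding M'_def by (subst integral_distr) auto
      also have "\<dots> = (\<integral>t. (\<integral>y. cis (f (t, y) \<bullet> \<xi>) \<partial>M) \<partial>T)"
        by (rule P.integral_fst'[symmetric]) (auto intro!: TM.integrable_const_bound[of _ 1])
      also have "\<dots> = (\<integral>t. complex_of_real (tent_ft ((\<tau> * exp (- t)) *\<^sub>R \<xi>) ^ (4 * N)) \<partial>T)"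
        using M(4)[of "exp (- _) *\<^sub>R \<xi>"] by (simp add: f_def inner_scaleR_left inner_scaleR_right)
      also have "\<dots> = (\<integral>t. (indicator {0..l} t * exp (- (2 * real N * t))) *\<^sub>R complex_of_real (tent_ft ((\<tau> * exp (- t)) *\<^sub>R \<xi>) ^ (4 * N)) \<partial>lborel)"
        unfolding T_def using continuous_tent_ft[where 'd = 'd]
        by (subst integral_density)
           (auto intro!: borel_measurable_continuous_onI continuous_intros continuous_on_compose2[OF continuous_tent_ft])
      also have "\<dots> = (\<integral>t. complex_of_real (indicator {0..l} t * exp (- (2 * real N * t)) * tent_ft ((\<tau> * exp (- t)) *\<^sub>R \<xi>) ^ (4 * N)) \<partial>lborel)"
        by (simp add: scaleR_conv_of_real)
      also have "\<dots> = complex_of_real (m \<xi>)" unfolding m_def by (rule integral_complex_of_real)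
      finally show ?thesis .
    qed
    have m0: "0 \<le> m \<xi>" for \<xi>
      unfolding m_def by (intro Bochner_Integration.integral_nonneg) (auto intro!: mult_nonneg_nonneg zero_le_even_power)
    have mU: "(\<tau> * norm \<xi>) ^ (2 * N) * m \<xi> = U (ln (\<tau> * norm \<xi>))" if "\<xi> \<noteq> 0" for \<xi>
    proof -
      define v where "v = ln (\<tau> * norm \<xi>)"
      have ev: "exp v = \<tau> * norm \<xi>" using \<tau> that by (simp add: v_def)
      have "U v = (\<integral>w. (indicator {v - l..v} (v + w) * G (v + w) ^ (2 * N)) \<partial>lborel)"
        unfolding U_def by (rule integral_translate_lborel[symmetric]) measurable
      also have "\<dots> = (\<integral>t. (indicator {v - l..v} (v + - t) * G (v + - t) ^ (2 * N)) \<partial>lborel)"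
        by (rule lborel_integral_real_affine[where c = "-1" and t = 0, simplified])
      also have "\<dots> = (\<integral>t. (\<tau> * norm \<xi>) ^ (2 * N) * (indicator {0..l} t * exp (- (2 * real N * t)) * tent_ft ((\<tau> * exp (- t)) *\<^sub>R \<xi>) ^ (4 * N)) \<partial>lborel)"
      proof (intro Bochner_Integration.integral_cong refl)
        fix t :: real
        have e: "exp (v + - t) = \<tau> * norm \<xi> * exp (- t)" unfolding exp_add ev ..
        then have e': "exp (v - t) = \<tau> * norm \<xi> * exp (- t)" by simp
        have r: "tent_ft (exp (v + - t) *\<^sub>R u) = tent_ft ((\<tau> * exp (- t)) *\<^sub>R \<xi>)"
          by (rule tent_ft_radial) (use \<tau> u in \<open>simp add: e' mult_ac abs_mult\<close>)
        have "G (v + - t) ^ (2 * N) = exp (v + - t) ^ (2 * N) * tent_ft ((\<tau> * exp (- t)) *\<^sub>R \<xi>) ^ (4 * N)"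
          unfolding G_def r power_mult_distrib power_mult[symmetric] by simp
        also have "exp (v + - t) ^ (2 * N) = (\<tau> * norm \<xi>) ^ (2 * N) * exp (- (2 * real N * t))"
          unfolding e power_mult_distrib by (simp add: exp_of_nat_mult[symmetric])
        finally have "G (v + - t) ^ (2 * N) = (\<tau> * norm \<xi>) ^ (2 * N) * exp (- (2 * real N * t)) * tent_ft ((\<tau> * exp (- t)) *\<^sub>R \<xi>) ^ (4 * N)" .
        then show "indicator {v - l..v} (v + - t) * G (v + - t) ^ (2 * N) = (\<tau> * norm \<xi>) ^ (2 * N) * (indicator {0..l} t * exp (- (2 * real N * t)) * tent_ft ((\<tau> * exp (- t)) *\<^sub>R \<xi>) ^ (4 * N))"
          by (auto simp: indicator_def)
      qed
      finally show ?thesis unfolding m_def v_def by simp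
    qed
    have BN: "4 * real N * exp v0 / \<rho> = \<beta> * real N" by (simp add: \<beta>_def)
    have sc: "norm \<xi> / (\<beta> * N) = exp (- v0) * (\<tau> * norm \<xi>)" for \<xi> :: "real^'d"
      using \<rho> N by (simp add: \<beta>_def \<tau>_def exp_minus field_simps)
    obtain I where I: "I > 0" "\<And>v. v \<in> {v0..v0 + ln 2} \<Longrightarrow> I \<le> U v" "\<And>v. U v \<le> C * I" "\<And>v. U v * exp (real B * v) \<le> C * I"
      using win[rule_format, of N] N unfolding U_def by auto
    \<comment> \<open>The passage from \<open>\<tau> * norm \<xi>\<close> to
      \<open>norm \<xi> / (\<beta> * N)\<close> costs this common factor, which is absorbed into the
      level \<open>I * e\<close>.\<close>
    define e where "e = exp (- v0) ^ (2 * N)"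
    have e: "e > 0" by (simp add: e_def)
    have scU: "(norm \<xi> / (\<beta> * N)) ^ (2 * N) * m \<xi> = e * U (ln (\<tau> * norm \<xi>))" if "\<xi> \<noteq> 0" for \<xi>
      unfolding sc power_mult_distrib e_def mU[OF that, symmetric] by simp
    have c5: "I * e > 0" using I(1) e by simp
    have c6: "I * e \<le> (norm \<xi> / (\<beta> * N)) ^ (2 * N) * m \<xi>" if "\<beta> * N \<le> norm \<xi>" "norm \<xi> \<le> 2 * (\<beta> * N)" for \<xi>
    proof -
      have bN: "\<beta> * N > 0" using \<beta> N by simp
      have nz: "\<xi> \<noteq> 0" using that(1) bN by auto
      have pos: "\<tau> * norm \<xi> > 0" using \<tau> nz by simp
      have tb: "\<tau> * (\<beta> * N) = exp v0" using \<rho> N by (simp add: \<tau>_def \<beta>_def)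
      have "exp v0 \<le> \<tau> * norm \<xi>" "\<tau> * norm \<xi> \<le> 2 * exp v0"
      proof -
        have "\<tau> * (\<beta> * N) \<le> \<tau> * norm \<xi>" "\<tau> * norm \<xi> \<le> \<tau> * (2 * (\<beta> * N))"
          using that \<tau> by (auto intro!: mult_left_mono)
        then show "exp v0 \<le> \<tau> * norm \<xi>" "\<tau> * norm \<xi> \<le> 2 * exp v0"
          using tb by linarith+
      qed
      then have "v0 \<le> ln (\<tau> * norm \<xi>)" "ln (\<tau> * norm \<xi>) \<le> ln (2 * exp v0)"
        using pos by (auto simp: ln_ge_iff)
      then have "ln (\<tau> * norm \<xi>) \<in> {v0..v0 + ln 2}" by (simp add: ln_mult)
      from I(2)[OF this] show ?thesis unfolding scU[OF nz] using e by (simp add: mult.commute)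
    qed
    have c7: "(norm \<xi> / (\<beta> * N)) ^ (2 * N) * m \<xi> \<le> C * (I * e)" for \<xi>
    proof (cases "\<xi> = 0")
      case True
      then show ?thesis using N C I(1) e by (simp add: power_0_left)
    next
      case False
      have "e * U (ln (\<tau> * norm \<xi>)) \<le> e * (C * I)"
        using e by (intro mult_left_mono I(3)) auto
      then show ?thesis unfolding scU[OF False] by (simp only: mult_ac)
    qed
    have c8: "(norm \<xi> / (\<beta> * N)) ^ B * ((norm \<xi> / (\<beta> * N)) ^ (2 * N) * m \<xi>) \<le> C * (I * e)" for \<xi>
    proof (cases "\<xi> = 0")
      case True
      then show ?thesis using N C I(1) e by (simp add: power_0_left)
    next
      case False
      define v where "v = ln (\<tau> * norm \<xi>)"
      have ev: "exp v = \<tau> * norm \<xi>" using \<tau> False by (simp add: v_def)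
      have U0: "U v \<ge> 0" unfolding U_def using G0 by (intro Bochner_Integration.integral_nonneg) auto
      have "(norm \<xi> / (\<beta> * N)) ^ B = exp (- v0) ^ B * exp (real B * v)"
        unfolding sc ev[symmetric] power_mult_distrib by (simp add: exp_of_nat_mult)
      also have "\<dots> \<le> 1 * exp (real B * v)" using v0 by (intro mult_right_mono power_le_one) auto
      finally have "(norm \<xi> / (\<beta> * N)) ^ B * (e * U v) \<le> exp (real B * v) * (e * U v)"
        using e U0 by (intro mult_right_mono) auto
      also have "\<dots> = e * (U v * exp (real B * v))" by simp
      also have "\<dots> \<le> e * (C * I)" using I(4)[of v] e by (intro mult_left_mono) auto
      finally show ?thesis unfolding scU[OF False] v_def by (simp add: mult_ac)
    qed
    show ?thesis
      by (rule exI[of _ M'], rule exI[of _ m], rule exI[of _ "I * e"])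
         (intro conjI allI impI c1 c2 c3 c4 m0 c5 c7 c8, elim conjE, rule c6)
  qed
  then have *: "\<forall>N\<ge>max 1 B. \<exists>(M :: (real ^ 'd) measure) m I.
    finite_measure M \<and> sets M = sets borel \<and> (AE y in M. norm y \<le> \<rho>) \<and> I > 0 \<and>
    (\<forall>\<xi>. (\<integral>y. cis (y \<bullet> \<xi>) \<partial>M) = complex_of_real (m \<xi>)) \<and> (\<forall>\<xi>. 0 \<le> m \<xi>) \<and>
    (\<forall>\<xi>. \<beta> * N \<le> norm \<xi> \<and> norm \<xi> \<le> 2 * (\<beta> * N) \<longrightarrow> I \<le> (norm \<xi> / (\<beta> * N)) ^ (2 * N) * m \<xi>) \<and>
    (\<forall>\<xi>. (norm \<xi> / (\<beta> * N)) ^ (2 * N) * m \<xi> \<le> C * I) \<and>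
    (\<forall>\<xi>. (norm \<xi> / (\<beta> * N)) ^ B * ((norm \<xi> / (\<beta> * N)) ^ (2 * N) * m \<xi>) \<le> C * I)"
    by (intro allI impI)
  show ?thesis
    by (rule exI[of _ \<beta>], rule exI[of _ C]) (intro conjI \<beta> C *)
qed

section \<open>Mollifiers and smearing\<close>

text \<open>The classical \<open>exp (- 1 / t)\<close>, multiplied by powers of \<open>1 / t\<close>
  so that derivatives are linear combinations of the same family.\<close>

definition bump :: "nat \<Rightarrow> real \<Rightarrow> real"
  where "bump n t = (if t > 0 then inverse t ^ n / exp (inverse t) else 0)"

lemma bump_nonneg: "0 \<le> bump n t" by (simp add: bump_def)

lemma bump_tendsto_0: "(bump n \<longlongrightarrow> 0) (at 0)"
proof -
  have "((\<lambda>t. inverse t ^ n / exp (inverse t)) \<longlongrightarrow> (0::real)) (at_right 0)"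
    by (rule filterlim_compose[OF tendsto_power_div_exp_0 filterlim_inverse_at_top_right])
  moreover have "\<forall>\<^sub>F t in at_right (0::real). inverse t ^ n / exp (inverse t) = bump n t"
    using eventually_at_right_less[of "0::real"] by eventually_elim (simp add: bump_def)
  ultimately have "(bump n \<longlongrightarrow> 0) (at_right 0)"
    by (rule Lim_transform_eventually)
  moreover have "(bump n \<longlongrightarrow> 0) (at_left 0)"
  proof (rule Lim_transform_eventually[OF tendsto_const])
    show "\<forall>\<^sub>F t in at_left (0::real). 0 = bump n t"
      unfolding eventually_at_left_field by (auto simp: bump_def intro!: exI[of _ "-1"])
  qed
  ultimately show ?thesis by (simp add: filterlim_at_split)
qed

lemma bump_has_real_derivative:
  "(bump n has_real_derivative (bump (n + 2) t - real n * bump (n + 1) t)) (at t)"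
proof -
  consider "t > 0" | "t < 0" | "t = 0" by linarith
  then show ?thesis
  proof cases
    case 1
    have "((\<lambda>t. inverse t ^ n * exp (- inverse t)) has_real_derivative
        (bump (n + 2) t - real n * bump (n + 1) t)) (at t)"
      using 1 by (auto intro!: derivative_eq_intros simp: bump_def exp_minus divide_inverse power2_eq_square)
        (cases n, auto simp: algebra_simps)
    then show ?thesis
      by (rule has_field_derivative_transform_within_open[of _ _ _ "{0<..}"])
         (use 1 in \<open>auto simp: bump_def exp_minus divide_inverse\<close>)
  next
    case 2
    have "((\<lambda>t. 0) has_real_derivative 0) (at t)" by simp
    then have "(bump n has_real_derivative 0) (at t)"
      by (rule has_field_derivative_transform_within_open[of _ _ _ "{..<0}"]) (use 2 in \<open>auto simp: bump_def\<close>)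
    with 2 show ?thesis by (simp add: bump_def)
  next
    case 3
    \<comment> \<open>At 0 the difference quotient of \<open>bump n\<close> is
      \<open>bump (Suc n)\<close>, which tends to 0.\<close>
    have "((\<lambda>y. (bump n y - bump n 0) / (y - 0)) \<longlongrightarrow> 0) (at 0)"
    proof (rule Lim_transform_eventually[OF bump_tendsto_0[of "Suc n"]])
      show "\<forall>\<^sub>F y in at 0. bump (Suc n) y = (bump n y - bump n 0) / (y - 0)"
        by (intro always_eventually allI) (simp add: bump_def divide_inverse mult_ac)
    qed
    with 3 show ?thesis by (simp add: has_field_derivative_iff bump_def)
  qed
qed

text \<open>Differentiation raises the index of \<open>bump\<close> or changes the smooth factor, so
  finite sums over all indices form the class for the coinduction.\<close>

inductive_set bump_span :: "(real ^ 'd \<Rightarrow> real) \<Rightarrow> (real ^ 'd \<Rightarrow> real) set" for q where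
  bump_span_gen: "smooth_fun h \<Longrightarrow> (\<lambda>x. h x * bump n (q x)) \<in> bump_span q"
| bump_span_add: "u \<in> bump_span q \<Longrightarrow> v \<in> bump_span q \<Longrightarrow> (\<lambda>x. u x + v x) \<in> bump_span q"

lemma partial_deriv_bump:
  assumes "q differentiable at x"
  shows "partial_deriv i (\<lambda>x. bump n (q x)) x = (bump (n + 2) (q x) - real n * bump (n + 1) (q x)) * partial_deriv i q x"
    and "(\<lambda>x. bump n (q x)) differentiable at x"
proof -
  obtain q' where q': "(q has_derivative q') (at x)" using assms by (auto simp: differentiable_def)
  have "((\<lambda>x. bump n (q x)) has_derivative (\<lambda>v. (bump (n + 2) (q x) - real n * bump (n + 1) (q x)) * q' v)) (at x)"
    by (rule has_derivative_compose[OF q']) (use bump_has_real_derivative[of n "q x"] in \<open>simp add: has_field_derivative_def\<close>)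
  from partial_deriv_has_derivative[OF this] partial_deriv_has_derivative[OF q'] this
  show "partial_deriv i (\<lambda>x. bump n (q x)) x = (bump (n + 2) (q x) - real n * bump (n + 1) (q x)) * partial_deriv i q x"
    "(\<lambda>x. bump n (q x)) differentiable at x"
    by (auto simp: differentiable_def)
qed

lemma smooth_fun_bump:
  fixes q :: "real ^ 'd::finite \<Rightarrow> real"
  assumes q: "smooth_fun q"
  shows "smooth_fun (\<lambda>x. bump n (q x))"
proof (rule smooth_fun_coinduct)
  have "(\<lambda>x. 1 * bump n (q x)) \<in> bump_span q" by (rule bump_span_gen) simp
  then show "(\<lambda>x. bump n (q x)) \<in> bump_span q" by simp
next
  fix u :: "real ^ 'd \<Rightarrow> real" and x
  assume "u \<in> bump_span q"
  then show "u differentiable at x"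
  proof induction
    case (bump_span_gen h n)
    then show ?case
      by (intro differentiable_mult smooth_fun_differentiable partial_deriv_bump q)
  qed (rule differentiable_add)
next
  fix u :: "real ^ 'd \<Rightarrow> real" and i
  assume "u \<in> bump_span q"
  then have "partial_deriv i u \<in> bump_span q \<and> (\<forall>x. u differentiable at x)"
  proof induction
    case (bump_span_gen h n)
    have d: "(\<lambda>x. h x * bump n (q x)) differentiable at x" for x
      using bump_span_gen by (intro differentiable_mult smooth_fun_differentiable partial_deriv_bump q)
    have "partial_deriv i (\<lambda>x. h x * bump n (q x)) x =
        partial_deriv i h x * bump n (q x) + ((h x * partial_deriv i q x) * bump (n + 2) (q x)
          + (- real n * (h x * partial_deriv i q x)) * bump (n + 1) (q x))" for x
      using bump_span_gen
      by (subst partial_deriv_bilinear[OF bounded_bilinear_mult])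
         (auto intro!: smooth_fun_differentiable partial_deriv_bump(2) q simp: partial_deriv_bump(1) smooth_fun_differentiable q algebra_simps)
    then have "partial_deriv i (\<lambda>x. h x * bump n (q x)) =
        (\<lambda>x. partial_deriv i h x * bump n (q x) + ((h x * partial_deriv i q x) * bump (n + 2) (q x)
          + (- real n * (h x * partial_deriv i q x)) * bump (n + 1) (q x)))" by (rule ext)
    moreover have "\<dots> \<in> bump_span q"
      using bump_span_gen q
      by (intro bump_span.intros smooth_fun_mult smooth_fun_partial_deriv smooth_fun_const)
    ultimately show ?case using d by simp
  next
    case (bump_span_add u v)
    then have "partial_deriv i (\<lambda>x. u x + v x) = (\<lambda>x. partial_deriv i u x + partial_deriv i v x)"
      by (auto simp: partial_deriv_add)
    with bump_span_add show ?case by (auto intro: bump_span.intros differentiable_add)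
  qed
  then show "partial_deriv i u \<in> bump_span q" ..
qed

lemma mollifier_exists:
  assumes \<epsilon>: "\<epsilon> > 0"
  shows "\<exists>\<kappa> :: real ^ 'd::finite \<Rightarrow> real. \<kappa> \<in> test_functions (cball 0 \<epsilon>) \<and> (\<forall>x. 0 \<le> \<kappa> x) \<and>
    (\<forall>x. \<epsilon> < norm x \<longrightarrow> \<kappa> x = 0) \<and> (\<integral>x. \<kappa> x \<partial>lborel) = 1"
proof -
  define b where "b x = bump 0 (\<epsilon>\<^sup>2 - (norm x)\<^sup>2)" for x :: "real^'d"
  have "smooth_fun (\<lambda>x::real^'d. \<epsilon>\<^sup>2 + (-1) * (norm x)\<^sup>2)"
    by (intro smooth_fun_add smooth_fun_const smooth_fun_mult smooth_fun_norm_power2)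
  then have "smooth_fun b" unfolding b_def[abs_def] by (intro smooth_fun_bump) simp
  moreover have b0: "b x = 0" if "\<epsilon> \<le> norm x" for x
  proof -
    have "\<epsilon>\<^sup>2 \<le> (norm x)\<^sup>2" using that \<epsilon> by (intro power_mono) auto
    then show ?thesis by (simp add: b_def bump_def not_less)
  qed
  ultimately have bt: "b \<in> test_functions (cball 0 \<epsilon>)"
    unfolding test_functions_iff by (auto intro!: exI[of _ "cball 0 \<epsilon>"])
  have bn: "0 \<le> b x" for x by (simp add: b_def bump_nonneg)
  have "(\<integral>x. b x \<partial>lborel) \<noteq> 0"
  proof
    assume "(\<integral>x. b x \<partial>lborel) = 0"
    then have "AE x in lborel. b x = 0"
      using integral_nonneg_eq_0_iff_AE[OF test_functions_integrable[OF bt]] bn by auto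
    moreover have "b x \<noteq> 0" if "x \<in> ball 0 \<epsilon>" for x
    proof -
      have "(norm x)\<^sup>2 < \<epsilon>\<^sup>2" using that by (intro power_strict_mono) auto
      then show ?thesis by (simp add: b_def bump_def)
    qed
    ultimately have "AE x in lborel. x \<notin> ball (0::real^'d) \<epsilon>" by auto
    then have "emeasure lborel (ball (0::real^'d) \<epsilon>) = 0"
      by (subst (asm) AE_iff_measurable[of "ball 0 \<epsilon>"]) auto
    then show False using content_ball_pos[OF \<epsilon>, of "0::real^'d"] by (simp add: measure_def)
  qed
  moreover have "(\<integral>x. b x \<partial>lborel) \<ge> 0" using bn by (intro Bochner_Integration.integral_nonneg) auto
  ultimately have Z: "(\<integral>x. b x \<partial>lborel) > 0" by simp
  define \<kappa> where "\<kappa> x = (1 / (\<integral>x. b x \<partial>lborel)) * b x" for x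
  have "\<kappa> \<in> test_functions (cball 0 \<epsilon>)"
    unfolding \<kappa>_def[abs_def] by (rule test_functions_comp_linear[OF bounded_linear_mult_right bt])
  moreover have "(\<integral>x. \<kappa> x \<partial>lborel) = 1" using Z by (simp add: \<kappa>_def)
  ultimately show ?thesis
    using bn Z b0 by (intro exI[of _ \<kappa>]) (auto simp: \<kappa>_def)
qed

text \<open>The remainder bound is uniform in \<open>x\<close>, so it survives integration of
  translates against any finite measure; this is what differentiates \<open>smear\<close> under the
  integral.\<close>

lemma test_functions_second_order:
  fixes \<phi> :: "real ^ 'd::finite \<Rightarrow> 'b::real_normed_vector"
  assumes \<phi>: "\<phi> \<in> test_functions \<Omega>"
  shows "\<exists>C>0. \<forall>x v. norm (\<phi> (x + v) - \<phi> x - (\<Sum>i\<in>UNIV. v $ i *\<^sub>R partial_deriv i \<phi> x)) \<le> C * (norm v)\<^sup>2"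
proof -
  have "\<exists>b>0. \<forall>x y. norm (partial_deriv i \<phi> x - partial_deriv i \<phi> y) \<le> b * norm (x - y)" for i
    using test_functions_Lipschitz[OF test_functions_partial_deriv[OF \<phi>]] by metis
  then obtain b where b: "\<And>i. b i > 0" "\<And>i x y. norm (partial_deriv i \<phi> x - partial_deriv i \<phi> y) \<le> b i * norm (x - y)" by metis
  let ?B = "\<Sum>i\<in>UNIV. b i"
  let ?D = "\<lambda>x v. \<Sum>i\<in>UNIV. v $ i *\<^sub>R partial_deriv i \<phi> x"
  have "norm (\<phi> (x + v) - \<phi> x - ?D x v) \<le> ?B * (norm v)\<^sup>2" for x v
  proof -
    have "norm (\<phi> (x + v) - \<phi> x - ?D x ((x + v) - x)) \<le> norm ((x + v) - x) * (?B * norm v)"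
    proof (rule differentiable_bound_linearization[where S = "cball x (norm v)"])
      fix t :: real assume "t \<in> {0..1}"
      then show "x + t *\<^sub>R (x + v - x) \<in> cball x (norm v)"
        by (simp add: dist_norm mult_left_le_one_le)
    next
      fix y assume "y \<in> cball x (norm v)"
      then have y: "norm (y - x) \<le> norm v" by (simp add: dist_norm norm_minus_commute)
      show "onorm (?D y - ?D x) \<le> ?B * norm v"
      proof (rule onorm_le)
        fix w :: "real^'d"
        have "(?D y - ?D x) w = (\<Sum>i\<in>UNIV. w $ i *\<^sub>R (partial_deriv i \<phi> y - partial_deriv i \<phi> x))"
          by (simp add: sum_subtractf scaleR_diff_right)
        also have "norm \<dots> \<le> (\<Sum>i\<in>UNIV. norm w * (b i * norm v))"
        proof (intro sum_norm_le)
          fix i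
          have "norm (partial_deriv i \<phi> y - partial_deriv i \<phi> x) \<le> b i * norm v"
            using b(2)[of i y x] mult_left_mono[OF y, of "b i"] b(1)[of i] by linarith
          then show "norm (w $ i *\<^sub>R (partial_deriv i \<phi> y - partial_deriv i \<phi> x)) \<le> norm w * (b i * norm v)"
            by (auto intro!: mult_mono component_le_norm_cart)
        qed
        also have "\<dots> = ?B * norm v * norm w" by (simp add: sum_distrib_left sum_distrib_right mult_ac)
        finally show "norm ((?D y - ?D x) w) \<le> ?B * norm v * norm w" .
      qed
    qed (use \<phi> in \<open>auto intro!: has_derivative_at_withinI has_derivative_partial smooth_fun_differentiable test_functions_smooth\<close>)
    then show ?thesis by (simp add: power2_eq_square mult_ac)
  qed
  moreover have "?B > 0" using b by (intro sum_pos) auto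
  ultimately show ?thesis by blast
qed

text \<open>Convolution with a measure instead of a density: the measure of
  \<open>radial_measure\<close> is concentrated on a ball but comes without a smooth density, and
  smearing a mollifier by it gives a test function.\<close>

definition smear :: "(real ^ 'd::finite) measure \<Rightarrow> (real ^ 'd \<Rightarrow> real) \<Rightarrow> real ^ 'd \<Rightarrow> real"
  where "smear M \<phi> x = (\<integral>y. \<phi> (x - y) \<partial>M)"

lemma smear_has_derivative:
  assumes M: "finite_measure M" "sets M = sets borel" and \<phi>: "\<phi> \<in> test_functions \<Omega>"
  shows "(smear M \<phi> has_derivative (\<lambda>v. \<Sum>i\<in>UNIV. v $ i *\<^sub>R smear M (partial_deriv i \<phi>) x)) (at x)"
proof -
  interpret finite_measure M by fact
  have [measurable_cong]: "sets M = sets borel" by fact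
  have int: "integrable M (\<lambda>y. \<psi> (x - y))" if \<psi>: "\<psi> \<in> test_functions \<Omega>" for \<psi> :: "real^'a \<Rightarrow> real" and x
  proof -
    obtain B where "\<And>x. norm (\<psi> x) \<le> B" using test_functions_bounded[OF \<psi>] by blast
    moreover have [measurable]: "\<psi> \<in> borel_measurable borel" using test_functions_borel[OF \<psi>] .
    ultimately show ?thesis by (intro integrable_const_bound[of _ B]) auto
  qed
  obtain C where C: "C > 0" "\<And>x v. norm (\<phi> (x + v) - \<phi> x - (\<Sum>i\<in>UNIV. v $ i *\<^sub>R partial_deriv i \<phi> x)) \<le> C * (norm v)\<^sup>2"
    using test_functions_second_order[OF \<phi>] by blast
  let ?D = "\<lambda>v. \<Sum>i\<in>UNIV. v $ i *\<^sub>R smear M (partial_deriv i \<phi>) x"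
  have bl: "bounded_linear ?D"
    by (intro bounded_linear_sum bounded_linear_compose[OF bounded_linear_scaleR_left] bounded_linear_vec_nth)
  have err: "norm (smear M \<phi> (x + v) - smear M \<phi> x - ?D v) \<le> C * measure M (space M) * (norm v)\<^sup>2" for v
  proof -
    let ?S = "\<lambda>y. \<Sum>i\<in>UNIV. v $ i *\<^sub>R partial_deriv i \<phi> (x - y)"
    let ?F = "\<lambda>y. \<phi> ((x - y) + v) - \<phi> (x - y) - ?S y"
    have 1: "smear M \<phi> (x + v) = (\<integral>y. \<phi> ((x - y) + v) \<partial>M)" by (simp add: smear_def algebra_simps)
    have i1: "integrable M (\<lambda>y. \<phi> ((x - y) + v))" using int[OF \<phi>, of "x + v"] by (simp add: algebra_simps)
    have i3: "integrable M (\<lambda>y. v $ i *\<^sub>R partial_deriv i \<phi> (x - y))" for i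
      by (intro integrable_scaleR_right int test_functions_partial_deriv \<phi>)
    have iS: "integrable M ?S" by (rule Bochner_Integration.integrable_sum) (rule i3)
    have iF: "integrable M ?F"
      by (intro Bochner_Integration.integrable_diff i1 iS int[OF \<phi>])
    have "?D v = (\<integral>y. ?S y \<partial>M)"
      unfolding smear_def by (subst Bochner_Integration.integral_sum[OF i3]) simp
    then have "smear M \<phi> (x + v) - smear M \<phi> x - ?D v = (\<integral>y. ?F y \<partial>M)"
      unfolding 1 Bochner_Integration.integral_diff[OF Bochner_Integration.integrable_diff[OF i1 int[OF \<phi>]] iS]
        Bochner_Integration.integral_diff[OF i1 int[OF \<phi>]] by (simp add: smear_def)
    also have "norm (\<integral>y. ?F y \<partial>M) \<le> (\<integral>y. norm (?F y) \<partial>M)" by (rule integral_norm_bound)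
    also have "\<dots> \<le> (\<integral>y. C * (norm v)\<^sup>2 \<partial>M)"
      by (rule integral_mono[OF integrable_norm[OF iF] integrable_const]) (rule C(2))
    also have "\<dots> = C * measure M (space M) * (norm v)\<^sup>2" by simp
    finally show ?thesis .
  qed
  have "((\<lambda>v. norm (smear M \<phi> (x + v) - smear M \<phi> x - ?D v) / norm v) \<longlongrightarrow> 0) (at 0)"
  proof (rule Lim_null_comparison[where g = "\<lambda>v. C * measure M (space M) * norm v"])
    show "\<forall>\<^sub>F v in at 0. norm (norm (smear M \<phi> (x + v) - smear M \<phi> x - ?D v) / norm v) \<le> C * measure M (space M) * norm v"
    proof (intro always_eventually allI)
      fix v :: "real^'a"
      show "norm (norm (smear M \<phi> (x + v) - smear M \<phi> x - ?D v) / norm v) \<le> C * measure M (space M) * norm v"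
        using err[of v] by (cases "v = 0") (auto simp: divide_le_eq power2_eq_square mult_ac)
    qed
    show "((\<lambda>v::real^'a. C * measure M (space M) * norm v) \<longlongrightarrow> 0) (at 0)"
    proof -
      have "((\<lambda>v::real^'a. C * measure M (space M) * norm v) \<longlongrightarrow> C * measure M (space M) * norm (0::real^'a)) (at 0)"
        by (intro tendsto_intros)
      then show ?thesis by simp
    qed
  qed
  with bl show ?thesis by (simp add: has_derivative_at)
qed

lemma smooth_fun_smear:
  assumes M: "finite_measure M" "sets M = sets borel" and \<phi>: "\<phi> \<in> test_functions \<Omega>"
  shows "smooth_fun (smear M \<phi>)"
proof (rule smooth_fun_coinduct[of _ "smear M ` test_functions \<Omega>"])
  fix u assume "u \<in> smear M ` test_functions \<Omega>"
  then obtain \<psi> where \<psi>: "\<psi> \<in> test_functions \<Omega>" "u = smear M \<psi>" by auto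
  show "u differentiable at x" for x
    unfolding \<psi>(2) differentiable_def using smear_has_derivative[OF M \<psi>(1)] by blast
  have "partial_deriv i u = smear M (partial_deriv i \<psi>)" for i
    unfolding \<psi>(2) using partial_deriv_has_derivative[OF smear_has_derivative[OF M \<psi>(1)], of i]
    by (auto simp: axis_def if_distrib[of "\<lambda>c. c * _"] cong: if_cong)
  then show "partial_deriv i u \<in> smear M ` test_functions \<Omega>" for i
    using test_functions_partial_deriv[OF \<psi>(1)] by auto
qed (use \<phi> in auto)

lemma smear_eq_0:
  assumes supp: "AE y in M. norm y \<le> \<rho>" and \<phi>: "\<And>x. \<epsilon> < norm x \<Longrightarrow> \<phi> x = 0" and x: "\<rho> + \<epsilon> < norm x"
  shows "smear M \<phi> x = 0"
  unfolding smear_def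
proof (rule integral_eq_zero_AE)
  show "AE y in M. \<phi> (x - y) = 0"
    using supp
  proof eventually_elim
    case (elim y)
    have "norm x - norm y \<le> norm (x - y)" by (rule norm_triangle_ineq2)
    with elim x show ?case by (intro \<phi>) linarith
  qed
qed

lemma test_functions_smear:
  assumes M: "finite_measure M" "sets M = sets borel" "AE y in M. norm y \<le> \<rho>"
    and \<phi>: "\<phi> \<in> test_functions UNIV" "\<And>x. \<epsilon> < norm x \<Longrightarrow> \<phi> x = 0"
  shows "smear M \<phi> \<in> test_functions (cball 0 (\<rho> + \<epsilon>))"
  unfolding test_functions_iff using smooth_fun_smear[OF M(1,2) \<phi>(1)] smear_eq_0[OF M(3) \<phi>(2)]
  by (auto intro!: exI[of _ "cball 0 (\<rho> + \<epsilon>)"])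

lemma ft_smear:
  assumes M: "finite_measure M" "sets M = sets borel"
    and \<phi>: "\<phi> \<in> test_functions \<Omega>"
  shows "ft (\<lambda>x. complex_of_real (smear M \<phi> x)) \<xi> = ft (\<lambda>x. complex_of_real (\<phi> x)) \<xi> * (\<integral>y. cis (y \<bullet> \<xi>) \<partial>M)"
proof -
  interpret finite_measure M by fact
  interpret P: pair_sigma_finite M "lborel :: (real^'a) measure" ..
  have [measurable_cong]: "sets M = sets borel" by fact
  note [measurable] = test_functions_borel[OF \<phi>]
  have tr: "(\<integral>x. \<bar>\<phi> (x - y)\<bar> \<partial>lborel) = (\<integral>x. \<bar>\<phi> x\<bar> \<partial>lborel)" for y
    using integral_translate_lborel[of "\<lambda>x. \<bar>\<phi> x\<bar>" "- y"] by simp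
  have itr: "integrable lborel (\<lambda>x. \<phi> (x - y))" for y
    using integrable_translate_lborel[of \<phi> "- y"] test_functions_integrable[OF \<phi>] by simp
  have "integrable (M \<Otimes>\<^sub>M lborel) (\<lambda>(y, x). complex_of_real (\<phi> (x - y)) * cis (x \<bullet> \<xi>))"
  proof (rule P.Fubini_integrable)
    show "integrable M (\<lambda>y. \<integral>x. norm (case (y, x) of (y, x) \<Rightarrow> complex_of_real (\<phi> (x - y)) * cis (x \<bullet> \<xi>)) \<partial>lborel)"
      by (simp add: norm_mult tr)
    show "AE y in M. integrable lborel (\<lambda>x. case (y, x) of (y, x) \<Rightarrow> complex_of_real (\<phi> (x - y)) * cis (x \<bullet> \<xi>))"
      using itr by (auto intro!: integrable_mult_cis simp: complex_of_real_integrable_eq)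
  qed measurable
  then have swap: "(\<integral>x. (\<integral>y. complex_of_real (\<phi> (x - y)) * cis (x \<bullet> \<xi>) \<partial>M) \<partial>lborel) =
      (\<integral>y. (\<integral>x. complex_of_real (\<phi> (x - y)) * cis (x \<bullet> \<xi>) \<partial>lborel) \<partial>M)"
    by (rule P.Fubini_integral)
  have "(\<integral>x. complex_of_real (\<phi> (x - y)) * cis (x \<bullet> \<xi>) \<partial>lborel) = ft (\<lambda>x. complex_of_real (\<phi> x)) \<xi> * cis (y \<bullet> \<xi>)" for y
  proof -
    have "(\<integral>x. complex_of_real (\<phi> (x - y)) * cis (x \<bullet> \<xi>) \<partial>lborel) = (\<integral>x. complex_of_real (\<phi> ((y + x) - y)) * cis ((y + x) \<bullet> \<xi>) \<partial>lborel)"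
      by (rule integral_translate_lborel[symmetric]) measurable
    also have "\<dots> = (\<integral>x. complex_of_real (\<phi> x) * cis (x \<bullet> \<xi>) * cis (y \<bullet> \<xi>) \<partial>lborel)"
      by (simp add: inner_add_left mult_ac flip: cis_mult)
    finally show ?thesis by (simp add: ft_def)
  qed
  then have "(\<integral>x. (\<integral>y. complex_of_real (\<phi> (x - y)) * cis (x \<bullet> \<xi>) \<partial>M) \<partial>lborel) =
      ft (\<lambda>x. complex_of_real (\<phi> x)) \<xi> * (\<integral>y. cis (y \<bullet> \<xi>) \<partial>M)"
    unfolding swap by simp
  then show ?thesis
    by (simp add: ft_def smear_def)
qed

section \<open>Annihilation of ridge functions\<close>

text \<open>The derivative of the transform along the line spanned by \<open>\<omega>\<close> is
  \<open>\<i>\<close> times the transform of \<open>(x \<bullet> \<omega>) * \<psi> x\<close>, and a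
  function that vanishes on the line has zero derivative there. The difference quotients are
  dominated through \<open>norm (cis t - 1) \<le> \<bar>t\<bar>\<close>.\<close>

lemma ft_ray_deriv_eq_0:
  fixes \<psi> :: "real ^ 'd::finite \<Rightarrow> real"
  assumes \<psi>: "\<psi> \<in> test_functions \<Omega>" and zero: "\<And>\<tau>::real. ft (\<lambda>x. complex_of_real (\<psi> x)) (\<tau> *\<^sub>R \<omega>) = 0"
  shows "ft (\<lambda>x. complex_of_real ((x \<bullet> \<omega>) * \<psi> x)) (\<tau> *\<^sub>R \<omega>) = 0"
proof -
  define s where "s n = inverse (real (Suc n))" for n
  have s: "s n > 0" for n by (simp add: s_def)
  have slim: "filterlim s (at 0) sequentially"
    unfolding filterlim_at using LIMSEQ_inverse_real_of_nat s unfolding s_def by (auto simp: less_le)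
  note [measurable] = test_functions_borel[OF \<psi>]
  have t1: "(\<lambda>x. (x \<bullet> \<omega>) * \<psi> x) \<in> test_functions \<Omega>"
    using test_functions_mult[OF \<psi> smooth_fun_inner_right[of \<omega>]] by (simp add: mult.commute)
  let ?e = "\<lambda>x. complex_of_real (\<psi> x) * cis (x \<bullet> (\<tau> *\<^sub>R \<omega>))"
  have eq: "complex_of_real (\<psi> x) * cis (x \<bullet> ((\<tau> + s n) *\<^sub>R \<omega>)) = ?e x * cis (s n * (x \<bullet> \<omega>))" for x n
    by (simp add: cis_mult scaleR_add_left inner_add_right)
  have "(\<lambda>n. \<integral>x. ?e x * ((cis (s n * (x \<bullet> \<omega>)) - 1) / complex_of_real (s n)) \<partial>lborel) \<longlonglongrightarrow>
      (\<integral>x. ?e x * (\<i> * complex_of_real (x \<bullet> \<omega>)) \<partial>lborel)"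
  proof (rule integral_dominated_convergence[where w = "\<lambda>x. \<bar>(x \<bullet> \<omega>) * \<psi> x\<bar>"])
    show "integrable lborel (\<lambda>x. \<bar>(x \<bullet> \<omega>) * \<psi> x\<bar>)"
      by (intro integrable_abs test_functions_integrable[OF t1])
    show "AE x in lborel. (\<lambda>n. ?e x * ((cis (s n * (x \<bullet> \<omega>)) - 1) / complex_of_real (s n))) \<longlonglongrightarrow> ?e x * (\<i> * complex_of_real (x \<bullet> \<omega>))"
    proof (intro AE_I2 tendsto_mult tendsto_const)
      fix x :: "real^'d"
      have "((\<lambda>t::real. cis (t * (x \<bullet> \<omega>))) has_vector_derivative (\<i> * complex_of_real (x \<bullet> \<omega>))) (at 0)"
        using exp_scaleR_has_vector_derivative_right[of "\<i> * complex_of_real (x \<bullet> \<omega>)" 0 UNIV]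
        by (simp add: cis_conv_exp scaleR_conv_of_real mult_ac)
      from has_vector_derivative_at_0_quotient[OF this]
      have "((\<lambda>t. (cis (t * (x \<bullet> \<omega>)) - 1) /\<^sub>R t) \<longlongrightarrow> \<i> * complex_of_real (x \<bullet> \<omega>)) (at 0)" by simp
      from filterlim_compose[OF this slim]
      show "(\<lambda>n. (cis (s n * (x \<bullet> \<omega>)) - 1) / complex_of_real (s n)) \<longlonglongrightarrow> \<i> * complex_of_real (x \<bullet> \<omega>)"
        by (simp add: scaleR_conv_of_real divide_inverse mult.commute)
    qed
    show "AE x in lborel. norm (?e x * ((cis (s n * (x \<bullet> \<omega>)) - 1) / complex_of_real (s n))) \<le> \<bar>(x \<bullet> \<omega>) * \<psi> x\<bar>" for n
    proof (intro AE_I2)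
      fix x :: "real^'d"
      have "norm (cis (s n * (x \<bullet> \<omega>)) - 1) \<le> s n * \<bar>x \<bullet> \<omega>\<bar>"
        using iexp_approx1[of "s n * (x \<bullet> \<omega>)" 0] s[of n] by (simp add: cis_conv_exp abs_mult)
      then have "norm (cis (s n * (x \<bullet> \<omega>)) - 1) / s n \<le> \<bar>x \<bullet> \<omega>\<bar>"
        using s[of n] by (simp add: divide_le_eq mult.commute)
      then have "\<bar>\<psi> x\<bar> * (norm (cis (s n * (x \<bullet> \<omega>)) - 1) / s n) \<le> \<bar>\<psi> x\<bar> * \<bar>x \<bullet> \<omega>\<bar>"
        by (intro mult_left_mono) auto
      then show "norm (?e x * ((cis (s n * (x \<bullet> \<omega>)) - 1) / complex_of_real (s n))) \<le> \<bar>(x \<bullet> \<omega>) * \<psi> x\<bar>"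
        using s[of n] by (simp add: norm_mult norm_divide abs_mult mult.commute)
    qed
  qed measurable
  moreover have "(\<integral>x. ?e x * ((cis (s n * (x \<bullet> \<omega>)) - 1) / complex_of_real (s n)) \<partial>lborel) = 0" for n
  proof -
    have i1: "integrable lborel (\<lambda>x. ?e x * cis (s n * (x \<bullet> \<omega>)))" "integrable lborel ?e"
    proof -
      have "integrable lborel (\<lambda>x. complex_of_real (\<psi> x))"
        by (rule test_functions_integrable[OF test_functions_of_real[OF \<psi>]])
      then show "integrable lborel (\<lambda>x. ?e x * cis (s n * (x \<bullet> \<omega>)))" "integrable lborel ?e"
        by (auto intro!: integrable_mult_cis)
    qed
    have "(\<integral>x. ?e x * ((cis (s n * (x \<bullet> \<omega>)) - 1) / complex_of_real (s n)) \<partial>lborel) =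
        (\<integral>x. (?e x * cis (s n * (x \<bullet> \<omega>)) - ?e x) / complex_of_real (s n) \<partial>lborel)"
      by (simp add: algebra_simps)
    also have "\<dots> = ((\<integral>x. ?e x * cis (s n * (x \<bullet> \<omega>)) \<partial>lborel) - (\<integral>x. ?e x \<partial>lborel)) / complex_of_real (s n)"
      unfolding integral_divide_zero by (subst Bochner_Integration.integral_diff[OF i1]) simp
    also have "\<dots> = 0" using zero[of "\<tau> + s n"] zero[of \<tau>] unfolding ft_def eq by simp
    finally show ?thesis .
  qed
  ultimately have "(\<integral>x. ?e x * (\<i> * complex_of_real (x \<bullet> \<omega>)) \<partial>lborel) = 0" by (simp only: LIMSEQ_const_iff)
  moreover have "(\<integral>x. ?e x * (\<i> * complex_of_real (x \<bullet> \<omega>)) \<partial>lborel) = (\<integral>x. \<i> * (complex_of_real ((x \<bullet> \<omega>) * \<psi> x) * cis (x \<bullet> (\<tau> *\<^sub>R \<omega>))) \<partial>lborel)"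
    by (simp add: mult_ac)
  ultimately have "\<i> * ft (\<lambda>x. complex_of_real ((x \<bullet> \<omega>) * \<psi> x)) (\<tau> *\<^sub>R \<omega>) = 0"
    unfolding ft_def integral_mult_right_zero by simp
  then show ?thesis by simp
qed

text \<open>Repeated differentiation along the line, evaluated at 0, shows that all moments of
  \<open>\<psi>\<close> against powers of \<open>x \<bullet> \<omega>\<close> vanish. On the compact
  range of \<open>x \<bullet> \<omega>\<close> a continuous profile is a uniform limit of
  polynomials.\<close>

lemma ridge_annihilation:
  fixes \<psi> :: "real ^ 'd::finite \<Rightarrow> real"
  assumes \<psi>: "\<psi> \<in> test_functions \<Omega>" and zero: "\<And>\<tau>::real. ft (\<lambda>x. complex_of_real (\<psi> x)) (\<tau> *\<^sub>R \<omega>) = 0"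
    and g: "continuous_on UNIV g"
  shows "(\<integral>x. g (x \<bullet> \<omega>) * \<psi> x \<partial>lborel) = 0"
proof -
  have mom: "(\<lambda>x. (x \<bullet> \<omega>) ^ l * \<psi> x) \<in> test_functions \<Omega> \<and> (\<forall>\<tau>. ft (\<lambda>x. complex_of_real ((x \<bullet> \<omega>) ^ l * \<psi> x)) (\<tau> *\<^sub>R \<omega>) = 0)" for l
  proof (induction l)
    case 0
    then show ?case using \<psi> zero by simp
  next
    case (Suc l)
    then have 1: "(\<lambda>x. (x \<bullet> \<omega>) ^ l * \<psi> x) \<in> test_functions \<Omega>"
      and 2: "\<And>\<tau>. ft (\<lambda>x. complex_of_real ((x \<bullet> \<omega>) ^ l * \<psi> x)) (\<tau> *\<^sub>R \<omega>) = 0" by auto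
    show ?case
      using test_functions_mult[OF 1 smooth_fun_inner_right[of \<omega>]] ft_ray_deriv_eq_0[OF 1 2]
      by (simp add: mult_ac)
  qed
  have mom0: "(\<integral>x. (x \<bullet> \<omega>) ^ l * \<psi> x \<partial>lborel) = 0" for l
  proof -
    have "complex_of_real (\<integral>x. (x \<bullet> \<omega>) ^ l * \<psi> x \<partial>lborel) = ft (\<lambda>x. complex_of_real ((x \<bullet> \<omega>) ^ l * \<psi> x)) (0 *\<^sub>R \<omega>)"
      unfolding ft_def by (simp only: scaleR_zero_left inner_zero_right cis_zero mult_1_right integral_complex_of_real)
    also have "\<dots> = 0" using mom by blast
    finally show ?thesis by simp
  qed
  note [measurable] = test_functions_borel[OF \<psi>] borel_measurable_continuous_onI[OF g]
  obtain K where K: "compact K" "\<And>x. x \<notin> K \<Longrightarrow> \<psi> x = 0"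
    using \<psi> unfolding test_functions_iff by blast
  define S where "S = (\<lambda>x. x \<bullet> \<omega>) ` K"
  have S: "compact S" unfolding S_def by (intro compact_continuous_image K continuous_intros)
  let ?I = "\<integral>x. \<bar>\<psi> x\<bar> \<partial>lborel"
  have I0: "?I \<ge> 0" by (intro Bochner_Integration.integral_nonneg) auto
  have gint: "integrable lborel (\<lambda>x. g (x \<bullet> \<omega>) * \<psi> x)"
  proof -
    have "integrable lborel (\<lambda>x. indicator K x *\<^sub>R (g (x \<bullet> \<omega>) * \<psi> x))"
      by (intro borel_integrable_compact K continuous_intros continuous_on_compose2[OF g]
          smooth_fun_continuous_on test_functions_smooth[OF \<psi>]) auto
    also have "(\<lambda>x. indicator K x *\<^sub>R (g (x \<bullet> \<omega>) * \<psi> x)) = (\<lambda>x. g (x \<bullet> \<omega>) * \<psi> x)"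
      using K(2) by (auto simp: indicator_def fun_eq_iff)
    finally show ?thesis .
  qed
  have "\<bar>\<integral>x. g (x \<bullet> \<omega>) * \<psi> x \<partial>lborel\<bar> \<le> e * ?I" if e: "e > 0" for e
  proof -
    obtain p where p: "real_polynomial_function p" "\<And>t. t \<in> S \<Longrightarrow> \<bar>g t - p t\<bar> < e"
      using Stone_Weierstrass_real_polynomial_function[OF S continuous_on_subset[OF g] e] by auto
    obtain a N where a: "p = (\<lambda>t. \<Sum>i\<le>N. a i * t ^ i)"
      using p(1) unfolding real_polynomial_function_iff_sum by blast
    have pint: "integrable lborel (\<lambda>x. p (x \<bullet> \<omega>) * \<psi> x)" "(\<integral>x. p (x \<bullet> \<omega>) * \<psi> x \<partial>lborel) = 0"
    proof -
      have eq: "(\<lambda>x. p (x \<bullet> \<omega>) * \<psi> x) = (\<lambda>x. \<Sum>i\<le>N. a i * ((x \<bullet> \<omega>) ^ i * \<psi> x))"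
        by (simp add: a sum_distrib_right mult.assoc)
      have i: "integrable lborel (\<lambda>x. a i * ((x \<bullet> \<omega>) ^ i * \<psi> x))" for i
        using mom[of i] by (intro integrable_mult_right) (auto intro: test_functions_integrable)
      show "integrable lborel (\<lambda>x. p (x \<bullet> \<omega>) * \<psi> x)" unfolding eq using i by auto
      show "(\<integral>x. p (x \<bullet> \<omega>) * \<psi> x \<partial>lborel) = 0"
        unfolding eq by (subst Bochner_Integration.integral_sum[OF i]) (simp add: mom0)
    qed
    have "(\<integral>x. g (x \<bullet> \<omega>) * \<psi> x \<partial>lborel) = (\<integral>x. g (x \<bullet> \<omega>) * \<psi> x - p (x \<bullet> \<omega>) * \<psi> x \<partial>lborel)"
      by (subst Bochner_Integration.integral_diff[OF gint pint(1)]) (simp add: pint(2))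
    also have "\<bar>\<dots>\<bar> \<le> (\<integral>x. \<bar>g (x \<bullet> \<omega>) * \<psi> x - p (x \<bullet> \<omega>) * \<psi> x\<bar> \<partial>lborel)"
      by (rule integral_abs_bound)
    also have "\<dots> \<le> (\<integral>x. e * \<bar>\<psi> x\<bar> \<partial>lborel)"
    proof (rule integral_mono)
      fix x
      show "\<bar>g (x \<bullet> \<omega>) * \<psi> x - p (x \<bullet> \<omega>) * \<psi> x\<bar> \<le> e * \<bar>\<psi> x\<bar>"
      proof (cases "x \<in> K")
        case True
        then have "\<bar>g (x \<bullet> \<omega>) - p (x \<bullet> \<omega>)\<bar> \<le> e" using p(2)[of "x \<bullet> \<omega>"] by (auto simp: S_def)
        then show ?thesis by (simp add: left_diff_distrib[symmetric] abs_mult mult_right_mono)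
      qed (simp add: K(2))
    qed (use gint pint(1) test_functions_integrable[OF \<psi>] in auto)
    finally show ?thesis by simp
  qed
  from this[of "inverse (real (Suc n))" for n]
  have "\<bar>\<integral>x. g (x \<bullet> \<omega>) * \<psi> x \<partial>lborel\<bar> \<le> inverse (real (Suc n)) * ?I" for n by auto
  moreover have "(\<lambda>n. inverse (real (Suc n)) * ?I) \<longlonglongrightarrow> 0 * ?I"
    by (intro tendsto_intros LIMSEQ_inverse_real_of_nat)
  ultimately have "\<bar>\<integral>x. g (x \<bullet> \<omega>) * \<psi> x \<partial>lborel\<bar> \<le> 0 * ?I"
    by (intro LIMSEQ_le_const) auto
  then show ?thesis by simp
qed

section \<open>The fooling test function\<close>

text \<open>A product weight: its integrability reduces to that of \<open>1 / (1 + t^2)\<close> on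
  the line.\<close>

definition decay_weight :: "real ^ 'd::finite \<Rightarrow> real"
  where "decay_weight y = (\<Prod>i\<in>UNIV. inverse (1 + (y $ i)\<^sup>2))"

lemma decay_weight_pos: "decay_weight y > 0"
  unfolding decay_weight_def by (intro prod_pos) (auto simp: add_pos_nonneg)

lemma decay_weight_borel [measurable]: "(decay_weight :: real ^ 'd::finite \<Rightarrow> real) \<in> borel_measurable borel"
  unfolding decay_weight_def[abs_def] by measurable

lemma integrable_decay_weight: "integrable lborel (decay_weight :: real ^ 'd::finite \<Rightarrow> real)"
proof -
  have "integrable lborel (\<lambda>t::real. inverse (1 + t\<^sup>2))"
    using integrable_inverse_1_plus_square by (simp add: set_integrable_def einterval_def)
  then have "integrable lborel (\<lambda>t::real. complex_of_real (inverse (1 + t\<^sup>2)))"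
    by (simp only: complex_of_real_integrable_eq)
  then have "integrable (lborel :: (real^'d) measure) (\<lambda>x. \<Prod>i\<in>UNIV. complex_of_real (inverse (1 + (x $ i)\<^sup>2)))"
    by (rule integrable_prod_coords)
  then show ?thesis
    unfolding decay_weight_def[abs_def] by (simp only: of_real_prod[symmetric] complex_of_real_integrable_eq)
qed

lemma decay_weight_integral_pos: "(\<integral>y. decay_weight (y :: real ^ 'd::finite) \<partial>lborel) > 0"
proof -
  have "(\<integral>y. decay_weight (y :: real ^ 'd) \<partial>lborel) \<noteq> 0"
  proof
    assume "(\<integral>y. decay_weight (y :: real ^ 'd) \<partial>lborel) = 0"
    moreover have nn: "AE y in (lborel :: (real^'d) measure). 0 \<le> decay_weight y"
      by (intro AE_I2 less_imp_le decay_weight_pos)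
    ultimately have "AE y in (lborel :: (real^'d) measure). decay_weight y = 0"
      by (simp only: integral_nonneg_eq_0_iff_AE[OF integrable_decay_weight nn])
    moreover have "AE y in (lborel :: (real^'d) measure). decay_weight y \<noteq> 0"
      by (intro AE_I2) (metis decay_weight_pos less_irrefl)
    ultimately have "AE y in (lborel :: (real^'d) measure). False" by eventually_elim auto
    then have "emeasure (lborel :: (real^'d) measure) UNIV = 0"
      by (subst (asm) AE_iff_measurable[of UNIV]) auto
    then show False by simp
  qed
  moreover have "(\<integral>y. decay_weight (y :: real ^ 'd) \<partial>lborel) \<ge> 0"
    by (intro Bochner_Integration.integral_nonneg less_imp_le decay_weight_pos)
  ultimately show ?thesis by simp
qed

text \<open>A bound for small and one for large \<open>norm y\<close> combine, since the product of
  the factors \<open>1 + (y $ i)^2\<close> is at most \<open>2 ^ d\<close> times the larger of 1 and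
  \<open>norm y ^ (2 * d)\<close>.\<close>

lemma le_decay_weight:
  fixes y :: "real ^ 'd::finite"
  assumes a: "0 \<le> a" "a \<le> b" "norm y ^ (2 * CARD('d)) * a \<le> b"
  shows "a \<le> b * (2 ^ CARD('d) * decay_weight y)"
proof -
  let ?P = "\<Prod>i\<in>(UNIV::'d set). 1 + (y $ i)\<^sup>2"
  have P: "?P > 0" by (intro prod_pos) (auto simp: add_pos_nonneg)
  have "?P \<le> (\<Prod>i\<in>(UNIV::'d set). 1 + (norm y)\<^sup>2)"
    by (intro prod_mono) (auto simp: abs_le_square_iff[symmetric] component_le_norm_cart)
  then have Pn: "?P \<le> (1 + (norm y)\<^sup>2) ^ CARD('d)" by simp
  have "a * ?P \<le> b * 2 ^ CARD('d)"
  proof (cases "norm y \<le> 1")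
    case True
    then have "(1 + (norm y)\<^sup>2) ^ CARD('d) \<le> 2 ^ CARD('d)"
      by (intro power_mono) (auto simp: abs_square_le_1)
    with Pn have "?P \<le> 2 ^ CARD('d)" by linarith
    then show ?thesis using a P by (intro mult_mono) auto
  next
    case False
    then have "1 \<le> (norm y)\<^sup>2" by (simp add: one_le_power)
    then have "(1 + (norm y)\<^sup>2) ^ CARD('d) \<le> (2 * (norm y)\<^sup>2) ^ CARD('d)"
      by (intro power_mono) auto
    also have "\<dots> = 2 ^ CARD('d) * norm y ^ (2 * CARD('d))" by (simp add: power_mult_distrib power_mult)
    finally have "a * ?P \<le> a * (2 ^ CARD('d) * norm y ^ (2 * CARD('d)))"
      using Pn a by (intro mult_left_mono) auto
    also have "\<dots> = 2 ^ CARD('d) * (norm y ^ (2 * CARD('d)) * a)" by simp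
    also have "\<dots> \<le> 2 ^ CARD('d) * b" using a by (intro mult_left_mono) auto
    finally show ?thesis by (simp add: mult.commute)
  qed
  moreover have "decay_weight y = inverse ?P" by (simp add: decay_weight_def prod_inversef[symmetric] comp_def)
  ultimately show ?thesis using P by (simp add: field_simps)
qed

text \<open>From \<open>x \<le> 1 + x^2 / 2 \<le> exp (x^2 / 2)\<close> with
  \<open>x = h * s\<close>. It absorbs the factor \<open>norm \<xi>\<close> that appears when the
  transform of the mollifier is replaced by 1.\<close>

lemma gauss_mult_le: "h > 0 \<Longrightarrow> exp (- (h\<^sup>2 * s\<^sup>2 / 2)) * s \<le> 1 / (h::real)"
proof -
  assume h: "h > 0"
  have "h * s \<le> 1 + (h * s)\<^sup>2 / 2" using sum_squares_ge_zero[of "h * s - 1" 0] by (simp add: power2_eq_square algebra_simps)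
  also have "\<dots> \<le> exp ((h * s)\<^sup>2 / 2)" by (rule exp_ge_add_one_self)
  finally have "exp (- ((h * s)\<^sup>2 / 2)) * (h * s) \<le> 1" by (simp add: exp_minus field_simps)
  then show ?thesis using h by (simp add: power_mult_distrib field_simps)
qed

lemma norm_cis_diff_1: "norm (cis x - 1) \<le> \<bar>x\<bar>"
  using iexp_approx1[of x 0] by (simp add: cis_conv_exp)

lemma ft_mollifier_close_1:
  assumes \<kappa>: "\<kappa> \<in> test_functions \<Omega>" "\<And>x. 0 \<le> \<kappa> x" "\<And>x. \<epsilon> < norm x \<Longrightarrow> \<kappa> x = 0"
    "(\<integral>x. \<kappa> x \<partial>lborel) = 1"
  shows "norm (ft (\<lambda>x. complex_of_real (\<kappa> x)) \<xi> - 1) \<le> \<epsilon> * norm \<xi>"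
proof -
  have i: "integrable lborel (\<lambda>x. complex_of_real (\<kappa> x))"
    by (rule test_functions_integrable[OF test_functions_of_real[OF \<kappa>(1)]])
  have i2: "integrable lborel (\<lambda>x. complex_of_real (\<kappa> x) * cis (x \<bullet> \<xi>))"
    by (rule integrable_mult_cis[OF i]) simp
  have "ft (\<lambda>x. complex_of_real (\<kappa> x)) \<xi> - 1 = (\<integral>x. complex_of_real (\<kappa> x) * cis (x \<bullet> \<xi>) \<partial>lborel) - (\<integral>x. complex_of_real (\<kappa> x) \<partial>lborel)"
    unfolding integral_complex_of_real \<kappa>(4) by (simp add: ft_def)
  also have "\<dots> = (\<integral>x. complex_of_real (\<kappa> x) * (cis (x \<bullet> \<xi>) - 1) \<partial>lborel)"
    by (subst Bochner_Integration.integral_diff[OF i2 i, symmetric]) (simp add: algebra_simps)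
  also have "norm \<dots> \<le> (\<integral>x. \<kappa> x * (\<epsilon> * norm \<xi>) \<partial>lborel)"
  proof (rule order_trans[OF integral_norm_bound], rule integral_mono)
    show "integrable lborel (\<lambda>x. norm (complex_of_real (\<kappa> x) * (cis (x \<bullet> \<xi>) - 1)))"
      using Bochner_Integration.integrable_diff[OF i2 i] by (intro integrable_norm) (simp add: algebra_simps)
    show "integrable lborel (\<lambda>x. \<kappa> x * (\<epsilon> * norm \<xi>))"
      by (intro integrable_mult_left test_functions_integrable[OF \<kappa>(1)])
    fix x
    show "norm (complex_of_real (\<kappa> x) * (cis (x \<bullet> \<xi>) - 1)) \<le> \<kappa> x * (\<epsilon> * norm \<xi>)"
    proof (cases "norm x \<le> \<epsilon>")
      case True
      have "norm (cis (x \<bullet> \<xi>) - 1) \<le> norm x * norm \<xi>"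
        using norm_cis_diff_1[of "x \<bullet> \<xi>"] Cauchy_Schwarz_ineq2[of x \<xi>] by linarith
      also have "\<dots> \<le> \<epsilon> * norm \<xi>" using True by (intro mult_right_mono) auto
      finally show ?thesis using \<kappa>(2)[of x] by (simp add: norm_mult mult_left_mono)
    qed (use \<kappa>(3)[of x] in simp)
  qed
  also have "\<dots> = \<epsilon> * norm \<xi>" by (simp add: \<kappa>(4))
  finally show ?thesis .
qed

lemma ft_replicate_deriv:
  assumes \<phi>: "\<phi> \<in> test_functions \<Omega>"
  shows "ft (iter_deriv (replicate m i) \<phi>) \<xi> = (- \<i> * complex_of_real (\<xi> $ i)) ^ m * ft \<phi> \<xi>"
proof (induction m)
  case (Suc m)
  with ft_partial_deriv[OF test_functions_iter_deriv[OF \<phi>, of "replicate m i"], of i \<xi>]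
  show ?case by (simp add: mult_ac)
qed simp

lemma iter_deriv_of_real:
  assumes "smooth_fun \<psi>"
  shows "iter_deriv is (\<lambda>x. complex_of_real (\<psi> x)) = (\<lambda>x. complex_of_real (iter_deriv is \<psi> x))"
proof (induction "is")
  case (Cons i "is")
  show ?case unfolding iter_deriv.simps Cons
    by (rule ext, rule partial_deriv_comp_linear[OF bounded_linear_of_real smooth_fun_differentiable[OF smooth_fun_iter_deriv[OF assms]]])
qed simp

lemma ft_replicate_deriv_of_real:
  fixes \<psi> :: "real ^ 'd::finite \<Rightarrow> real"
  assumes \<psi>: "\<psi> \<in> test_functions \<Omega>"
  shows "ft (\<lambda>x. complex_of_real (iter_deriv (replicate m i) \<psi> x)) \<xi> = (- \<i> * complex_of_real (\<xi> $ i)) ^ m * ft (\<lambda>x. complex_of_real (\<psi> x)) \<xi>"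
  using ft_replicate_deriv[OF test_functions_of_real[OF \<psi>, where 'b = complex], of m i \<xi>]
  by (simp only: iter_deriv_of_real[OF test_functions_smooth[OF \<psi>]])

lemma hom_poly_coord_power: "hom_poly m (\<lambda>x. (x $ i) ^ m)"
proof (induction m)
  case (Suc m)
  then show ?case using hom_poly_coord[OF Suc, of i] by simp
qed (simp add: hom_poly_const)

text \<open>Pigeonhole over the coordinates: on the shell some coordinate is at least \<open>d\<^bsup>-1/2\<^esup>\<close>.\<close>

lemma coordinate_moment:
  fixes P :: "real ^ 'd::finite \<Rightarrow> real"
  assumes P: "hom_poly k P" "\<And>y. 0 \<le> P y"
  shows "\<exists>i. (\<integral>y. indicator shell y * (P y / norm y ^ M) \<partial>lborel) / real CARD('d) ^ (m + 1)
      \<le> (\<integral>y. indicator shell y * ((y $ i) ^ (2 * m) * P y / norm y ^ M) \<partial>lborel)"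
proof (rule ccontr)
  let ?J = "\<lambda>i. \<integral>y. indicator shell y * ((y $ i) ^ (2 * m) * P y / norm y ^ M) \<partial>lborel"
  let ?I = "\<integral>y. indicator shell y * (P y / norm y ^ M) \<partial>lborel"
  let ?d = "real CARD('d)"
  have d: "?d > 0" by simp
  assume "\<not> ?thesis"
  \<comment> \<open>The exponent \<open>m + 1\<close> has two sources: the sum of the
    \<open>(y $ i) ^ (2 * m)\<close> is at least \<open>1 / d ^ m\<close> on the shell, and the best
    of \<open>d\<close> coordinates gets a share of at least \<open>1 / d\<close>.\<close>
  then have "?J i < ?I / ?d ^ (m + 1)" for i by (simp add: not_le)
  then have "(\<Sum>i\<in>UNIV. ?J i) < (\<Sum>i\<in>(UNIV::'d set). ?I / ?d ^ (m + 1))"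
    by (intro sum_strict_mono) auto
  also have "\<dots> = ?I / ?d ^ m" by simp
  finally have lt: "(\<Sum>i\<in>UNIV. ?J i) < ?I / ?d ^ m" .
  have int: "integrable lborel (\<lambda>y. indicator shell y * ((y $ i) ^ (2 * m) * P y / norm y ^ M))" for i
    by (rule integrable_ip[OF hom_poly_coord_power P(1)])
  have intP: "integrable lborel (\<lambda>y. indicator shell y * (P y / norm y ^ M))"
    by (intro integrable_shell continuous_on_shell_div hom_poly_continuous[OF P(1)])
  have "?I / ?d ^ m = (\<integral>y. indicator shell y * (P y / norm y ^ M) / ?d ^ m \<partial>lborel)"
    by (rule integral_divide_zero[symmetric])
  also have "\<dots> \<le> (\<integral>y. (\<Sum>i\<in>UNIV. indicator shell y * ((y $ i) ^ (2 * m) * P y / norm y ^ M)) \<partial>lborel)"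
  proof (rule integral_mono)
    show "integrable lborel (\<lambda>y. indicator shell y * (P y / norm y ^ M) / ?d ^ m)"
      using intP by (intro integrable_divide)
    show "integrable lborel (\<lambda>y. \<Sum>i\<in>UNIV. indicator shell y * ((y $ i) ^ (2 * m) * P y / norm y ^ M))"
      by (intro Bochner_Integration.integrable_sum int)
    fix y :: "real^'d"
    show "indicator shell y * (P y / norm y ^ M) / ?d ^ m \<le> (\<Sum>i\<in>UNIV. indicator shell y * ((y $ i) ^ (2 * m) * P y / norm y ^ M))"
    proof (cases "y \<in> shell")
      case True
      then have "1 \<le> (norm y)\<^sup>2" by (simp add: shell_iff one_le_power)
      also have "(norm y)\<^sup>2 = (\<Sum>i\<in>UNIV. (y $ i)\<^sup>2)"
        unfolding power2_norm_eq_inner inner_vec_def by (simp add: power2_eq_square)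
      finally have s: "1 \<le> (\<Sum>i\<in>UNIV. (y $ i)\<^sup>2)" .
      have "\<exists>i. 1 / ?d \<le> (y $ i)\<^sup>2"
      proof (rule ccontr)
        assume "\<nexists>i. 1 / ?d \<le> (y $ i)\<^sup>2"
        then have "(\<Sum>i\<in>UNIV. (y $ i)\<^sup>2) < (\<Sum>i\<in>(UNIV::'d set). 1 / ?d)"
          by (intro sum_strict_mono) (auto simp: not_le)
        with s show False by simp
      qed
      then obtain i where "1 / ?d \<le> (y $ i)\<^sup>2" by blast
      then have "(1 / ?d) ^ m \<le> ((y $ i)\<^sup>2) ^ m" by (intro power_mono) auto
      also have "\<dots> = (y $ i) ^ (2 * m)" by (simp add: power_mult)
      also have "\<dots> \<le> (\<Sum>i\<in>UNIV. (y $ i) ^ (2 * m))" by (rule member_le_sum) auto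
      finally have "(P y / norm y ^ M) * (1 / ?d) ^ m \<le> (P y / norm y ^ M) * (\<Sum>i\<in>UNIV. (y $ i) ^ (2 * m))"
        using P(2)[of y] by (intro mult_left_mono) auto
      with True show ?thesis by (simp add: sum_distrib_left power_divide mult_ac)
    qed simp
  qed
  also have "\<dots> = (\<Sum>i\<in>UNIV. ?J i)" by (rule Bochner_Integration.integral_sum[OF int])
  finally show False using lt by simp
qed


text \<open>On the frequency side \<open>\<psi>\<close> is \<open>\<xi>_i ^ m * P * mh\<close>, up
  to a unimodular constant and the transform of a fine mollifier. With
  \<open>R = \<beta> * N\<close>, its \<open>L^2\<close> norm is at most of order
  \<open>I * R powr (2N + m + d/2)\<close>, while the pairing is at least of order
  \<open>N powr (- d) * I * R ^ (2N + 2m + d)\<close>. The level \<open>I\<close>, about which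
  nothing but positivity is known, and the power \<open>R ^ (2N)\<close> cancel in the quotient,
  which leaves \<open>N powr (m - d/2)\<close>.\<close>

lemma fooling_test_function:
  fixes m :: nat
  assumes d: "CARD('d::finite) \<ge> 2" and \<rho>: "\<rho> > 0"
  shows "\<exists>c>0. \<exists>K0. \<forall>K\<ge>K0. \<forall>n. \<forall>\<omega> :: nat \<Rightarrow> real ^ 'd. 2 * n \<le> (K + 1) ^ (CARD('d) - 1) \<longrightarrow>
    (\<exists>i \<psi> S. \<psi> \<in> test_functions (cball 0 \<rho>) \<and> S > 0 \<and> (\<integral>x. (\<psi> x)\<^sup>2 \<partial>lborel) \<le> S\<^sup>2 \<and>
      (\<forall>r<n. \<forall>\<tau>::real. ft (\<lambda>x. complex_of_real (\<psi> x)) (\<tau> *\<^sub>R \<omega> r) = 0) \<and>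
      c * real (K * (CARD('d) - 1)) powr (real m - real CARD('d) / 2) * S \<le>
        \<bar>\<integral>x. exp (- ((norm x)\<^sup>2 * (real (K * (CARD('d) - 1)))\<^sup>2 / 2)) * iter_deriv (replicate m i) \<psi> x \<partial>lborel\<bar>)"
proof -
  let ?d = "CARD('d)"
  \<comment> \<open>The decay asked of the measure: \<open>2 * m\<close> for the powers of a
    coordinate and \<open>2 * d\<close> for domination by \<open>decay_weight\<close>.\<close>
  define B where "B = 2 * m + 2 * ?d"
  obtain \<beta> C where \<beta>: "\<beta> > 0" and C: "C > 0" and meas: "\<forall>N\<ge>max 1 B. \<exists>(M :: (real ^ 'd) measure) mh I.
    finite_measure M \<and> sets M = sets borel \<and> (AE y in M. norm y \<le> \<rho> / 2) \<and> I > 0 \<and>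
    (\<forall>\<xi>. (\<integral>y. cis (y \<bullet> \<xi>) \<partial>M) = complex_of_real (mh \<xi>)) \<and> (\<forall>\<xi>. 0 \<le> mh \<xi>) \<and>
    (\<forall>\<xi>. \<beta> * N \<le> norm \<xi> \<and> norm \<xi> \<le> 2 * (\<beta> * N) \<longrightarrow> I \<le> (norm \<xi> / (\<beta> * N)) ^ (2 * N) * mh \<xi>) \<and>
    (\<forall>\<xi>. (norm \<xi> / (\<beta> * N)) ^ (2 * N) * mh \<xi> \<le> C * I) \<and>
    (\<forall>\<xi>. (norm \<xi> / (\<beta> * N)) ^ B * ((norm \<xi> / (\<beta> * N)) ^ (2 * N) * mh \<xi>) \<le> C * I)"
  proof -
    have "\<rho> / 2 > 0" using \<rho> by simp
    from radial_measure[OF this, where B = B and 'd = 'd] show ?thesis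
      by (elim exE conjE) (rule that)
  qed
  define vol where "vol = measure lborel (shell :: (real^'d) set)"
  have vol: "vol > 0" unfolding vol_def by (rule shell_volume_pos)
  define Wc where "Wc = (\<integral>y. decay_weight (y :: real ^ 'd) \<partial>lborel)"
  have Wc: "Wc > 0" unfolding Wc_def by (rule decay_weight_integral_pos)
  \<comment> \<open>For radii between \<open>R\<close> and \<open>2 * R\<close>,
    \<open>h * norm \<xi> \<le> 2 * \<beta>\<close>, so the Gaussian is at least
    \<open>exp (- (2 * \<beta>^2))\<close>; the other factor is the mean of \<open>P\<close> after
    the choice of a coordinate.\<close>
  define c2 where "c2 = exp (- (2 * \<beta>\<^sup>2)) * (vol / 2 / real ?d ^ (m + 1))"
  have c2: "c2 > 0" using vol by (simp add: c2_def)
  \<comment> \<open>Chosen to make the final comparison of the pairing bound with \<open>S\<close>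
    an identity.\<close>
  define c where "c = sqrt (c2\<^sup>2 * \<beta> ^ (2 * m + ?d) / (4 * C\<^sup>2 * 2 ^ ?d * Wc))"
  have c: "c > 0" using c2 \<beta> C Wc by (simp add: c_def)
  have csq: "c\<^sup>2 = c2\<^sup>2 * \<beta> ^ (2 * m + ?d) / (4 * C\<^sup>2 * 2 ^ ?d * Wc)"
    unfolding c_def using \<beta> Wc by (intro real_sqrt_pow2) auto
  \<comment> \<open>Ensures \<open>N \<ge> K \<ge> max 1 B\<close>, the range in which the radial
    measure is available.\<close>
  define K0 where "K0 = max 1 B"
  have "\<exists>i \<psi> S. \<psi> \<in> test_functions (cball 0 \<rho>) \<and> S > 0 \<and> (\<integral>x. (\<psi> x)\<^sup>2 \<partial>lborel) \<le> S\<^sup>2 \<and>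
      (\<forall>r<n. \<forall>\<tau>::real. ft (\<lambda>x. complex_of_real (\<psi> x)) (\<tau> *\<^sub>R \<omega> r) = 0) \<and>
      c * real (K * (?d - 1)) powr (real m - real ?d / 2) * S \<le>
        \<bar>\<integral>x. exp (- ((norm x)\<^sup>2 * (real (K * (?d - 1)))\<^sup>2 / 2)) * iter_deriv (replicate m i) \<psi> x \<partial>lborel\<bar>"
    if K: "K \<ge> K0" and n: "2 * n \<le> (K + 1) ^ (?d - 1)" for K n and \<omega> :: "nat \<Rightarrow> real ^ 'd"
  proof -
    define N where "N = K * (?d - 1)"
    have K1: "K \<ge> 1" using K by (simp add: K0_def)
    have "K * 1 \<le> K * (?d - 1)" using d by (intro mult_le_mono2) auto
    then have NK: "N \<ge> K" by (simp add: N_def)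
    then have NB: "N \<ge> max 1 B" using K by (simp add: K0_def)
    have N1: "N \<ge> 1" using NB by simp
    define R where "R = \<beta> * real N"
    have R: "R > 0" using \<beta> N1 by (simp add: R_def)
    define h where "h = 1 / real N"
    have h: "h > 0" using N1 by (simp add: h_def)
    obtain P where P: "hom_poly (2 * N) P" "\<And>r. r < n \<Longrightarrow> P (\<omega> r) = 0"
      "\<And>y. 0 \<le> P y" "\<And>y. P y \<le> norm y ^ (2 * N)"
      "vol / 2 \<le> (\<integral>y. indicator shell y * (P y / norm y ^ (2 * N)) \<partial>lborel)"
      using fooling_polynomial[OF d K1 n, of \<omega>] unfolding N_def vol_def by blast
    obtain M :: "(real ^ 'd) measure" and mh I where M: "finite_measure M" "sets M = sets borel"
      "AE y in M. norm y \<le> \<rho> / 2" and I: "I > 0"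
      and mh: "\<And>\<xi>. (\<integral>y. cis (y \<bullet> \<xi>) \<partial>M) = complex_of_real (mh \<xi>)" "\<And>\<xi>. 0 \<le> mh \<xi>"
        "\<And>\<xi>. R \<le> norm \<xi> \<Longrightarrow> norm \<xi> \<le> 2 * R \<Longrightarrow> I \<le> (norm \<xi> / R) ^ (2 * N) * mh \<xi>"
        "\<And>\<xi>. (norm \<xi> / R) ^ (2 * N) * mh \<xi> \<le> C * I"
        "\<And>\<xi>. (norm \<xi> / R) ^ B * ((norm \<xi> / R) ^ (2 * N) * mh \<xi>) \<le> C * I"
      using meas[rule_format, OF NB] unfolding R_def by (elim exE conjE) blast
    have [measurable_cong]: "sets M = sets borel" by fact
    interpret finite_measure M by fact
    have mhb [measurable]: "mh \<in> borel_measurable borel"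
    proof -
      have "mh = (\<lambda>\<xi>. Re (\<integral>y. cis (y \<bullet> \<xi>) \<partial>M))" by (simp add: mh(1))
      then show ?thesis by simp
    qed
    note [measurable] = hom_poly_borel[OF P(1)]
    obtain i where i: "vol / 2 / real ?d ^ (m + 1) \<le> (\<integral>y. indicator shell y * ((y $ i) ^ (2 * m) * P y / norm y ^ (2 * N)) \<partial>lborel)"
      using coordinate_moment[OF P(1,3), of "2 * N" m] P(5)
      by (meson divide_right_mono order_trans of_nat_0_le_iff zero_le_power)
    \<comment> \<open>The transform of the measure compensated by the growth of \<open>P\<close>: at
      least \<open>I\<close> for radii between \<open>R\<close> and \<open>2 * R\<close>, and at
      most \<open>C * I\<close> everywhere, even after multiplication by powers of
      \<open>norm \<xi> / R\<close> up to \<open>B\<close>.\<close>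
    define v where "v \<xi> = (norm \<xi> / R) ^ (2 * N) * mh \<xi>" for \<xi>
    have v0: "0 \<le> v \<xi>" for \<xi> using mh(2) R by (simp add: v_def)
    have v_le: "(norm \<xi> / R) ^ k * v \<xi> \<le> C * I" if "k \<le> B" for \<xi> k
    proof (cases "norm \<xi> / R \<le> 1")
      case True
      then have "(norm \<xi> / R) ^ k * v \<xi> \<le> 1 * v \<xi>" using R v0 by (intro mult_right_mono power_le_one) auto
      then show ?thesis using mh(4)[of \<xi>] by (simp add: v_def)
    next
      case False
      then have "(norm \<xi> / R) ^ k * v \<xi> \<le> (norm \<xi> / R) ^ B * v \<xi>" using v0 that by (intro mult_right_mono power_increasing) auto
      then show ?thesis using mh(5)[of \<xi>] by (simp add: v_def)
    qed
    define y where "y \<xi> = (1 / R) *\<^sub>R \<xi>" for \<xi> :: "real^'d"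
    have ny: "norm (y \<xi>) = norm \<xi> / R" for \<xi> using R by (simp add: y_def)
    \<comment> \<open>\<open>W1\<close> controls the integrand of the pairing and \<open>W2\<close>
      the squared transform of \<open>\<psi>\<close>; both bounds are integrable in
      \<open>\<xi>\<close>, with an integral of order \<open>R ^ d\<close>.\<close>
    have W1: "(norm \<xi> / R) ^ (2 * m) * v \<xi> \<le> C * I * (2 ^ ?d * decay_weight (y \<xi>))" for \<xi>
    proof (rule le_decay_weight)
      show "0 \<le> (norm \<xi> / R) ^ (2 * m) * v \<xi>" using v0 R by simp
      show "(norm \<xi> / R) ^ (2 * m) * v \<xi> \<le> C * I" by (rule v_le) (simp add: B_def)
      show "norm (y \<xi>) ^ (2 * ?d) * ((norm \<xi> / R) ^ (2 * m) * v \<xi>) \<le> C * I"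
        using v_le[of "2 * ?d + 2 * m" \<xi>] by (simp add: ny power_add B_def mult.assoc)
    qed
    have W2: "(norm \<xi> / R) ^ (2 * m) * (v \<xi>)\<^sup>2 \<le> (C * I)\<^sup>2 * (2 ^ ?d * decay_weight (y \<xi>))" for \<xi>
    proof (rule le_decay_weight)
      have sq: "((norm \<xi> / R) ^ k * v \<xi>)\<^sup>2 \<le> (C * I)\<^sup>2" if "k \<le> B" for k
        using v_le[OF that] v0 R by (intro power_mono) auto
      show "0 \<le> (norm \<xi> / R) ^ (2 * m) * (v \<xi>)\<^sup>2" using R by simp
      show "(norm \<xi> / R) ^ (2 * m) * (v \<xi>)\<^sup>2 \<le> (C * I)\<^sup>2"
        using sq[of m] by (simp add: B_def power_mult_distrib power_mult[symmetric] mult.commute)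
      have "norm (y \<xi>) ^ (2 * ?d) * ((norm \<xi> / R) ^ (2 * m) * (v \<xi>)\<^sup>2) = ((norm \<xi> / R) ^ (?d + m) * v \<xi>)\<^sup>2"
        by (simp add: ny power_mult_distrib power_add power_mult[symmetric] mult_ac)
      also have "\<dots> \<le> (C * I)\<^sup>2" by (rule sq) (simp add: B_def)
      finally show "norm (y \<xi>) ^ (2 * ?d) * ((norm \<xi> / R) ^ (2 * m) * (v \<xi>)\<^sup>2) \<le> (C * I)\<^sup>2" .
    qed
    have Wy: "integrable lborel (\<lambda>\<xi>. decay_weight (y \<xi>))" "(\<integral>\<xi>. decay_weight (y \<xi>) \<partial>lborel) = R ^ ?d * Wc"
    proof -
      have R': "1 / R > 0" using R by simp
      show "integrable lborel (\<lambda>\<xi>. decay_weight (y \<xi>))"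
        unfolding y_def using integrable_affine_lborel[OF decay_weight_borel[where 'd = 'd] R', of 0] integrable_decay_weight[where 'd = 'd] by simp
      have "Wc = (1 / R) ^ ?d * (\<integral>\<xi>. decay_weight (y \<xi>) \<partial>lborel)"
        unfolding Wc_def y_def using integral_affine_lborel[OF decay_weight_borel[where 'd = 'd] R', of 0] by simp
      then show "(\<integral>\<xi>. decay_weight (y \<xi>) \<partial>lborel) = R ^ ?d * Wc" using R by (simp add: power_divide)
    qed
    have coord: "\<bar>\<xi> $ i\<bar> ^ k \<le> norm \<xi> ^ k" for \<xi> :: "real^'d" and k
      by (intro power_mono component_le_norm_cart) auto
    have sc: "norm \<xi> ^ k = R ^ k * (norm \<xi> / R) ^ k" for \<xi> :: "real^'d" and k
      using R by (simp add: power_divide)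
    define F where "F \<xi> = (\<xi> $ i) ^ (2 * m) * P \<xi> * mh \<xi>" for \<xi>
    have [measurable]: "F \<in> borel_measurable borel" unfolding F_def by measurable
    have F0: "0 \<le> F \<xi>" for \<xi> unfolding F_def using P(3) mh(2) by (intro mult_nonneg_nonneg) auto
    have FW: "F \<xi> \<le> R ^ (2 * m + 2 * N) * (C * I * (2 ^ ?d * decay_weight (y \<xi>)))" for \<xi>
    proof -
      have "(\<xi> $ i) ^ (2 * m) \<le> norm \<xi> ^ (2 * m)" using coord[of \<xi> "2 * m"] by (simp add: power_even_abs)
      then have "F \<xi> \<le> norm \<xi> ^ (2 * m) * norm \<xi> ^ (2 * N) * mh \<xi>"
        unfolding F_def using P(3,4) mh(2) by (intro mult_mono mult_right_mono) auto
      also have "\<dots> = R ^ (2 * m + 2 * N) * ((norm \<xi> / R) ^ (2 * m) * v \<xi>)"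
        unfolding sc[of \<xi> "2 * m"] sc[of \<xi> "2 * N"] v_def by (simp add: power_add mult_ac)
      also have "\<dots> \<le> R ^ (2 * m + 2 * N) * (C * I * (2 ^ ?d * decay_weight (y \<xi>)))"
        using R by (intro mult_left_mono W1) auto
      finally show ?thesis .
    qed
    have Fint: "integrable lborel F"
      by (rule Bochner_Integration.integrable_bound[where f = "\<lambda>\<xi>. R ^ (2 * m + 2 * N) * (C * I * (2 ^ ?d * decay_weight (y \<xi>)))"])
        (use Wy(1) FW F0 in \<open>auto simp: abs_of_nonneg intro!: AE_I2 order_trans[OF FW abs_ge_self]\<close>)
    define E where "E \<xi> = exp (- (h\<^sup>2 * (norm \<xi>)\<^sup>2 / 2))" for \<xi> :: "real^'d"
    have E: "0 < E \<xi>" "E \<xi> \<le> 1" for \<xi> by (auto simp: E_def)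
    have [measurable]: "E \<in> borel_measurable borel" unfolding E_def by measurable
    have EF: "integrable lborel (\<lambda>\<xi>. E \<xi> * F \<xi>)"
      by (rule Bochner_Integration.integrable_bound[OF Fint])
        (use E F0 in \<open>auto simp: abs_mult abs_of_nonneg less_imp_le intro!: AE_I2 mult_left_le_one_le\<close>)
    \<comment> \<open>The lower bound for the pairing before mollification: level \<open>I\<close>,
      homogeneity \<open>2N + 2m\<close>, and \<open>R ^ d\<close> for the volume of the dilated
      shell.\<close>
    define A where "A = c2 * I * R ^ (2 * N + 2 * m + ?d)"
    have A0: "A > 0" using c2 I R by (simp add: A_def)
    have A: "A \<le> (\<integral>\<xi>. E \<xi> * F \<xi> \<partial>lborel)"
    proof -
      let ?G = "\<lambda>y. indicator shell y * ((y $ i) ^ (2 * m) * P y / norm y ^ (2 * N))"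
      have Gint: "integrable lborel ?G" by (rule integrable_ip[OF hom_poly_coord_power P(1)])
      have "A = (exp (- (2 * \<beta>\<^sup>2)) * I * R ^ (2 * N + 2 * m)) * (R ^ ?d * (vol / 2 / real ?d ^ (m + 1)))"
        unfolding A_def c2_def by (simp add: power_add)
      also have "\<dots> \<le> (exp (- (2 * \<beta>\<^sup>2)) * I * R ^ (2 * N + 2 * m)) * (R ^ ?d * (\<integral>y. ?G y \<partial>lborel))"
        using i I R by (intro mult_left_mono) auto
      also have "R ^ ?d * (\<integral>y. ?G y \<partial>lborel) = (\<integral>\<xi>. ?G (y \<xi>) \<partial>lborel)"
      proof -
        have R': "1 / R > 0" using R by simp
        have "?G \<in> borel_measurable borel" by measurable
        from integral_affine_lborel[OF this R', of 0] show ?thesis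
          using R by (simp add: y_def power_divide)
      qed
      also have "exp (- (2 * \<beta>\<^sup>2)) * I * R ^ (2 * N + 2 * m) * (\<integral>\<xi>. ?G (y \<xi>) \<partial>lborel) =
          (\<integral>\<xi>. exp (- (2 * \<beta>\<^sup>2)) * I * R ^ (2 * N + 2 * m) * ?G (y \<xi>) \<partial>lborel)"
        by (rule integral_mult_right_zero[symmetric])
      also have "\<dots> \<le> (\<integral>\<xi>. E \<xi> * F \<xi> \<partial>lborel)"
      proof (rule integral_mono[OF _ EF])
        have R': "1 / R > 0" using R by simp
        have "integrable lborel (\<lambda>\<xi>. ?G (0 + (1 / R) *\<^sub>R \<xi>))"
          using integrable_affine_lborel[OF _ R', of ?G 0] Gint by auto
        then have "integrable lborel (\<lambda>\<xi>. ?G (y \<xi>))" by (simp only: y_def add_0)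
        then show "integrable lborel (\<lambda>\<xi>. exp (- (2 * \<beta>\<^sup>2)) * I * R ^ (2 * N + 2 * m) * ?G (y \<xi>))"
          by (rule integrable_mult_right)
        fix \<xi> :: "real^'d"
        show "exp (- (2 * \<beta>\<^sup>2)) * I * R ^ (2 * N + 2 * m) * ?G (y \<xi>) \<le> E \<xi> * F \<xi>"
        proof (cases "y \<xi> \<in> shell")
          case False
          then show ?thesis using E(1)[of \<xi>] F0[of \<xi>] by simp
        next
          case True
          then have r: "R \<le> norm \<xi>" "norm \<xi> \<le> 2 * R"
            using R by (auto simp: shell_iff ny pos_le_divide_eq pos_divide_le_eq)
          have nz: "norm \<xi> > 0" using r(1) R by linarith
          have "h * norm \<xi> \<le> h * (2 * R)" using r(2) h by (intro mult_left_mono) auto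
          also have "h * (2 * R) = 2 * \<beta>" using N1 by (simp add: h_def R_def)
          finally have "(h * norm \<xi>)\<^sup>2 \<le> (2 * \<beta>)\<^sup>2" using h by (intro power_mono) auto
          then have e: "exp (- (2 * \<beta>\<^sup>2)) \<le> E \<xi>" by (simp add: E_def power_mult_distrib)
          have "P (y \<xi>) = (1 / R) ^ (2 * N) * P \<xi>" unfolding y_def by (rule hom_poly_scale[OF P(1)])
          then have G: "?G (y \<xi>) = (1 / R) ^ (2 * m) * ((\<xi> $ i) ^ (2 * m) * P \<xi>) / norm \<xi> ^ (2 * N)"
            using True R nz by (simp add: ny power_divide) (simp add: y_def power_divide)
          have "I * R ^ (2 * N + 2 * m) * ?G (y \<xi>) = ((\<xi> $ i) ^ (2 * m) * P \<xi>) * (I * (R / norm \<xi>) ^ (2 * N))"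
            unfolding G using R by (simp add: power_add power_divide)
          also have "\<dots> \<le> ((\<xi> $ i) ^ (2 * m) * P \<xi>) * mh \<xi>"
          proof (rule mult_left_mono)
            have "I * (R / norm \<xi>) ^ (2 * N) \<le> ((norm \<xi> / R) ^ (2 * N) * mh \<xi>) * (R / norm \<xi>) ^ (2 * N)"
              using mh(3)[OF r] R by (intro mult_right_mono) auto
            also have "\<dots> = mh \<xi>" using R nz by (simp add: power_divide)
            finally show "I * (R / norm \<xi>) ^ (2 * N) \<le> mh \<xi>" .
            show "0 \<le> (\<xi> $ i) ^ (2 * m) * P \<xi>" using P(3) by (intro mult_nonneg_nonneg) auto
          qed
          finally have "I * R ^ (2 * N + 2 * m) * ?G (y \<xi>) \<le> F \<xi>" by (simp add: F_def)
          then have "exp (- (2 * \<beta>\<^sup>2)) * (I * R ^ (2 * N + 2 * m) * ?G (y \<xi>)) \<le> E \<xi> * F \<xi>"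
            using e E(1)[of \<xi>] I R P(3) by (intro mult_mono) (auto simp: indicator_def)
          then show ?thesis by (simp only: mult.assoc)
        qed
      qed
      finally show ?thesis .
    qed
    let ?IF = "\<integral>\<xi>. F \<xi> \<partial>lborel"
    have IF: "0 \<le> ?IF" using F0 by (intro Bochner_Integration.integral_nonneg) auto
    \<comment> \<open>Replacing the transform of the mollifier by 1 costs at most
      \<open>(\<epsilon> / h) * ?IF\<close>, which this choice keeps below \<open>A / 2\<close>; the
      \<open>+ 1\<close> avoids a division by 0, and \<open>\<rho> / 2\<close> leaves room for the
      support.\<close>
    define \<epsilon> where "\<epsilon> = min (\<rho> / 2) (A * h / (2 * (?IF + 1)))"
    have \<epsilon>: "\<epsilon> > 0" "\<epsilon> \<le> \<rho> / 2" "\<epsilon> \<le> A * h / (2 * (?IF + 1))"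
    proof -
      have "A * h / (2 * (?IF + 1)) > 0" using A0 h IF by (intro divide_pos_pos mult_pos_pos) auto
      then show "\<epsilon> > 0" using \<rho> unfolding \<epsilon>_def by linarith
      show "\<epsilon> \<le> \<rho> / 2" "\<epsilon> \<le> A * h / (2 * (?IF + 1))" unfolding \<epsilon>_def by linarith+
    qed
    obtain \<kappa> :: "real ^ 'd \<Rightarrow> real" where \<kappa>: "\<kappa> \<in> test_functions (cball 0 \<epsilon>)" "\<And>x. 0 \<le> \<kappa> x"
      "\<And>x. \<epsilon> < norm x \<Longrightarrow> \<kappa> x = 0" "(\<integral>x. \<kappa> x \<partial>lborel) = 1"
      using mollifier_exists[OF \<epsilon>(1)] by blast
    have \<kappa>U: "\<kappa> \<in> test_functions UNIV" using \<kappa>(1) by (rule test_functions_mono) simp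
    define kh where "kh = ft (\<lambda>x. complex_of_real (\<kappa> x))"
    have [measurable]: "kh \<in> borel_measurable borel" unfolding kh_def using test_functions_borel[OF \<kappa>U] by simp
    have kh1: "norm (kh \<xi>) \<le> 1" for \<xi>
      using norm_ft_le[of "\<lambda>x. complex_of_real (\<kappa> x)" \<xi>] \<kappa>(2,4) by (simp add: kh_def abs_of_nonneg)
    have khc: "norm (kh \<xi> - 1) \<le> \<epsilon> * norm \<xi>" for \<xi>
      unfolding kh_def by (rule ft_mollifier_close_1[OF \<kappa>])
    define ph where "ph = smear M \<kappa>"
    have ph: "ph \<in> test_functions (cball 0 \<rho>)"
      unfolding ph_def
      by (rule test_functions_mono[OF test_functions_smear[OF M \<kappa>U \<kappa>(3)]]) (use \<epsilon>(2) in auto)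
    obtain \<psi> where \<psi>: "\<psi> \<in> test_functions (cball 0 \<rho>)" "\<And>\<xi>. ft (\<lambda>x. complex_of_real (\<psi> x)) \<xi> =
      (- \<i>) ^ (m + 2 * N) * complex_of_real ((\<xi> $ i) ^ m * P \<xi>) * ft (\<lambda>x. complex_of_real (ph x)) \<xi>"
      using hom_poly_multiplier[OF hom_poly_mult[OF hom_poly_coord_power[of m i] P(1)] ph] by blast
    have fph: "ft (\<lambda>x. complex_of_real (ph x)) \<xi> = kh \<xi> * complex_of_real (mh \<xi>)" for \<xi>
      unfolding ph_def ft_smear[OF M(1,2) \<kappa>U] mh(1) kh_def ..
    have nps: "(norm (ft (\<lambda>x. complex_of_real (\<psi> x)) \<xi>))\<^sup>2 \<le> R ^ (4 * N + 2 * m) * ((C * I)\<^sup>2 * (2 ^ ?d * decay_weight (y \<xi>)))" for \<xi>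
    proof -
      have "norm (ft (\<lambda>x. complex_of_real (\<psi> x)) \<xi>) = \<bar>\<xi> $ i\<bar> ^ m * P \<xi> * (norm (kh \<xi>) * mh \<xi>)"
        unfolding \<psi>(2) fph using P(3) mh(2) by (simp add: norm_mult norm_power abs_mult power_abs)
      also have "\<dots> \<le> norm \<xi> ^ m * norm \<xi> ^ (2 * N) * (1 * mh \<xi>)"
        using P(3,4) mh(2) kh1 coord by (intro mult_mono) auto
      also have "\<dots> = R ^ (m + 2 * N) * ((norm \<xi> / R) ^ m * v \<xi>)"
        unfolding sc[of \<xi> m] sc[of \<xi> "2 * N"] v_def by (simp add: power_add mult_ac)
      finally have "(norm (ft (\<lambda>x. complex_of_real (\<psi> x)) \<xi>))\<^sup>2 \<le> (R ^ (m + 2 * N) * ((norm \<xi> / R) ^ m * v \<xi>))\<^sup>2"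
        by (intro power_mono) auto
      also have "\<dots> = R ^ (4 * N + 2 * m) * ((norm \<xi> / R) ^ (2 * m) * (v \<xi>)\<^sup>2)"
        by (simp add: power_mult_distrib power_mult[symmetric] algebra_simps)
      also have "\<dots> \<le> R ^ (4 * N + 2 * m) * ((C * I)\<^sup>2 * (2 ^ ?d * decay_weight (y \<xi>)))"
        using R by (intro mult_left_mono W2) auto
      finally show ?thesis .
    qed
    \<comment> \<open>Because the transform of the mollifier is bounded by 1, this bound does not
      involve \<open>\<epsilon>\<close>, which depends on \<open>P\<close> and the measure.\<close>
    define S2 where "S2 = R ^ (4 * N + 2 * m) * ((C * I)\<^sup>2 * (2 ^ ?d * (R ^ ?d * Wc))) / (2 * pi) ^ ?d"
    have S2: "S2 > 0" using R C I Wc by (simp add: S2_def)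
    have \<psi>c: "(\<lambda>x. complex_of_real (\<psi> x)) \<in> test_functions (cball 0 \<rho>)" by (rule test_functions_of_real[OF \<psi>(1)])
    have [measurable]: "ft (\<lambda>x. complex_of_real (\<psi> x)) \<in> borel_measurable borel"
      using test_functions_borel[OF \<psi>(1)] by simp
    have iW: "integrable lborel (\<lambda>\<xi>. R ^ (4 * N + 2 * m) * ((C * I)\<^sup>2 * (2 ^ ?d * decay_weight (y \<xi>))))"
      using Wy(1) by simp
    have fint: "integrable lborel (\<lambda>\<xi>. (norm (ft (\<lambda>x. complex_of_real (\<psi> x)) \<xi>))\<^sup>2)"
      by (rule Bochner_Integration.integrable_bound[OF iW])
        (auto intro!: AE_I2 order_trans[OF nps abs_ge_self])
    have "(2 * pi) ^ ?d * (\<integral>x. (\<psi> x)\<^sup>2 \<partial>lborel) \<le> (\<integral>\<xi>. (norm (ft (\<lambda>x. complex_of_real (\<psi> x)) \<xi>))\<^sup>2 \<partial>lborel)"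
      using plancherel_le[OF \<psi>c fint] by simp
    also have "\<dots> \<le> (\<integral>\<xi>. R ^ (4 * N + 2 * m) * ((C * I)\<^sup>2 * (2 ^ ?d * decay_weight (y \<xi>))) \<partial>lborel)"
      by (rule integral_mono[OF fint iW nps])
    also have "\<dots> = R ^ (4 * N + 2 * m) * ((C * I)\<^sup>2 * (2 ^ ?d * (R ^ ?d * Wc)))"
      unfolding integral_mult_right_zero Wy(2) ..
    finally have L2: "(\<integral>x. (\<psi> x)\<^sup>2 \<partial>lborel) \<le> S2"
      by (simp add: S2_def pos_le_divide_eq mult.commute)
    have ann: "ft (\<lambda>x. complex_of_real (\<psi> x)) (\<tau> *\<^sub>R \<omega> r) = 0" if "r < n" for r and \<tau> :: real
      unfolding \<psi>(2) hom_poly_scale[OF P(1)] P(2)[OF that] by simp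
    let ?D = "iter_deriv (replicate m i) \<psi>"
    have Dt: "?D \<in> test_functions (cball 0 \<rho>)" by (rule test_functions_iter_deriv[OF \<psi>(1)])
    have fD: "ft (\<lambda>x. complex_of_real (?D x)) \<xi> = (- \<i>) ^ (2 * m + 2 * N) * (complex_of_real (F \<xi>) * kh \<xi>)" for \<xi>
    proof -
      have "(a * x) ^ m * (a ^ (m + 2 * N) * (x ^ m * p) * (k * b)) = a ^ (2 * m + 2 * N) * (x ^ (2 * m) * p * b * k)"
        for a x p k b :: complex
        unfolding mult_2[of m] power_add power_mult_distrib by (simp only: mult_ac)
      from this[of "- \<i>" "complex_of_real (\<xi> $ i)" "complex_of_real (P \<xi>)" "kh \<xi>" "complex_of_real (mh \<xi>)"]
      show ?thesis
        unfolding ft_replicate_deriv_of_real[OF \<psi>(1)] \<psi>(2) fph F_def of_real_mult of_real_power .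
    qed
    define s0 where "s0 = (h / sqrt (2 * pi)) ^ ?d"
    have s0: "s0 > 0" using h by (simp add: s0_def)
    have EFk: "integrable lborel (\<lambda>\<xi>. complex_of_real (E \<xi> * F \<xi>) * kh \<xi>)"
      by (rule Bochner_Integration.integrable_bound[OF EF])
        (use kh1 in \<open>auto simp: norm_mult abs_mult intro!: AE_I2 mult_right_le_one_le\<close>)
    have low: "A / 2 \<le> norm (\<integral>\<xi>. complex_of_real (E \<xi> * F \<xi>) * kh \<xi> \<partial>lborel)"
    proof -
      have EFc: "integrable lborel (\<lambda>\<xi>. complex_of_real (E \<xi> * F \<xi>))" using EF by (simp only: complex_of_real_integrable_eq)
      have "(\<integral>\<xi>. complex_of_real (E \<xi> * F \<xi>) \<partial>lborel) - (\<integral>\<xi>. complex_of_real (E \<xi> * F \<xi>) * kh \<xi> \<partial>lborel)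
          = (\<integral>\<xi>. complex_of_real (E \<xi> * F \<xi>) * (1 - kh \<xi>) \<partial>lborel)"
        by (subst Bochner_Integration.integral_diff[OF EFc EFk, symmetric]) (simp add: algebra_simps)
      also have "norm \<dots> \<le> (\<integral>\<xi>. (\<epsilon> / h) * F \<xi> \<partial>lborel)"
      proof (rule order_trans[OF integral_norm_bound], rule integral_mono)
        show "integrable lborel (\<lambda>\<xi>. norm (complex_of_real (E \<xi> * F \<xi>) * (1 - kh \<xi>)))"
          using Bochner_Integration.integrable_diff[OF EFc EFk] by (intro integrable_norm) (simp add: algebra_simps)
        show "integrable lborel (\<lambda>\<xi>. (\<epsilon> / h) * F \<xi>)" using Fint by simp
        fix \<xi> :: "real^'d"
        have "norm (complex_of_real (E \<xi> * F \<xi>) * (1 - kh \<xi>)) = F \<xi> * (E \<xi> * norm (kh \<xi> - 1))"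
          using E(1)[of \<xi>] F0[of \<xi>] by (simp add: norm_mult abs_mult norm_minus_commute)
        also have "\<dots> \<le> F \<xi> * (E \<xi> * (\<epsilon> * norm \<xi>))"
          using E(1)[of \<xi>] F0[of \<xi>] khc[of \<xi>] by (intro mult_left_mono) auto
        also have "\<dots> = F \<xi> * \<epsilon> * (E \<xi> * norm \<xi>)" by simp
        also have "\<dots> \<le> F \<xi> * \<epsilon> * (1 / h)"
          using F0[of \<xi>] \<epsilon>(1) gauss_mult_le[OF h, of "norm \<xi>"] unfolding E_def by (intro mult_left_mono) auto
        finally show "norm (complex_of_real (E \<xi> * F \<xi>) * (1 - kh \<xi>)) \<le> (\<epsilon> / h) * F \<xi>"
          by (simp add: mult.commute)
      qed
      also have "\<dots> = (\<epsilon> / h) * ?IF" by simp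
      also have "\<dots> \<le> (A / (2 * (?IF + 1))) * ?IF"
        using \<epsilon>(3) h IF by (intro mult_right_mono) (auto simp: pos_divide_le_eq)
      also have "\<dots> \<le> A / 2" using A0 IF by (simp add: field_simps)
      finally have "norm ((\<integral>\<xi>. complex_of_real (E \<xi> * F \<xi>) \<partial>lborel) - (\<integral>\<xi>. complex_of_real (E \<xi> * F \<xi>) * kh \<xi> \<partial>lborel)) \<le> A / 2" .
      moreover have "A \<le> norm (\<integral>\<xi>. complex_of_real (E \<xi> * F \<xi>) \<partial>lborel)"
        using A A0 unfolding integral_complex_of_real norm_of_real by linarith
      ultimately show ?thesis
        using norm_triangle_ineq2[of "\<integral>\<xi>. complex_of_real (E \<xi> * F \<xi>) \<partial>lborel" "\<integral>\<xi>. complex_of_real (E \<xi> * F \<xi>) * kh \<xi> \<partial>lborel"]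
        by linarith
    qed
    let ?L = "\<integral>x. exp (- ((norm x)\<^sup>2 * (real N)\<^sup>2 / 2)) * ?D x \<partial>lborel"
    have pars: "complex_of_real ?L = complex_of_real s0 * ((- \<i>) ^ (2 * m + 2 * N) * (\<integral>\<xi>. complex_of_real (E \<xi> * F \<xi>) * kh \<xi> \<partial>lborel))"
    proof -
      have "complex_of_real ?L = (\<integral>x. complex_of_real (exp (- ((norm x)\<^sup>2 * (real N)\<^sup>2 / 2)) * ?D x) \<partial>lborel)"
        by (rule integral_complex_of_real[symmetric])
      also have "\<dots> = (\<integral>x. complex_of_real (exp (- ((norm x)\<^sup>2 / (2 * h\<^sup>2)))) * complex_of_real (?D x) \<partial>lborel)"
        by (simp add: h_def power_divide mult_ac)
      also have "\<dots> = complex_of_real s0 * (\<integral>\<xi>. complex_of_real (E \<xi>) * ft (\<lambda>x. complex_of_real (?D x)) \<xi> \<partial>lborel)"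
        unfolding s0_def E_def by (rule gauss_parseval[OF h test_functions_integrable[OF test_functions_of_real[OF Dt]]])
      also have "(\<integral>\<xi>. complex_of_real (E \<xi>) * ft (\<lambda>x. complex_of_real (?D x)) \<xi> \<partial>lborel) =
          (\<integral>\<xi>. (- \<i>) ^ (2 * m + 2 * N) * (complex_of_real (E \<xi> * F \<xi>) * kh \<xi>) \<partial>lborel)"
        unfolding fD by (simp add: mult_ac)
      also have "\<dots> = (- \<i>) ^ (2 * m + 2 * N) * (\<integral>\<xi>. complex_of_real (E \<xi> * F \<xi>) * kh \<xi> \<partial>lborel)"
        by (rule integral_mult_right_zero)
      finally show ?thesis .
    qed
    have "\<bar>?L\<bar> = norm (complex_of_real ?L)" by (simp only: norm_of_real)
    also have "\<dots> = s0 * norm (\<integral>\<xi>. complex_of_real (E \<xi> * F \<xi>) * kh \<xi> \<partial>lborel)"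
      unfolding pars norm_mult norm_power norm_of_real using s0 by simp
    also have "\<dots> \<ge> s0 * (A / 2)" using low s0 by (intro mult_left_mono) auto
    finally have L: "s0 * (A / 2) \<le> \<bar>?L\<bar>" .
    define S where "S = sqrt S2"
    have S: "S > 0" "S\<^sup>2 = S2" using S2 by (auto simp: S_def)
    \<comment> \<open>Compared after squaring, which turns the half-integer powers into integral
      ones.\<close>
    have eq: "c * real N powr (real m - real ?d / 2) * S = s0 * (A / 2)"
    proof (rule power2_eq_imp_eq)
      have N0: "real N > 0" using N1 by simp
      have "(real N powr (real m - real ?d / 2))\<^sup>2 = real N powr (real (2 * m + ?d) - real (2 * ?d))"
        using N0 by (simp add: power2_eq_square powr_add[symmetric])
      also have "\<dots> = real N ^ (2 * m + ?d) / real N ^ (2 * ?d)"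
        unfolding powr_diff powr_realpow[OF N0] ..
      finally have pw: "(real N powr (real m - real ?d / 2))\<^sup>2 = real N ^ (2 * m + ?d) / real N ^ (2 * ?d)" .
      have s0sq: "s0\<^sup>2 = 1 / (real N ^ (2 * ?d) * (2 * pi) ^ ?d)"
      proof -
        have "s0\<^sup>2 = ((h / sqrt (2 * pi))\<^sup>2) ^ ?d" unfolding s0_def by (simp only: power_mult[symmetric] mult.commute)
        also have "(h / sqrt (2 * pi))\<^sup>2 = 1 / ((real N)\<^sup>2 * (2 * pi))"
          by (simp add: h_def power_divide power_mult_distrib)
        finally show ?thesis by (simp add: power_divide power_mult_distrib power_mult[symmetric])
      qed
      have bR: "\<beta> ^ (2 * m + ?d) * real N ^ (2 * m + ?d) = R ^ (2 * m + ?d)" by (simp add: R_def power_mult_distrib)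
      have "(c * real N powr (real m - real ?d / 2) * S)\<^sup>2 = c\<^sup>2 * (real N powr (real m - real ?d / 2))\<^sup>2 * S2"
        by (simp only: power_mult_distrib S(2))
      also have "\<dots> = (c2\<^sup>2 / (4 * C\<^sup>2 * 2 ^ ?d * Wc)) * (\<beta> ^ (2 * m + ?d) * real N ^ (2 * m + ?d)) / real N ^ (2 * ?d) * S2"
        unfolding csq pw by simp
      also have "\<dots> = (c2\<^sup>2 / (4 * C\<^sup>2 * 2 ^ ?d * Wc)) * (R ^ (2 * m + ?d) * (R ^ (4 * N + 2 * m) * ((C * I)\<^sup>2 * (2 ^ ?d * (R ^ ?d * Wc))))) / (real N ^ (2 * ?d) * (2 * pi) ^ ?d)"
        unfolding bR S2_def by simp
      also have "R ^ (2 * m + ?d) * (R ^ (4 * N + 2 * m) * ((C * I)\<^sup>2 * (2 ^ ?d * (R ^ ?d * Wc)))) = (R ^ (2 * N + 2 * m + ?d))\<^sup>2 * ((C * I)\<^sup>2 * (2 ^ ?d * Wc))"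
        by (simp add: power_mult[symmetric] power_add[symmetric] mult.commute mult.left_commute) (simp add: power_add mult_ac power2_eq_square)
      also have "(c2\<^sup>2 / (4 * C\<^sup>2 * 2 ^ ?d * Wc)) * ((R ^ (2 * N + 2 * m + ?d))\<^sup>2 * ((C * I)\<^sup>2 * (2 ^ ?d * Wc))) / (real N ^ (2 * ?d) * (2 * pi) ^ ?d) = s0\<^sup>2 * (A / 2)\<^sup>2"
        unfolding s0sq A_def using C Wc by (simp add: power_mult_distrib power_divide) (simp add: mult_ac)
      finally show "(c * real N powr (real m - real ?d / 2) * S)\<^sup>2 = (s0 * (A / 2))\<^sup>2"
        by (simp only: power_mult_distrib)
    qed (use c S s0 A0 in auto)
    show ?thesis
      using \<psi>(1) S(1) L2 ann L unfolding S(2)[symmetric] eq[symmetric] N_def[symmetric]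
      by (intro exI[of _ i] exI[of _ \<psi>] exI[of _ S]) auto
  qed
  then have "\<forall>K\<ge>K0. \<forall>n. \<forall>\<omega> :: nat \<Rightarrow> real ^ 'd. 2 * n \<le> (K + 1) ^ (CARD('d) - 1) \<longrightarrow>
    (\<exists>i \<psi> S. \<psi> \<in> test_functions (cball 0 \<rho>) \<and> S > 0 \<and> (\<integral>x. (\<psi> x)\<^sup>2 \<partial>lborel) \<le> S\<^sup>2 \<and>
      (\<forall>r<n. \<forall>\<tau>::real. ft (\<lambda>x. complex_of_real (\<psi> x)) (\<tau> *\<^sub>R \<omega> r) = 0) \<and>
      c * real (K * (CARD('d) - 1)) powr (real m - real CARD('d) / 2) * S \<le>
        \<bar>\<integral>x. exp (- ((norm x)\<^sup>2 * (real (K * (CARD('d) - 1)))\<^sup>2 / 2)) * iter_deriv (replicate m i) \<psi> x \<partial>lborel\<bar>)"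
    by (intro allI impI)
  with c show ?thesis by (intro exI[of _ c] conjI exI[of _ K0])
qed

section \<open>Besov norms of Gaussians\<close>

lemma epowr_mono: "x \<le> y \<Longrightarrow> s \<ge> 0 \<Longrightarrow> epowr x s \<le> epowr y s"
  unfolding epowr_def
  by (auto simp: top_unique less_top intro!: ennreal_leI powr_mono2 enn2real_mono)

lemma epowr_ennreal: "a \<ge> 0 \<Longrightarrow> epowr (ennreal a) s = ennreal (a powr s)"
  unfolding epowr_def by simp

lemma Lp_qnorm_UNIV_le:
  fixes g :: "real ^ 'd::finite \<Rightarrow> 'b::real_normed_vector"
  assumes p: "p > 0" and b: "b \<ge> 0" and le: "(\<integral>\<^sup>+x. ennreal (norm (g x) powr p) \<partial>lborel) \<le> ennreal (b powr p)"
  shows "Lp_qnorm p UNIV g \<le> ennreal b"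
proof -
  have "Lp_qnorm p UNIV g \<le> epowr (ennreal (b powr p)) (1 / p)"
    unfolding Lp_qnorm_def using p le by (intro epowr_mono) (auto simp: nn_integral_completion)
  also have "\<dots> = ennreal b" using p b by (simp add: epowr_ennreal powr_powr)
  finally show ?thesis .
qed

section \<open>Integrable functions as tempered distributions\<close>

lemma mi_deriv_0: "mi_deriv (\<lambda>_. 0) \<phi> = \<phi>"
proof -
  have "(SOME is::'a list. \<forall>i. count_list is i = 0) = []"
  proof (rule some_equality)
    fix "is" :: "'a list" assume "\<forall>i. count_list is i = 0"
    then show "is = []" by (cases "is") (auto dest: spec[of _ "hd is"])
  qed simp
  then show ?thesis by (simp add: mi_deriv_def)
qed

lemma order_mi_le_0: "order_mi \<alpha> \<le> 0 \<Longrightarrow> \<alpha> = (\<lambda>_. 0)"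
  unfolding order_mi_def by (intro ext) simp

lemma schwartz_norm_le_seminorm_0:
  assumes \<phi>: "\<phi> \<in> schwartz_space"
  shows "norm (\<phi> x) \<le> schwartz_seminorm 0 \<phi>"
proof -
  let ?S = "{(1 + norm x) ^ 0 * norm (mi_deriv \<alpha> \<phi> x) | x \<alpha>. order_mi \<alpha> \<le> 0}"
  have S: "?S = range (\<lambda>x. norm (\<phi> x))"
  proof -
    have 0: "order_mi (\<lambda>_::'a. 0) \<le> 0" by (simp add: order_mi_def)
    have "mi_deriv \<alpha> \<phi> = \<phi>" if "order_mi \<alpha> \<le> 0" for \<alpha> :: "'a \<Rightarrow> nat"
      using order_mi_le_0[OF that] mi_deriv_0[of \<phi>] by simp
    then have "?S \<subseteq> range (\<lambda>x. norm (\<phi> x))" by auto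
    moreover have "norm (\<phi> x) \<in> ?S" for x
    proof -
      have "norm (\<phi> x) = (1 + norm x) ^ 0 * norm (mi_deriv (\<lambda>_. 0) \<phi> x)" by (simp add: mi_deriv_0)
      with 0 show ?thesis by blast
    qed
    ultimately show ?thesis by blast
  qed
  have "bounded (range (\<lambda>x. (1 + norm x) ^ 0 *\<^sub>R mi_deriv (\<lambda>_. 0) \<phi> x))"
    using \<phi> unfolding schwartz_space_def by blast
  then have "bounded (range \<phi>)" by (simp add: mi_deriv_0)
  then obtain B where "\<And>x. norm (\<phi> x) \<le> B" unfolding bounded_iff by auto
  then have "bdd_above (range (\<lambda>x. norm (\<phi> x)))" by (auto intro!: bdd_aboveI)
  then have "norm (\<phi> x) \<le> Sup (range (\<lambda>x. norm (\<phi> x)))" by (intro cSup_upper) auto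
  then show ?thesis unfolding schwartz_seminorm_def S .
qed

definition function_distribution :: "(real ^ 'd::finite \<Rightarrow> real) \<Rightarrow> (real ^ 'd \<Rightarrow> complex) \<Rightarrow> complex"
  where "function_distribution f \<phi> = (\<integral>x. complex_of_real (f x) * \<phi> x \<partial>lebesgue)"

text \<open>Continuity holds with the seminorm of order 0 and the \<open>L^1\<close> norm of
  \<open>f\<close> as constant. Schwartz functions are Borel measurable, so the integral may be
  taken over \<open>lborel\<close>, where the estimates are made.\<close>

lemma tempered_function_distribution:
  fixes f :: "real ^ 'd::finite \<Rightarrow> real"
  assumes f: "integrable lborel f"
  shows "tempered_distribution (function_distribution f)"
proof -
  have fc: "integrable lborel (\<lambda>x. complex_of_real (f x))" using f by (simp only: complex_of_real_integrable_eq)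
  have [measurable]: "f \<in> borel_measurable borel" using f by auto
  have b: "\<phi> \<in> borel_measurable borel" if "\<phi> \<in> schwartz_space" for \<phi> :: "real^'d \<Rightarrow> complex"
    using that by (intro borel_measurable_continuous_onI smooth_fun_continuous_on) (auto simp: schwartz_space_def)
  have le: "norm (complex_of_real (f x) * \<phi> x) \<le> \<bar>f x\<bar> * schwartz_seminorm 0 \<phi>" if "\<phi> \<in> schwartz_space" for \<phi> x
    using schwartz_norm_le_seminorm_0[OF that, of x] by (simp add: norm_mult mult_left_mono)
  have intg: "integrable lborel (\<lambda>x. complex_of_real (f x) * \<phi> x)" if "\<phi> \<in> schwartz_space" for \<phi>
  proof (rule Bochner_Integration.integrable_bound[where f = "\<lambda>x. \<bar>f x\<bar> * schwartz_seminorm 0 \<phi>"])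
    show "AE x in lborel. norm (complex_of_real (f x) * \<phi> x) \<le> norm (\<bar>f x\<bar> * schwartz_seminorm 0 \<phi>)"
      by (intro AE_I2 order_trans[OF le[OF that]]) simp
  qed (use f b[OF that] in auto)
  have lb: "function_distribution f \<phi> = (\<integral>x. complex_of_real (f x) * \<phi> x \<partial>lborel)" if "\<phi> \<in> borel_measurable borel" for \<phi>
    unfolding function_distribution_def by (rule integral_completion) (use that in measurable)
  show ?thesis
    unfolding tempered_distribution_def
  proof (intro conjI ballI allI exI[of _ "\<integral>x. \<bar>f x\<bar> \<partial>lborel"] exI[of _ "0::nat"])
    fix \<phi> \<psi> :: "real^'d \<Rightarrow> complex" assume s: "\<phi> \<in> schwartz_space" "\<psi> \<in> schwartz_space"
    have "function_distribution f (\<lambda>x. \<phi> x + \<psi> x) = (\<integral>x. complex_of_real (f x) * \<phi> x + complex_of_real (f x) * \<psi> x \<partial>lborel)"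
      using b[OF s(1)] b[OF s(2)] by (simp add: lb distrib_left)
    also have "\<dots> = function_distribution f \<phi> + function_distribution f \<psi>"
      by (simp add: lb b s Bochner_Integration.integral_add[OF intg[OF s(1)] intg[OF s(2)]])
    finally show "function_distribution f (\<lambda>x. \<phi> x + \<psi> x) = function_distribution f \<phi> + function_distribution f \<psi>" .
  next
    fix \<phi> :: "real^'d \<Rightarrow> complex" and c assume s: "\<phi> \<in> schwartz_space"
    have "function_distribution f (\<lambda>x. c * \<phi> x) = (\<integral>x. c * (complex_of_real (f x) * \<phi> x) \<partial>lborel)"
      using b[OF s] by (simp add: lb mult_ac)
    then show "function_distribution f (\<lambda>x. c * \<phi> x) = c * function_distribution f \<phi>"
      by (simp add: lb b s)
  next
    fix \<phi> :: "real^'d \<Rightarrow> complex" assume s: "\<phi> \<in> schwartz_space"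
    have "norm (function_distribution f \<phi>) \<le> (\<integral>x. \<bar>f x\<bar> * schwartz_seminorm 0 \<phi> \<partial>lborel)"
      unfolding lb[OF b[OF s]]
      by (rule order_trans[OF integral_norm_bound], rule integral_mono[OF integrable_norm[OF intg[OF s]] _ le[OF s]])
         (use f in auto)
    then show "norm (function_distribution f \<phi>) \<le> (\<integral>x. \<bar>f x\<bar> \<partial>lborel) * schwartz_seminorm 0 \<phi>" by simp
  qed
qed

lemma restricts_to_function_distribution:
  fixes f :: "real ^ 'd::finite \<Rightarrow> real"
  assumes f: "integrable lborel f"
  shows "restricts_to (function_distribution f) \<Omega> f"
  unfolding restricts_to_def
proof
  have fl: "integrable lebesgue f" using f by (subst integrable_completion) auto
  show "locally_integrable_in \<Omega> f"
    unfolding locally_integrable_in_def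
  proof (intro allI impI)
    fix K assume "compact K \<and> K \<subseteq> \<Omega>"
    then have "K \<in> sets lebesgue" using lmeasurable_compact by blast
    from integrable_mult_indicator[OF this fl] show "f absolutely_integrable_on K"
      by (simp add: set_integrable_def)
  qed
  show "\<forall>\<phi>\<in>test_functions \<Omega>. function_distribution f \<phi> = (LINT x:\<Omega>|lebesgue. complex_of_real (f x) * \<phi> x)"
  proof
    fix \<phi> :: "real^'d \<Rightarrow> complex" assume "\<phi> \<in> test_functions \<Omega>"
    then have "\<phi> x = 0" if "x \<notin> \<Omega>" for x using that unfolding test_functions_iff by blast
    then have "complex_of_real (f x) * \<phi> x = indicator \<Omega> x *\<^sub>R (complex_of_real (f x) * \<phi> x)" for x
      by (auto simp: indicator_def)
    then show "function_distribution f \<phi> = (LINT x:\<Omega>|lebesgue. complex_of_real (f x) * \<phi> x)"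
      unfolding function_distribution_def set_lebesgue_integral_def by simp
  qed
qed

text \<open>The parameter will be \<open>\<mu> = (2 ^ j * h)^2\<close>: up to a factor, this is the
  transform of a bump of width \<open>h\<close> after rescaling frequencies by
  \<open>2 ^ j\<close>.\<close>

definition gauss :: "real \<Rightarrow> real ^ 'd::finite \<Rightarrow> complex"
  where "gauss \<mu> x = complex_of_real (exp (- (\<mu> * (norm x)\<^sup>2 / 2)))"

lemma gauss_borel [measurable]: "gauss \<mu> \<in> borel_measurable borel"
  unfolding gauss_def[abs_def] by measurable

lemma smooth_fun_gauss: "smooth_fun (gauss \<mu> :: real ^ 'd::finite \<Rightarrow> complex)"
proof -
  have "smooth_fun (\<lambda>x::real^'d. exp ((- \<mu> / 2) * (norm x)\<^sup>2))"
    by (intro smooth_fun_exp smooth_fun_mult smooth_fun_const smooth_fun_norm_power2)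
  from smooth_fun_of_real[OF this, where 'b = complex] show ?thesis
    by (simp add: gauss_def[abs_def])
qed

lemma partial_deriv_gauss:
  "partial_deriv i (gauss \<mu>) (x :: real ^ 'd::finite) = - (complex_of_real (\<mu> * x $ i) * gauss \<mu> x)"
proof -
  have "((\<lambda>x::real^'d. complex_of_real (exp (- (\<mu> * (x \<bullet> x) / 2)))) has_derivative
      (\<lambda>v. complex_of_real (exp (- (\<mu> * (x \<bullet> x) / 2)) * (- (\<mu> * (x \<bullet> v + v \<bullet> x) / 2))))) (at x)"
    by (auto intro!: derivative_eq_intros)
  from partial_deriv_has_derivative[OF this, of i] show ?thesis
    by (simp add: gauss_def[abs_def] power2_norm_eq_inner inner_axis inner_axis' mult_ac)
qed

text \<open>Polynomials in \<open>\<mu>\<close> with test function coefficients that vanish near the origin: differentiating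
  such a function times \<open>gauss \<mu>\<close> stays in the class, with constants independent of \<open>\<mu>\<close>.\<close>

inductive_set mu_poly :: "real \<Rightarrow> (real \<Rightarrow> real ^ 'd::finite \<Rightarrow> complex) set" for r where
  mu_poly_gen: "s \<in> test_functions UNIV \<Longrightarrow> (\<And>\<eta>. norm \<eta> < r \<Longrightarrow> s \<eta> = 0) \<Longrightarrow>
    (\<lambda>\<mu> \<eta>. complex_of_real (\<mu> ^ a) * s \<eta>) \<in> mu_poly r"
| mu_poly_add: "G \<in> mu_poly r \<Longrightarrow> H \<in> mu_poly r \<Longrightarrow> (\<lambda>\<mu> \<eta>. G \<mu> \<eta> + H \<mu> \<eta>) \<in> mu_poly r"

lemma mu_poly_test: "G \<in> mu_poly r \<Longrightarrow> G \<mu> \<in> test_functions UNIV"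
  by (induction rule: mu_poly.induct)
     (auto intro: test_functions_add test_functions_comp_linear[OF bounded_linear_mult_right])

lemma mu_poly_zero: "G \<in> mu_poly r \<Longrightarrow> norm \<eta> < r \<Longrightarrow> G \<mu> \<eta> = 0"
  by (induction rule: mu_poly.induct) auto

lemma mu_poly_bound:
  "G \<in> mu_poly r \<Longrightarrow> \<exists>C n. C > 0 \<and> (\<forall>\<mu>\<ge>0. (\<integral>\<eta>. norm (G \<mu> \<eta>) \<partial>lborel) \<le> C * (1 + \<mu>) ^ n)"
proof (induction rule: mu_poly.induct)
  case (mu_poly_gen s a)
  have "(\<integral>\<eta>. norm (complex_of_real (\<mu> ^ a) * s \<eta>) \<partial>lborel) \<le> ((\<integral>\<eta>. norm (s \<eta>) \<partial>lborel) + 1) * (1 + \<mu>) ^ a"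
    if "\<mu> \<ge> 0" for \<mu>
  proof -
    have "(\<integral>\<eta>. norm (complex_of_real (\<mu> ^ a) * s \<eta>) \<partial>lborel) = \<mu> ^ a * (\<integral>\<eta>. norm (s \<eta>) \<partial>lborel)"
      using that by (simp add: norm_mult norm_power)
    also have "\<dots> \<le> (1 + \<mu>) ^ a * ((\<integral>\<eta>. norm (s \<eta>) \<partial>lborel) + 1)"
      using that by (intro mult_mono power_mono) auto
    finally show ?thesis by (simp add: mult.commute)
  qed
  moreover have "(\<integral>\<eta>. norm (s \<eta>) \<partial>lborel) + 1 > 0"
  proof -
    have "0 \<le> (\<integral>\<eta>. norm (s \<eta>) \<partial>lborel)" by (intro Bochner_Integration.integral_nonneg) auto
    then show ?thesis by linarith
  qed
  ultimately show ?case by blast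
next
  case (mu_poly_add G H)
  then obtain C n C' n' where C: "C > 0" "\<And>\<mu>. \<mu> \<ge> 0 \<Longrightarrow> (\<integral>\<eta>. norm (G \<mu> \<eta>) \<partial>lborel) \<le> C * (1 + \<mu>) ^ n"
    "C' > 0" "\<And>\<mu>. \<mu> \<ge> 0 \<Longrightarrow> (\<integral>\<eta>. norm (H \<mu> \<eta>) \<partial>lborel) \<le> C' * (1 + \<mu>) ^ n'" by blast
  have "(\<integral>\<eta>. norm (G \<mu> \<eta> + H \<mu> \<eta>) \<partial>lborel) \<le> (C + C') * (1 + \<mu>) ^ max n n'" if l: "\<mu> \<ge> 0" for \<mu>
  proof -
    have iG: "integrable lborel (G \<mu>)" and iH: "integrable lborel (H \<mu>)"
      using mu_poly_test[OF mu_poly_add.hyps(1)] mu_poly_test[OF mu_poly_add.hyps(2)] test_functions_integrable by blast+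
    have "(\<integral>\<eta>. norm (G \<mu> \<eta> + H \<mu> \<eta>) \<partial>lborel) \<le> (\<integral>\<eta>. norm (G \<mu> \<eta>) + norm (H \<mu> \<eta>) \<partial>lborel)"
      using iG iH by (intro integral_mono) (auto intro: norm_triangle_ineq)
    also have "\<dots> \<le> C * (1 + \<mu>) ^ n + C' * (1 + \<mu>) ^ n'"
      using iG iH C(2)[OF l] C(4)[OF l] by simp
    also have "\<dots> \<le> C * (1 + \<mu>) ^ max n n' + C' * (1 + \<mu>) ^ max n n'"
      using l C by (intro add_mono mult_left_mono power_increasing) auto
    finally show ?thesis by (simp add: distrib_right)
  qed
  then show ?case using C by (intro exI[of _ "C + C'"] exI[of _ "max n n'"]) auto
qed

text \<open>Differentiating \<open>G \<mu> \<eta> * gauss \<mu> \<eta>\<close> and factoring out the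
  Gaussian replaces \<open>G\<close> by this expression; the extra \<open>\<mu>\<close> only raises
  the degree in \<open>\<mu>\<close>.\<close>

lemma mu_poly_deriv:
  "G \<in> mu_poly r \<Longrightarrow> (\<lambda>\<mu> \<eta>. partial_deriv i (G \<mu>) \<eta> + - complex_of_real (\<mu> * \<eta> $ i) * G \<mu> \<eta>) \<in> mu_poly r"
proof (induction rule: mu_poly.induct)
  case (mu_poly_gen s a)
  have pd: "partial_deriv i (\<lambda>\<eta>. complex_of_real (\<mu> ^ a) * s \<eta>) \<eta> = complex_of_real (\<mu> ^ a) * partial_deriv i s \<eta>" for \<mu> \<eta>
    by (rule partial_deriv_comp_linear[OF bounded_linear_mult_right smooth_fun_differentiable[OF test_functions_smooth[OF mu_poly_gen(1)]]])
  have eq: "(\<lambda>\<mu> \<eta>. partial_deriv i (\<lambda>\<eta>. complex_of_real (\<mu> ^ a) * s \<eta>) \<eta> + - complex_of_real (\<mu> * \<eta> $ i) * (complex_of_real (\<mu> ^ a) * s \<eta>))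
    = (\<lambda>\<mu> \<eta>. complex_of_real (\<mu> ^ a) * partial_deriv i s \<eta> + complex_of_real (\<mu> ^ Suc a) * (s \<eta> * - complex_of_real (\<eta> $ i)))"
    unfolding pd by (simp add: mult_ac)
  have z: "partial_deriv i s \<eta> = 0" if "norm \<eta> < r" for \<eta>
  proof -
    have "(s has_derivative (\<lambda>_. 0)) (at \<eta>)"
      by (rule has_derivative_transform_within_open[of "\<lambda>_. 0" _ _ _ "ball 0 r"]) (use that mu_poly_gen(2) in auto)
    from partial_deriv_has_derivative[OF this] show ?thesis by simp
  qed
  have sm: "smooth_fun (\<lambda>\<eta>::real^'a. - complex_of_real (\<eta> $ i))"
    using smooth_fun_comp_linear[OF bounded_linear_minus[OF bounded_linear_ident] smooth_fun_of_real[OF smooth_fun_coord]] .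
  show ?case unfolding eq
    by (intro mu_poly.intros test_functions_partial_deriv test_functions_mult[OF mu_poly_gen(1) sm] mu_poly_gen(1))
       (auto simp: z mu_poly_gen(2))
next
  case (mu_poly_add G H)
  have "partial_deriv i (\<lambda>\<eta>. G \<mu> \<eta> + H \<mu> \<eta>) \<eta> = partial_deriv i (G \<mu>) \<eta> + partial_deriv i (H \<mu>) \<eta>" for \<mu> \<eta>
    using mu_poly_add.hyps
    by (intro partial_deriv_add smooth_fun_differentiable test_functions_smooth[OF mu_poly_test])
  with mu_poly.mu_poly_add[OF mu_poly_add.IH] show ?case
    by (simp add: algebra_simps)
qed

lemma iter_deriv_gauss:
  assumes s: "s \<in> test_functions UNIV" "\<And>\<eta>. norm \<eta> < r \<Longrightarrow> s \<eta> = 0"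
  shows "\<exists>G\<in>mu_poly r. \<forall>\<mu>. iter_deriv (replicate A i) (\<lambda>\<eta>. s \<eta> * gauss \<mu> \<eta>) = (\<lambda>\<eta>. G \<mu> \<eta> * gauss \<mu> \<eta>)"
proof (induction A)
  case 0
  have "(\<lambda>\<mu> \<eta>. complex_of_real (\<mu> ^ 0) * s \<eta>) \<in> mu_poly r" by (rule mu_poly_gen[OF s])
  then show ?case by (intro bexI[of _ "\<lambda>\<mu> \<eta>. complex_of_real (\<mu> ^ 0) * s \<eta>"]) auto
next
  case (Suc A)
  then obtain G where G: "G \<in> mu_poly r"
    "\<And>\<mu>. iter_deriv (replicate A i) (\<lambda>\<eta>. s \<eta> * gauss \<mu> \<eta>) = (\<lambda>\<eta>. G \<mu> \<eta> * gauss \<mu> \<eta>)" by blast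
  have "partial_deriv i (\<lambda>\<eta>. G \<mu> \<eta> * gauss \<mu> \<eta>) \<eta> =
      (partial_deriv i (G \<mu>) \<eta> + - complex_of_real (\<mu> * \<eta> $ i) * G \<mu> \<eta>) * gauss \<mu> \<eta>" for \<mu> \<eta>
    by (subst partial_deriv_bilinear[OF bounded_bilinear_mult])
       (auto intro!: smooth_fun_differentiable smooth_fun_gauss test_functions_smooth[OF mu_poly_test[OF G(1)]]
         simp: partial_deriv_gauss algebra_simps)
  then have "iter_deriv (replicate (Suc A) i) (\<lambda>\<eta>. s \<eta> * gauss \<mu> \<eta>) =
      (\<lambda>\<eta>. (partial_deriv i (G \<mu>) \<eta> + - complex_of_real (\<mu> * \<eta> $ i) * G \<mu> \<eta>) * gauss \<mu> \<eta>)" for \<mu>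
    by (simp add: G(2) fun_eq_iff)
  then show ?case
    by (intro bexI[of _ "\<lambda>\<mu> \<eta>. partial_deriv i (G \<mu>) \<eta> + - complex_of_real (\<mu> * \<eta> $ i) * G \<mu> \<eta>"]
        allI mu_poly_deriv[OF G(1)])
qed

text \<open>\<open>A\<close> derivatives in direction \<open>i\<close> become the factor
  \<open>\<bar>z $ i\<bar> ^ A\<close>. They leave the function zero for
  \<open>norm \<eta> < r\<close>, so the Gaussian contributes
  \<open>exp (- (\<mu> * r^2 / 2))\<close>, which for \<open>r > 0\<close> outweighs the polynomial
  growth in \<open>\<mu>\<close>. The case \<open>r = 0\<close> serves the low-frequency
  block.\<close>

lemma ft_gauss_coord_decay:
  fixes s :: "real ^ 'd::finite \<Rightarrow> complex"
  assumes s: "s \<in> test_functions UNIV" "\<And>\<eta>. norm \<eta> < r \<Longrightarrow> s \<eta> = 0" and r: "r \<ge> 0"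
  shows "\<exists>C n. C > 0 \<and> (\<forall>\<mu>\<ge>0. \<forall>z. \<bar>z $ i\<bar> ^ A * norm (ft (\<lambda>\<eta>. s \<eta> * gauss \<mu> \<eta>) z) \<le> C * (1 + \<mu>) ^ n * exp (- (\<mu> * r\<^sup>2 / 2)))"
proof -
  obtain G where G: "G \<in> mu_poly r"
    "\<And>\<mu>. iter_deriv (replicate A i) (\<lambda>\<eta>. s \<eta> * gauss \<mu> \<eta>) = (\<lambda>\<eta>. G \<mu> \<eta> * gauss \<mu> \<eta>)"
  proof -
    have "\<exists>G\<in>mu_poly r. \<forall>\<mu>. iter_deriv (replicate A i) (\<lambda>\<eta>. s \<eta> * gauss \<mu> \<eta>) = (\<lambda>\<eta>. G \<mu> \<eta> * gauss \<mu> \<eta>)"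
      by (rule iter_deriv_gauss) (fact s)+
    then show ?thesis
      by (elim bexE) (rule that, assumption, erule spec)
  qed
  obtain C n where C: "C > 0" "\<And>\<mu>. \<mu> \<ge> 0 \<Longrightarrow> (\<integral>\<eta>. norm (G \<mu> \<eta>) \<partial>lborel) \<le> C * (1 + \<mu>) ^ n"
    using mu_poly_bound[OF G(1)] by blast
  have "\<bar>z $ i\<bar> ^ A * norm (ft (\<lambda>\<eta>. s \<eta> * gauss \<mu> \<eta>) z) \<le> C * (1 + \<mu>) ^ n * exp (- (\<mu> * r\<^sup>2 / 2))"
    if l: "\<mu> \<ge> 0" for \<mu> z
  proof -
    have t: "(\<lambda>\<eta>. s \<eta> * gauss \<mu> \<eta>) \<in> test_functions UNIV" by (rule test_functions_mult[OF s(1) smooth_fun_gauss])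
    have "ft (\<lambda>\<eta>. G \<mu> \<eta> * gauss \<mu> \<eta>) z = (- \<i> * complex_of_real (z $ i)) ^ A * ft (\<lambda>\<eta>. s \<eta> * gauss \<mu> \<eta>) z"
      using ft_replicate_deriv[OF t, of A i z] by (simp only: G(2))
    then have "\<bar>z $ i\<bar> ^ A * norm (ft (\<lambda>\<eta>. s \<eta> * gauss \<mu> \<eta>) z) = norm (ft (\<lambda>\<eta>. G \<mu> \<eta> * gauss \<mu> \<eta>) z)"
      by (simp only: norm_mult norm_power norm_minus_cancel norm_ii norm_of_real mult_1_left)
    also have "\<dots> \<le> (\<integral>\<eta>. norm (G \<mu> \<eta> * gauss \<mu> \<eta>) \<partial>lborel)" by (rule norm_ft_le)
    also have "\<dots> \<le> (\<integral>\<eta>. norm (G \<mu> \<eta>) * exp (- (\<mu> * r\<^sup>2 / 2)) \<partial>lborel)"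
    proof (rule integral_mono)
      show "integrable lborel (\<lambda>\<eta>. norm (G \<mu> \<eta> * gauss \<mu> \<eta>))"
        by (rule integrable_norm[OF test_functions_integrable[OF test_functions_mult[OF mu_poly_test[OF G(1)] smooth_fun_gauss]]])
      show "integrable lborel (\<lambda>\<eta>. norm (G \<mu> \<eta>) * exp (- (\<mu> * r\<^sup>2 / 2)))"
        by (intro integrable_mult_left integrable_norm test_functions_integrable[OF mu_poly_test[OF G(1)]])
      fix \<eta> :: "real^'d"
      show "norm (G \<mu> \<eta> * gauss \<mu> \<eta>) \<le> norm (G \<mu> \<eta>) * exp (- (\<mu> * r\<^sup>2 / 2))"
      proof (cases "norm \<eta> < r")
        case False
        then have "\<mu> * r\<^sup>2 \<le> \<mu> * (norm \<eta>)\<^sup>2" using r l by (intro mult_left_mono power_mono) auto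
        then have "exp (- (\<mu> * (norm \<eta>)\<^sup>2 / 2)) \<le> exp (- (\<mu> * r\<^sup>2 / 2))" by simp
        then show ?thesis unfolding norm_mult gauss_def norm_of_real abs_exp_cancel
          by (intro mult_left_mono) auto
      qed (simp add: mu_poly_zero[OF G(1)])
    qed
    also have "\<dots> = (\<integral>\<eta>. norm (G \<mu> \<eta>) \<partial>lborel) * exp (- (\<mu> * r\<^sup>2 / 2))" by simp
    also have "\<dots> \<le> C * (1 + \<mu>) ^ n * exp (- (\<mu> * r\<^sup>2 / 2))" using C(2)[OF l] by (intro mult_right_mono) auto
    finally show ?thesis .
  qed
  then show ?thesis using C(1) by (intro exI[of _ C] exI[of _ n] conjI allI impI)
qed

lemma norm_power_le_sum_coords:
  fixes z :: "real ^ 'd::finite"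
  shows "norm z ^ A \<le> real CARD('d) ^ A * (\<Sum>i\<in>UNIV. \<bar>z $ i\<bar> ^ A)"
proof -
  have "\<exists>i. \<forall>j. \<bar>z $ j\<bar> \<le> \<bar>z $ i\<bar>"
  proof -
    have "Max (range (\<lambda>j. \<bar>z $ j\<bar>)) \<in> range (\<lambda>j. \<bar>z $ j\<bar>)" by (intro Max_in) auto
    then obtain i where i: "Max (range (\<lambda>j. \<bar>z $ j\<bar>)) = \<bar>z $ i\<bar>" by (rule rangeE)
    have "\<bar>z $ j\<bar> \<le> \<bar>z $ i\<bar>" for j unfolding i[symmetric] by (intro Max_ge) auto
    then show ?thesis by blast
  qed
  then obtain i where i: "\<And>j. \<bar>z $ j\<bar> \<le> \<bar>z $ i\<bar>" by blast
  have "norm z \<le> (\<Sum>j\<in>UNIV. \<bar>z $ j\<bar>)" by (rule norm_le_l1_cart)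
  also have "\<dots> \<le> real CARD('d) * \<bar>z $ i\<bar>" using sum_bounded_above[of UNIV "\<lambda>j. \<bar>z $ j\<bar>", OF i] by simp
  finally have "norm z ^ A \<le> (real CARD('d) * \<bar>z $ i\<bar>) ^ A" by (intro power_mono) auto
  also have "\<dots> \<le> real CARD('d) ^ A * (\<Sum>i\<in>UNIV. \<bar>z $ i\<bar> ^ A)"
    unfolding power_mult_distrib by (intro mult_left_mono member_le_sum) auto
  finally show ?thesis .
qed

lemma ft_gauss_decay:
  fixes s :: "real ^ 'd::finite \<Rightarrow> complex"
  assumes s: "s \<in> test_functions UNIV" "\<And>\<eta>. norm \<eta> < r \<Longrightarrow> s \<eta> = 0" and r: "r \<ge> 0"
  shows "\<exists>C n. C > 0 \<and> (\<forall>\<mu>\<ge>0. \<forall>z. norm z ^ A * norm (ft (\<lambda>\<eta>. s \<eta> * gauss \<mu> \<eta>) z) \<le> C * (1 + \<mu>) ^ n * exp (- (\<mu> * r\<^sup>2 / 2)))"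
proof -
  define Q where "Q i c n \<longleftrightarrow> c > 0 \<and> (\<forall>\<mu>\<ge>0. \<forall>z. \<bar>z $ i\<bar> ^ A * norm (ft (\<lambda>\<eta>. s \<eta> * gauss \<mu> \<eta>) z) \<le> c * (1 + \<mu>) ^ n * exp (- (\<mu> * r\<^sup>2 / 2)))"
    for i c n
  have "\<exists>c n. Q i c n" for i
    unfolding Q_def by (rule ft_gauss_coord_decay) (fact s r)+
  then obtain C n where Q: "\<And>i. Q i (C i) (n i)" by metis
  have C: "C i > 0" "\<mu> \<ge> 0 \<Longrightarrow> \<bar>z $ i\<bar> ^ A * norm (ft (\<lambda>\<eta>. s \<eta> * gauss \<mu> \<eta>) z) \<le> C i * (1 + \<mu>) ^ n i * exp (- (\<mu> * r\<^sup>2 / 2))"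
    for i \<mu> z
    using Q[of i] unfolding Q_def by blast+
  define m where "m = (\<Sum>i\<in>UNIV. n i)"
  have "norm z ^ A * norm (ft (\<lambda>\<eta>. s \<eta> * gauss \<mu> \<eta>) z) \<le> (real CARD('d) ^ A * (\<Sum>i\<in>UNIV. C i)) * (1 + \<mu>) ^ m * exp (- (\<mu> * r\<^sup>2 / 2))"
    if l: "\<mu> \<ge> 0" for \<mu> z
  proof -
    let ?f = "norm (ft (\<lambda>\<eta>. s \<eta> * gauss \<mu> \<eta>) z)"
    have "norm z ^ A * ?f \<le> real CARD('d) ^ A * (\<Sum>i\<in>UNIV. \<bar>z $ i\<bar> ^ A) * ?f"
      by (intro mult_right_mono norm_power_le_sum_coords) auto
    also have "\<dots> = real CARD('d) ^ A * (\<Sum>i\<in>UNIV. \<bar>z $ i\<bar> ^ A * ?f)" by (simp add: sum_distrib_right)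
    also have "\<dots> \<le> real CARD('d) ^ A * (\<Sum>i\<in>UNIV. C i * (1 + \<mu>) ^ m * exp (- (\<mu> * r\<^sup>2 / 2)))"
    proof (intro mult_left_mono sum_mono)
      fix i
      have "n i \<le> m" unfolding m_def by (rule member_le_sum) auto
      then have "C i * (1 + \<mu>) ^ n i * exp (- (\<mu> * r\<^sup>2 / 2)) \<le> C i * (1 + \<mu>) ^ m * exp (- (\<mu> * r\<^sup>2 / 2))"
        using l C(1)[of i] by (intro mult_right_mono mult_left_mono power_increasing) auto
      with C(2)[OF l, of z i] show "\<bar>z $ i\<bar> ^ A * ?f \<le> C i * (1 + \<mu>) ^ m * exp (- (\<mu> * r\<^sup>2 / 2))" by linarith
    qed simp
    also have "(\<Sum>i\<in>UNIV. C i * (1 + \<mu>) ^ m * exp (- (\<mu> * r\<^sup>2 / 2))) = (\<Sum>i\<in>UNIV. C i) * ((1 + \<mu>) ^ m * exp (- (\<mu> * r\<^sup>2 / 2)))"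
      by (simp add: sum_distrib_right mult.assoc)
    finally show ?thesis by (simp only: mult.assoc)
  qed
  moreover have "real CARD('d) ^ A * (\<Sum>i\<in>UNIV. C i) > 0" using C(1) by (intro mult_pos_pos sum_pos) auto
  ultimately show ?thesis by (intro exI[of _ "real CARD('d) ^ A * (\<Sum>i\<in>UNIV. C i)"] exI[of _ m] conjI allI impI)
qed

section \<open>Littlewood-Paley blocks of Gaussians\<close>

lemma smooth_fun_dilate:
  assumes f: "smooth_fun f"
  shows "smooth_fun (\<lambda>x. f (c *\<^sub>R x))"
proof (rule smooth_fun_coinduct)
  let ?S = "{\<lambda>x. g (c *\<^sub>R x) | g. smooth_fun g}"
  show "(\<lambda>x. f (c *\<^sub>R x)) \<in> ?S" using f by blast
  fix u assume "u \<in> ?S"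
  then obtain g where g: "smooth_fun g" "u = (\<lambda>x. g (c *\<^sub>R x))" by blast
  have d: "\<exists>g'. (g has_derivative g') (at (c *\<^sub>R x)) \<and> (u has_derivative (\<lambda>v. g' (c *\<^sub>R v))) (at x)" for x
  proof -
    obtain g' where g': "(g has_derivative g') (at (c *\<^sub>R x))"
      using smooth_fun_differentiable[OF g(1), of "c *\<^sub>R x"] by (auto simp: differentiable_def)
    have "((\<lambda>x. c *\<^sub>R x) has_derivative (\<lambda>v. c *\<^sub>R v)) (at x)" by (auto intro!: derivative_eq_intros)
    from has_derivative_compose[OF this g'] g' show ?thesis unfolding g(2) by blast
  qed
  then show "u differentiable at x" for x unfolding differentiable_def by blast
  have e: "partial_deriv i u = (\<lambda>x. (\<lambda>y. c *\<^sub>R partial_deriv i g y) (c *\<^sub>R x))" for i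
  proof
    fix x
    obtain g' where g': "(g has_derivative g') (at (c *\<^sub>R x))" "(u has_derivative (\<lambda>v. g' (c *\<^sub>R v))) (at x)"
      using d by blast
    show "partial_deriv i u x = c *\<^sub>R partial_deriv i g (c *\<^sub>R x)"
      using has_derivative_bounded_linear[OF g'(1)]
      by (simp add: partial_deriv_has_derivative[OF g'(1)] partial_deriv_has_derivative[OF g'(2)] linear_simps)
  qed
  have "smooth_fun (\<lambda>y. c *\<^sub>R partial_deriv i g y)" for i
    by (intro smooth_fun_comp_linear[OF bounded_linear_scaleR_right] smooth_fun_partial_deriv g)
  then show "partial_deriv i u \<in> ?S" for i
    unfolding e by (intro CollectI exI[of _ "\<lambda>y. c *\<^sub>R partial_deriv i g y"] conjI refl)
qed

lemma test_functions_dilate: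
  fixes f :: "real ^ 'd::finite \<Rightarrow> 'b::real_normed_vector"
  assumes f: "f \<in> test_functions UNIV" and c: "c \<noteq> 0"
  shows "(\<lambda>x. f (c *\<^sub>R x)) \<in> test_functions UNIV"
proof -
  from f obtain K where K: "smooth_fun f" "compact K" "\<forall>x. x \<notin> K \<longrightarrow> f x = 0"
    unfolding test_functions_iff by auto
  have "f (c *\<^sub>R x) = 0" if "x \<notin> (\<lambda>x. (1 / c) *\<^sub>R x) ` K" for x
  proof -
    have "x = (1 / c) *\<^sub>R (c *\<^sub>R x)" using c by simp
    with that have "c *\<^sub>R x \<notin> K" by blast
    with K(3) show ?thesis by blast
  qed
  then show ?thesis unfolding test_functions_iff
    using smooth_fun_dilate[OF K(1), of c] compact_scaling[OF K(2), of "1 / c"] by blast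
qed

text \<open>All symbols with \<open>j \<ge> 1\<close> are dilates of a single profile, so estimates
  are made for two profiles only. The difference is written as a sum to fit the closure of test
  functions under addition.\<close>

definition base_symbol :: "(real ^ 'd::finite \<Rightarrow> complex) \<Rightarrow> nat \<Rightarrow> real ^ 'd \<Rightarrow> complex"
  where "base_symbol \<theta> j = (if j = 0 then \<theta> else (\<lambda>\<eta>. \<theta> \<eta> + (-1) * \<theta> (2 *\<^sub>R \<eta>)))"

lemma LP_symbol_base: "LP_symbol \<theta> j \<xi> = base_symbol \<theta> j ((1 / 2 ^ j) *\<^sub>R \<xi>)"
proof (cases j)
  case (Suc n)
  have 1: "(1 / 2 ^ Suc n) *\<^sub>R \<xi> = \<xi> /\<^sub>R 2 ^ Suc n"
    by (simp only: divide_inverse mult_1_left)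
  have 2: "2 *\<^sub>R (\<xi> /\<^sub>R 2 ^ Suc n) = \<xi> /\<^sub>R 2 ^ n" by simp
  have "base_symbol \<theta> (Suc n) (\<xi> /\<^sub>R 2 ^ Suc n) = \<theta> (\<xi> /\<^sub>R 2 ^ Suc n) + (-1) * \<theta> (2 *\<^sub>R (\<xi> /\<^sub>R 2 ^ Suc n))"
    unfolding base_symbol_def by (simp only: nat.distinct if_False)
  then show ?thesis unfolding Suc 1 2 LP_symbol.simps by (simp only: mult_minus1 diff_conv_add_uminus)
qed (simp add: base_symbol_def)

lemma test_functions_base_symbol:
  assumes "\<theta> \<in> test_functions UNIV"
  shows "base_symbol \<theta> j \<in> test_functions UNIV"
proof (cases "j = 0")
  case False
  have "(\<lambda>\<eta>. \<theta> (2 *\<^sub>R \<eta>)) \<in> test_functions UNIV"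
    by (rule test_functions_dilate[OF assms]) simp
  then have "(\<lambda>\<eta>. (-1) * \<theta> (2 *\<^sub>R \<eta>)) \<in> test_functions UNIV"
    by (rule test_functions_comp_linear[OF bounded_linear_mult_right])
  from test_functions_add[OF assms this] False show ?thesis unfolding base_symbol_def by simp
next
  case True
  with assms show ?thesis unfolding base_symbol_def by simp
qed

lemma integrable_gaussian_bump:
  assumes h: "h > 0"
  shows "integrable lborel (\<lambda>x::real ^ 'd::finite. A * exp (- ((norm (x - x0))\<^sup>2 / (2 * h\<^sup>2))))"
proof -
  have "1 / h\<^sup>2 > 0" using h by simp
  from integrable_gauss[OF this, where 'd = 'd]
  have "integrable lborel (\<lambda>u::real^'d. exp (- ((norm u)\<^sup>2 / (2 * h\<^sup>2))))" by (simp add: mult.commute)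
  then have "integrable lborel (\<lambda>x::real^'d. exp (- ((norm (- x0 + x))\<^sup>2 / (2 * h\<^sup>2))))"
    by (subst integrable_translate_lborel[of "\<lambda>u. exp (- ((norm u)\<^sup>2 / (2 * h\<^sup>2)))" "- x0"]) auto
  then show ?thesis by simp
qed

text \<open>Kernel and Gaussian are both Fourier integrals. After exchanging them and rescaling
  frequencies by \<open>2 ^ j\<close>, scale and width enter the Gaussian only through
  \<open>2 ^ j * h\<close>; what else depends on them is the prefactor and the dilation of the
  argument.\<close>

lemma LP_block_gauss:
  fixes \<theta> :: "real ^ 'd::finite \<Rightarrow> complex"
  assumes \<theta>: "\<theta> \<in> test_functions UNIV" and h: "h > 0"
  shows "LP_block \<theta> j (function_distribution (\<lambda>x. A * exp (- ((norm (x - x0))\<^sup>2 / (2 * h\<^sup>2))))) x =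
    complex_of_real (A * h ^ CARD('d) * (2 ^ j) ^ CARD('d) / sqrt (2 * pi) ^ CARD('d)) *
      ft (\<lambda>\<eta>. base_symbol \<theta> j \<eta> * gauss ((2 ^ j * h)\<^sup>2) \<eta>) ((2 ^ j) *\<^sub>R (x - x0))"
proof -
  let ?d = "CARD('d)"
  let ?f = "\<lambda>x. A * exp (- ((norm (x - x0))\<^sup>2 / (2 * h\<^sup>2)))"
  let ?fc = "\<lambda>x. complex_of_real (?f x)"
  define sy where "sy = LP_symbol \<theta> j"
  have "(\<lambda>\<xi>. base_symbol \<theta> j ((1 / 2 ^ j) *\<^sub>R \<xi>)) \<in> test_functions UNIV"
    by (intro test_functions_dilate test_functions_base_symbol \<theta>) simp
  then have sy: "sy \<in> test_functions UNIV" by (simp only: sy_def LP_symbol_base[abs_def])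
  note [measurable] = test_functions_borel[OF sy] test_functions_borel[OF test_functions_base_symbol[OF \<theta>]]
  have ah: "1 / h\<^sup>2 > 0" using h by simp
  have fi: "integrable lborel ?fc"
    using integrable_gaussian_bump[OF h, of A x0] by (simp add: complex_of_real_integrable_eq del: of_real_mult)
  have kern: "LP_kernel \<theta> j z = ft sy z / complex_of_real ((2 * pi) ^ ?d)" for z
  proof -
    have "(LINT \<xi>|lebesgue. sy \<xi> * cis (z \<bullet> \<xi>)) = (\<integral>\<xi>. sy \<xi> * cis (z \<bullet> \<xi>) \<partial>lborel)"
      by (rule integral_completion) measurable
    then show ?thesis unfolding LP_kernel_def ft_def sy_def by (simp add: inner_commute)
  qed
  have inner: "(\<integral>y. ?fc y * cis (\<xi> \<bullet> (x - y)) \<partial>lborel) =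
      complex_of_real (A * (sqrt (2 * pi) * h) ^ ?d) * (gauss (h\<^sup>2) \<xi> * cis (\<xi> \<bullet> (x - x0)))" for \<xi>
  proof -
    have "(\<integral>y. ?fc y * cis (\<xi> \<bullet> (x - y)) \<partial>lborel) = (\<integral>u. ?fc (x0 + u) * cis (\<xi> \<bullet> (x - (x0 + u))) \<partial>lborel)"
      by (rule integral_translate_lborel[symmetric]) measurable
    also have "\<dots> = (\<integral>u. (complex_of_real A * cis (\<xi> \<bullet> (x - x0))) * (complex_of_real (exp (- ((1 / h\<^sup>2) * (norm u)\<^sup>2 / 2))) * cis (u \<bullet> (- \<xi>))) \<partial>lborel)"
    proof (intro Bochner_Integration.integral_cong refl)
      fix u :: "real^'d"
      have "\<xi> \<bullet> (x - (x0 + u)) = \<xi> \<bullet> (x - x0) + u \<bullet> (- \<xi>)"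
        by (simp add: inner_diff_right inner_add_right inner_commute)
      then have "cis (\<xi> \<bullet> (x - (x0 + u))) = cis (\<xi> \<bullet> (x - x0)) * cis (u \<bullet> (- \<xi>))"
        by (simp only: cis_mult)
      then show "?fc (x0 + u) * cis (\<xi> \<bullet> (x - (x0 + u))) = (complex_of_real A * cis (\<xi> \<bullet> (x - x0))) * (complex_of_real (exp (- ((1 / h\<^sup>2) * (norm u)\<^sup>2 / 2))) * cis (u \<bullet> (- \<xi>)))"
        by (simp add: mult_ac)
    qed
    also have "\<dots> = (complex_of_real A * cis (\<xi> \<bullet> (x - x0))) * ft (\<lambda>u. complex_of_real (exp (- ((1 / h\<^sup>2) * (norm u)\<^sup>2 / 2)))) (- \<xi>)"
      unfolding ft_def by (rule integral_mult_right_zero)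
    also have "\<dots> = (complex_of_real A * cis (\<xi> \<bullet> (x - x0))) * complex_of_real ((sqrt (2 * pi) * h) ^ ?d * exp (- (h\<^sup>2 * (norm \<xi>)\<^sup>2 / 2)))"
      unfolding ft_gauss[OF ah] using h by (simp add: real_sqrt_mult mult.commute)
    finally show ?thesis by (simp add: gauss_def mult_ac)
  qed
  have "LP_block \<theta> j (function_distribution ?f) x = (\<integral>y. ?fc y * (ft sy (x - y) / complex_of_real ((2 * pi) ^ ?d)) \<partial>lebesgue)"
    unfolding LP_block_def function_distribution_def kern ..
  also have "\<dots> = (\<integral>y. ?fc y * (ft sy (x - y) / complex_of_real ((2 * pi) ^ ?d)) \<partial>lborel)"
    by (rule integral_completion) measurable
  also have "\<dots> = (\<integral>y. ?fc y * (\<integral>\<xi>. sy \<xi> * cis (\<xi> \<bullet> (x - y)) \<partial>lborel) \<partial>lborel) / complex_of_real ((2 * pi) ^ ?d)"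
    unfolding ft_def times_divide_eq_right integral_divide_zero ..
  also have "(\<integral>y. ?fc y * (\<integral>\<xi>. sy \<xi> * cis (\<xi> \<bullet> (x - y)) \<partial>lborel) \<partial>lborel) =
      (\<integral>\<xi>. sy \<xi> * (\<integral>y. ?fc y * cis (\<xi> \<bullet> (x - y)) \<partial>lborel) \<partial>lborel)"
    by (rule lborel_pair.Fubini_kernel(1)[OF fi test_functions_integrable[OF sy]]) auto
  also have "(\<integral>\<xi>. sy \<xi> * (\<integral>y. ?fc y * cis (\<xi> \<bullet> (x - y)) \<partial>lborel) \<partial>lborel) =
      complex_of_real (A * (sqrt (2 * pi) * h) ^ ?d) * (\<integral>\<xi>. sy \<xi> * gauss (h\<^sup>2) \<xi> * cis (\<xi> \<bullet> (x - x0)) \<partial>lborel)"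
    unfolding inner by (subst integral_mult_right_zero[symmetric]) (simp add: mult_ac)
  also have "(\<integral>\<xi>. sy \<xi> * gauss (h\<^sup>2) \<xi> * cis (\<xi> \<bullet> (x - x0)) \<partial>lborel) =
      (2 ^ j) ^ ?d *\<^sub>R (\<integral>\<eta>. sy (0 + (2 ^ j) *\<^sub>R \<eta>) * gauss (h\<^sup>2) (0 + (2 ^ j) *\<^sub>R \<eta>) * cis ((0 + (2 ^ j) *\<^sub>R \<eta>) \<bullet> (x - x0)) \<partial>lborel)"
    by (subst integral_affine_lborel[of _ "2 ^ j" 0]) auto
  also have "(\<integral>\<eta>. sy (0 + (2 ^ j) *\<^sub>R \<eta>) * gauss (h\<^sup>2) (0 + (2 ^ j) *\<^sub>R \<eta>) * cis ((0 + (2 ^ j) *\<^sub>R \<eta>) \<bullet> (x - x0)) \<partial>lborel) =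
      ft (\<lambda>\<eta>. base_symbol \<theta> j \<eta> * gauss ((2 ^ j * h)\<^sup>2) \<eta>) ((2 ^ j) *\<^sub>R (x - x0))"
    unfolding ft_def sy_def LP_symbol_base by (simp add: gauss_def power_mult_distrib mult_ac)
  finally have fin: "LP_block \<theta> j (function_distribution ?f) x =
     complex_of_real (A * (sqrt (2 * pi) * h) ^ ?d) * ((2 ^ j) ^ ?d *\<^sub>R ft (\<lambda>\<eta>. base_symbol \<theta> j \<eta> * gauss ((2 ^ j * h)\<^sup>2) \<eta>) ((2 ^ j) *\<^sub>R (x - x0))) / complex_of_real ((2 * pi) ^ ?d)" .
  have two: "(2 * pi) ^ ?d = sqrt (2 * pi) ^ ?d * sqrt (2 * pi) ^ ?d"
    unfolding power_mult_distrib[of "sqrt (2 * pi)" "sqrt (2 * pi)", symmetric] by simp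
  show ?thesis unfolding fin two by (simp add: scaleR_conv_of_real power_mult_distrib)
qed

text \<open>From \<open>t \<le> 1 + t^2 = u\<close> and \<open>x \<le> exp x\<close> at
  \<open>x = c * u / N\<close>, raised to a power \<open>N\<close> that exceeds the total degree
  \<open>a + n\<close> in \<open>u\<close>.\<close>

lemma poly_times_gauss_bounded:
  assumes c: "c > 0"
  shows "\<exists>D>0. \<forall>t\<ge>0. t ^ a * (1 + t\<^sup>2) ^ n * exp (- (c * t\<^sup>2)) \<le> (D::real)"
proof -
  define N where "N = a + n + 1"
  have N: "real N > 0" by (simp add: N_def)
  have "t ^ a * (1 + t\<^sup>2) ^ n * exp (- (c * t\<^sup>2)) \<le> (real N / c) ^ N * exp c" if t: "t \<ge> 0" for t
  proof -
    define u where "u = 1 + t\<^sup>2"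
    have u: "u \<ge> 1" by (simp add: u_def)
    have "0 \<le> (t - 1)\<^sup>2" by simp
    then have tu: "t \<le> u" using t by (simp add: u_def power2_eq_square algebra_simps)
    have "t ^ a * u ^ n \<le> u ^ a * u ^ n" using t tu u by (intro mult_right_mono power_mono) auto
    also have "\<dots> = u ^ (a + n)" by (simp add: power_add)
    also have "\<dots> \<le> u ^ N" using u by (intro power_increasing) (auto simp: N_def)
    also have "u ^ N = (real N / c) ^ N * (c * u / real N) ^ N" using c N by (simp add: power_mult_distrib[symmetric])
    also have "\<dots> \<le> (real N / c) ^ N * exp (c * u / real N) ^ N"
    proof (intro mult_left_mono power_mono)
      show "c * u / real N \<le> exp (c * u / real N)" using exp_ge_add_one_self[of "c * u / real N"] by linarith
    qed (use c u in auto)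
    also have "exp (c * u / real N) ^ N = exp (c * u)" using N by (simp add: exp_of_nat_mult[symmetric])
    finally have "t ^ a * u ^ n * exp (- (c * t\<^sup>2)) \<le> (real N / c) ^ N * exp (c * u) * exp (- (c * t\<^sup>2))"
      by (intro mult_right_mono) auto
    also have "\<dots> = (real N / c) ^ N * exp c" by (simp add: u_def exp_add[symmetric] distrib_left mult.assoc)
    finally show ?thesis by (simp add: u_def)
  qed
  moreover have "(real N / c) ^ N * exp c > 0" using N c by simp
  ultimately show ?thesis by blast
qed

text \<open>The minimum peaks where \<open>2 ^ j\<close> is closest to \<open>1 / h\<close> and
  falls off geometrically on both sides, so two geometric series bound the sum wherever the peak
  lies.\<close>

lemma dyadic_min_sum:
  assumes q: "q > 0"
  shows "\<exists>C>0. \<forall>h. 0 < h \<and> h \<le> 1 \<longrightarrow> (\<Sum>j. ennreal (min (2 ^ j * h) (1 / (2 ^ j * h)) powr q)) \<le> ennreal C"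
proof -
  define a where "a = (1 / 2) powr q"
  have a: "0 < a" "a < 1" using gr_one_powr[of 2 q] q by (auto simp: a_def powr_divide)
  define C where "C = 2 powr q * (2 / (1 - a))"
  have "(\<Sum>j. ennreal (min (2 ^ j * h) (1 / (2 ^ j * h)) powr q)) \<le> ennreal C" if h: "0 < h" "h \<le> 1" for h
  proof -
    obtain n0 where "1 / h < 2 ^ n0" using real_arch_pow[of 2 "1 / h"] by auto
    then have ex: "1 < 2 ^ n0 * h" using h by (simp add: pos_divide_less_eq)
    \<comment> \<open>\<open>J = L - 1\<close> is the last index with
      \<open>2 ^ J * h \<le> 1\<close>. The factor \<open>2 powr q\<close> in \<open>u\<close> below
      pays for the gap between \<open>2 ^ J\<close> and \<open>1 / h\<close>.\<close>
    define L where "L = (LEAST n. 1 < 2 ^ n * h)"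
    have L: "1 < 2 ^ L * h" unfolding L_def by (rule LeastI[of "\<lambda>n. 1 < 2 ^ n * h", OF ex])
    have "L \<noteq> 0" using L h by (intro notI) simp
    then obtain J where J: "L = Suc J" using not0_implies_Suc by blast
    have J1: "2 ^ J * h \<le> 1" using not_less_Least[of J "\<lambda>n. 1 < 2 ^ n * h"] J by (simp add: L_def not_less)
    have hJ: "h \<le> 1 / 2 ^ J" using J1 by (simp add: pos_le_divide_eq mult.commute)
    have hL: "1 / h \<le> 2 * 2 ^ J" using L J h by (simp add: pos_divide_le_eq mult_ac)
    have apow: "a ^ i = (1 / 2 ^ i) powr q" for i
    proof -
      have "(1 / 2 ^ i) powr q = ((1 / 2) powr real i) powr q" by (simp add: powr_realpow power_one_over)
      also have "\<dots> = (1 / 2) powr (q * real i)" by (simp only: powr_powr mult.commute)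
      also have "\<dots> = a powr real i" by (simp only: a_def powr_powr)
      also have "\<dots> = a ^ i" using a by (simp add: powr_realpow)
      finally show ?thesis ..
    qed
    define u where "u j = 2 powr q * (if j \<le> J then a ^ (J - j) else a ^ (j - J))" for j
    have le: "min (2 ^ j * h) (1 / (2 ^ j * h)) powr q \<le> u j" for j
    proof (cases "j \<le> J")
      case True
      have "2 ^ j * h \<le> 2 ^ j * (1 / 2 ^ J)" using hJ by (intro mult_left_mono) auto
      also have "\<dots> = 1 / 2 ^ (J - j)" using True by (simp add: power_diff)
      finally have "min (2 ^ j * h) (1 / (2 ^ j * h)) \<le> 1 / 2 ^ (J - j)" by linarith
      then have "min (2 ^ j * h) (1 / (2 ^ j * h)) powr q \<le> (1 / 2 ^ (J - j)) powr q"
        using h q by (intro powr_mono2) auto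
      also have "\<dots> = 1 * a ^ (J - j)" by (simp add: apow)
      also have "\<dots> \<le> 2 powr q * a ^ (J - j)" using q a by (intro mult_right_mono ge_one_powr_ge_zero) auto
      finally show ?thesis using True by (simp add: u_def)
    next
      case False
      have "1 / (2 ^ j * h) = (1 / 2 ^ j) * (1 / h)" by simp
      also have "\<dots> \<le> (1 / 2 ^ j) * (2 * 2 ^ J)" using hL by (intro mult_left_mono) auto
      also have "\<dots> = 2 * (1 / 2 ^ (j - J))" using False by (simp add: power_diff)
      finally have "min (2 ^ j * h) (1 / (2 ^ j * h)) \<le> 2 * (1 / 2 ^ (j - J))" by linarith
      then have "min (2 ^ j * h) (1 / (2 ^ j * h)) powr q \<le> (2 * (1 / 2 ^ (j - J))) powr q"
        using h q by (intro powr_mono2) auto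
      also have "\<dots> = 2 powr q * a ^ (j - J)" unfolding apow by (subst powr_mult) auto
      finally show ?thesis using False by (simp add: u_def)
    qed
    have geo: "(\<Sum>i\<in>I. a ^ i) \<le> 1 / (1 - a)" if "finite I" for I :: "nat set"
      using sum_le_suminf[of "\<lambda>i. a ^ i" I] that a by (simp add: suminf_geometric summable_geometric)
    have fin: "(\<Sum>j<n. u j) \<le> C" for n
    proof -
      have "(\<Sum>j<n. if j \<le> J then a ^ (J - j) else a ^ (j - J)) = (\<Sum>j\<in>{..<n} \<inter> {..J}. a ^ (J - j)) + (\<Sum>j\<in>{..<n} \<inter> - {..J}. a ^ (j - J))"
        by (subst sum.If_cases) (auto simp: atMost_def)
      also have "(\<Sum>j\<in>{..<n} \<inter> {..J}. a ^ (J - j)) = (\<Sum>i\<in>(\<lambda>j. J - j) ` ({..<n} \<inter> {..J}). a ^ i)"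
        by (subst sum.reindex) (auto simp: inj_on_def)
      also have "(\<Sum>j\<in>{..<n} \<inter> - {..J}. a ^ (j - J)) = (\<Sum>i\<in>(\<lambda>j. j - J) ` ({..<n} \<inter> - {..J}). a ^ i)"
        by (subst sum.reindex) (auto simp: inj_on_def)
      also have "(\<Sum>i\<in>(\<lambda>j. J - j) ` ({..<n} \<inter> {..J}). a ^ i) + (\<Sum>i\<in>(\<lambda>j. j - J) ` ({..<n} \<inter> - {..J}). a ^ i) \<le> 1 / (1 - a) + 1 / (1 - a)"
        by (intro add_mono geo) auto
      finally show ?thesis
        unfolding u_def C_def sum_distrib_left[symmetric] by (intro mult_left_mono) auto
    qed
    have u0: "0 \<le> u j" for j using a by (simp add: u_def)
    have "(\<Sum>j. ennreal (min (2 ^ j * h) (1 / (2 ^ j * h)) powr q)) \<le> (\<Sum>j. ennreal (u j))"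
      by (intro suminf_le ennreal_leI le) auto
    also have "\<dots> \<le> ennreal C"
    proof (rule suminf_le_const)
      fix n show "(\<Sum>j<n. ennreal (u j)) \<le> ennreal C"
        using fin[of n] u0 by (simp add: sum_ennreal ennreal_leI)
    qed simp
    finally show ?thesis .
  qed
  moreover have "C > 0" using a by (simp add: C_def)
  ultimately show ?thesis by blast
qed

text \<open>A small \<open>p\<close> weakens decay, so the number \<open>M\<close> of derivatives is
  at least \<open>2 * d / p\<close>: then the \<open>p\<close>-th power still decays like
  \<open>norm z powr (- 2 * d)\<close> and \<open>decay_weight\<close> dominates it.\<close>

lemma ft_gauss_powr_le:
  assumes s: "s \<in> test_functions UNIV" and z: "\<And>\<eta>. norm \<eta> < r \<Longrightarrow> s \<eta> = 0" and r: "r \<ge> 0" and p: "p > 0"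
  shows "\<exists>C n. C > 0 \<and> (\<forall>\<mu>\<ge>0. \<forall>z :: real ^ 'd::finite.
    norm (ft (\<lambda>\<eta>. s \<eta> * gauss \<mu> \<eta>) z) powr p
      \<le> (C * (1 + \<mu>) ^ n * exp (- (\<mu> * r\<^sup>2 / 2))) powr p * (2 ^ CARD('d) * decay_weight z))"
proof -
  define M where "M = nat \<lceil>2 * real CARD('d) / p\<rceil>"
  have M: "2 * real CARD('d) \<le> real M * p"
    using real_nat_ceiling_ge[of "2 * real CARD('d) / p"] p unfolding M_def[symmetric] by (simp only: pos_divide_le_eq)
  obtain C0 n0 where 0: "C0 > 0"
    "\<And>\<mu> z. \<mu> \<ge> 0 \<Longrightarrow> norm z ^ 0 * norm (ft (\<lambda>\<eta>. s \<eta> * gauss \<mu> \<eta>) z) \<le> C0 * (1 + \<mu>) ^ n0 * exp (- (\<mu> * r\<^sup>2 / 2))"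
    using ft_gauss_decay[OF s z r, of 0] by auto
  obtain C1 n1 where 1: "C1 > 0"
    "\<And>\<mu> z. \<mu> \<ge> 0 \<Longrightarrow> norm z ^ M * norm (ft (\<lambda>\<eta>. s \<eta> * gauss \<mu> \<eta>) z) \<le> C1 * (1 + \<mu>) ^ n1 * exp (- (\<mu> * r\<^sup>2 / 2))"
    using ft_gauss_decay[OF s z r, of M] by auto
  define n where "n = max n0 n1"
  have "norm (ft (\<lambda>\<eta>. s \<eta> * gauss \<mu> \<eta>) z) powr p
      \<le> ((C0 + C1) * (1 + \<mu>) ^ n * exp (- (\<mu> * r\<^sup>2 / 2))) powr p * (2 ^ CARD('d) * decay_weight z)"
    if m: "\<mu> \<ge> 0" for \<mu> and z :: "real^'d"
  proof -
    define b where "b = (C0 + C1) * (1 + \<mu>) ^ n * exp (- (\<mu> * r\<^sup>2 / 2))"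
    define u where "u = norm (ft (\<lambda>\<eta>. s \<eta> * gauss \<mu> \<eta>) z)"
    have u0: "u \<ge> 0" by (simp add: u_def)
    have "C0 * (1 + \<mu>) ^ n0 * exp (- (\<mu> * r\<^sup>2 / 2)) \<le> b"
      unfolding b_def using m 0(1) 1(1) by (intro mult_mono power_increasing) (auto simp: n_def)
    with 0(2)[OF m, of z] have b0: "u \<le> b" by (simp add: u_def)
    have "C1 * (1 + \<mu>) ^ n1 * exp (- (\<mu> * r\<^sup>2 / 2)) \<le> b"
      unfolding b_def using m 0(1) 1(1) by (intro mult_mono power_increasing) (auto simp: n_def)
    with 1(2)[OF m, of z] have b1: "norm z ^ M * u \<le> b" by (simp add: u_def)
    have l0: "u powr p \<le> b powr p" using b0 u0 p by (intro powr_mono2) auto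
    have "norm z ^ (2 * CARD('d)) * u powr p \<le> b powr p"
    proof (cases "norm z \<le> 1")
      case True
      then have "norm z ^ (2 * CARD('d)) * u powr p \<le> 1 * u powr p"
        by (intro mult_right_mono power_le_one) auto
      with l0 show ?thesis by simp
    next
      case False
      then have "norm z ^ (2 * CARD('d)) = norm z powr (2 * real CARD('d))"
        by (subst powr_realpow[symmetric]) auto
      also have "\<dots> \<le> norm z powr (real M * p)" using False M by (intro powr_mono) auto
      also have "\<dots> = (norm z ^ M) powr p" using False
        by (subst powr_powr[symmetric], subst powr_realpow) auto
      finally have "norm z ^ (2 * CARD('d)) * u powr p \<le> (norm z ^ M) powr p * u powr p"
        by (intro mult_right_mono) auto
      also have "\<dots> = (norm z ^ M * u) powr p" using u0 by (subst powr_mult) auto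
      also have "\<dots> \<le> b powr p" using b1 u0 p by (intro powr_mono2) auto
      finally show ?thesis .
    qed
    from le_decay_weight[OF _ l0 this] show ?thesis unfolding b_def u_def by simp
  qed
  then show ?thesis using 0(1) 1(1) by (intro exI[of _ "C0 + C1"] exI[of _ n]) auto
qed

text \<open>Scaling: \<open>2 powr (j * (k + d / p))\<close> from the weight,
  \<open>A * h ^ d * 2 ^ (j * d)\<close> from the block and \<open>2 powr (- j * d / p)\<close> from
  the dilation in \<open>L^p\<close> combine to \<open>A / h ^ k * (2 ^ j * h) ^ (d + k)\<close>,
  and the powers with \<open>d / p\<close> cancel. \<open>C\<close> and \<open>n\<close> are fixed
  before \<open>j\<close>; \<open>s\<close> stands for one of the two profiles.\<close>

lemma LP_block_gauss_Lp_le: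
  fixes \<theta> :: "real ^ 'd::finite \<Rightarrow> complex"
  assumes \<theta>: "\<theta> \<in> test_functions UNIV" and s: "\<And>\<eta>. norm \<eta> < r \<Longrightarrow> s \<eta> = 0" and r: "r \<ge> 0" and p: "p > 0"
    and st: "s \<in> test_functions UNIV"
  shows "\<exists>C n. C > 0 \<and> (\<forall>j h A x0. base_symbol \<theta> j = s \<longrightarrow> h > 0 \<longrightarrow> A \<ge> 0 \<longrightarrow>
    ennreal (2 powr (real j * (real k + real CARD('d) / p))) *
      Lp_qnorm p UNIV (LP_block \<theta> j (function_distribution (\<lambda>x. A * exp (- ((norm (x - x0))\<^sup>2 / (2 * h\<^sup>2))))))
    \<le> ennreal (A / h ^ k * (C * ((2 ^ j * h) ^ (CARD('d) + k) * (1 + (2 ^ j * h)\<^sup>2) ^ n * exp (- (r\<^sup>2 / 2 * (2 ^ j * h)\<^sup>2))))))"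
proof -
  let ?d = "CARD('d)"
  obtain C n where C: "C > 0" "\<And>\<mu> z. \<mu> \<ge> 0 \<Longrightarrow> norm (ft (\<lambda>\<eta>. s \<eta> * gauss \<mu> \<eta>) z) powr p
      \<le> (C * (1 + \<mu>) ^ n * exp (- (\<mu> * r\<^sup>2 / 2))) powr p * (2 ^ ?d * decay_weight (z :: real^'d))"
    using ft_gauss_powr_le[OF st s r p] by blast
  define W where "W = (\<integral>z. decay_weight (z :: real^'d) \<partial>lborel)"
  have W: "W > 0" unfolding W_def by (rule decay_weight_integral_pos)
  define Q where "Q = (2 ^ ?d * W) powr (1 / p)"
  have Q: "Q > 0" using W by (simp add: Q_def)
  define C' where "C' = C * Q / sqrt (2 * pi) ^ ?d"
  have C'0: "C' > 0" using C Q by (simp add: C'_def)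
  have "ennreal (2 powr (real j * (real k + real ?d / p))) *
      Lp_qnorm p UNIV (LP_block \<theta> j (function_distribution (\<lambda>x. A * exp (- ((norm (x - x0))\<^sup>2 / (2 * h\<^sup>2))))))
    \<le> ennreal (A / h ^ k * (C' * ((2 ^ j * h) ^ (?d + k) * (1 + (2 ^ j * h)\<^sup>2) ^ n * exp (- (r\<^sup>2 / 2 * (2 ^ j * h)\<^sup>2)))))"
    if bs: "base_symbol \<theta> j = s" and h: "h > 0" and A: "A \<ge> 0" for j h A and x0 :: "real^'d"
  proof -
    let ?f = "\<lambda>x::real^'d. A * exp (- ((norm (x - x0))\<^sup>2 / (2 * h\<^sup>2)))"
    define t where "t = 2 ^ j * h"
    define b where "b = C * (1 + t\<^sup>2) ^ n * exp (- (t\<^sup>2 * r\<^sup>2 / 2))"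
    define a where "a = A * h ^ ?d * (2 ^ j) ^ ?d / sqrt (2 * pi) ^ ?d"
    have a0: "a \<ge> 0" using A h by (simp add: a_def)
    have b0: "b \<ge> 0" using C by (simp add: b_def)
    define c :: real where "c = 2 ^ j"
    have c0: "c > 0" by (simp add: c_def)
    have pt: "norm (LP_block \<theta> j (function_distribution ?f) x) powr p \<le> (a * b) powr p * (2 ^ ?d * decay_weight (- (c *\<^sub>R x0) + c *\<^sub>R x))" for x
    proof -
      have eq: "LP_block \<theta> j (function_distribution ?f) x = complex_of_real a * ft (\<lambda>\<eta>. s \<eta> * gauss (t\<^sup>2) \<eta>) (c *\<^sub>R (x - x0))"
        unfolding LP_block_gauss[OF \<theta> h] a_def bs t_def c_def ..
      have "norm (LP_block \<theta> j (function_distribution ?f) x) powr p = a powr p * norm (ft (\<lambda>\<eta>. s \<eta> * gauss (t\<^sup>2) \<eta>) (c *\<^sub>R (x - x0))) powr p"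
        unfolding eq norm_mult using a0 by (simp add: powr_mult)
      also have "\<dots> \<le> a powr p * (b powr p * (2 ^ ?d * decay_weight (c *\<^sub>R (x - x0))))"
        unfolding b_def by (intro mult_left_mono C(2)) auto
      also have "\<dots> = (a * b) powr p * (2 ^ ?d * decay_weight (c *\<^sub>R (x - x0)))"
        using a0 b0 by (simp add: powr_mult)
      finally show ?thesis by (simp add: scaleR_diff_right)
    qed
    have dw: "(\<integral>\<^sup>+x. ennreal (decay_weight (- (c *\<^sub>R x0) + c *\<^sub>R x)) \<partial>lborel) = ennreal (W / c ^ ?d)"
    proof -
      have "ennreal W = (\<integral>\<^sup>+z. ennreal (decay_weight (z::real^'d)) \<partial>lborel)"
        unfolding W_def by (rule nn_integral_eq_integral[symmetric, OF integrable_decay_weight])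
          (simp add: decay_weight_pos less_imp_le)
      also have "\<dots> = ennreal (c ^ ?d) * (\<integral>\<^sup>+x. ennreal (decay_weight (- (c *\<^sub>R x0) + c *\<^sub>R x)) \<partial>lborel)"
        by (subst nn_integral_affine_lborel[of _ c "- (c *\<^sub>R x0)"]) (use c0 in auto)
      finally have "ennreal W = ennreal (c ^ ?d) * (\<integral>\<^sup>+x. ennreal (decay_weight (- (c *\<^sub>R x0) + c *\<^sub>R x)) \<partial>lborel)" .
      then have "ennreal (1 / c ^ ?d) * ennreal W = (ennreal (1 / c ^ ?d) * ennreal (c ^ ?d)) * (\<integral>\<^sup>+x. ennreal (decay_weight (- (c *\<^sub>R x0) + c *\<^sub>R x)) \<partial>lborel)"
        by (simp add: mult.assoc)
      moreover have "ennreal (1 / c ^ ?d) * ennreal (c ^ ?d) = 1" using c0 by (subst ennreal_mult[symmetric]) auto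
      ultimately show ?thesis using c0 W by (simp add: ennreal_mult[symmetric])
    qed
    \<comment> \<open>The \<open>p\<close>-th root of the bound for the integral, arranged so that
      the dilation factor \<open>c powr (d / p)\<close> is visible.\<close>
    define B where "B = a * b * (Q / c powr (real ?d / p))"
    have B0: "B \<ge> 0" using a0 b0 Q by (simp add: B_def)
    have Bp: "B powr p = (a * b) powr p * 2 ^ ?d * (W / c ^ ?d)"
    proof -
      have "(Q / c powr (real ?d / p)) powr p = Q powr p / (c powr (real ?d / p)) powr p"
        using Q by (subst powr_divide) auto
      also have "\<dots> = 2 ^ ?d * W / c ^ ?d"
        using p W c0 by (simp add: Q_def powr_powr powr_realpow)
      finally have "(Q / c powr (real ?d / p)) powr p = 2 ^ ?d * W / c ^ ?d" .
      moreover have "B powr p = (a * b) powr p * (Q / c powr (real ?d / p)) powr p"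
        unfolding B_def using a0 b0 Q by (subst powr_mult) auto
      ultimately show ?thesis by simp
    qed
    have "(\<integral>\<^sup>+x. ennreal (norm (LP_block \<theta> j (function_distribution ?f) x) powr p) \<partial>lborel) \<le>
       (\<integral>\<^sup>+x. ennreal ((a * b) powr p * 2 ^ ?d) * ennreal (decay_weight (- (c *\<^sub>R x0) + c *\<^sub>R x)) \<partial>lborel)"
    proof (rule nn_integral_mono)
      fix x
      have "ennreal (norm (LP_block \<theta> j (function_distribution ?f) x) powr p) \<le> ennreal (((a * b) powr p * 2 ^ ?d) * decay_weight (- (c *\<^sub>R x0) + c *\<^sub>R x))"
        using pt[of x] by (intro ennreal_leI) (simp add: mult_ac)
      then show "ennreal (norm (LP_block \<theta> j (function_distribution ?f) x) powr p) \<le> ennreal ((a * b) powr p * 2 ^ ?d) * ennreal (decay_weight (- (c *\<^sub>R x0) + c *\<^sub>R x))"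
        by (subst ennreal_mult[symmetric]) (auto simp: decay_weight_pos less_imp_le)
    qed
    also have "\<dots> = ennreal ((a * b) powr p * 2 ^ ?d) * ennreal (W / c ^ ?d)"
      by (subst nn_integral_cmult) (use dw in auto)
    also have "\<dots> = ennreal (B powr p)"
      unfolding Bp using c0 W by (subst ennreal_mult[symmetric]) auto
    finally have "Lp_qnorm p UNIV (LP_block \<theta> j (function_distribution ?f)) \<le> ennreal B"
      by (rule Lp_qnorm_UNIV_le[OF p B0])
    then have "ennreal (2 powr (real j * (real k + real ?d / p))) * Lp_qnorm p UNIV (LP_block \<theta> j (function_distribution ?f))
       \<le> ennreal (2 powr (real j * (real k + real ?d / p))) * ennreal B"
      by (rule mult_left_mono) simp
    also have "\<dots> = ennreal (2 powr (real j * (real k + real ?d / p)) * B)"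
      using B0 by (simp add: ennreal_mult)
    also have "2 powr (real j * (real k + real ?d / p)) * B = A / h ^ k * (C' * (t ^ (?d + k) * (1 + t\<^sup>2) ^ n * exp (- (r\<^sup>2 / 2 * t\<^sup>2))))"
    proof -
      have cp: "c = 2 powr real j" by (simp add: c_def powr_realpow)
      have "2 powr (real j * (real k + real ?d / p)) = c powr (real k + real ?d / p)"
        unfolding cp by (simp add: powr_powr)
      also have "\<dots> = c ^ k * c powr (real ?d / p)" using c0 by (simp add: powr_add powr_realpow)
      finally have 1: "2 powr (real j * (real k + real ?d / p)) = c ^ k * c powr (real ?d / p)" .
      have 2: "c powr (real ?d / p) > 0" using c0 by simp
      have "2 powr (real j * (real k + real ?d / p)) * B = c ^ k * (a * b * Q)"
        unfolding 1 B_def using 2 by simp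
      moreover have "t = c * h" by (simp add: t_def c_def)
      ultimately show ?thesis
        unfolding a_def b_def C'_def c_def[symmetric] using h
        by (simp add: power_add power_mult_distrib mult_ac)
    qed
    finally show ?thesis unfolding t_def .
  qed
  then show ?thesis using C'0 by (intro exI[of _ C'] exI[of _ n]) auto
qed

text \<open>With \<open>t = 2 ^ j * h\<close>, block \<open>j\<close> contributes at most a multiple
  of \<open>A / h ^ k * min t (1 / t)\<close>: for small \<open>t\<close> by the power
  \<open>t ^ (d + k)\<close>, for large \<open>t\<close> because the profile vanishes near the
  origin and the Gaussian is tiny on its support. These values have summable powers, uniformly in
  \<open>h\<close>. The bump lives on the whole space, so it is its own extension from every
  \<open>\<Omega>\<close>.\<close>

lemma besov_norm_gaussian_bump_le:
  fixes \<theta> :: "real ^ 'd::finite \<Rightarrow> complex"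
  assumes \<theta>: "LP_generator \<theta>" and p: "p > 0" and q: "q > 0"
  shows "\<exists>C>0. \<forall>h A x0 \<Omega>. 0 < h \<and> h \<le> 1 \<and> A \<ge> 0 \<longrightarrow>
    besov_norm \<theta> (real k + real CARD('d) / p) p q \<Omega> (\<lambda>x. A * exp (- ((norm (x - x0))\<^sup>2 / (2 * h\<^sup>2))))
      \<le> ennreal (A / h ^ k * C)"
proof -
  let ?d = "CARD('d)"
  obtain r0 where \<theta>t: "\<theta> \<in> test_functions UNIV" and r0: "r0 > 0" "\<And>\<xi>. \<xi> \<in> ball 0 r0 \<Longrightarrow> \<theta> \<xi> = 1"
    using \<theta> unfolding LP_generator_def by blast
  \<comment> \<open>Both \<open>\<theta> \<eta>\<close> and
    \<open>\<theta> (2 *\<^sub>R \<eta>)\<close> equal 1 for \<open>norm \<eta> < r0 / 2\<close>, so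
    their difference vanishes there.\<close>
  define r where "r = r0 / 2"
  have r: "r > 0" using r0 by (simp add: r_def)
  have van: "base_symbol \<theta> 1 \<eta> = 0" if "norm \<eta> < r" for \<eta>
    using that r0 by (simp add: base_symbol_def r_def)
  define T where "T j h A x0 = ennreal (2 powr (real j * (real k + real ?d / p))) *
      Lp_qnorm p UNIV (LP_block \<theta> j (function_distribution (\<lambda>x. A * exp (- ((norm (x - x0))\<^sup>2 / (2 * h\<^sup>2))))))"
    for j and h A :: real and x0 :: "real^'d"
  \<comment> \<open>The profile for \<open>j = 0\<close> is 1 near the origin; it is treated with
    radius 0, for which the vanishing condition is vacuous. No Gaussian decay remains, but
    \<open>t = h \<le> 1\<close> in this block.\<close>
  have th0: "\<theta> \<eta> = 0" if "norm \<eta> < 0" for \<eta> using that by simp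
  have z: "(0::real) \<ge> 0" by simp
  obtain C0 n0 where C0: "C0 > 0" "\<And>j h A x0. base_symbol \<theta> j = \<theta> \<Longrightarrow> h > 0 \<Longrightarrow> A \<ge> 0 \<Longrightarrow>
      T j h A x0 \<le> ennreal (A / h ^ k * (C0 * ((2 ^ j * h) ^ (?d + k) * (1 + (2 ^ j * h)\<^sup>2) ^ n0 * exp (- (0\<^sup>2 / 2 * (2 ^ j * h)\<^sup>2)))))"
    using LP_block_gauss_Lp_le[OF \<theta>t th0 z p \<theta>t, of k] unfolding T_def by blast
  obtain C1 n1 where C1: "C1 > 0" "\<And>j h A x0. base_symbol \<theta> j = base_symbol \<theta> 1 \<Longrightarrow> h > 0 \<Longrightarrow> A \<ge> 0 \<Longrightarrow>
      T j h A x0 \<le> ennreal (A / h ^ k * (C1 * ((2 ^ j * h) ^ (?d + k) * (1 + (2 ^ j * h)\<^sup>2) ^ n1 * exp (- (r\<^sup>2 / 2 * (2 ^ j * h)\<^sup>2)))))"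
    using LP_block_gauss_Lp_le[OF \<theta>t van less_imp_le[OF r] p test_functions_base_symbol[OF \<theta>t], of k] unfolding T_def by blast
  have c: "r\<^sup>2 / 2 > 0" using r by simp
  \<comment> \<open>Exponents one below and one above \<open>d + k\<close>, to extract the factor
    \<open>t\<close> and the factor \<open>1 / t\<close>.\<close>
  obtain D1 where D1: "D1 > 0" "\<And>t. t \<ge> 0 \<Longrightarrow> t ^ (?d + k - 1) * (1 + t\<^sup>2) ^ n1 * exp (- (r\<^sup>2 / 2 * t\<^sup>2)) \<le> D1"
    using poly_times_gauss_bounded[OF c] by blast
  obtain D2 where D2: "D2 > 0" "\<And>t. t \<ge> 0 \<Longrightarrow> t ^ (?d + k + 1) * (1 + t\<^sup>2) ^ n1 * exp (- (r\<^sup>2 / 2 * t\<^sup>2)) \<le> D2"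
    using poly_times_gauss_bounded[OF c] by blast
  define D where "D = C0 * 2 ^ n0 + C1 * (D1 + D2)"
  have D: "D > 0" using C0 C1 D1 D2 by (simp add: D_def add_pos_pos)
  have dk: "?d + k = Suc (?d + k - 1)" using zero_less_card_finite[where 'a = 'd] by simp
  have Tle: "T j h A x0 \<le> ennreal (A / h ^ k * D * min (2 ^ j * h) (1 / (2 ^ j * h)))"
    if h: "0 < h" "h \<le> 1" and A: "A \<ge> 0" for j h A x0
  proof (cases "j = 0")
    case True
    have "(2 ^ j * h) ^ (?d + k) * (1 + (2 ^ j * h)\<^sup>2) ^ n0 * exp (- (0\<^sup>2 / 2 * (2 ^ j * h)\<^sup>2)) = h ^ (?d + k) * (1 + h\<^sup>2) ^ n0"
      using True by simp
    also have "\<dots> \<le> h * 2 ^ n0"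
    proof (intro mult_mono power_mono)
      have "h ^ (?d + k) = h * h ^ (?d + k - 1)" by (subst dk) (rule power_Suc)
      also have "\<dots> \<le> h * 1" using h by (intro mult_left_mono power_le_one) auto
      finally show "h ^ (?d + k) \<le> h" by simp
      show "1 + h\<^sup>2 \<le> 2" using h power_le_one[of h 2] by simp
    qed (use h in auto)
    also have "h * 2 ^ n0 = 2 ^ n0 * min (2 ^ j * h) (1 / (2 ^ j * h))"
    proof -
      have "h \<le> 1 / h" using h mult_le_one[of h h] by (simp add: pos_le_divide_eq)
      then show ?thesis using True by (simp add: min_def mult.commute)
    qed
    finally have "C0 * ((2 ^ j * h) ^ (?d + k) * (1 + (2 ^ j * h)\<^sup>2) ^ n0 * exp (- (0\<^sup>2 / 2 * (2 ^ j * h)\<^sup>2)))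
        \<le> C0 * (2 ^ n0 * min (2 ^ j * h) (1 / (2 ^ j * h)))"
      using C0(1) by (intro mult_left_mono) auto
    also have "\<dots> \<le> D * min (2 ^ j * h) (1 / (2 ^ j * h))"
      unfolding mult.assoc[symmetric] D_def using C1 D1 D2 h by (intro mult_right_mono) auto
    finally have "T j h A x0 \<le> ennreal (A / h ^ k * (D * min (2 ^ j * h) (1 / (2 ^ j * h))))"
      using A h True
      by (intro order_trans[OF C0(2)] ennreal_leI mult_left_mono) (auto simp: base_symbol_def)
    then show ?thesis by (simp only: mult.assoc)
  next
    case False
    define t where "t = 2 ^ j * h"
    have t: "t > 0" using h by (simp add: t_def)
    define e where "e = (1 + t\<^sup>2) ^ n1 * exp (- (r\<^sup>2 / 2 * t\<^sup>2))"
    have 1: "t ^ (?d + k) * e \<le> (D1 + D2) * t"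
    proof -
      have "t ^ (?d + k) * e = t * (t ^ (?d + k - 1) * e)" by (subst dk) (simp only: power_Suc mult.assoc)
      also have "\<dots> \<le> t * D1" using t D1(2)[of t] by (intro mult_left_mono) (auto simp: e_def mult.assoc)
      also have "\<dots> \<le> (D1 + D2) * t" using t D2(1) by (simp add: algebra_simps)
      finally show ?thesis .
    qed
    have 2: "t ^ (?d + k) * e \<le> (D1 + D2) * (1 / t)"
    proof -
      have "t ^ (?d + k) * e = (t ^ (?d + k + 1) * e) / t" using t by simp
      also have "\<dots> \<le> D2 / t" using t D2(2)[of t] by (intro divide_right_mono) (auto simp: e_def mult.assoc)
      also have "\<dots> \<le> (D1 + D2) / t" using t D1 by (intro divide_right_mono) auto
      finally show ?thesis by simp
    qed
    have "t ^ (?d + k) * e \<le> (D1 + D2) * min t (1 / t)"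
      using 1 2 by (simp only: min_def split: if_split) auto
    then have "C1 * (t ^ (?d + k) * e) \<le> C1 * ((D1 + D2) * min t (1 / t))"
      using C1(1) by (intro mult_left_mono) auto
    also have "\<dots> \<le> D * min t (1 / t)"
      unfolding mult.assoc[symmetric] D_def using C0 t by (intro mult_right_mono) auto
    finally have fin: "C1 * (t ^ (?d + k) * e) \<le> D * min t (1 / t)" .
    have bs: "base_symbol \<theta> j = base_symbol \<theta> 1" using False by (simp add: base_symbol_def)
    have "T j h A x0 \<le> ennreal (A / h ^ k * (C1 * (t ^ (?d + k) * e)))"
      using C1(2)[OF bs h(1) A, of x0] unfolding t_def e_def by (simp only: mult.assoc)
    also have "\<dots> \<le> ennreal (A / h ^ k * (D * min t (1 / t)))"
      by (intro ennreal_leI mult_left_mono fin) (use A h in auto)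
    finally have "T j h A x0 \<le> ennreal (A / h ^ k * (D * min t (1 / t)))" .
    then show ?thesis by (simp only: mult.assoc t_def)
  qed
  obtain S where S: "S > 0" "\<And>h. 0 < h \<Longrightarrow> h \<le> 1 \<Longrightarrow> (\<Sum>j. ennreal (min (2 ^ j * h) (1 / (2 ^ j * h)) powr q)) \<le> ennreal S"
    using dyadic_min_sum[OF q] by blast
  define C where "C = D * S powr (1 / q)"
  have "besov_norm \<theta> (real k + real ?d / p) p q \<Omega> (\<lambda>x. A * exp (- ((norm (x - x0))\<^sup>2 / (2 * h\<^sup>2)))) \<le> ennreal (A / h ^ k * C)"
    if h: "0 < h" "h \<le> 1" and A: "A \<ge> 0" for h A and x0 :: "real^'d" and \<Omega>
  proof -
    let ?f = "\<lambda>x::real^'d. A * exp (- ((norm (x - x0))\<^sup>2 / (2 * h\<^sup>2)))"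
    define U where "U = A / h ^ k * D"
    have U: "U \<ge> 0" using A h D by (simp add: U_def)
    have "besov_norm \<theta> (real k + real ?d / p) p q \<Omega> ?f \<le> besov_norm_Rd \<theta> (real k + real ?d / p) p q (function_distribution ?f)"
      unfolding besov_norm_def using tempered_function_distribution[OF integrable_gaussian_bump[OF h(1)]]
        restricts_to_function_distribution[OF integrable_gaussian_bump[OF h(1)]]
      by (intro Inf_lower) blast
    also have "\<dots> = epowr (\<Sum>j. epowr (T j h A x0) q) (1 / q)"
      unfolding besov_norm_Rd_def T_def ..
    also have "\<dots> \<le> epowr (ennreal (U powr q * S)) (1 / q)"
    proof (intro epowr_mono)
      have "epowr (T j h A x0) q \<le> ennreal (U powr q) * ennreal (min (2 ^ j * h) (1 / (2 ^ j * h)) powr q)" for j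
      proof -
        have "epowr (T j h A x0) q \<le> epowr (ennreal (U * min (2 ^ j * h) (1 / (2 ^ j * h)))) q"
          unfolding U_def using q by (intro epowr_mono Tle h A) auto
        also have "\<dots> = ennreal ((U * min (2 ^ j * h) (1 / (2 ^ j * h))) powr q)"
          using U h by (intro epowr_ennreal) auto
        also have "\<dots> = ennreal (U powr q * min (2 ^ j * h) (1 / (2 ^ j * h)) powr q)"
          using U h by (subst powr_mult) auto
        finally show ?thesis by (simp add: ennreal_mult)
      qed
      then have "(\<Sum>j. epowr (T j h A x0) q) \<le> (\<Sum>j. ennreal (U powr q) * ennreal (min (2 ^ j * h) (1 / (2 ^ j * h)) powr q))"
        by (intro suminf_le) auto
      also have "\<dots> = ennreal (U powr q) * (\<Sum>j. ennreal (min (2 ^ j * h) (1 / (2 ^ j * h)) powr q))"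
        by (rule ennreal_suminf_cmult)
      also have "\<dots> \<le> ennreal (U powr q) * ennreal S" by (intro mult_left_mono S(2) h) auto
      finally show "(\<Sum>j. epowr (T j h A x0) q) \<le> ennreal (U powr q * S)" using S(1) by (simp add: ennreal_mult)
    qed (use q in auto)
    also have "\<dots> = ennreal ((U powr q * S) powr (1 / q))" using S(1) by (intro epowr_ennreal) auto
    also have "(U powr q * S) powr (1 / q) = U * S powr (1 / q)"
      using S(1) U q by (simp add: powr_mult powr_powr)
    finally show ?thesis by (simp add: U_def C_def mult.assoc)
  qed
  moreover have "C > 0" using D S(1) by (simp add: C_def)
  ultimately show ?thesis by (intro exI[of _ C]) blast
qed

section \<open>The lower bound\<close>

lemma order_mi_single: "order_mi (\<lambda>j. if j = i then m else 0) = m"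
  unfolding order_mi_def by (simp add: sum.delta)

text \<open>A list in which a single index occurs is determined by its length, so
  \<open>SOME\<close> has no freedom and the symmetry of mixed derivatives never enters. For this
  reason the test function is differentiated along one coordinate, found by
  \<open>coordinate_moment\<close>.\<close>

lemma mi_deriv_single:
  "mi_deriv (\<lambda>j. if j = i then m else 0) f = iter_deriv (replicate m i) f"
proof -
  have cr: "count_list (replicate n i) j = (if j = i then n else 0)" for n j
    by (induction n) auto
  have "(SOME is. \<forall>j. count_list is j = (if j = i then m else 0)) = replicate m i"
  proof (rule some_equality)
    fix "is" assume c: "\<forall>j. count_list is j = (if j = i then m else 0)"
    have "j = i" if "j \<in> set is" for j
    proof (rule ccontr)
      assume "j \<noteq> i"
      then have "count_list is j = 0" using c by simp
      with that show False by (simp add: count_list_0_iff)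
    qed
    then have eq: "is = replicate (length is) i" by (intro replicate_eqI) auto
    have "count_list (replicate (length is) i) i = m" using c eq by metis
    then have "length is = m" by (simp add: cr)
    with eq show "is = replicate m i" by simp
  qed (simp add: cr)
  then show ?thesis unfolding mi_deriv_def by simp
qed

lemma finite_order_mi_le: "finite {\<alpha> :: 'd::finite \<Rightarrow> nat. order_mi \<alpha> \<le> m}"
proof (rule finite_subset)
  show "{\<alpha> :: 'd \<Rightarrow> nat. order_mi \<alpha> \<le> m} \<subseteq> PiE UNIV (\<lambda>_. {..m})"
  proof
    fix \<alpha> :: "'d \<Rightarrow> nat" assume "\<alpha> \<in> {\<alpha>. order_mi \<alpha> \<le> m}"
    then have "\<alpha> i \<le> m" for i
      using member_le_sum[of i UNIV \<alpha>] by (simp add: order_mi_def)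
    then show "\<alpha> \<in> PiE UNIV (\<lambda>_. {..m})" by auto
  qed
qed (intro finite_PiE; simp)

lemma epowr_half_power2: "(epowr x (1 / 2))\<^sup>2 = x"
proof (cases x)
  case (real r)
  then show ?thesis by (simp add: epowr_ennreal ennreal_power powr_half_sqrt)
qed (simp add: epowr_def)

lemma set_integral_test_function:
  fixes \<psi> :: "real ^ 'd::finite \<Rightarrow> real"
  assumes "\<psi> \<in> test_functions \<Omega>"
  shows "(LINT x:\<Omega>|lebesgue. u x * \<psi> x) = (\<integral>x. u x * \<psi> x \<partial>lebesgue)"
proof -
  have "\<psi> x = 0" if "x \<notin> \<Omega>" for x using that assms unfolding test_functions_iff by blast
  then have "indicator \<Omega> x *\<^sub>R (u x * \<psi> x) = u x * \<psi> x" for x by (auto simp: indicator_def)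
  then show ?thesis unfolding set_lebesgue_integral_def by (simp only:)
qed

text \<open>Duality: the derivative moves from \<open>\<psi>\<close> onto \<open>u\<close>, then
  Cauchy-Schwarz. Working in \<open>ennreal\<close> covers infinite norms, and if some weak
  derivative is missing the norm is infinite by definition.\<close>

lemma sobolev_norm_ge:
  fixes \<psi> u :: "real ^ 'd::finite \<Rightarrow> real"
  assumes \<psi>: "\<psi> \<in> test_functions \<Omega>" and S: "S > 0" and \<psi>S: "(\<integral>x. (\<psi> x)\<^sup>2 \<partial>lborel) \<le> S\<^sup>2"
    and \<alpha>: "order_mi \<alpha> \<le> m"
  shows "ennreal (\<bar>LINT x:\<Omega>|lebesgue. u x * mi_deriv \<alpha> \<psi> x\<bar> / S) \<le> sobolev_norm m \<Omega> u"
proof (cases "\<forall>\<alpha>. order_mi \<alpha> \<le> m \<longrightarrow> (\<exists>v. has_weak_deriv \<Omega> \<alpha> u v)")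
  case True
  define v where "v = weak_deriv \<Omega> \<alpha> u"
  have "\<exists>v. has_weak_deriv \<Omega> \<alpha> u v" using True \<alpha> by blast
  then have wd: "has_weak_deriv \<Omega> \<alpha> u v" unfolding v_def weak_deriv_def by (rule someI_ex)
  define K where "K = closure {x. \<psi> x \<noteq> 0}"
  have K: "compact K" "K \<subseteq> \<Omega>" using \<psi> by (auto simp: K_def test_functions_def)
  \<comment> \<open>\<open>v\<close> is only locally integrable in \<open>\<Omega>\<close>; cutting
    it off to the support of \<open>\<psi>\<close> makes it integrable and leaves the pairing
    unchanged.\<close>
  define w where "w x = indicator K x * v x" for x
  have "v absolutely_integrable_on K"
    using wd K unfolding has_weak_deriv_def locally_integrable_in_def by blast
  then have wi: "integrable lebesgue w" by (simp add: set_integrable_def w_def[abs_def])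
  then have wm [measurable]: "w \<in> borel_measurable lebesgue" by auto
  have \<psi>b: "\<psi> \<in> borel_measurable borel" by (rule test_functions_borel[OF \<psi>])
  then have \<psi>m [measurable]: "\<psi> \<in> borel_measurable lebesgue" by (simp add: measurable_completion)
  have "\<psi> x = 0" if "x \<notin> K" for x
    using that closure_subset[of "{x. \<psi> x \<noteq> 0}"] by (auto simp: K_def)
  then have vw: "v x * \<psi> x = w x * \<psi> x" for x by (auto simp: w_def indicator_def)
  define a where "a = \<bar>LINT x:\<Omega>|lebesgue. u x * mi_deriv \<alpha> \<psi> x\<bar>"
  have "(LINT x:\<Omega>|lebesgue. u x * mi_deriv \<alpha> \<psi> x) = (- 1) ^ order_mi \<alpha> * (LINT x:\<Omega>|lebesgue. v x * \<psi> x)"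
    using wd \<psi> unfolding has_weak_deriv_def by blast
  then have a: "a = \<bar>\<integral>x. w x * \<psi> x \<partial>lebesgue\<bar>"
    unfolding a_def set_integral_test_function[OF \<psi>] vw by (simp add: abs_mult)
  \<comment> \<open>If the product were not integrable, its integral would be 0 by convention and
    the bound trivial.\<close>
  have "ennreal a \<le> (\<integral>\<^sup>+x. ennreal (norm (w x * \<psi> x)) \<partial>lebesgue)"
    unfolding a using integral_norm_bound_ennreal[of lebesgue "\<lambda>x. w x * \<psi> x"]
    by (cases "integrable lebesgue (\<lambda>x. w x * \<psi> x)") (auto simp: not_integrable_integral_eq)
  also have "\<dots> = (\<integral>\<^sup>+x. ennreal \<bar>w x\<bar> * ennreal \<bar>\<psi> x\<bar> \<partial>lebesgue)"
    by (simp add: abs_mult ennreal_mult)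
  finally have "(ennreal a)\<^sup>2 \<le> (\<integral>\<^sup>+x. ennreal \<bar>w x\<bar> * ennreal \<bar>\<psi> x\<bar> \<partial>lebesgue)\<^sup>2"
    by (intro power_mono) auto
  also have "\<dots> \<le> (\<integral>\<^sup>+x. (ennreal \<bar>w x\<bar>)\<^sup>2 \<partial>lebesgue) * (\<integral>\<^sup>+x. (ennreal \<bar>\<psi> x\<bar>)\<^sup>2 \<partial>lebesgue)"
    by (rule Cauchy_Schwarz_nn_integral) measurable
  also have "\<dots> \<le> (sobolev_norm m \<Omega> u)\<^sup>2 * ennreal (S\<^sup>2)"
  proof (intro mult_mono)
    have "(\<integral>\<^sup>+x. (ennreal \<bar>w x\<bar>)\<^sup>2 \<partial>lebesgue) \<le> (\<integral>\<^sup>+x\<in>\<Omega>. ennreal (norm (v x) powr 2) \<partial>lebesgue)"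
    proof (rule nn_integral_mono)
      fix x show "(ennreal \<bar>w x\<bar>)\<^sup>2 \<le> ennreal (norm (v x) powr 2) * indicator \<Omega> x"
        using K(2) by (auto simp: w_def indicator_def ennreal_power)
    qed
    also have "\<dots> = (Lp_qnorm 2 \<Omega> v)\<^sup>2" unfolding Lp_qnorm_def epowr_half_power2 ..
    also have "\<dots> \<le> (\<Sum>\<alpha> | order_mi \<alpha> \<le> m. (Lp_qnorm 2 \<Omega> (weak_deriv \<Omega> \<alpha> u))\<^sup>2)"
      unfolding v_def using \<alpha>
      by (intro member_le_sum[of _ _ "\<lambda>\<alpha>. (Lp_qnorm 2 \<Omega> (weak_deriv \<Omega> \<alpha> u))\<^sup>2"] finite_order_mi_le) auto
    also have "\<dots> = (sobolev_norm m \<Omega> u)\<^sup>2"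
      unfolding sobolev_norm_def if_P[OF True] epowr_half_power2 ..
    finally show "(\<integral>\<^sup>+x. (ennreal \<bar>w x\<bar>)\<^sup>2 \<partial>lebesgue) \<le> (sobolev_norm m \<Omega> u)\<^sup>2" .
  next
    have sq: "(\<lambda>x. \<psi> x * \<psi> x) \<in> test_functions \<Omega>"
      by (rule test_functions_mult[OF \<psi> test_functions_smooth[OF \<psi>]])
    have "(\<integral>\<^sup>+x. (ennreal \<bar>\<psi> x\<bar>)\<^sup>2 \<partial>lebesgue) = (\<integral>\<^sup>+x. ennreal ((\<psi> x)\<^sup>2) \<partial>lborel)"
      by (simp add: ennreal_power nn_integral_completion)
    also have "\<dots> = ennreal (\<integral>x. (\<psi> x)\<^sup>2 \<partial>lborel)"
      using test_functions_integrable[OF sq]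
      by (intro nn_integral_eq_integral) (auto simp: power2_eq_square)
    also have "\<dots> \<le> ennreal (S\<^sup>2)" by (rule ennreal_leI[OF \<psi>S])
    finally show "(\<integral>\<^sup>+x. (ennreal \<bar>\<psi> x\<bar>)\<^sup>2 \<partial>lebesgue) \<le> ennreal (S\<^sup>2)" .
  qed auto
  finally have sq: "(ennreal a)\<^sup>2 \<le> (sobolev_norm m \<Omega> u)\<^sup>2 * ennreal (S\<^sup>2)" .
  have a0: "a \<ge> 0" by (simp add: a_def)
  show ?thesis unfolding a_def[symmetric]
  proof (cases "sobolev_norm m \<Omega> u")
    case (real s)
    have "ennreal (a\<^sup>2) \<le> ennreal (s\<^sup>2 * S\<^sup>2)"
      using sq real a0 by (simp add: ennreal_power ennreal_mult)
    then have "a\<^sup>2 \<le> (s * S)\<^sup>2" using real by (simp add: ennreal_le_iff power_mult_distrib)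
    then have "a \<le> s * S" by (rule power2_le_imp_le) (use real S in auto)
    then show "ennreal (a / S) \<le> sobolev_norm m \<Omega> u"
      using S real by (simp add: ennreal_le_iff pos_divide_le_eq)
  qed simp
next
  case False
  then show ?thesis unfolding sobolev_norm_def if_not_P[OF False] by simp
qed

lemma integrable_continuous_mult_test_function:
  fixes g \<psi> :: "real ^ 'd::finite \<Rightarrow> real"
  assumes \<psi>: "\<psi> \<in> test_functions \<Omega>" and g: "continuous_on UNIV g"
  shows "integrable lborel (\<lambda>x. g x * \<psi> x)"
proof -
  define K where "K = closure {x. \<psi> x \<noteq> 0}"
  have K: "compact K" using \<psi> by (auto simp: K_def test_functions_def)
  have "\<psi> x = 0" if "x \<notin> K" for x
    using that closure_subset[of "{x. \<psi> x \<noteq> 0}"] by (auto simp: K_def)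
  then have "indicator K x *\<^sub>R (g x * \<psi> x) = g x * \<psi> x" for x by (auto simp: indicator_def)
  moreover have "integrable lborel (\<lambda>x. indicator K x *\<^sub>R (g x * \<psi> x))"
    by (intro borel_integrable_compact K continuous_intros continuous_on_subset[OF g]
          continuous_on_subset[OF smooth_fun_continuous_on[OF test_functions_smooth[OF \<psi>]]]) auto
  ultimately show ?thesis by (simp only:)
qed

lemma continuous_on_sigma_k [continuous_intros]:
  "continuous_on S f \<Longrightarrow> continuous_on S (\<lambda>x. sigma_k k (f x))"
  unfolding sigma_k_def by (intro continuous_intros)

text \<open>The test function is translated to \<open>x0\<close>; seen from there a ridge function
  is again one, with bias \<open>b r - \<omega> r \<bullet> x0\<close>. The derivative of
  \<open>\<psi>\<close> annihilates it, because differentiation only multiplies the transform by a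
  polynomial. What survives of the pairing is the Gaussian.\<close>

lemma sobolev_norm_gaussian_minus_ridge_ge:
  fixes \<psi> :: "real ^ 'd::finite \<Rightarrow> real" and n N :: nat
  assumes \<psi>: "\<psi> \<in> test_functions (cball 0 \<rho>)" and sub: "cball x0 \<rho> \<subseteq> \<Omega>"
    and S: "S > 0" and \<psi>S: "(\<integral>x. (\<psi> x)\<^sup>2 \<partial>lborel) \<le> S\<^sup>2"
    and van: "\<And>r \<tau>. r < n \<Longrightarrow> ft (\<lambda>x. complex_of_real (\<psi> x)) (\<tau> *\<^sub>R \<omega> r) = 0"
    and A: "A \<ge> 0" and N: "N \<le> n"
  shows "ennreal (A * \<bar>\<integral>x. exp (- ((norm x)\<^sup>2 / (2 * h\<^sup>2))) * iter_deriv (replicate m i) \<psi> x \<partial>lborel\<bar> / S)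
    \<le> sobolev_norm m \<Omega> (\<lambda>x. A * exp (- ((norm (x - x0))\<^sup>2 / (2 * h\<^sup>2))) - (\<Sum>r<N. a r * sigma_k k (\<omega> r \<bullet> x - b r)))"
proof -
  define u where "u x = A * exp (- ((norm (x - x0))\<^sup>2 / (2 * h\<^sup>2))) - (\<Sum>r<N. a r * sigma_k k (\<omega> r \<bullet> x - b r))" for x
  define \<eta> where "\<eta> = iter_deriv (replicate m i) \<psi>"
  have t: "\<eta> \<in> test_functions (cball 0 \<rho>)" unfolding \<eta>_def by (rule test_functions_iter_deriv[OF \<psi>])
  have shift: "(\<lambda>x. \<phi> (x - x0)) \<in> test_functions \<Omega>" if "\<phi> \<in> test_functions (cball 0 \<rho>)" for \<phi> :: "real^'d \<Rightarrow> real"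
    using test_functions_translate[OF that, of x0] sub by (auto intro: test_functions_mono)
  have ridge: "(\<integral>x. sigma_k k (\<omega> r \<bullet> (x0 + x) - b r) * \<eta> x \<partial>lborel) = 0" if r: "r < N" for r
  proof -
    have z: "ft (\<lambda>x. complex_of_real (\<eta> x)) (\<tau> *\<^sub>R \<omega> r) = 0" for \<tau>
      unfolding \<eta>_def ft_replicate_deriv_of_real[OF \<psi>] van[OF less_le_trans[OF r N]] by simp
    have "(\<integral>x. sigma_k k (x \<bullet> \<omega> r + (\<omega> r \<bullet> x0 - b r)) * \<eta> x \<partial>lborel) = 0"
      by (rule ridge_annihilation[OF t z, where g = "\<lambda>s. sigma_k k (s + (\<omega> r \<bullet> x0 - b r))"]) (intro continuous_intros)
    then show ?thesis by (simp add: inner_add_right inner_commute algebra_simps)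
  qed
  have gi: "integrable lborel (\<lambda>x. (A * exp (- ((norm x)\<^sup>2 / (2 * h\<^sup>2)))) * \<eta> x)"
    by (rule integrable_continuous_mult_test_function[OF t]) (cases "h = 0"; auto intro!: continuous_intros)
  have ri: "integrable lborel (\<lambda>x. (a r * sigma_k k (\<omega> r \<bullet> (x0 + x) - b r)) * \<eta> x)" for r
    by (rule integrable_continuous_mult_test_function[OF t]) (intro continuous_intros)
  note [measurable] = test_functions_borel[OF \<psi>]
  have [measurable]: "\<eta> \<in> borel_measurable borel" by (rule test_functions_borel[OF t])
  have "(\<lambda>x. sigma_k k (\<omega> r \<bullet> x - b r)) \<in> borel_measurable borel" for r
    by (intro borel_measurable_continuous_onI continuous_intros)
  then have [measurable]: "u \<in> borel_measurable borel" unfolding u_def[abs_def] by measurable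
  have "(LINT x:\<Omega>|lebesgue. u x * mi_deriv (\<lambda>j. if j = i then m else 0) (\<lambda>x. \<psi> (x - x0)) x)
      = (LINT x:\<Omega>|lebesgue. u x * \<eta> (x - x0))"
    unfolding mi_deriv_single iter_deriv_translate \<eta>_def ..
  also have "\<dots> = (\<integral>x. u x * \<eta> (x - x0) \<partial>lebesgue)"
    by (rule set_integral_test_function[OF shift[OF t]])
  also have "\<dots> = (\<integral>x. u x * \<eta> (x - x0) \<partial>lborel)" by (rule integral_completion) measurable
  also have "\<dots> = (\<integral>x. u (x0 + x) * \<eta> ((x0 + x) - x0) \<partial>lborel)"
    by (rule integral_translate_lborel[symmetric]) measurable
  also have "\<dots> = (\<integral>x. (A * exp (- ((norm x)\<^sup>2 / (2 * h\<^sup>2)))) * \<eta> x - (\<Sum>r<N. (a r * sigma_k k (\<omega> r \<bullet> (x0 + x) - b r)) * \<eta> x) \<partial>lborel)"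
    unfolding u_def by (simp only: left_diff_distrib sum_distrib_right add_diff_cancel_left')
  also have "\<dots> = (\<integral>x. (A * exp (- ((norm x)\<^sup>2 / (2 * h\<^sup>2)))) * \<eta> x \<partial>lborel) - (\<integral>x. (\<Sum>r<N. (a r * sigma_k k (\<omega> r \<bullet> (x0 + x) - b r)) * \<eta> x) \<partial>lborel)"
    by (rule Bochner_Integration.integral_diff[OF gi Bochner_Integration.integrable_sum[OF ri]])
  also have "(\<integral>x. (\<Sum>r<N. (a r * sigma_k k (\<omega> r \<bullet> (x0 + x) - b r)) * \<eta> x) \<partial>lborel) = 0"
    by (subst Bochner_Integration.integral_sum[OF ri]) (simp add: mult.assoc ridge)
  finally have eq: "(LINT x:\<Omega>|lebesgue. u x * mi_deriv (\<lambda>j. if j = i then m else 0) (\<lambda>x. \<psi> (x - x0)) x)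
      = A * (\<integral>x. exp (- ((norm x)\<^sup>2 / (2 * h\<^sup>2))) * \<eta> x \<partial>lborel)"
    by (simp add: mult.assoc)
  have "(\<integral>x. (\<psi> (x - x0))\<^sup>2 \<partial>lborel) = (\<integral>x. (\<psi> ((x0 + x) - x0))\<^sup>2 \<partial>lborel)"
    by (rule integral_translate_lborel[symmetric]) measurable
  then have "(\<integral>x. (\<psi> (x - x0))\<^sup>2 \<partial>lborel) \<le> S\<^sup>2" using \<psi>S by simp
  from sobolev_norm_ge[OF shift[OF \<psi>] S this, of "\<lambda>j. if j = i then m else 0" m u]
  have "ennreal (\<bar>A * (\<integral>x. exp (- ((norm x)\<^sup>2 / (2 * h\<^sup>2))) * \<eta> x \<partial>lborel)\<bar> / S) \<le> sobolev_norm m \<Omega> u"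
    unfolding eq order_mi_single by simp
  then show ?thesis using A unfolding u_def[abs_def] \<eta>_def by (simp add: abs_mult)
qed

text \<open>The dimension condition asks for \<open>K\<close> of order
  \<open>n powr (1 / (d - 1))\<close>, the uniform constants for \<open>K \<ge> K0\<close>. Additive
  terms are absorbed into the factor because \<open>n powr (1 / (d - 1)) \<ge> 1\<close>.\<close>

lemma exists_resolution:
  assumes d: "d \<ge> 2" and n: "n \<ge> 1"
  shows "\<exists>K\<ge>K0. K \<ge> 1 \<and> 2 * n \<le> (K + 1) ^ (d - 1) \<and> real K \<le> (real K0 + 4) * real n powr (1 / (real d - 1))"
proof -
  define e where "e = 1 / (real d - 1)"
  have e: "0 < e" "e \<le> 1" using d by (auto simp: e_def field_simps)
  define L where "L = nat \<lceil>real (2 * n) powr e\<rceil>"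
  have L: "real (2 * n) powr e \<le> real L" unfolding L_def by (rule real_nat_ceiling_ge)
  have L2: "real L \<le> real (2 * n) powr e + 1" unfolding L_def using ceiling_correct[of "real (2 * n) powr e"] powr_ge_zero[of "real (2 * n)" e] by linarith
  define K where "K = K0 + 1 + L"
  have "real (2 * n) = (real (2 * n) powr e) powr (real (d - 1))"
    using d n by (simp add: powr_powr e_def of_nat_diff)
  also have "\<dots> \<le> (real (K + 1)) powr (real (d - 1))" using L by (intro powr_mono2) (auto simp: K_def)
  also have "\<dots> = real ((K + 1) ^ (d - 1))" by (subst powr_realpow) auto
  finally have 1: "2 * n \<le> (K + 1) ^ (d - 1)" by (simp only: of_nat_le_iff)
  have n1: "1 \<le> real n powr e" using n e by (intro ge_one_powr_ge_zero) auto
  have "2 powr e \<le> (2::real) powr 1" using e by (intro powr_mono) auto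
  then have "2 powr e * real n powr e \<le> 2 * real n powr e" by (intro mult_right_mono) auto
  then have "real K \<le> real K0 + 2 + 2 * real n powr e"
    using L2 unfolding K_def by (simp add: powr_mult)
  also have "\<dots> \<le> (real K0 + 2) * real n powr e + 2 * real n powr e"
    using mult_left_mono[OF n1, of "real K0 + 2"] by simp
  finally have "real K \<le> (real K0 + 4) * real n powr e" by (simp add: algebra_simps)
  with 1 show ?thesis unfolding e_def by (intro exI[of _ K]) (auto simp: K_def)
qed

text \<open>Order of choices: the resolution \<open>K\<close> and the Gaussian come from
  \<open>n\<close>, then an arbitrary approximant \<open>g\<close> is given, and the test function
  is built from the directions of \<open>g\<close>. This matches the supremum outside and the
  infimum inside.\<close>

theorem theorem5p2:
  fixes \<Omega> :: "(real ^ 'd) set" and \<theta> :: "real ^ 'd \<Rightarrow> complex"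
    and k m :: nat and p q bm bp :: real
  assumes "CARD('d) \<ge> 2" and "k \<ge> 1" and "0 < p" "p < 1" and "0 < q" "q \<le> 1" and "m \<le> k"
    and "bounded_lipschitz_domain \<Omega>"
    and "LP_generator \<theta>"
    and "bm < Inf {\<omega> \<bullet> x | x \<omega>. x \<in> \<Omega> \<and> norm \<omega> = 1} - 1"
    and "bp > Sup {\<omega> \<bullet> x | x \<omega>. x \<in> \<Omega> \<and> norm \<omega> = 1} + 1"
  shows "\<exists>c::real. c > 0 \<and> (\<forall>(M::ennreal) (n::nat). n \<ge> 1 \<longrightarrow>
    approx_error k bm bp n m \<Omega>
      {f. besov_norm \<theta> (real k + real CARD('d) / p) p q \<Omega> f \<le> 1} M
    \<ge> ennreal (c * real n powr
        (- ((real k - real m + real CARD('d) / 2) / (real CARD('d) - 1)))))"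
proof -
  let ?d = "CARD('d)"
  note dom = assms(8)[unfolded bounded_lipschitz_domain_def]
  have "open \<Omega>" "\<Omega> \<noteq> {}"
    using dom[THEN conjunct1] dom[THEN conjunct2, THEN conjunct2, THEN conjunct1] .
  then obtain x0 where "x0 \<in> \<Omega>" "\<forall>x\<in>\<Omega>. \<exists>\<rho>>0. cball x \<rho> \<subseteq> \<Omega>"
    unfolding open_contains_cball by auto
  then obtain \<rho> where \<rho>: "\<rho> > 0" "cball x0 \<rho> \<subseteq> \<Omega>" by blast
  obtain C where C: "C > 0" "\<forall>h A x0 \<Omega>. 0 < h \<and> h \<le> 1 \<and> A \<ge> 0 \<longrightarrow>
      besov_norm \<theta> (real k + real ?d / p) p q \<Omega> (\<lambda>x. A * exp (- ((norm (x - x0))\<^sup>2 / (2 * h\<^sup>2)))) \<le> ennreal (A / h ^ k * C)"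
    using besov_norm_gaussian_bump_le[OF assms(9,3,5), of k] by (elim exE conjE) (rule that)
  obtain c K0 where c: "c > 0" and fool: "\<forall>K\<ge>K0. \<forall>n. \<forall>\<omega>. 2 * n \<le> (K + 1) ^ (?d - 1) \<longrightarrow>
    (\<exists>i \<psi> S. \<psi> \<in> test_functions (cball (0::real^'d) \<rho>) \<and> S > 0 \<and> (\<integral>x. (\<psi> x)\<^sup>2 \<partial>lborel) \<le> S\<^sup>2 \<and>
      (\<forall>r<n. \<forall>\<tau>. ft (\<lambda>x. complex_of_real (\<psi> x)) (\<tau> *\<^sub>R \<omega> r) = 0) \<and>
      c * real (K * (?d - 1)) powr (real m - real ?d / 2) * S
        \<le> \<bar>\<integral>x. exp (- ((norm x)\<^sup>2 * (real (K * (?d - 1)))\<^sup>2 / 2)) * iter_deriv (replicate m i) \<psi> x \<partial>lborel\<bar>)"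
    using fooling_test_function[OF assms(1) \<rho>(1), of m] by (elim exE conjE) (rule that)
  define e where "e = real k - real m + real ?d / 2"
  have e: "e > 0" using assms(1,7) by (simp add: e_def)
  \<comment> \<open>The factor between \<open>N = K * (d - 1)\<close> and
    \<open>n powr (1 / (d - 1))\<close>; it enters the final constant with exponent
    \<open>- e\<close>.\<close>
  define B where "B = (real K0 + 4) * (real ?d - 1)"
  have B: "B > 0" using assms(1) by (simp add: B_def)
  define c' where "c' = c / C * B powr (- e)"
  have "ennreal (c' * real n powr (- (e / (real ?d - 1)))) \<le>
      approx_error k bm bp n m \<Omega> {f. besov_norm \<theta> (real k + real ?d / p) p q \<Omega> f \<le> 1} M"
    if n: "n \<ge> 1" for n M
  proof -
    obtain K where K: "K \<ge> K0" "K \<ge> 1" "2 * n \<le> (K + 1) ^ (?d - 1)" "real K \<le> (real K0 + 4) * real n powr (1 / (real ?d - 1))"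
      using exists_resolution[OF assms(1) n, of K0] by blast
    define N where "N = real (K * (?d - 1))"
    have N1: "N \<ge> 1"
    proof -
      have "1 \<le> K * (?d - 1)" using mult_le_mono[of 1 K 1 "?d - 1"] K(2) assms(1) by simp
      then have "real 1 \<le> real (K * (?d - 1))" by (rule of_nat_mono)
      then show ?thesis by (simp only: N_def of_nat_1)
    qed
    have NB: "N \<le> B * real n powr (1 / (real ?d - 1))"
    proof -
      have "N = (real ?d - 1) * real K" using assms(1) by (simp add: N_def of_nat_diff)
      also have "\<dots> \<le> (real ?d - 1) * ((real K0 + 4) * real n powr (1 / (real ?d - 1)))"
        using assms(1) by (intro mult_left_mono K(4)) auto
      finally show ?thesis by (simp add: B_def mult_ac)
    qed
    define h where "h = 1 / N"
    have h: "0 < h" "h \<le> 1" using N1 by (auto simp: h_def)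
    \<comment> \<open>The largest height for which the Besov estimate still gives norm at most
      1.\<close>
    define A where "A = h ^ k / C"
    have A: "A > 0" using h C by (simp add: A_def)
    define f where "f x = A * exp (- ((norm (x - x0))\<^sup>2 / (2 * h\<^sup>2)))" for x
    have "besov_norm \<theta> (real k + real ?d / p) p q \<Omega> f \<le> ennreal (A / h ^ k * C)"
      unfolding f_def by (rule C(2)[rule_format]) (use h A in auto)
    also have "A / h ^ k * C = 1" using h C by (simp add: A_def)
    finally have f1: "f \<in> {f. besov_norm \<theta> (real k + real ?d / p) p q \<Omega> f \<le> 1}" by simp
    have "c' * real n powr (- (e / (real ?d - 1))) = c / C * (B * real n powr (1 / (real ?d - 1))) powr (- e)"
      unfolding c'_def using B by (simp add: powr_mult powr_powr)
    also have "\<dots> \<le> c / C * N powr (- e)"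
      using c C e N1 NB by (intro mult_left_mono powr_mono2') auto
    \<comment> \<open>The height supplies the missing part of the exponent:
      \<open>h ^ k = N powr (- k)\<close>.\<close>
    also have "\<dots> = A * (c * N powr (real m - real ?d / 2))"
    proof -
      have "h ^ k = N powr (- real k)" using N1 by (simp add: h_def power_one_over powr_minus powr_realpow field_simps)
      moreover have "- e = - real k + (real m - real ?d / 2)" by (simp add: e_def)
      ultimately show ?thesis unfolding A_def by (simp only: powr_add) simp
    qed
    finally have le: "c' * real n powr (- (e / (real ?d - 1))) \<le> A * (c * N powr (real m - real ?d / 2))" .
    have "ennreal (c' * real n powr (- (e / (real ?d - 1)))) \<le> sobolev_norm m \<Omega> (\<lambda>x. f x - g x)"
      if "g \<in> Sigma_nM k bm bp n M" for g
    proof -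
      obtain N' a \<omega> b where g: "g = (\<lambda>x. \<Sum>r<N'. a r * sigma_k k (\<omega> r \<bullet> x - b r))" and N': "N' \<le> n"
        using \<open>g \<in> _\<close> unfolding Sigma_nM_def by blast
      \<comment> \<open>\<open>\<omega>\<close> is a total function; its values at indices from
        \<open>N'\<close> up to \<open>n\<close> only prescribe further zeros, so the same
        resolution serves every \<open>g\<close>.\<close>
      obtain i \<psi> S where \<psi>: "\<psi> \<in> test_functions (cball (0::real^'d) \<rho>)" "S > 0" "(\<integral>x. (\<psi> x)\<^sup>2 \<partial>lborel) \<le> S\<^sup>2"
        "\<forall>r<n. \<forall>\<tau>. ft (\<lambda>x. complex_of_real (\<psi> x)) (\<tau> *\<^sub>R \<omega> r) = 0"
        "c * N powr (real m - real ?d / 2) * S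
          \<le> \<bar>\<integral>x. exp (- ((norm x)\<^sup>2 * N\<^sup>2 / 2)) * iter_deriv (replicate m i) \<psi> x \<partial>lborel\<bar>"
        using fool[rule_format, OF K(1,3), of \<omega>, folded N_def] by (elim exE conjE) (rule that)
      have hN: "z / (2 * h\<^sup>2) = z * N\<^sup>2 / 2" for z using N1 by (simp add: h_def power_one_over)
      have "A * (c * N powr (real m - real ?d / 2)) = A * (c * N powr (real m - real ?d / 2) * S) / S"
        using \<psi>(2) by simp
      also have "\<dots> \<le> A * \<bar>\<integral>x. exp (- ((norm x)\<^sup>2 / (2 * h\<^sup>2))) * iter_deriv (replicate m i) \<psi> x \<partial>lborel\<bar> / S"
        unfolding hN using \<psi>(2,5) A by (intro divide_right_mono mult_left_mono) auto
      finally have "ennreal (c' * real n powr (- (e / (real ?d - 1)))) \<le>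
          ennreal (A * \<bar>\<integral>x. exp (- ((norm x)\<^sup>2 / (2 * h\<^sup>2))) * iter_deriv (replicate m i) \<psi> x \<partial>lborel\<bar> / S)"
        using le by (intro ennreal_leI) linarith
      also have "\<dots> \<le> sobolev_norm m \<Omega> (\<lambda>x. f x - g x)"
        unfolding f_def g
        by (rule sobolev_norm_gaussian_minus_ridge_ge[OF \<psi>(1) \<rho>(2) \<psi>(2,3) \<psi>(4)[rule_format] less_imp_le[OF A] N'])
      finally show ?thesis .
    qed
    then have "ennreal (c' * real n powr (- (e / (real ?d - 1)))) \<le> (INF g\<in>Sigma_nM k bm bp n M. sobolev_norm m \<Omega> (\<lambda>x. f x - g x))"
      by (rule INF_greatest)
    also have "\<dots> \<le> approx_error k bm bp n m \<Omega> {f. besov_norm \<theta> (real k + real ?d / p) p q \<Omega> f \<le> 1} M"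
      unfolding approx_error_def by (rule SUP_upper[OF f1])
    finally show ?thesis .
  qed
  then show ?thesis unfolding e_def using c C B
    by (intro exI[of _ c'] conjI allI impI) (simp_all add: c'_def)
qed

end
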